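(* Let $M$ be an open smooth connected submanifold of $\mathbb{R}^n$ equipped with the induced flat affine connection $D$ and the induced parallel volume form $\omega=du^1\wedge\dots\wedge du^n$. Given a smooth map $A=(a^1,\dots,a^{n+1}):M\to\mathbb{R}^{n+1}$ and $Q\in C^\infty(M)$, define $F:M\times(\mathbb{R}^{n+1})^{\ast}\to\mathbb{R}$ by $F(u,x)=\langle A(u),x\rangle+Q(u)$. Define the Hessian $\operatorname{Hess}F$ (and its adjugate, $N$ and $\mathsf U(F)$) with respect to the product flat connection $\nabla$ and the volume form $\Upsilon=\omega\wedge\Psi^{\ast}$ on $M\times(\mathbb{R}^{n+1})^{\ast}$. Let $V=\sum_{i=1}^{n+1}(-1)^{i+1}dA^{(i)}\partial_{x_i}$. Then: (1) $V$ is contained in the radical of $\operatorname{Hess}F$. (2) The adjugate tensor of $\operatorname{Hess}F$ equals $(-1)^nV\otimes V$, and the vector field $N^i=U^{ij}F_j$ equals $N=(-1)^n|A\ dA|\,V$. (3) $A$ is an immersion if and only if the rank of $\operatorname{Hess}F$ is $2n$. In this case $V$ generates the radical of $\operatorname{Hess}F$. (4) The following are equivalent: (a) $A$ is a centroaffine immersion; (b) $\mathsf U(F)$ is nowhere vanishing on $M\times(\mathbb{R}^{n+1})^{\ast}$; (c) the one-form $\beta=\sum_{i=1}^{n+1}a^i\,dx_i$ is a contact one-form. In this case, a nontrivial level set $\Sigma$ of $F$ is a smoothly immersed nondegenerate submanifold of $M\times(\mathbb{R}^{n+1})^{\ast}$ co-oriented by $N=(-1)^n|A\ dA|\,V$,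 and the adjugate of $\operatorname{Hess}F$ equals $(-1)^n|A\ dA|^{-2}N\otimes N$. Moreover, the restriction to $\Sigma$ of $\Omega=d\beta$ is a symplectic form. (5) If there is a nonzero constant $\kappa$ such that $A^{\ast}(\mu)=\kappa\,\omega$ (equivalently, $\beta\wedge\Omega^n=(-1)^{n(n+1)/2}n!\,\kappa\,\Upsilon$), then $A$ is a centroaffine immersion and, for a nontrivial level set $\Sigma=\{(u,x)\in M\times(\mathbb{R}^{n+1})^{\ast}:F(u,x)=t\}$ of $F$, there hold: (a) $\Sigma$ has zero equiaffine mean curvature and equiaffine normal $\mathsf W=(-1)^{n+1}|\kappa|^{-2(n+1)/(n+2)}N=-\operatorname{sgn}(\kappa)|\kappa|^{-n/(n+2)}V$. (b) The equiaffine shape operator $S$ of $\Sigma$ is nilpotent with square equal to zero, and $\ker S$ contains the tangent distribution $\mathcal T$ of a ruling of $\Sigma$ by $n$-dimensional affine planes Lagrangian with respect to the symplectic form $\Omega$. (c) The ruling $\mathcal T$ of $\Sigma$ is not cylindrical. (d) The equiaffine metric $h$ of $\Sigma$ has split signature. (e) The Reeb field of $\beta$ is $\kappa^{-1}V$. (f) Define $\Phi:\mathbb{R}\times\mathbb{R}^n\times\mathbb{R}^n\to M\times(\mathbb{R}^{n+1})^{\ast}$ by $\Phi(t,r,s)=(r^1,\dots,r^n,c^1(t,r,s),\dots,c^{n+1}(t,r,s))$, where $c^i(t,r,s)=(-1)^{i+1}\kappa^{-1}(t-Q(r))\,dA^{(i)}(r)+e^i(t,r,s)$, for $e^1(t,r,s)=s^1a^2(r)$,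 $e^{n+1}(t,r,s)=-s^na^n(r)$, and $e^i(t,r,s)=-s^{i-1}a^{i-1}(r)+s^ia^{i+1}(r)$ for $2\le i\le n$. Then $F(\Phi(t,r,s))=t$, and for each $t\in\mathbb{R}$ for which $\Sigma=\{(u,x)\in M\times(\mathbb{R}^{n+1})^{\ast}:F(u,x)=t\}$ is nonempty, $\Phi(t,\cdot,\cdot):\mathbb{R}^n\times\mathbb{R}^n\to M\times(\mathbb{R}^{n+1})^{\ast}$ is a parameterization of $\Sigma$. (g) The map $\varphi:\mathbb{R}\times\mathbb{R}^n\times\mathbb{R}^n\to M\times(\mathbb{R}^{n+1})^{\ast}$ defined by $\varphi(t,r,s)=\Phi(-|\kappa|^{2/(n+2)}t,r,s)$ solves the affine normal flow $\tfrac{d}{dt}\varphi(t,r,s)=\mathsf W_{\varphi(t,r,s)}$.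
   Context: $\mathbb{R}^{n+1}$ has its standard flat connection and determinant volume form $\Psi$; $(\mathbb{R}^{n+1})^{\ast}$ has the standard (dual) flat connection, dual parallel volume form $\Psi^{\ast}$, and coordinates $x_1,\dots,x_{n+1}$ dual to the standard ones; $\langle\cdot,\cdot\rangle$ is the pairing. $\mathbb{X}$ is the radial (position) vector field on $\mathbb{R}^{n+1}$ and $\mu=\iota(\mathbb X)\Psi$. An immersion $A$ of an $n$-manifold into $\mathbb{R}^{n+1}$ is centroaffine if its image omits the origin and is everywhere transverse to $\mathbb X$. $dA$ is the $(n+1)\times n$ Jacobian matrix with columns $A_I=\partial A/\partial u^I$; $dA^{(i)}$ is the determinant of the $n\times n$ matrix obtained from $dA$ by deleting the $i$th row; $|A\ dA|$ is the determinant of the $(n+1)\times(n+1)$ matrix with columns $A,A_1,\dots,A_n$. For a function $F$ on the flat space $M\times(\mathbb{R}^{n+1})^{\ast}$ (dimension $2n+1$), in the coordinates $(u^1,\dots,u^n,x_1,\dots,x_{n+1})$: $\operatorname{Hess}F=(F_{ij})$ is the matrix of second partial derivatives, $U^{ij}$ its adjugate matrix, regarded as a symmetric contravariant two-tensor, $N^i=U^{ij}F_j$, and $\mathsf U(F)=U^{ij}F_iF_j$, where $F_i$ are the components of $dF$. Equiaffine geometry of a co-oriented $m$-dimensional hypersurface $\Sigma$: a transversal $T$ determines $\bar\nabla,h,S,\tau$ on $\Sigma$ by $\nabla_XY=\bar\nabla_XY+h(X,Y)T$, $\nabla_XT=-S(X)+\tau(X)T$ for $X,Y$ tangent to $\Sigma$.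 $\Sigma$ is nondegenerate if $h$ is. The equiaffine normal $\mathsf W$ is the transversal, unique up to sign, such that $|\iota(\mathsf W)\Upsilon|$ equals the volume density of the corresponding $h$ and is parallel for the corresponding $\bar\nabla$; for a level set of $F$ the sign is fixed by the co-orientation given by $-\operatorname{sgn}(\mathsf U(F))N$. The corresponding $h$, $S$ are the equiaffine metric and equiaffine shape operator; the equiaffine mean curvature is $\tfrac1m\operatorname{tr}S$. A ruling by $k$-planes is a foliation by totally geodesic $k$-dimensional submanifolds; it is cylindrical if its leaves are parallel planes. The Reeb field $R$ of a contact form $\beta$ satisfies $\beta(R)=1$, $\iota(R)d\beta=0$.
   Formalization: In (5a) and (5g) the exponents use dim Σ = 2n in place of n (the printed ones fail for |κ| ≠ 1); in (5f) Φ(t,·,·) parameterizes the part of Σ over the points where a^2,…,a^n are all nonzero (it fails elsewhere); r ranges over M rather than R^n. *)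

theory Defs
  imports "HOL-Analysis.Analysis" "HOL-Combinatorics.Combinatorics"
begin

section \<open>Smooth maps and submanifolds of Euclidean space\<close>

text \<open>Meant for open \<open>S\<close>; iterated directional derivatives of all orders exist and are continuous.\<close>

primrec Ck_on :: "nat \<Rightarrow> 'a::euclidean_space set \<Rightarrow> ('a \<Rightarrow> 'b::euclidean_space) \<Rightarrow> bool" where
  "Ck_on 0 S f \<longleftrightarrow> continuous_on S f"
| "Ck_on (Suc k) S f \<longleftrightarrow> (\<forall>x\<in>S. f differentiable (at x)) \<and>
     (\<forall>v. Ck_on k S (\<lambda>x. frechet_derivative f (at x) v))"

definition smooth_on :: "'a::euclidean_space set \<Rightarrow> ('a \<Rightarrow> 'b::euclidean_space) \<Rightarrow> bool" where
  "smooth_on S f \<longleftrightarrow> (\<forall>k. Ck_on k S f)"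

text \<open>Smoothness of a map on an arbitrary subset: local smooth extendability. It depends only on
  the values of \<open>f\<close> on \<open>S\<close>.\<close>

definition smooth_along :: "'a::euclidean_space set \<Rightarrow> ('a \<Rightarrow> 'b::euclidean_space) \<Rightarrow> bool" where
  "smooth_along S f \<longleftrightarrow>
     (\<forall>p\<in>S. \<exists>U g. open U \<and> p \<in> U \<and> smooth_on U g \<and> (\<forall>q\<in>S \<inter> U. g q = f q))"

definition immersion_on :: "'a::euclidean_space set \<Rightarrow> ('a \<Rightarrow> 'b::euclidean_space) \<Rightarrow> bool" where
  "immersion_on S f \<longleftrightarrow> smooth_on S f \<and> (\<forall>u\<in>S. inj (frechet_derivative f (at u)))"

definition smooth_submanifold :: "nat \<Rightarrow> 'a::euclidean_space set \<Rightarrow> bool" where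
  "smooth_submanifold k S \<longleftrightarrow>
     (\<forall>p\<in>S. \<exists>U U' f g H. open U \<and> p \<in> U \<and> open U' \<and> homeomorphism U U' f g \<and>
        smooth_on U f \<and> smooth_on U' g \<and>
        subspace H \<and> dim H = k \<and> f ` (U \<inter> S) = U' \<inter> (H :: 'a set))"

definition tangent_space :: "'a::euclidean_space set \<Rightarrow> 'a \<Rightarrow> 'a set" where
  "tangent_space S p =
     {v. \<exists>c \<epsilon>. \<epsilon> > 0 \<and> smooth_on {-\<epsilon><..<\<epsilon>} c \<and> c 0 = p \<and>
        (\<forall>t\<in>{-\<epsilon><..<\<epsilon>::real}. c t \<in> S) \<and> (c has_vector_derivative v) (at 0)}"

definition tangent_field :: "'a::euclidean_space set \<Rightarrow> ('a \<Rightarrow> 'a) \<Rightarrow> bool" where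
  "tangent_field S X \<longleftrightarrow> smooth_along S X \<and> (\<forall>p\<in>S. X p \<in> tangent_space S p)"

text \<open>Global parameterization, i.e. a smooth embedding with image \<open>S\<close>.\<close>

definition parameterization ::
  "'a::euclidean_space set \<Rightarrow> ('a \<Rightarrow> 'b::euclidean_space) \<Rightarrow> 'b set \<Rightarrow> bool" where
  "parameterization W f S \<longleftrightarrow> open W \<and> immersion_on W f \<and> (\<exists>g. homeomorphism W S f g)"


section \<open>Equiaffine geometry of a hypersurface in flat space\<close>

text \<open>The flat connection applied to a field \<open>Y\<close> along \<open>S\<close>. The argument \<open>v\<close> is always tangent
  to \<open>S\<close>; for such \<open>v\<close> the value does not depend on the choice of a derivative within \<open>S\<close>, and
  it involves only the values of \<open>Y\<close> on \<open>S\<close>.\<close>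

definition flat_deriv ::
  "'a::euclidean_space set \<Rightarrow> ('a \<Rightarrow> 'b::euclidean_space) \<Rightarrow> 'a \<Rightarrow> 'a \<Rightarrow> 'b" where
  "flat_deriv S Y p v = frechet_derivative Y (at p within S) v"

definition transversal :: "'a::euclidean_space set \<Rightarrow> ('a \<Rightarrow> 'a) \<Rightarrow> bool" where
  "transversal S T \<longleftrightarrow> smooth_along S T \<and> (\<forall>p\<in>S. T p \<notin> tangent_space S p)"

definition tangential_part ::
  "'a::euclidean_space set \<Rightarrow> ('a \<Rightarrow> 'a) \<Rightarrow> 'a \<Rightarrow> 'a \<Rightarrow> 'a" where
  "tangential_part S T p z = (THE w. w \<in> tangent_space S p \<and> (\<exists>c. z = w + c *\<^sub>R T p))"

definition transversal_coeff ::
  "'a::euclidean_space set \<Rightarrow> ('a \<Rightarrow> 'a) \<Rightarrow> 'a \<Rightarrow> 'a \<Rightarrow> real" where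
  "transversal_coeff S T p z = (THE c. z - c *\<^sub>R T p \<in> tangent_space S p)"

text \<open>The data induced by \<open>T\<close> through
  \<open>\<nabla>\<^sub>X Y = induced_connection X Y + h(X,Y) T\<close> and \<open>\<nabla>\<^sub>X T = - shape(X) + \<tau>(X) T\<close>.\<close>

definition induced_connection ::
  "'a::euclidean_space set \<Rightarrow> ('a \<Rightarrow> 'a) \<Rightarrow> ('a \<Rightarrow> 'a) \<Rightarrow> ('a \<Rightarrow> 'a) \<Rightarrow> 'a \<Rightarrow> 'a" where
  "induced_connection S T X Y p = tangential_part S T p (flat_deriv S Y p (X p))"

definition induced_metric ::
  "'a::euclidean_space set \<Rightarrow> ('a \<Rightarrow> 'a) \<Rightarrow> 'a \<Rightarrow> 'a \<Rightarrow> 'a \<Rightarrow> real" where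
  "induced_metric S T p v w =
     (THE c. \<exists>X Y. tangent_field S X \<and> tangent_field S Y \<and> X p = v \<and> Y p = w \<and>
        c = transversal_coeff S T p (flat_deriv S Y p (X p)))"

definition induced_shape :: "'a::euclidean_space set \<Rightarrow> ('a \<Rightarrow> 'a) \<Rightarrow> 'a \<Rightarrow> 'a \<Rightarrow> 'a" where
  "induced_shape S T p v = - tangential_part S T p (flat_deriv S T p v)"

text \<open>Nondegeneracy of \<open>h\<close> does not depend on the transversal.\<close>

definition nondegenerate_hypersurface :: "'a::euclidean_space set \<Rightarrow> bool" where
  "nondegenerate_hypersurface S \<longleftrightarrow>
     (\<exists>T. transversal S T \<and>
       (\<forall>p\<in>S. \<forall>v\<in>tangent_space S p.
          (\<forall>w\<in>tangent_space S p. induced_metric S T p v w = 0) \<longrightarrow> v = 0))"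

text \<open>A \<open>k\<close>-form at a point is a function of a sequence of vectors, of which only the entries
  with indices \<open>0, \<dots>, k - 1\<close> matter.\<close>

definition contract :: "'a \<Rightarrow> ((nat \<Rightarrow> 'a) \<Rightarrow> real) \<Rightarrow> ((nat \<Rightarrow> 'a) \<Rightarrow> real)" where
  "contract X \<alpha> v = \<alpha> (case_nat X v)"

definition det_nat :: "nat \<Rightarrow> (nat \<Rightarrow> nat \<Rightarrow> real) \<Rightarrow> real" where
  "det_nat m B = (\<Sum>\<sigma> | \<sigma> permutes {..<m}. of_int (sign \<sigma>) * (\<Prod>i<m. B i (\<sigma> i)))"

definition volume_density :: "nat \<Rightarrow> ('a \<Rightarrow> 'a \<Rightarrow> real) \<Rightarrow> (nat \<Rightarrow> 'a) \<Rightarrow> real" where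
  "volume_density m h v = sqrt \<bar>det_nat m (\<lambda>i j. h (v i) (v j))\<bar>"

definition parallel_form ::
  "'a::euclidean_space set \<Rightarrow> ('a \<Rightarrow> 'a) \<Rightarrow> nat \<Rightarrow> ('a \<Rightarrow> (nat \<Rightarrow> 'a) \<Rightarrow> real) \<Rightarrow> bool" where
  "parallel_form S T m \<alpha> \<longleftrightarrow>
     (\<forall>X Y. tangent_field S X \<and> (\<forall>i<m. tangent_field S (Y i)) \<longrightarrow>
       (\<forall>p\<in>S. flat_deriv S (\<lambda>q. \<alpha> q (\<lambda>i. Y i q)) p (X p) =
          (\<Sum>i<m. \<alpha> p ((\<lambda>j. Y j p)(i := induced_connection S T X (Y i) p)))))"

text \<open>\<open>Vol\<close> is the parallel volume form of the ambient space and \<open>C\<close> a transversal field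
  representing the co-orientation. Since \<open>\<iota>(W)Vol\<close> vanishes nowhere on \<open>S\<close>, the density
  \<open>\<bar>\<iota>(W)Vol\<bar>\<close> is locally \<open>\<plusminus>\<iota>(W)Vol\<close>, so one is parallel iff the other is.\<close>

definition is_equiaffine_normal ::
  "((nat \<Rightarrow> 'a) \<Rightarrow> real) \<Rightarrow> 'a::euclidean_space set \<Rightarrow> ('a \<Rightarrow> 'a) \<Rightarrow> ('a \<Rightarrow> 'a) \<Rightarrow> bool" where
  "is_equiaffine_normal Vol S C W \<longleftrightarrow>
     transversal S W \<and>
     (\<forall>p\<in>S. \<exists>c>0. W p - c *\<^sub>R C p \<in> tangent_space S p) \<and>
     (\<forall>p\<in>S. \<forall>v. (\<forall>i<DIM('a) - 1. v i \<in> tangent_space S p) \<longrightarrow>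
        \<bar>contract (W p) Vol v\<bar> = volume_density (DIM('a) - 1) (induced_metric S W p) v) \<and>
     parallel_form S W (DIM('a) - 1) (\<lambda>p. contract (W p) Vol)"

text \<open>Determined on \<open>S\<close> only.\<close>

definition equiaffine_normal ::
  "((nat \<Rightarrow> 'a) \<Rightarrow> real) \<Rightarrow> 'a::euclidean_space set \<Rightarrow> ('a \<Rightarrow> 'a) \<Rightarrow> 'a \<Rightarrow> 'a" where
  "equiaffine_normal Vol S C p = (THE w. \<exists>W. is_equiaffine_normal Vol S C W \<and> w = W p)"

definition equiaffine_metric ::
  "((nat \<Rightarrow> 'a) \<Rightarrow> real) \<Rightarrow> 'a::euclidean_space set \<Rightarrow> ('a \<Rightarrow> 'a) \<Rightarrow> 'a \<Rightarrow> 'a \<Rightarrow> 'a \<Rightarrow> real" where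
  "equiaffine_metric Vol S C = induced_metric S (equiaffine_normal Vol S C)"

definition equiaffine_shape ::
  "((nat \<Rightarrow> 'a) \<Rightarrow> real) \<Rightarrow> 'a::euclidean_space set \<Rightarrow> ('a \<Rightarrow> 'a) \<Rightarrow> 'a \<Rightarrow> 'a \<Rightarrow> 'a" where
  "equiaffine_shape Vol S C = induced_shape S (equiaffine_normal Vol S C)"

definition trace_on :: "'a::euclidean_space set \<Rightarrow> ('a \<Rightarrow> 'a) \<Rightarrow> real" where
  "trace_on H f = (let B = (SOME B. independent B \<and> span B = H)
     in \<Sum>b\<in>B. representation B (f b) b)"

definition equiaffine_mean_curvature ::
  "((nat \<Rightarrow> 'a) \<Rightarrow> real) \<Rightarrow> 'a::euclidean_space set \<Rightarrow> ('a \<Rightarrow> 'a) \<Rightarrow> 'a \<Rightarrow> real" where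
  "equiaffine_mean_curvature Vol S C p =
     trace_on (tangent_space S p) (equiaffine_shape Vol S C p) / real (DIM('a) - 1)"

definition has_signature ::
  "'a::euclidean_space set \<Rightarrow> ('a \<Rightarrow> 'a \<Rightarrow> real) \<Rightarrow> nat \<Rightarrow> nat \<Rightarrow> bool" where
  "has_signature H h k l \<longleftrightarrow> dim H = k + l \<and>
     (\<exists>b :: nat \<Rightarrow> 'a. span (b ` {..<k + l}) = H \<and>
        (\<forall>i<k + l. \<forall>j<k + l. h (b i) (b j) = (if i \<noteq> j then 0 else if i < k then 1 else -1)))"

definition totally_geodesic :: "'a::euclidean_space set \<Rightarrow> bool" where
  "totally_geodesic L \<longleftrightarrow>
     (\<forall>X Y. tangent_field L X \<and> tangent_field L Y \<longrightarrow>
        (\<forall>p\<in>L. flat_deriv L Y p (X p) \<in> tangent_space L p))"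

text \<open>A ruling is given by its set of leaves. The last clause says that the tangent spaces
  of the leaves form a smooth distribution on \<open>S\<close>. Totally geodesic leaves are relatively open
  in affine planes, so requiring them to be embedded is no restriction.\<close>

definition ruling :: "nat \<Rightarrow> 'a::euclidean_space set \<Rightarrow> 'a set set \<Rightarrow> bool" where
  "ruling k S \<L> \<longleftrightarrow> partition_on S \<L> \<and>
     (\<forall>L\<in>\<L>. connected L \<and> smooth_submanifold k L \<and> totally_geodesic L) \<and>
     (\<forall>p\<in>S. \<exists>U (E :: nat \<Rightarrow> 'a \<Rightarrow> 'a). open U \<and> p \<in> U \<and> (\<forall>i<k. smooth_along (S \<inter> U) (E i)) \<and>
        (\<forall>L\<in>\<L>. \<forall>q\<in>L \<inter> U. tangent_space L q = span ((\<lambda>i. E i q) ` {..<k})))"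

definition cylindrical :: "'a::euclidean_space set set \<Rightarrow> bool" where
  "cylindrical \<L> \<longleftrightarrow>
     (\<forall>L\<in>\<L>. \<forall>L'\<in>\<L>. \<forall>p\<in>L. \<forall>q\<in>L'. tangent_space L p = tangent_space L' q)"


section \<open>Differential forms\<close>

text \<open>Normalized so that \<open>du\<^sup>1 \<and> \<dots> \<and> du\<^sup>n\<close> is the determinant.\<close>

definition wedge ::
  "nat \<Rightarrow> nat \<Rightarrow> ((nat \<Rightarrow> 'a) \<Rightarrow> real) \<Rightarrow> ((nat \<Rightarrow> 'a) \<Rightarrow> real) \<Rightarrow> ((nat \<Rightarrow> 'a) \<Rightarrow> real)" where
  "wedge k l \<alpha> \<gamma> v =
     (\<Sum>\<sigma> | \<sigma> permutes {..<k + l}.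
        of_int (sign \<sigma>) * \<alpha> (\<lambda>i. v (\<sigma> i)) * \<gamma> (\<lambda>i. v (\<sigma> (k + i)))) / (fact k * fact l)"

primrec wedge_power2 :: "((nat \<Rightarrow> 'a) \<Rightarrow> real) \<Rightarrow> nat \<Rightarrow> ((nat \<Rightarrow> 'a) \<Rightarrow> real)" where
  "wedge_power2 \<alpha> 0 = (\<lambda>v. 1)"
| "wedge_power2 \<alpha> (Suc n) = wedge 2 (2 * n) \<alpha> (wedge_power2 \<alpha> n)"

definition ext_deriv ::
  "nat \<Rightarrow> ('a::euclidean_space \<Rightarrow> (nat \<Rightarrow> 'a) \<Rightarrow> real) \<Rightarrow> 'a \<Rightarrow> (nat \<Rightarrow> 'a) \<Rightarrow> real" where
  "ext_deriv k \<alpha> p v =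
     (\<Sum>i\<le>k. (-1) ^ i *
        frechet_derivative (\<lambda>q. \<alpha> q (\<lambda>j. if j < i then v j else v (Suc j))) (at p) (v i))"

definition pullback ::
  "('a::euclidean_space \<Rightarrow> 'b::euclidean_space) \<Rightarrow> ('b \<Rightarrow> (nat \<Rightarrow> 'b) \<Rightarrow> real) \<Rightarrow>
     'a \<Rightarrow> (nat \<Rightarrow> 'a) \<Rightarrow> real" where
  "pullback f \<alpha> u v = \<alpha> (f u) (\<lambda>i. frechet_derivative f (at u) (v i))"

definition contact_form ::
  "'a::euclidean_space set \<Rightarrow> ('a \<Rightarrow> (nat \<Rightarrow> 'a) \<Rightarrow> real) \<Rightarrow> bool" where
  "contact_form D \<beta> \<longleftrightarrow> odd DIM('a) \<and> (\<forall>v. smooth_on D (\<lambda>p. \<beta> p v)) \<and>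
     (\<forall>p\<in>D. \<exists>v. wedge 1 (DIM('a) - 1) (\<beta> p)
        (wedge_power2 (ext_deriv 1 \<beta> p) ((DIM('a) - 1) div 2)) v \<noteq> 0)"

definition is_Reeb_field ::
  "'a::euclidean_space set \<Rightarrow> ('a \<Rightarrow> (nat \<Rightarrow> 'a) \<Rightarrow> real) \<Rightarrow> ('a \<Rightarrow> 'a) \<Rightarrow> bool" where
  "is_Reeb_field D \<beta> R \<longleftrightarrow>
     (\<forall>p\<in>D. \<beta> p (\<lambda>_. R p) = 1 \<and> contract (R p) (ext_deriv 1 \<beta> p) = (\<lambda>_. 0))"

definition two_form_at :: "((nat \<Rightarrow> 'a) \<Rightarrow> real) \<Rightarrow> 'a \<Rightarrow> 'a \<Rightarrow> real" where
  "two_form_at \<alpha> v w = \<alpha> (case_nat v (\<lambda>_. w))"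

text \<open>The restriction to \<open>S\<close> of the two-form \<open>\<alpha>\<close> of the ambient space is symplectic. Closedness
  is \<open>d(\<alpha>|S) = (d\<alpha>)|S = 0\<close>.\<close>

definition symplectic_restriction ::
  "'a::euclidean_space set \<Rightarrow> ('a \<Rightarrow> (nat \<Rightarrow> 'a) \<Rightarrow> real) \<Rightarrow> bool" where
  "symplectic_restriction S \<alpha> \<longleftrightarrow>
     (\<forall>v. smooth_along S (\<lambda>p. \<alpha> p v)) \<and>
     (\<forall>p\<in>S. \<forall>v. (\<forall>i<3. v i \<in> tangent_space S p) \<longrightarrow> ext_deriv 2 \<alpha> p v = 0) \<and>
     (\<forall>p\<in>S. bilinear (two_form_at (\<alpha> p)) \<and> (\<forall>v. two_form_at (\<alpha> p) v v = 0)) \<and>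
     (\<forall>p\<in>S. \<forall>v\<in>tangent_space S p.
        (\<forall>w\<in>tangent_space S p. two_form_at (\<alpha> p) v w = 0) \<longrightarrow> v = 0)"

definition Lagrangian :: "'a::euclidean_space set \<Rightarrow> ('a \<Rightarrow> 'a \<Rightarrow> real) \<Rightarrow> 'a set \<Rightarrow> bool" where
  "Lagrangian H \<Omega> L \<longleftrightarrow>
     subspace L \<and> L \<subseteq> H \<and> 2 * dim L = dim H \<and> (\<forall>v\<in>L. \<forall>w\<in>L. \<Omega> v w = 0)"


section \<open>Coordinates, Hessian and adjugate\<close>

text \<open>The coordinate indices \<open>1, \<dots>, n\<close> and \<open>1, \<dots>, n + 1\<close> are the elements, in increasing order, of
  finite linearly ordered types \<open>'n\<close> and \<open>'m\<close> with \<open>CARD('m) = CARD('n) + 1\<close>. The dual space of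
  \<open>real ^ 'm\<close> is identified with \<open>real ^ 'm\<close> by means of the dual coordinates, which turns the
  pairing into the inner product.\<close>

definition pos :: "'k::{finite,linorder} \<Rightarrow> nat" where
  "pos i = card {j. j \<le> i}"

definition ith :: "nat \<Rightarrow> 'k::{finite,linorder}" where
  "ith k = sorted_list_of_set UNIV ! (k - 1)"

text \<open>The increasing enumeration of the indices different from \<open>i\<close>.\<close>

definition skip :: "'m::{finite,linorder} \<Rightarrow> 'n::{finite,linorder} \<Rightarrow> 'm" where
  "skip i j = sorted_list_of_set (UNIV - {i}) ! (pos j - 1)"

text \<open>The standard volume form: the determinant of the matrix with columns \<open>v 0, v 1, \<dots>\<close>.\<close>

definition det_form :: "(nat \<Rightarrow> real ^ 'k::{finite,linorder}) \<Rightarrow> real" where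
  "det_form v = det (\<chi> i j. v (pos j - 1) $ i)"

type_synonym 'k rvec = "real ^ 'k"
type_synonym ('n, 'm) phase = "'n rvec \<times> 'm rvec"

definition coords :: "('n::finite, 'm::finite) phase \<Rightarrow> real ^ ('n + 'm)" where
  "coords z = (\<chi> k. case k of Inl I \<Rightarrow> fst z $ I | Inr i \<Rightarrow> snd z $ i)"

definition of_coords :: "real ^ ('n + 'm) \<Rightarrow> ('n::finite, 'm::finite) phase" where
  "of_coords w = (\<chi> I. w $ Inl I, \<chi> i. w $ Inr i)"

definition partial ::
  "'n + 'm \<Rightarrow> (('n::finite, 'm::finite) phase \<Rightarrow> real) \<Rightarrow> ('n, 'm) phase \<Rightarrow> real" where
  "partial k F p = frechet_derivative F (at p) (of_coords (axis k 1))"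

definition Hess ::
  "(('n::finite, 'm::finite) phase \<Rightarrow> real) \<Rightarrow> ('n, 'm) phase \<Rightarrow> real ^ ('n + 'm) ^ ('n + 'm)" where
  "Hess F p = (\<chi> i j. partial i (partial j F) p)"

definition Hess_radical ::
  "(('n::finite, 'm::finite) phase \<Rightarrow> real) \<Rightarrow> ('n, 'm) phase \<Rightarrow> ('n, 'm) phase set" where
  "Hess_radical F p = {v. \<forall>w. coords v \<bullet> (Hess F p *v coords w) = 0}"

text \<open>Cofactors without reference to an ordering of the indices: replacing row \<open>j\<close> and column \<open>i\<close>
  by those of the unit matrix, up to the common entry 1, yields the signed minor.\<close>

definition adjugate :: "real ^ 'k ^ 'k \<Rightarrow> real ^ 'k ^ 'k" where
  "adjugate B = (\<chi> i j. det (\<chi> k l. if k = j \<and> l = i then 1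
                                     else if k = j \<or> l = i then 0 else B $ k $ l))"

definition N_field ::
  "(('n::finite, 'm::finite) phase \<Rightarrow> real) \<Rightarrow> ('n, 'm) phase \<Rightarrow> ('n, 'm) phase" where
  "N_field F p = of_coords (\<chi> i. \<Sum>j\<in>UNIV. adjugate (Hess F p) $ i $ j * partial j F p)"

definition U_fun :: "(('n::finite, 'm::finite) phase \<Rightarrow> real) \<Rightarrow> ('n, 'm) phase \<Rightarrow> real" where
  "U_fun F p =
     (\<Sum>i\<in>UNIV. \<Sum>j\<in>UNIV. adjugate (Hess F p) $ i $ j * partial i F p * partial j F p)"

definition tensor_square :: "('n::finite, 'm::finite) phase \<Rightarrow> real ^ ('n + 'm) ^ ('n + 'm)" where
  "tensor_square v = (\<chi> i j. coords v $ i * coords v $ j)"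

text \<open>The transversal field that fixes the sign of the equiaffine normal of level sets of \<open>F\<close>.\<close>

definition co_orientation ::
  "(('n::finite, 'm::finite) phase \<Rightarrow> real) \<Rightarrow> ('n, 'm) phase \<Rightarrow> ('n, 'm) phase" where
  "co_orientation F p = - (sgn (U_fun F p) *\<^sub>R N_field F p)"

text \<open>\<open>\<Upsilon> = \<omega> \<and> \<Psi>\<^sup>*\<close>\<close>

definition Upsilon ::
  "(nat \<Rightarrow> ('n::{finite,linorder}, 'm::{finite,linorder}) phase) \<Rightarrow> real" where
  "Upsilon = wedge CARD('n) CARD('m)
     (\<lambda>v. det_form (\<lambda>i. fst (v i))) (\<lambda>v. det_form (\<lambda>i. snd (v i)))"

text \<open>\<open>\<mu> = \<iota>(\<X>)\<Psi>\<close> with \<open>\<X>\<close> the position vector field\<close>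

definition mu_form ::
  "'m::{finite,linorder} rvec \<Rightarrow> (nat \<Rightarrow> 'm rvec) \<Rightarrow> real" where
  "mu_form y = contract y det_form"


section \<open>The data attached to \<open>A\<close> and \<open>Q\<close>\<close>

definition centroaffine_immersion ::
  "('n::finite rvec) set \<Rightarrow> ('n rvec \<Rightarrow> 'm::finite rvec) \<Rightarrow> bool" where
  "centroaffine_immersion M A \<longleftrightarrow> immersion_on M A \<and>
     (\<forall>u\<in>M. A u \<noteq> 0 \<and> A u \<notin> range (frechet_derivative A (at u)))"

definition F_fun ::
  "('n::finite rvec \<Rightarrow> 'm::finite rvec) \<Rightarrow> ('n rvec \<Rightarrow> real) \<Rightarrow> ('n, 'm) phase \<Rightarrow> real" where
  "F_fun A Q p = A (fst p) \<bullet> snd p + Q (fst p)"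

definition level_set ::
  "('n::finite rvec) set \<Rightarrow> (('n, 'm::finite) phase \<Rightarrow> real) \<Rightarrow> real \<Rightarrow> ('n, 'm) phase set" where
  "level_set M F t = {p \<in> M \<times> UNIV. F p = t}"

definition dA_minor ::
  "('n::{finite,linorder} rvec \<Rightarrow> 'm::{finite,linorder} rvec) \<Rightarrow> 'm \<Rightarrow> 'n rvec \<Rightarrow> real" where
  "dA_minor A i u = det (\<chi> a b. jacobian A (at u) $ (skip i a) $ b :: ('n rvec, 'n) vec)"

definition det_A_dA ::
  "('n::{finite,linorder} rvec \<Rightarrow> 'm::{finite,linorder} rvec) \<Rightarrow> 'n rvec \<Rightarrow> real" where
  "det_A_dA A u =
     det (\<chi> i j. if pos j = 1 then A u $ i else jacobian A (at u) $ i $ (ith (pos j - 1)))"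

definition V_field ::
  "('n::{finite,linorder} rvec \<Rightarrow> 'm::{finite,linorder} rvec) \<Rightarrow> ('n, 'm) phase \<Rightarrow>
     ('n, 'm) phase" where
  "V_field A p = (0, \<chi> i. (-1) ^ (pos i + 1) * dA_minor A i (fst p))"

definition beta ::
  "('n::finite rvec \<Rightarrow> 'm::finite rvec) \<Rightarrow> ('n, 'm) phase \<Rightarrow>
     (nat \<Rightarrow> ('n, 'm) phase) \<Rightarrow> real" where
  "beta A p v = (\<Sum>i\<in>UNIV. A (fst p) $ i * snd (v 0) $ i)"

definition Omega ::
  "('n::finite rvec \<Rightarrow> 'm::finite rvec) \<Rightarrow> ('n, 'm) phase \<Rightarrow>
     (nat \<Rightarrow> ('n, 'm) phase) \<Rightarrow> real" where
  "Omega A = ext_deriv 1 (beta A)"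

definition Phi_e ::
  "'m::{finite,linorder} rvec \<Rightarrow> 'n::{finite,linorder} rvec \<Rightarrow> 'm rvec" where
  "Phi_e a s = (\<chi> j. let i = pos j in
     if i = 1 then s $ ith 1 * a $ ith 2
     else if i = CARD('n) + 1 then - (s $ ith CARD('n)) * a $ ith CARD('n)
     else - (s $ ith (i - 1)) * a $ ith (i - 1) + s $ ith i * a $ ith (i + 1))"

definition Phi ::
  "('n::{finite,linorder} rvec \<Rightarrow> 'm::{finite,linorder} rvec) \<Rightarrow>
     ('n rvec \<Rightarrow> real) \<Rightarrow> real \<Rightarrow> real \<Rightarrow> 'n rvec \<Rightarrow> 'n rvec \<Rightarrow>
     ('n, 'm) phase" where
  "Phi A Q \<kappa> t r s =
     (r, (\<chi> i. (-1) ^ (pos i + 1) * inverse \<kappa> * (t - Q r) * dA_minor A i r) + Phi_e (A r) s)"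

text \<open>For fixed \<open>t\<close> and \<open>r\<close>, \<open>Phi\<close> maps onto the fibre of the level set over \<open>r\<close> if and only if
  \<open>a\<^sup>2(r), \<dots>, a\<^sup>n(r)\<close> are all nonzero (an empty condition when \<open>n = 1\<close>).\<close>

definition regular_locus ::
  "('n::{finite,linorder} rvec) set \<Rightarrow> ('n rvec \<Rightarrow> 'm::{finite,linorder} rvec) \<Rightarrow>
     ('n rvec) set" where
  "regular_locus M A = {r \<in> M. \<forall>i. 2 \<le> pos i \<and> pos i \<le> CARD('n) \<longrightarrow> A r $ i \<noteq> 0}"

end

theory Submission
  imports Defs
begin

text \<open>The Hessian of \<open>F(u, x) = \<langle>A(u), x\<rangle> + Q(u)\<close> is the block matrix \<open>[[B, C\<^sup>T], [C, 0]]\<close> with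
  \<open>C = dA\<close>. By Cramer's rule the vector of signed maximal minors of \<open>C\<close> spans the orthogonal
  complement of the columns of \<open>C\<close> as soon as they are independent, so the whole linear algebra is that of
  \<open>V\<close>. Both \<open>dF\<close> and \<open>\<beta>\<close> evaluate on \<open>V\<close> to \<open>K = \<langle>A, V\<rangle> = |A dA|\<close>.

  If \<open>K\<close> vanishes nowhere, a frame of \<open>\<real>\<^sup>n\<close> and vectors \<open>y\<^sub>J\<close> annihilated by \<open>A\<close> and dual to the columns
  of \<open>dA\<close> give frames of the level sets of \<open>F\<close> in which the Hessian is a sum of hyperbolic planes; they also
  normalize \<open>\<Omega>\<close> and \<open>\<beta>\<close>. For a transversal \<open>W\<close> of a level set, with \<open>h = - Hess F / dF(W)\<close>, the volume
  condition on \<open>W\<close> becomes \<open>|dF(W)|\<^bsup>n+1\<^esup> = |K|\<close>. If \<open>K = \<kappa>\<close> is constant, this fixes \<open>dF(W)\<close>, and the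
  volume form is parallel iff the derivatives of \<open>W\<close> along the level set are tangent to it, i.e. iff
  \<open>Hess F(W, -) = 0\<close> on tangent vectors; hence \<open>W = c V\<close> for a constant \<open>c\<close>. As \<open>V\<close> is a function of
  \<open>u\<close> with values in the \<open>x\<close>-directions, its derivative is a square zero map that kills the
  \<open>x\<close>-directions, which gives all claims on the shape operator. The fibres over \<open>u\<close> of a level set are the
  leaves of the ruling, and the flow of \<open>W\<close> is a translation of \<open>t\<close> in \<open>\<Phi>\<close>.\<close>

section \<open>Smooth maps\<close>

text \<open>The equiaffine normal, the induced metric and the induced connection are given by
  definite descriptions and the trace by a choice of basis, so each has to be pinned down before it
  can be computed. The means is the ambient function: v is tangent iff \<open>dF p v = 0\<close>,
  and since \<open>dF p (V p)\<close> is nonzero, projection along V extends every tangent vector to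
  a globally defined tangent field. As F is affine in x with slope A, curves in the level sets and
  charts for them can be written down explicitly.

  The formulas for the adjugate and for the contact volume form must also hold where dA or K
  degenerates. The adjugate is therefore obtained from a factorization and not from the rank, and
  the contact volume form is treated separately at points with K = 0.

  The exponents reflect the dimension 2n of the level sets: |dF(W)| is the (n+1)-st root of
  |\<kappa>|, and c = dF(W) / \<kappa> has absolute value |\<kappa>| to the power -n/(n+1), which is
  -m/(m+2) for m = 2n. The co-orientation is represented by -\<kappa> V, on which dF is negative;
  this fixes the sign of c.\<close>

lemma Ck_on_SucI:
  fixes f :: "'a::euclidean_space \<Rightarrow> 'b::euclidean_space"
  assumes "open S" "\<And>x. x \<in> S \<Longrightarrow> (f has_derivative f' x) (at x)"
    and "\<And>v. Ck_on k S (\<lambda>x. f' x v)"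
    and cong: "\<And>g h :: 'a \<Rightarrow> 'b. (\<And>x. x \<in> S \<Longrightarrow> g x = h x) \<Longrightarrow> Ck_on k S g \<Longrightarrow> Ck_on k S h"
  shows "Ck_on (Suc k) S f"
proof -
  have eq: "frechet_derivative f (at x) = f' x" if "x \<in> S" for x
    using frechet_derivative_at[OF assms(2)[OF that]] by simp
  have "Ck_on k S (\<lambda>x. frechet_derivative f (at x) v)" for v
    by (rule cong[OF _ assms(3)[of v]]) (simp add: eq)
  then show ?thesis
    using assms(2) by (auto intro: differentiableI)
qed

text \<open>On an open set equal functions have equal derivatives, so order k + 1 reduces to order k
  for the derivatives. \<open>Ck_on_SucI\<close> takes this lower-order congruence as its premise
  \<open>cong\<close>, here the induction hypothesis; \<open>Ck_onI\<close> then discharges it once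
  and for all.\<close>

lemma Ck_on_eq:
  assumes "open S" "\<And>x. x \<in> S \<Longrightarrow> f x = g x" "Ck_on k S f"
  shows "Ck_on k S g"
  using assms(2,3)
proof (induction k arbitrary: f g)
  case 0
  then show ?case by (simp cong: continuous_on_cong)
next
  case (Suc k)
  have "(g has_derivative frechet_derivative f (at x)) (at x)" if "x \<in> S" for x
    using Suc.prems that assms(1)
    by (metis Ck_on.simps(2) frechet_derivative_works has_derivative_transform_within_open)
  then show ?case
  proof (rule Ck_on_SucI[OF assms(1)])
    show "Ck_on k S (\<lambda>x. frechet_derivative f (at x) v)" for v
      using Suc.prems(2) by simp
    show "Ck_on k S h" if "\<And>x. x \<in> S \<Longrightarrow> p x = h x" "Ck_on k S p" for p h :: "'a \<Rightarrow> 'b"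
      using that by (rule Suc.IH)
  qed simp
qed

lemma Ck_onI:
  assumes "open S" "\<And>x. x \<in> S \<Longrightarrow> (f has_derivative f' x) (at x)"
    and "\<And>v. Ck_on k S (\<lambda>x. f' x v)"
  shows "Ck_on (Suc k) S f"
  by (rule Ck_on_SucI[OF assms]) (assumption, rule Ck_on_eq[OF assms(1)])

lemma Ck_on_has_derivative:
  "Ck_on (Suc k) S f \<Longrightarrow> x \<in> S \<Longrightarrow> (f has_derivative frechet_derivative f (at x)) (at x)"
  by (simp add: frechet_derivative_works)

lemma Ck_on_lower: "Ck_on (Suc k) S f \<Longrightarrow> Ck_on k S f"
proof (induction k arbitrary: f)
  case 0
  then show ?case
    by (auto intro!: continuous_at_imp_continuous_on differentiable_imp_continuous_within)
qed auto

lemma Ck_on_subset: "Ck_on k S f \<Longrightarrow> T \<subseteq> S \<Longrightarrow> Ck_on k T f"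
  by (induction k arbitrary: f) (auto intro: continuous_on_subset)

lemma Ck_on_const: "open S \<Longrightarrow> Ck_on k S (\<lambda>x. c)"
  by (induction k arbitrary: c) (auto simp: frechet_derivative_const)

lemma Ck_on_bounded_linear:
  assumes "open S" "bounded_linear L" "Ck_on k S f"
  shows "Ck_on k S (\<lambda>x. L (f x))"
  using assms(3)
proof (induction k arbitrary: f)
  case 0
  then show ?case using assms(2) by (auto intro: bounded_linear.continuous_on)
next
  case (Suc k)
  then show ?case
    by (intro Ck_onI[OF assms(1), where f' = "\<lambda>x v. L (frechet_derivative f (at x) v)"]
        bounded_linear.has_derivative[OF assms(2)] Ck_on_has_derivative) auto
qed

lemma Ck_on_id: "open S \<Longrightarrow> Ck_on k S (\<lambda>x. x)"
  by (cases k) (auto simp: frechet_derivative_ident Ck_on_const)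

lemma Ck_on_add:
  assumes "open S" "Ck_on k S f" "Ck_on k S g"
  shows "Ck_on k S (\<lambda>x. f x + g x)"
  using assms(2,3)
proof (induction k arbitrary: f g)
  case 0
  then show ?case by (auto intro: continuous_on_add)
next
  case (Suc k)
  then show ?case
    by (intro Ck_onI[OF assms(1), where
          f' = "\<lambda>x v. frechet_derivative f (at x) v + frechet_derivative g (at x) v"]
        has_derivative_add Ck_on_has_derivative) auto
qed

lemma Ck_on_bilinear:
  fixes f :: "'a::euclidean_space \<Rightarrow> 'b::euclidean_space" and g :: "'a \<Rightarrow> 'c::euclidean_space"
    and prod :: "'b \<Rightarrow> 'c \<Rightarrow> 'd::euclidean_space"
  assumes "open S" "bounded_bilinear prod" "Ck_on k S f" "Ck_on k S g"
  shows "Ck_on k S (\<lambda>x. prod (f x) (g x))"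
  using assms(3,4)
proof (induction k arbitrary: f g)
  case 0
  then show ?case using assms(2) by (auto intro: bounded_bilinear.continuous_on)
next
  case (Suc k)
  note lower = Suc.prems[THEN Ck_on_lower]
  show ?case
    by (intro Ck_onI[OF assms(1), where f' = "\<lambda>x v. prod (f x) (frechet_derivative g (at x) v)
          + prod (frechet_derivative f (at x) v) (g x)"]
        bounded_bilinear.FDERIV[OF assms(2)] Ck_on_has_derivative Ck_on_add[OF assms(1)] Suc.IH)
      (use Suc.prems lower in auto)
qed

text \<open>The derivative of 1/f contains 1/f again, but only to order k, where the induction
  hypothesis supplies it.\<close>

lemma Ck_on_inverse:
  fixes f :: "'a::euclidean_space \<Rightarrow> real"
  assumes "open S" "\<And>x. x \<in> S \<Longrightarrow> f x \<noteq> 0" "Ck_on k S f"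
  shows "Ck_on k S (\<lambda>x. inverse (f x))"
  using assms(3)
proof (induction k)
  case 0
  then show ?case using assms by (auto intro: continuous_on_inverse)
next
  case (Suc k)
  note mult = Ck_on_bilinear[OF assms(1) bounded_bilinear_mult]
  note IH = Suc.IH[OF Ck_on_lower[OF Suc.prems]]
  have "Ck_on k S (\<lambda>x. - (inverse (f x) * frechet_derivative f (at x) v * inverse (f x)))" for v
    using Suc.prems
    by (intro Ck_on_bounded_linear[OF assms(1), of uminus] bounded_linear_minus bounded_linear_ident mult IH) auto
  then show ?case
    by (intro Ck_onI[OF assms(1), where
          f' = "\<lambda>x v. - (inverse (f x) * frechet_derivative f (at x) v * inverse (f x))"]
        Deriv.has_derivative_inverse Ck_on_has_derivative[OF Suc.prems] assms(2)) auto
qed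

lemma linear_euclidean_expansion:
  fixes f :: "'a::euclidean_space \<Rightarrow> 'b::real_vector"
  assumes "linear f"
  shows "f x = (\<Sum>b\<in>Basis. (x \<bullet> b) *\<^sub>R f b)"
proof -
  interpret linear f by fact
  have "f x = f (\<Sum>b\<in>Basis. (x \<bullet> b) *\<^sub>R b)" by (simp add: euclidean_representation)
  then show ?thesis by (simp add: sum scaleR)
qed

lemma Ck_on_sum:
  assumes "open S" "\<And>i. i \<in> I \<Longrightarrow> Ck_on k S (f i)"
  shows "Ck_on k S (\<lambda>x. \<Sum>i\<in>I. f i x)"
proof (cases "finite I")
  case True
  then show ?thesis using assms(2)
    by (induction I) (auto intro: Ck_on_add Ck_on_const assms(1))
qed (simp add: Ck_on_const assms(1))

text \<open>The chain rule evaluates the derivative of f in a direction that moves with x, while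
  \<open>Ck_on\<close> speaks of fixed directions. Expanding the moving direction in
  \<open>Basis\<close> gives a finite sum of products to which the induction hypothesis
  applies.\<close>

lemma Ck_on_compose:
  fixes f :: "'b::euclidean_space \<Rightarrow> 'c::euclidean_space" and g :: "'a::euclidean_space \<Rightarrow> 'b"
  assumes "open S" "Ck_on k S g" "Ck_on k T f" "g ` S \<subseteq> T"
  shows "Ck_on k S (\<lambda>x. f (g x))"
  using assms(2,3)
proof (induction k arbitrary: f)
  case 0
  then show ?case using assms(4) by (auto intro: continuous_on_compose2)
next
  case (Suc k)
  have d: "((\<lambda>x. f (g x)) has_derivative
      (\<lambda>v. frechet_derivative f (at (g x)) (frechet_derivative g (at x) v))) (at x)" if "x \<in> S" for x
    by (rule has_derivative_compose[OF Ck_on_has_derivative[OF Suc.prems(1) that]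
          Ck_on_has_derivative[OF Suc.prems(2)]]) (use that assms(4) in auto)
  have eq: "frechet_derivative f (at (g x)) (frechet_derivative g (at x) v)
     = (\<Sum>b\<in>Basis. (frechet_derivative g (at x) v \<bullet> b) *\<^sub>R frechet_derivative f (at (g x)) b)"
    if "x \<in> S" for x v
    by (rule linear_euclidean_expansion)
      (use that assms(4) Suc.prems in \<open>auto intro!: linear_frechet_derivative\<close>)
  have "Ck_on k S (\<lambda>x. \<Sum>b\<in>Basis. (frechet_derivative g (at x) v \<bullet> b) *\<^sub>R frechet_derivative f (at (g x)) b)" for v
    using Suc.prems Ck_on_lower[OF Suc.prems(1)]
    by (intro Ck_on_sum Ck_on_bilinear[OF assms(1) bounded_bilinear_scaleR]
        Ck_on_bilinear[OF assms(1) bounded_bilinear_inner] Ck_on_const assms(1) Suc.IH) auto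
  then have "Ck_on k S (\<lambda>x. frechet_derivative f (at (g x)) (frechet_derivative g (at x) v))" for v
    by (rule Ck_on_eq[OF assms(1), rotated]) (simp add: eq)
  then show ?case by (intro Ck_onI[OF assms(1) d])
qed

lemma smooth_on_eq: "open S \<Longrightarrow> smooth_on S f \<Longrightarrow> (\<And>x. x \<in> S \<Longrightarrow> f x = g x) \<Longrightarrow> smooth_on S g"
  unfolding smooth_on_def using Ck_on_eq by blast

lemma smooth_on_subset: "smooth_on S f \<Longrightarrow> T \<subseteq> S \<Longrightarrow> smooth_on T f"
  unfolding smooth_on_def using Ck_on_subset by blast

lemma smooth_on_const [intro]: "open S \<Longrightarrow> smooth_on S (\<lambda>x. c)"
  by (simp add: smooth_on_def Ck_on_const)

lemma smooth_on_ident [intro]: "open S \<Longrightarrow> smooth_on S (\<lambda>x. x)"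
  by (simp add: smooth_on_def Ck_on_id)

lemma smooth_on_linear_compose:
  "open S \<Longrightarrow> linear L \<Longrightarrow> smooth_on S f \<Longrightarrow> smooth_on S (\<lambda>x. L (f x))"
  by (simp add: smooth_on_def Ck_on_bounded_linear linear_conv_bounded_linear)

lemma smooth_on_linear: "open S \<Longrightarrow> linear L \<Longrightarrow> smooth_on S L"
  using smooth_on_linear_compose[OF _ _ smooth_on_ident] by blast

lemma smooth_on_add: "open S \<Longrightarrow> smooth_on S f \<Longrightarrow> smooth_on S g \<Longrightarrow> smooth_on S (\<lambda>x. f x + g x)"
  by (simp add: smooth_on_def Ck_on_add)

lemma smooth_on_minus: "open S \<Longrightarrow> smooth_on S f \<Longrightarrow> smooth_on S (\<lambda>x. - f x)"
  using smooth_on_linear_compose[of S uminus f] by (simp add: linear_uminus)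

lemma smooth_on_diff: "open S \<Longrightarrow> smooth_on S f \<Longrightarrow> smooth_on S g \<Longrightarrow> smooth_on S (\<lambda>x. f x - g x)"
  using smooth_on_add[of S f "\<lambda>x. - g x"] smooth_on_minus by fastforce

lemma smooth_on_scaleR:
  "open S \<Longrightarrow> smooth_on S f \<Longrightarrow> smooth_on S g \<Longrightarrow> smooth_on S (\<lambda>x. f x *\<^sub>R g x)"
  by (simp add: smooth_on_def Ck_on_bilinear bounded_bilinear_scaleR)

lemma smooth_on_mult:
  "open S \<Longrightarrow> smooth_on S f \<Longrightarrow> smooth_on S g \<Longrightarrow> smooth_on S (\<lambda>x. f x * g x :: real)"
  by (simp add: smooth_on_def Ck_on_bilinear bounded_bilinear_mult)

lemma smooth_on_inner:
  "open S \<Longrightarrow> smooth_on S f \<Longrightarrow> smooth_on S g \<Longrightarrow> smooth_on S (\<lambda>x. f x \<bullet> g x)"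
  by (simp add: smooth_on_def Ck_on_bilinear bounded_bilinear_inner)

lemma smooth_on_inverse:
  "open S \<Longrightarrow> smooth_on S f \<Longrightarrow> (\<And>x. x \<in> S \<Longrightarrow> f x \<noteq> 0) \<Longrightarrow> smooth_on S (\<lambda>x. inverse (f x :: real))"
  by (simp add: smooth_on_def Ck_on_inverse)

lemma smooth_on_divide:
  "open S \<Longrightarrow> smooth_on S f \<Longrightarrow> smooth_on S g \<Longrightarrow> (\<And>x. x \<in> S \<Longrightarrow> g x \<noteq> 0) \<Longrightarrow>
     smooth_on S (\<lambda>x. f x / g x :: real)"
  by (simp add: divide_inverse smooth_on_mult smooth_on_inverse)

lemma smooth_on_sum:
  "open S \<Longrightarrow> (\<And>i. i \<in> I \<Longrightarrow> smooth_on S (f i)) \<Longrightarrow> smooth_on S (\<lambda>x. \<Sum>i\<in>I. f i x)"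
  by (simp add: smooth_on_def Ck_on_sum)

lemma smooth_on_prod:
  assumes "open S" "\<And>i. i \<in> I \<Longrightarrow> smooth_on S (f i)"
  shows "smooth_on S (\<lambda>x. \<Prod>i\<in>I. f i x :: real)"
proof (cases "finite I")
  case True
  then show ?thesis using assms(2)
    by (induction I) (auto intro: smooth_on_mult assms(1))
qed (simp add: smooth_on_const assms(1))

lemma smooth_on_compose:
  "open S \<Longrightarrow> smooth_on S g \<Longrightarrow> smooth_on T f \<Longrightarrow> g ` S \<subseteq> T \<Longrightarrow> smooth_on S (\<lambda>x. f (g x))"
  unfolding smooth_on_def using Ck_on_compose by blast

lemma smooth_on_Pair:
  assumes "open S" "smooth_on S f" "smooth_on S g"
  shows "smooth_on S (\<lambda>x. (f x, g x))"
proof -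
  have "smooth_on S (\<lambda>x. (f x, 0) + (0, g x))"
    using assms by (intro smooth_on_add smooth_on_linear_compose[of S "\<lambda>y. (y, 0)"]
        smooth_on_linear_compose[of S "\<lambda>y. (0, y)"]) (auto intro!: linearI)
  then show ?thesis by simp
qed

lemma smooth_on_vec_lambda:
  fixes f :: "'a::euclidean_space \<Rightarrow> 'i::finite \<Rightarrow> real"
  assumes "open S" "\<And>i. smooth_on S (\<lambda>x. f x i)"
  shows "smooth_on S (\<lambda>x. \<chi> i. f x i)"
proof -
  have "smooth_on S (\<lambda>x. \<Sum>i\<in>UNIV. f x i *\<^sub>R axis i (1::real))"
    using assms by (intro smooth_on_sum smooth_on_scaleR smooth_on_const)
  moreover have "(\<Sum>i\<in>UNIV. f x i *\<^sub>R axis i (1::real)) = (\<chi> i. f x i)" for x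
    by (simp add: vec_eq_iff axis_def if_distrib[of "(*) _"] sum.delta' cong: if_cong)
  ultimately show ?thesis by simp
qed

lemma smooth_on_nth: "open S \<Longrightarrow> smooth_on S f \<Longrightarrow> smooth_on S (\<lambda>x. f x $ i :: real)"
  using smooth_on_linear_compose[of S "\<lambda>y. y $ i" f] by (simp add: linearI)

lemma smooth_on_fst: "open S \<Longrightarrow> smooth_on S f \<Longrightarrow> smooth_on S (\<lambda>x. fst (f x))"
  using smooth_on_linear_compose[of S fst f] by (simp add: linear_fst)

lemma smooth_on_snd: "open S \<Longrightarrow> smooth_on S f \<Longrightarrow> smooth_on S (\<lambda>x. snd (f x))"
  using smooth_on_linear_compose[of S snd f] by (simp add: linear_snd)

lemma smooth_on_frechet_derivative:
  assumes "smooth_on S f" shows "smooth_on S (\<lambda>x. frechet_derivative f (at x) v)"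
  unfolding smooth_on_def
proof
  fix k show "Ck_on k S (\<lambda>x. frechet_derivative f (at x) v)"
    using assms[unfolded smooth_on_def, rule_format, of "Suc k"] by simp
qed

lemma smooth_on_has_derivative:
  "smooth_on S f \<Longrightarrow> x \<in> S \<Longrightarrow> (f has_derivative frechet_derivative f (at x)) (at x)"
  using Ck_on_has_derivative unfolding smooth_on_def by blast

lemma smooth_on_continuous_on: "smooth_on S f \<Longrightarrow> continuous_on S f"
  unfolding smooth_on_def by (metis Ck_on.simps(1))

lemma smooth_on_linear_derivative: "smooth_on S f \<Longrightarrow> x \<in> S \<Longrightarrow> linear (frechet_derivative f (at x))"
  using smooth_on_has_derivative has_derivative_linear by blast

section \<open>Symmetry of second derivatives\<close>

lemma has_vector_derivative_line:
  assumes "(g has_derivative g') (at (x + s *\<^sub>R v))"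
  shows "((\<lambda>s. g (x + s *\<^sub>R v)) has_vector_derivative g' v) (at s)"
proof -
  have "((\<lambda>s. x + s *\<^sub>R v) has_derivative (\<lambda>h. h *\<^sub>R v)) (at s)"
    by (auto intro!: derivative_eq_intros)
  from has_derivative_compose[OF this assms]
  show ?thesis
    unfolding has_vector_derivative_def
    by (simp add: linear_cmul[OF has_derivative_linear[OF assms]])
qed

text \<open>The mean value theorem, applied once along v and once along w, identifies the second
  difference with \<open>h\<^sup>2\<close> times D at a point of the parallelogram; continuity of D
  does the rest. The second difference is symmetric in v and w, which is where the symmetry of
  second derivatives comes from.\<close>

lemma second_difference_estimate:
  fixes g :: "'a::euclidean_space \<Rightarrow> real" and v w :: 'a
  assumes "open S" "smooth_on S g" "x \<in> S" "e > 0"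
  defines "D \<equiv> \<lambda>y. frechet_derivative (\<lambda>y. frechet_derivative g (at y) v) (at y) w"
  shows "\<exists>d>0. \<forall>h. 0 < h \<and> h < d \<longrightarrow>
    \<bar>g (x + h *\<^sub>R v + h *\<^sub>R w) - g (x + h *\<^sub>R v) - g (x + h *\<^sub>R w) + g x - h\<^sup>2 * D x\<bar> \<le> e * h\<^sup>2"
proof -
  note sv = smooth_on_frechet_derivative[OF assms(2), of v]
  have "continuous_on S D"
    unfolding D_def by (rule smooth_on_continuous_on[OF smooth_on_frechet_derivative[OF sv]])
  then obtain r1 where r1: "r1 > 0" "\<And>y. y \<in> S \<Longrightarrow> dist y x < r1 \<Longrightarrow> dist (D y) (D x) < e"
    using assms(3,4) unfolding continuous_on_iff by metis
  obtain r2 where r2: "r2 > 0" "ball x r2 \<subseteq> S"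
    using assms(1,3) openE by blast
  define r where "r = min r1 r2"
  have r: "r > 0" "\<And>y. dist y x < r \<Longrightarrow> y \<in> S \<and> \<bar>D y - D x\<bar> < e"
    using r1 r2 by (auto simp: r_def dist_real_def dist_commute subset_iff)
  \<comment> \<open>For h < d the whole parallelogram spanned by h v and h w lies within distance r
    of x; the summand 1 keeps the denominator positive when v = w = 0.\<close>
  define d where "d = r / (norm v + norm w + 1)"
  have pos: "norm v + norm w + 1 > 0" by (smt (verit) norm_ge_zero)
  have "\<bar>g (x + h *\<^sub>R v + h *\<^sub>R w) - g (x + h *\<^sub>R v) - g (x + h *\<^sub>R w) + g x - h\<^sup>2 * D x\<bar> \<le> e * h\<^sup>2"
    if h: "0 < h" "h < d" for h
  proof -
    have near: "dist (x + s *\<^sub>R v + t *\<^sub>R w) x < r" if "0 \<le> s" "s \<le> h" "0 \<le> t" "t \<le> h" for s t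
    proof -
      have "dist (x + s *\<^sub>R v + t *\<^sub>R w) x \<le> norm (s *\<^sub>R v) + norm (t *\<^sub>R w)"
        using norm_triangle_ineq[of "s *\<^sub>R v" "t *\<^sub>R w"] by (simp only: dist_norm add_diff_cancel_left' add.assoc)
      also have "\<dots> = s * norm v + t * norm w" using that by simp
      also have "\<dots> \<le> h * norm v + h * norm w"
        using that by (intro add_mono mult_right_mono) auto
      also have "\<dots> = h * (norm v + norm w)" by (simp add: algebra_simps)
      also have "\<dots> \<le> h * (norm v + norm w + 1)" using h by simp
      also have "\<dots> < r" using h pos by (simp add: d_def field_simps)
      finally show ?thesis .
    qed
    have inS: "x + s *\<^sub>R v + t *\<^sub>R w \<in> S" if "0 \<le> s" "s \<le> h" "0 \<le> t" "t \<le> h" for s t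
      using near[OF that] r(2) by blast
    let ?p = "\<lambda>s. g (x + s *\<^sub>R v + h *\<^sub>R w) - g (x + s *\<^sub>R v)"
    let ?d = "\<lambda>y. frechet_derivative g (at y) v"
    have dp: "(?p has_field_derivative ?d (x + s *\<^sub>R v + h *\<^sub>R w) - ?d (x + s *\<^sub>R v)) (at s)"
      if "0 \<le> s" "s \<le> h" for s
    proof -
      have "((\<lambda>s. g ((x + h *\<^sub>R w) + s *\<^sub>R v)) has_vector_derivative ?d ((x + h *\<^sub>R w) + s *\<^sub>R v)) (at s)"
        using inS[OF that, of h] h
        by (intro has_vector_derivative_line smooth_on_has_derivative[OF assms(2)]) (simp add: add_ac)
      moreover have "((\<lambda>s. g (x + s *\<^sub>R v)) has_vector_derivative ?d (x + s *\<^sub>R v)) (at s)"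
        using inS[OF that, of 0] h
        by (intro has_vector_derivative_line smooth_on_has_derivative[OF assms(2)]) simp
      ultimately show ?thesis
        by (auto simp: add_ac has_real_derivative_iff_has_vector_derivative intro: has_vector_derivative_diff)
    qed
    obtain s where s: "0 < s" "s < h"
      "?p h - ?p 0 = (h - 0) * (?d (x + s *\<^sub>R v + h *\<^sub>R w) - ?d (x + s *\<^sub>R v))"
      using MVT2[OF h(1), of ?p "\<lambda>s. ?d (x + s *\<^sub>R v + h *\<^sub>R w) - ?d (x + s *\<^sub>R v)"] dp by blast
    have dq: "((\<lambda>t. ?d (x + s *\<^sub>R v + t *\<^sub>R w)) has_field_derivative D (x + s *\<^sub>R v + t *\<^sub>R w)) (at t)"
      if "0 \<le> t" "t \<le> h" for t
      unfolding has_real_derivative_iff_has_vector_derivative D_def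
      using inS[of s t] that s
      by (intro has_vector_derivative_line smooth_on_has_derivative[OF sv]) simp
    obtain t where t: "0 < t" "t < h"
      "?d (x + s *\<^sub>R v + h *\<^sub>R w) - ?d (x + s *\<^sub>R v + 0 *\<^sub>R w) = (h - 0) * D (x + s *\<^sub>R v + t *\<^sub>R w)"
      using MVT2[OF h(1), of "\<lambda>t. ?d (x + s *\<^sub>R v + t *\<^sub>R w)" "\<lambda>t. D (x + s *\<^sub>R v + t *\<^sub>R w)"] dq by blast
    have "?p h - ?p 0 = h\<^sup>2 * D (x + s *\<^sub>R v + t *\<^sub>R w)"
      using s(3) t(3) by (simp add: power2_eq_square)
    then have "g (x + h *\<^sub>R v + h *\<^sub>R w) - g (x + h *\<^sub>R v) - g (x + h *\<^sub>R w) + g x - h\<^sup>2 * D x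
       = h\<^sup>2 * (D (x + s *\<^sub>R v + t *\<^sub>R w) - D x)"
      by (simp add: algebra_simps)
    moreover have "\<bar>D (x + s *\<^sub>R v + t *\<^sub>R w) - D x\<bar> < e"
      using near[of s t] r(2) s t by simp
    ultimately show ?thesis
      using mult_right_mono[of "\<bar>D (x + s *\<^sub>R v + t *\<^sub>R w) - D x\<bar>" e "h\<^sup>2"]
      by (simp add: abs_mult mult.commute)
  qed
  moreover have "d > 0" using r pos by (simp add: d_def)
  ultimately show ?thesis by blast
qed

lemma second_derivative_symmetric_real:
  fixes g :: "'a::euclidean_space \<Rightarrow> real"
  assumes "open S" "smooth_on S g" "x \<in> S"
  shows "frechet_derivative (\<lambda>y. frechet_derivative g (at y) v) (at x) w =
         frechet_derivative (\<lambda>y. frechet_derivative g (at y) w) (at x) v" (is "?a = ?b")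
proof (rule ccontr)
  assume "?a \<noteq> ?b"
  \<comment> \<open>Two errors of size e add up to half of the assumed gap, a contradiction.\<close>
  define e where "e = \<bar>?a - ?b\<bar> / 4"
  have e: "e > 0" using \<open>?a \<noteq> ?b\<close> by (simp add: e_def)
  obtain d1 where d1: "d1 > 0" "\<And>h. 0 < h \<and> h < d1 \<Longrightarrow>
    \<bar>g (x + h *\<^sub>R v + h *\<^sub>R w) - g (x + h *\<^sub>R v) - g (x + h *\<^sub>R w) + g x - h\<^sup>2 * ?a\<bar> \<le> e * h\<^sup>2"
    using second_difference_estimate[OF assms e] by meson
  obtain d2 where d2: "d2 > 0" "\<And>h. 0 < h \<and> h < d2 \<Longrightarrow>
    \<bar>g (x + h *\<^sub>R w + h *\<^sub>R v) - g (x + h *\<^sub>R w) - g (x + h *\<^sub>R v) + g x - h\<^sup>2 * ?b\<bar> \<le> e * h\<^sup>2"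
    using second_difference_estimate[OF assms e] by meson
  define h where "h = min d1 d2 / 2"
  have h: "0 < h" "h < d1" "h < d2" using d1 d2 by (auto simp: h_def)
  have comm: "x + h *\<^sub>R w + h *\<^sub>R v = x + h *\<^sub>R v + h *\<^sub>R w" by (simp add: add_ac)
  have "\<bar>h\<^sup>2 * ?a - h\<^sup>2 * ?b\<bar> \<le> 2 * (e * h\<^sup>2)"
    using d1(2)[of h] d2(2)[of h] h unfolding comm by linarith
  then have "h\<^sup>2 * \<bar>?a - ?b\<bar> \<le> h\<^sup>2 * (2 * e)"
    by (simp only: right_diff_distrib[symmetric] abs_mult) (simp add: mult_ac)
  then have "\<bar>?a - ?b\<bar> \<le> 2 * e" using h by simp
  then show False using e by (simp add: e_def)
qed

lemma frechet_derivative_linear_compose: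
  assumes "linear L" "(f has_derivative f') (at (x::'a::euclidean_space))"
  shows "frechet_derivative (\<lambda>y. L (f y :: 'b::euclidean_space) :: 'c::euclidean_space) (at x) = (\<lambda>v. L (f' v))"
  using frechet_derivative_at[OF bounded_linear.has_derivative[OF _ assms(2), of L]] assms(1)
  by (simp add: linear_conv_bounded_linear)

lemma second_derivative_symmetric:
  assumes "open S" "smooth_on S f" "x \<in> S"
  shows "frechet_derivative (\<lambda>y. frechet_derivative f (at y) v) (at x) w =
         frechet_derivative (\<lambda>y. frechet_derivative f (at y) w) (at x) v"
proof (rule euclidean_eqI)
  fix b :: 'b assume "b \<in> Basis"
  let ?L = "\<lambda>y::'b. y \<bullet> b"
  have L: "linear ?L" by (simp add: bounded_linear.linear bounded_linear_inner_left)
  let ?g = "\<lambda>y. f y \<bullet> b"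
  have g: "smooth_on S ?g" using smooth_on_linear_compose[OF assms(1) L assms(2)] .
  have 1: "frechet_derivative ?g (at y) v = frechet_derivative f (at y) v \<bullet> b" if "y \<in> S" for y v
    using frechet_derivative_linear_compose[OF L smooth_on_has_derivative[OF assms(2) that]] by simp
  have 2: "frechet_derivative (\<lambda>y. frechet_derivative ?g (at y) v) (at x) w =
    frechet_derivative (\<lambda>y. frechet_derivative f (at y) v) (at x) w \<bullet> b" for v w
  proof -
    note sv = smooth_on_frechet_derivative[OF assms(2), of v]
    have "frechet_derivative (\<lambda>y. frechet_derivative f (at y) v \<bullet> b) (at x) =
      frechet_derivative (\<lambda>y. frechet_derivative ?g (at y) v) (at x)"
      using assms 1 smooth_on_has_derivative[OF smooth_on_linear_compose[OF assms(1) L sv]]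
      by (intro frechet_derivative_transform_within_open[of _ _ S]) (auto intro: differentiableI)
    then show ?thesis
      using fun_cong[OF frechet_derivative_linear_compose[OF L smooth_on_has_derivative[OF sv assms(3)]], of w]
      by (simp only:)
  qed
  show "frechet_derivative (\<lambda>y. frechet_derivative f (at y) v) (at x) w \<bullet> b =
         frechet_derivative (\<lambda>y. frechet_derivative f (at y) w) (at x) v \<bullet> b"
    using second_derivative_symmetric_real[OF assms(1) g assms(3), of v w] by (simp add: 2)
qed

section \<open>Alternating forms\<close>

text \<open>Alternation is encoded as vanishing on repeated arguments; the sign rule follows from it
  in \<open>alt_form_permute\<close>.\<close>

definition alt_form :: "nat \<Rightarrow> ((nat \<Rightarrow> 'a::real_vector) \<Rightarrow> real) \<Rightarrow> bool" where
  "alt_form k \<alpha> \<longleftrightarrow>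
     (\<forall>v w. (\<forall>i<k. v i = w i) \<longrightarrow> \<alpha> v = \<alpha> w) \<and>
     (\<forall>v. \<forall>i<k. linear (\<lambda>x. \<alpha> (v(i := x)))) \<and>
     (\<forall>v i j. i < j \<longrightarrow> j < k \<longrightarrow> v i = v j \<longrightarrow> \<alpha> v = 0)"

lemma alt_form_cong: "alt_form k \<alpha> \<Longrightarrow> (\<And>i. i < k \<Longrightarrow> v i = w i) \<Longrightarrow> \<alpha> v = \<alpha> w"
  unfolding alt_form_def by blast

lemma alt_form_linear: "alt_form k \<alpha> \<Longrightarrow> i < k \<Longrightarrow> linear (\<lambda>x. \<alpha> (v(i := x)))"
  unfolding alt_form_def by blast

lemma alt_form_equal: "alt_form k \<alpha> \<Longrightarrow> i < k \<Longrightarrow> j < k \<Longrightarrow> i \<noteq> j \<Longrightarrow> v i = v j \<Longrightarrow> \<alpha> v = 0"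
  unfolding alt_form_def by (metis nat_neq_iff)

text \<open>Polarization: the form vanishes with \<open>v i + v j\<close> in both slots, and
  expanding leaves the two mixed terms.\<close>

lemma alt_form_transpose:
  assumes "alt_form k \<alpha>" "i < k" "j < k" "i \<noteq> j"
  shows "\<alpha> (v \<circ> Transposition.transpose i j) = - \<alpha> v"
proof -
  let ?f = "\<lambda>x y. \<alpha> (v(i := x, j := y))"
  have l2: "linear (?f x)" for x using alt_form_linear[OF assms(1,3)] .
  have l1: "linear (\<lambda>x. ?f x y)" for y
    using alt_form_linear[OF assms(1,2), of "v(j := y)"] assms(4) by (simp add: fun_upd_twist)
  have 0: "?f x x = 0" for x
    by (rule alt_form_equal[OF assms]) (use assms(4) in auto)
  have "?f (v i + v j) (v i + v j) = ?f (v i) (v i) + ?f (v i) (v j) + (?f (v j) (v i) + ?f (v j) (v j))"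
    using linear_add[OF l1] linear_add[OF l2] by simp
  then have "?f (v j) (v i) = - ?f (v i) (v j)" using 0[of "v i"] 0[of "v j"] 0[of "v i + v j"] by linarith
  moreover have "v(i := v j, j := v i) = v \<circ> Transposition.transpose i j" using assms(4)
    by (auto simp: fun_eq_iff Transposition.transpose_def)
  ultimately show ?thesis by simp
qed

lemma alt_form_permute:
  assumes "alt_form k \<alpha>" "\<sigma> permutes {..<k}"
  shows "\<alpha> (v \<circ> \<sigma>) = of_int (sign \<sigma>) * \<alpha> v"
proof -
  have "\<forall>v. \<alpha> (v \<circ> \<sigma>) = of_int (sign \<sigma>) * \<alpha> v"
    using assms(2) finite_lessThan
  proof (induction rule: permutes_induct)
    case (swap a b p)
    have "permutation p" using swap permutation_permutes by blast
    then have "sign (Transposition.transpose a b \<circ> p) = - sign p"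
      using swap by (simp add: sign_compose permutation_swap_id sign_swap_id)
    moreover have "\<alpha> (w \<circ> p) = of_int (sign p) * \<alpha> w" for w using swap by blast
    moreover have "\<alpha> (v \<circ> Transposition.transpose a b) = - \<alpha> v" for v
      using swap alt_form_transpose[OF assms(1), of a b v] by simp
    ultimately have "\<alpha> ((v \<circ> Transposition.transpose a b) \<circ> p) = of_int (sign (Transposition.transpose a b \<circ> p)) * \<alpha> v" for v
      by (simp only: of_int_minus mult_minus_left mult_minus_right)
    then show ?case by (metis comp_assoc)
  qed simp
  then show ?thesis by blast
qed

lemma alt_form_zero_arg:
  assumes "alt_form k \<alpha>" "i < k" "v i = 0" shows "\<alpha> v = 0"
  using linear_0[OF alt_form_linear[OF assms(1,2), of v]] assms(3) by (metis fun_upd_triv)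

text \<open>The induction runs over the number r of arguments already expanded, the tail
  \<open>v\<close> being arbitrary so that the r-th argument can be passed through it. A choice
  function on r + 1 slots is a choice on r slots together with one more index.\<close>

lemma alt_form_expand:
  assumes "alt_form k \<alpha>" "finite J" "r \<le> k"
  shows "\<alpha> (\<lambda>i. if i < r then \<Sum>j\<in>J. C i j *\<^sub>R b j else v i) =
    (\<Sum>f\<in>Pi\<^sub>E {..<r} (\<lambda>_. J). (\<Prod>i<r. C i (f i)) * \<alpha> (\<lambda>i. if i < r then b (f i) else v i))"
  using assms(3)
proof (induction r arbitrary: v)
  case 0
  then show ?case by simp
next
  case (Suc r)
  let ?v = "\<lambda>x. v(r := x)"
  let ?g = "\<lambda>f x. \<lambda>i. if i < r then b (f i) else ?v x i"
  have lin: "linear (\<lambda>x. \<alpha> (?g f x))" for f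
  proof -
    have "?g f x = (\<lambda>i. if i < r then b (f i) else v i)(r := x)" for x by auto
    then show ?thesis
      using alt_form_linear[OF assms(1), of r "\<lambda>i. if i < r then b (f i) else v i"] Suc.prems by simp
  qed
  have "\<alpha> (\<lambda>i. if i < Suc r then \<Sum>j\<in>J. C i j *\<^sub>R b j else v i) =
      \<alpha> (\<lambda>i. if i < r then \<Sum>j\<in>J. C i j *\<^sub>R b j else ?v (\<Sum>j\<in>J. C r j *\<^sub>R b j) i)"
    by (rule arg_cong[of _ _ \<alpha>]) (auto simp: fun_eq_iff less_Suc_eq)
  also have "\<dots> = (\<Sum>f\<in>Pi\<^sub>E {..<r} (\<lambda>_. J). (\<Prod>i<r. C i (f i)) * \<alpha> (?g f (\<Sum>j\<in>J. C r j *\<^sub>R b j)))"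
    using Suc by simp
  also have "\<dots> = (\<Sum>f\<in>Pi\<^sub>E {..<r} (\<lambda>_. J). \<Sum>j\<in>J. (\<Prod>i<r. C i (f i)) * C r j * \<alpha> (?g f (b j)))"
    unfolding linear_sum[OF lin] linear_cmul[OF lin] sum_distrib_left by (simp only: mult.assoc real_scaleR_def)
  also have "\<dots> = (\<Sum>(j, f)\<in>J \<times> Pi\<^sub>E {..<r} (\<lambda>_. J). (\<Prod>i<r. C i (f i)) * C r j * \<alpha> (?g f (b j)))"
    by (subst sum.swap) (simp add: sum.cartesian_product)
  also have "\<dots> = (\<Sum>f\<in>Pi\<^sub>E {..<Suc r} (\<lambda>_. J). (\<Prod>i<Suc r. C i (f i)) * \<alpha> (\<lambda>i. if i < Suc r then b (f i) else v i))"
  proof -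
    have "inj_on (\<lambda>(j, f). f(r := j)) (J \<times> Pi\<^sub>E {..<r} (\<lambda>_. J))"
      using inj_combinator[of r "{..<r}" "\<lambda>_. J"] by simp
    moreover have "(\<lambda>(j, f). f(r := j)) ` (J \<times> Pi\<^sub>E {..<r} (\<lambda>_. J)) = Pi\<^sub>E {..<Suc r} (\<lambda>_. J)"
      unfolding lessThan_Suc by (simp add: PiE_insert_eq)
    moreover have eq: "(\<Prod>i<r. C i (f i)) * C r j * \<alpha> (?g f (b j)) =
        (\<Prod>i<Suc r. C i ((f(r := j)) i)) * \<alpha> (\<lambda>i. if i < Suc r then b ((f(r := j)) i) else v i)" for j f
    proof -
      have "?g f (b j) = (\<lambda>i. if i < Suc r then b ((f(r := j)) i) else v i)"
        by (auto simp: fun_eq_iff less_Suc_eq)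
      then show ?thesis by simp
    qed
    ultimately show ?thesis
      by (intro sum.reindex_cong[symmetric, of "\<lambda>(j, f). f(r := j)"]) (simp_all only: split_paired_all prod.case)
  qed
  finally show ?case .
qed

text \<open>In the full expansion non-injective index functions contribute zero by alternation. The
  injective ones are the permutations, each contributing its sign, and the sum is the Leibniz
  formula.\<close>

lemma alt_form_det_nat_expand:
  assumes "alt_form k \<alpha>" "\<And>i. i < k \<Longrightarrow> v i = (\<Sum>j<k. C i j *\<^sub>R b j)"
  shows "\<alpha> v = det_nat k C * \<alpha> b"
proof -
  let ?T = "\<lambda>f. (\<Prod>i<k. C i (f i)) * \<alpha> (\<lambda>i. b (f i))"
  let ?P = "Pi\<^sub>E {..<k} (\<lambda>_. {..<k})"
  have "\<alpha> v = \<alpha> (\<lambda>i. if i < k then \<Sum>j<k. C i j *\<^sub>R b j else undefined)"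
    by (rule alt_form_cong[OF assms(1)]) (simp add: assms(2))
  also have "\<dots> = (\<Sum>f\<in>?P. (\<Prod>i<k. C i (f i)) * \<alpha> (\<lambda>i. if i < k then b (f i) else undefined))"
    by (rule alt_form_expand[OF assms(1)]) auto
  also have "\<dots> = (\<Sum>f\<in>?P. ?T f)"
    by (intro sum.cong refl arg_cong2[of _ _ _ _ "(*)"] alt_form_cong[OF assms(1)]) auto
  also have "\<dots> = (\<Sum>f\<in>{f\<in>?P. inj_on f {..<k}}. ?T f)"
  proof (rule sum.mono_neutral_right)
    show "\<forall>f\<in>?P - {f \<in> ?P. inj_on f {..<k}}. ?T f = 0"
    proof
      fix f assume "f \<in> ?P - {f \<in> ?P. inj_on f {..<k}}"
      then obtain i j where "i < k" "j < k" "i \<noteq> j" "f i = f j" unfolding inj_on_def by auto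
      then show "?T f = 0" using alt_form_equal[OF assms(1), of i j "\<lambda>i. b (f i)"] by simp
    qed
  qed (auto intro: finite_PiE)
  also have "\<dots> = (\<Sum>\<sigma> | \<sigma> permutes {..<k}. ?T \<sigma>)"
  proof (rule sum.reindex_bij_witness[of _ "\<lambda>\<sigma>. restrict \<sigma> {..<k}" "\<lambda>f i. if i < k then f i else i"])
    fix f assume f: "f \<in> {f \<in> ?P. inj_on f {..<k}}"
    then show "restrict (\<lambda>i. if i < k then f i else i) {..<k} = f"
      by (auto simp: restrict_def fun_eq_iff PiE_def extensional_def)
    have "f ` {..<k} = {..<k}" using f by (intro endo_inj_surj) auto
    then show "(\<lambda>i. if i < k then f i else i) \<in> {\<sigma>. \<sigma> permutes {..<k}}"
      using f by (auto intro!: bij_imp_permutes simp: bij_betw_def inj_on_def)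
    show "?T (\<lambda>i. if i < k then f i else i) = ?T f"
      by (intro arg_cong2[of _ _ _ _ "(*)"] prod.cong refl alt_form_cong[OF assms(1)]) auto
  next
    fix \<sigma> assume "\<sigma> \<in> {\<sigma>. \<sigma> permutes {..<k}}"
    then have \<sigma>: "\<sigma> permutes {..<k}" by simp
    then show "(\<lambda>i. if i < k then restrict \<sigma> {..<k} i else i) = \<sigma>"
      by (auto simp: fun_eq_iff permutes_not_in)
    show "restrict \<sigma> {..<k} \<in> {f \<in> ?P. inj_on f {..<k}}"
      using permutes_in_image[OF \<sigma>] permutes_inj_on[OF \<sigma>, of "{..<k}"] by auto
  qed
  also have "\<dots> = det_nat k C * \<alpha> b"
    using alt_form_permute[OF assms(1), of _ b]
    by (auto simp: det_nat_def sum_distrib_right comp_def intro!: sum.cong)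
  finally show ?thesis .
qed

lemma span_lessThan_expand:
  assumes "x \<in> span (b ` {..<k})"
  shows "\<exists>c. x = (\<Sum>j<(k::nat). c j *\<^sub>R b j)"
  using assms
proof (induction rule: span_induct_alt)
  case base
  show ?case by (rule exI[of _ "\<lambda>_. 0"]) simp
next
  case (step c x y)
  then obtain d i where d: "y = (\<Sum>j<k. d j *\<^sub>R b j)" "x = b i" "i < k" by auto
  have "c *\<^sub>R x + y = (\<Sum>j<k. (d j + (if j = i then c else 0)) *\<^sub>R b j)"
    using d(3) by (simp add: d(1,2) scaleR_add_left sum.distrib if_distrib[of "\<lambda>t. t *\<^sub>R _"] cong: if_cong)
  then show ?case by (rule exI[of _ "\<lambda>j. d j + (if j = i then c else 0)"])
qed

lemma alt_form_expand_span:
  assumes "\<And>i. i < k \<Longrightarrow> v i \<in> span (b ` {..<k})"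
  shows "\<exists>C. \<forall>i<k. v i = (\<Sum>j<(k::nat). C i j *\<^sub>R b j)"
proof -
  have "\<forall>i. \<exists>c. i < k \<longrightarrow> v i = (\<Sum>j<k. c j *\<^sub>R b j)"
    using span_lessThan_expand assms by metis
  then show ?thesis by metis
qed

text \<open>Both values are the same determinant times the value on \<open>b\<close>. This is the
  standard way below to identify determinants and forms of top degree: check that both sides
  alternate, then evaluate on one frame.\<close>

lemma alt_form_unique:
  assumes "alt_form k \<alpha>" "alt_form k \<gamma>" "\<alpha> b = \<gamma> b" "\<And>i. i < k \<Longrightarrow> v i \<in> span (b ` {..<k})"
  shows "\<alpha> v = \<gamma> v"
proof -
  obtain C where C: "\<forall>i<k. v i = (\<Sum>j<k. C i j *\<^sub>R b j)"
    using alt_form_expand_span[of k v b] assms(4) by metis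
  show ?thesis
    using alt_form_det_nat_expand[OF assms(1), of v C b] alt_form_det_nat_expand[OF assms(2), of v C b] C assms(3)
    by simp
qed

text \<open>A column operation: components along a direction that the form annihilates may be
  removed from all arguments at once.\<close>

lemma alt_form_shift:
  assumes "alt_form k \<alpha>" "\<And>v j. j < k \<Longrightarrow> \<alpha> (v(j := e)) = 0"
  shows "\<alpha> (\<lambda>i. v i + t i *\<^sub>R e) = \<alpha> v"
proof -
  have "\<alpha> (\<lambda>i. if i < r then v i + t i *\<^sub>R e else v i) = \<alpha> v" if "r \<le> k" for r
    using that
  proof (induction r)
    case (Suc r)
    let ?w = "\<lambda>i. if i < r then v i + t i *\<^sub>R e else v i"
    have r: "r < k" using Suc.prems by simp
    have "(\<lambda>i. if i < Suc r then v i + t i *\<^sub>R e else v i) = ?w(r := v r + t r *\<^sub>R e)"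
      by (auto simp: fun_eq_iff)
    then have "\<alpha> (\<lambda>i. if i < Suc r then v i + t i *\<^sub>R e else v i) = \<alpha> (?w(r := v r)) + t r * \<alpha> (?w(r := e))"
      using linear_add[OF alt_form_linear[OF assms(1) r]] linear_cmul[OF alt_form_linear[OF assms(1) r]] by simp
    moreover have "?w(r := v r) = ?w" by auto
    ultimately show ?case using Suc assms(2)[OF r] by simp
  qed simp
  from this[OF order_refl] show ?thesis
    using alt_form_cong[OF assms(1), of "\<lambda>i. v i + t i *\<^sub>R e" "\<lambda>i. if i < k then v i + t i *\<^sub>R e else v i"] by simp
qed

lemma alt_form_contract:
  assumes "alt_form (Suc k) \<alpha>" shows "alt_form k (contract x \<alpha>)"
  unfolding alt_form_def contract_def
proof (intro conjI allI impI)
  fix v w :: "nat \<Rightarrow> 'a" assume "\<forall>i<k. v i = w i"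
  then show "\<alpha> (case_nat x v) = \<alpha> (case_nat x w)"
    by (intro alt_form_cong[OF assms]) (auto split: nat.split)
next
  fix v and i assume "i < k"
  moreover have "case_nat x (v(i := y)) = (case_nat x v)(Suc i := y)" for y
    by (auto simp: fun_eq_iff split: nat.split)
  ultimately show "linear (\<lambda>y. \<alpha> (case_nat x (v(i := y))))"
    using alt_form_linear[OF assms, of "Suc i" "case_nat x v"] by simp
next
  fix v :: "nat \<Rightarrow> 'a" and i j assume "i < j" "j < k" "v i = v j"
  then show "\<alpha> (case_nat x v) = 0"
    by (intro alt_form_equal[OF assms, of "Suc i" "Suc j"]) auto
qed

lemma alt_form_scale:
  fixes \<alpha> :: "(nat \<Rightarrow> 'a::real_vector) \<Rightarrow> real"
  assumes "alt_form k \<alpha>" shows "alt_form k (\<lambda>v. c * \<alpha> v)"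
proof -
  have "linear (\<lambda>x. c * f x)" if "linear f" for f :: "'a \<Rightarrow> real"
    by (rule linearI) (simp_all add: linear_add[OF that] linear_cmul[OF that] distrib_left)
  then show ?thesis using assms unfolding alt_form_def by auto
qed

lemma alt_form_linear_image:
  assumes "alt_form k \<alpha>" "linear L" shows "alt_form k (\<lambda>v. \<alpha> (\<lambda>i. L (v i)))"
  unfolding alt_form_def
proof (intro conjI allI impI)
  fix v w :: "nat \<Rightarrow> 'b" assume "\<forall>i<k. v i = w i"
  then show "\<alpha> (\<lambda>i. L (v i)) = \<alpha> (\<lambda>i. L (w i))"
    by (intro alt_form_cong[OF assms(1)]) auto
next
  fix v and i assume "i < k"
  have "(\<lambda>j. L ((v(i := x)) j)) = (\<lambda>j. L (v j))(i := L x)" for x by auto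
  then show "linear (\<lambda>x. \<alpha> (\<lambda>j. L ((v(i := x)) j)))"
    using linear_compose[OF assms(2) alt_form_linear[OF assms(1) \<open>i < k\<close>, of "\<lambda>j. L (v j)"]]
    by (simp add: comp_def)
next
  fix v :: "nat \<Rightarrow> 'b" and i j assume "i < j" "j < k" "v i = v j"
  then show "\<alpha> (\<lambda>i. L (v i)) = 0" by (intro alt_form_equal[OF assms(1), of i j]) auto
qed

lemma alt_form_adjacent_swap:
  assumes "alt_form k \<alpha>" "length xs + Suc (length zs) < k"
  shows "\<alpha> ((!) (xs @ a # b # zs)) = - \<alpha> ((!) (xs @ b # a # zs))"
proof -
  let ?i = "length xs"
  have "\<alpha> ((!) (xs @ b # a # zs) \<circ> Transposition.transpose ?i (Suc ?i)) = - \<alpha> ((!) (xs @ b # a # zs))"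
    using assms(2) by (intro alt_form_transpose[OF assms(1)]) auto
  moreover have "(!) (xs @ b # a # zs) \<circ> Transposition.transpose ?i (Suc ?i) = (!) (xs @ a # b # zs)"
    by (auto simp: fun_eq_iff Transposition.transpose_def nth_append nth_Cons split: nat.split)
  ultimately show ?thesis by simp
qed

lemma alt_form_move:
  assumes "alt_form k \<alpha>" "length xs + length ys + length zs < k"
  shows "\<alpha> ((!) (xs @ a # ys @ zs)) = (-1) ^ length ys * \<alpha> ((!) (xs @ ys @ a # zs))"
  using assms(2)
proof (induction ys arbitrary: xs)
  case (Cons y ys)
  have "\<alpha> ((!) (xs @ a # y # ys @ zs)) = - \<alpha> ((!) (xs @ y # a # ys @ zs))"
    using alt_form_adjacent_swap[OF assms(1), of xs "ys @ zs" a y] Cons.prems by simp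
  also have "\<alpha> ((!) (xs @ y # a # ys @ zs)) = (-1) ^ length ys * \<alpha> ((!) (xs @ y # ys @ a # zs))"
    using Cons.IH[of "xs @ [y]"] Cons.prems by simp
  finally show ?case by simp
qed simp

text \<open>The order e1, y1, e2, y2, ... in which a power of a two-form is evaluated on symplectic
  pairs; a product volume form wants all e before all y.\<close>

fun interleave :: "'a list \<Rightarrow> 'a list \<Rightarrow> 'a list" where
  "interleave (e # es) (y # ys) = e # y # interleave es ys"
| "interleave _ _ = []"

text \<open>Sorting moves each e to the left. The i-th one passes over \<open>zs\<close> and over
  the i vectors y left behind earlier, hence the exponent. In the induction \<open>xs\<close>
  collects the sorted e and \<open>zs\<close> grows by one y per step.\<close>

lemma alt_form_interleave:
  assumes "alt_form k \<alpha>" "length es = length ys" "length xs + length zs + 2 * length es \<le> k"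
  shows "\<alpha> ((!) (xs @ zs @ interleave es ys)) =
    (-1) ^ (\<Sum>i<length es. length zs + i) * \<alpha> ((!) (xs @ es @ zs @ ys))"
  using assms(2,3)
proof (induction es ys arbitrary: xs zs rule: list_induct2)
  case (Cons e es y ys)
  let ?r = "interleave es ys"
  have len: "length ?r = 2 * length es" using Cons.hyps
    by (induction es ys rule: list_induct2) auto
  have "\<alpha> ((!) (xs @ e # zs @ y # ?r)) = (-1) ^ length zs * \<alpha> ((!) (xs @ zs @ e # y # ?r))"
    using alt_form_move[OF assms(1), of xs zs "y # ?r" e] Cons.prems len by simp
  then have "\<alpha> ((!) (xs @ zs @ e # y # ?r)) = (-1) ^ length zs * \<alpha> ((!) (xs @ e # zs @ y # ?r))"
    by (simp flip: power_add mult.assoc)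
  also have "\<alpha> ((!) (xs @ e # zs @ y # ?r)) =
      (-1) ^ (\<Sum>i<length es. length zs + Suc i) * \<alpha> ((!) (xs @ e # es @ zs @ y # ys))"
    using Cons.IH[of "xs @ [e]" "zs @ [y]"] Cons.prems by simp
  finally show ?case
    by (simp add: sum.lessThan_Suc_shift power_add del: sum.lessThan_Suc)
qed simp

section \<open>Wedge products and powers of two-forms\<close>

lemma linear_mult_const_real:
  fixes f :: "'a::real_vector \<Rightarrow> real"
  assumes "linear f" shows "linear (\<lambda>x. c * f x * d)"
  by (rule linearI) (simp_all add: linear_add[OF assms] linear_cmul[OF assms] algebra_simps)

lemma alt_form_wedge:
  assumes "alt_form k \<alpha>" "alt_form l \<gamma>"
  shows "alt_form (k + l) (wedge k l \<alpha> \<gamma>)"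
  unfolding alt_form_def
proof (intro conjI allI impI)
  fix v w :: "nat \<Rightarrow> 'a" assume vw: "\<forall>i<k + l. v i = w i"
  have "\<alpha> (\<lambda>i. v (\<sigma> i)) = \<alpha> (\<lambda>i. w (\<sigma> i)) \<and> \<gamma> (\<lambda>i. v (\<sigma> (k + i))) = \<gamma> (\<lambda>i. w (\<sigma> (k + i)))"
    if "\<sigma> permutes {..<k + l}" for \<sigma>
    using vw permutes_in_image[OF that]
    by (intro conjI alt_form_cong[OF assms(1)] alt_form_cong[OF assms(2)]) auto
  then show "wedge k l \<alpha> \<gamma> v = wedge k l \<alpha> \<gamma> w"
    unfolding wedge_def by (intro arg_cong2[of _ _ _ _ "(/)"] sum.cong) auto
next
  fix v :: "nat \<Rightarrow> 'a" and i assume i: "i < k + l"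
  have "linear (\<lambda>x. of_int (sign \<sigma>) * \<alpha> (\<lambda>j. (v(i := x)) (\<sigma> j)) * \<gamma> (\<lambda>j. (v(i := x)) (\<sigma> (k + j))))"
    if \<sigma>: "\<sigma> permutes {..<k + l}" for \<sigma>
  proof -
    \<comment> \<open>The place to which the permutation sends argument i: below k it is a slot of
      \<alpha>, otherwise slot p - k of \<gamma>, so each summand is linear through exactly one
      factor.\<close>
    define p where "p = inv \<sigma> i"
    have p: "\<sigma> p = i" "p < k + l" "\<And>j. \<sigma> j = i \<longleftrightarrow> j = p"
      using \<sigma> i permutes_inverses[OF \<sigma>] permutes_in_image[OF permutes_inv[OF \<sigma>], of i]
      by (auto simp: p_def)
    show ?thesis
    proof (cases "p < k")
      case True
      have "(\<lambda>j. (v(i := x)) (\<sigma> j)) = (\<lambda>j. v (\<sigma> j))(p := x)" for x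
        by (auto simp: fun_eq_iff p)
      moreover have "(\<lambda>j. (v(i := x)) (\<sigma> (k + j))) = (\<lambda>j. v (\<sigma> (k + j)))" for x
        using True by (auto simp: fun_eq_iff p)
      ultimately show ?thesis
        using linear_mult_const_real[OF alt_form_linear[OF assms(1) True, of "\<lambda>j. v (\<sigma> j)"]] by simp
    next
      case False
      have "(\<lambda>j. (v(i := x)) (\<sigma> (k + j))) = (\<lambda>j. v (\<sigma> (k + j)))(p - k := x)" for x
        using False by (auto simp: fun_eq_iff p)
      moreover have "\<alpha> (\<lambda>j. (v(i := x)) (\<sigma> j)) = \<alpha> (\<lambda>j. v (\<sigma> j))" for x
        using False by (intro alt_form_cong[OF assms(1)]) (auto simp: p)
      moreover have "p - k < l" using False p by simp
      ultimately show ?thesis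
        using linear_mult_const_real[OF alt_form_linear[OF assms(2) \<open>p - k < l\<close>, of "\<lambda>j. v (\<sigma> (k + j))"], of _ 1] by simp
    qed
  qed
  then have "linear (\<lambda>x. \<Sum>\<sigma> | \<sigma> permutes {..<k + l}. of_int (sign \<sigma>) *
      \<alpha> (\<lambda>j. (v(i := x)) (\<sigma> j)) * \<gamma> (\<lambda>j. (v(i := x)) (\<sigma> (k + j))))"
    by (intro linear_compose_sum) auto
  from linear_mult_const_real[OF this, of "inverse (fact k * fact l)" 1]
  show "linear (\<lambda>x. wedge k l \<alpha> \<gamma> (v(i := x)))"
    unfolding wedge_def by (simp add: divide_inverse mult.commute)
next
  fix v :: "nat \<Rightarrow> 'a" and i j assume ij: "i < j" "j < k + l" "v i = v j"
  let ?t = "Transposition.transpose i j"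
  let ?T = "\<lambda>\<sigma>. of_int (sign \<sigma>) * \<alpha> (\<lambda>i. v (\<sigma> i)) * \<gamma> (\<lambda>i. v (\<sigma> (k + i)))"
  let ?P = "{\<sigma>. \<sigma> permutes {..<k + l}}"
  have t: "?t permutes {..<k + l}" using ij by (intro permutes_swap_id) auto
  have v: "v (?t a) = v a" for a using ij by (auto simp: Transposition.transpose_def)
  have tt: "?t \<circ> (?t \<circ> \<sigma>) = \<sigma>" for \<sigma> by (simp add: fun_eq_iff)
  \<comment> \<open>Composing with the transposition of the two equal arguments leaves both factors
    unchanged and reverses the sign, so the sum equals its own negative.\<close>
  have "sum ?T ?P = (\<Sum>\<sigma>\<in>?P. ?T (?t \<circ> \<sigma>))"
    by (rule sum.reindex_bij_witness[of _ "\<lambda>\<sigma>. ?t \<circ> \<sigma>" "\<lambda>\<sigma>. ?t \<circ> \<sigma>"])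
      (simp_all only: tt mem_Collect_eq permutes_compose[OF _ t])
  also have "\<dots> = (\<Sum>\<sigma>\<in>?P. - ?T \<sigma>)"
  proof (intro sum.cong refl)
    fix \<sigma> assume "\<sigma> \<in> ?P"
    then have "permutation \<sigma>" using permutation_permutes by blast
    then have "sign (?t \<circ> \<sigma>) = - sign \<sigma>"
      using ij by (simp add: sign_compose permutation_swap_id sign_swap_id)
    moreover have "\<alpha> (\<lambda>i. v ((?t \<circ> \<sigma>) i)) = \<alpha> (\<lambda>i. v (\<sigma> i))"
      "\<gamma> (\<lambda>i. v ((?t \<circ> \<sigma>) (k + i))) = \<gamma> (\<lambda>i. v (\<sigma> (k + i)))" by (simp_all add: v)
    ultimately show "?T (?t \<circ> \<sigma>) = - ?T \<sigma>" by (simp only: of_int_minus mult_minus_left)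
  qed
  finally show "wedge k l \<alpha> \<gamma> v = 0"
    unfolding wedge_def sum_negf by simp
qed

lemma wedge_kernel_arg:
  assumes "\<And>w i. i < k \<Longrightarrow> w i = z \<Longrightarrow> \<alpha> w = 0" "\<And>w i. i < l \<Longrightarrow> w i = z \<Longrightarrow> \<gamma> w = 0"
    and "i < k + l" "v i = z"
  shows "wedge k l \<alpha> \<gamma> v = 0"
proof -
  have "\<alpha> (\<lambda>i. v (\<sigma> i)) * \<gamma> (\<lambda>i. v (\<sigma> (k + i))) = 0" if \<sigma>: "\<sigma> permutes {..<k + l}" for \<sigma>
  proof -
    obtain p where p: "\<sigma> p = i" "p < k + l"
      using \<sigma> assms(3) permutes_inverses[OF \<sigma>] permutes_in_image[OF permutes_inv[OF \<sigma>], of i] by auto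
    show ?thesis
    proof (cases "p < k")
      case True
      then show ?thesis using assms(1)[of p "\<lambda>i. v (\<sigma> i)"] p assms(4) by simp
    next
      case False
      then have "\<gamma> (\<lambda>i. v (\<sigma> (k + i))) = 0"
        using assms(2)[of "p - k" "\<lambda>i. v (\<sigma> (k + i))"] p assms(4) by simp
      then show ?thesis by simp
    qed
  qed
  then show ?thesis unfolding wedge_def by (auto intro!: sum.neutral simp: mult.assoc)
qed

definition shift_perm :: "nat \<Rightarrow> (nat \<Rightarrow> nat) \<Rightarrow> nat \<Rightarrow> nat" where
  "shift_perm k q i = (if k \<le> i then k + q (i - k) else i)"

lemma shift_perm:
  assumes "q permutes {..<l}"
  shows "shift_perm k q permutes {k..<k + l} \<and> sign (shift_perm k q) = sign q"
  using assms finite_lessThan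
proof (induction rule: permutes_induct)
  case id
  have "shift_perm k id = id" by (auto simp: shift_perm_def fun_eq_iff)
  then show ?case by (simp only: permutes_id sign_id)
next
  case (swap a b p)
  have eq: "shift_perm k (Transposition.transpose a b \<circ> p) = Transposition.transpose (k + a) (k + b) \<circ> shift_perm k p"
    by (auto simp: shift_perm_def fun_eq_iff Transposition.transpose_def)
  have t: "Transposition.transpose (k + a) (k + b) permutes {k..<k + l}"
    using swap by (intro permutes_swap_id) auto
  have "permutation p" "permutation (shift_perm k p)"
    using swap permutation_permutes by blast+
  then have "sign (Transposition.transpose a b \<circ> p) = - sign p"
    "sign (Transposition.transpose (k + a) (k + b) \<circ> shift_perm k p) = - sign (shift_perm k p)"
    using swap by (simp_all add: sign_compose permutation_swap_id sign_swap_id)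
  then show ?case
    using swap.IH permutes_compose[OF _ t] unfolding eq by metis
qed

text \<open>The premise \<open>van\<close> kills every permutation that mixes the two blocks. The
  others are pairs of permutations of the blocks; there are k! l! of them, each gives the same
  product, and this cancels the normalization of \<open>wedge\<close>.\<close>

lemma wedge_split:
  assumes "alt_form k \<alpha>" "alt_form l \<gamma>"
    and van: "\<And>w i j. i < k \<Longrightarrow> k \<le> j \<Longrightarrow> j < k + l \<Longrightarrow> w i = v j \<Longrightarrow> \<alpha> w = 0"
  shows "wedge k l \<alpha> \<gamma> v = \<alpha> v * \<gamma> (\<lambda>i. v (k + i))"
proof -
  let ?T = "\<lambda>\<sigma>. of_int (sign \<sigma>) * \<alpha> (\<lambda>i. v (\<sigma> i)) * \<gamma> (\<lambda>i. v (\<sigma> (k + i)))"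
  let ?P = "\<lambda>k. {\<sigma>. \<sigma> permutes {..<k::nat}}"
  let ?G = "{\<sigma>\<in>?P (k + l). \<forall>i<k. \<sigma> i < k}"
  have "sum ?T (?P (k + l)) = sum ?T ?G"
  proof (rule sum.mono_neutral_right)
    show "\<forall>\<sigma>\<in>?P (k + l) - ?G. ?T \<sigma> = 0"
    proof
      fix \<sigma> assume "\<sigma> \<in> ?P (k + l) - ?G"
      then obtain i where i: "\<sigma> permutes {..<k + l}" "i < k" "\<not> \<sigma> i < k" by auto
      then have "\<sigma> i < k + l" using permutes_in_image[OF i(1), of i] by auto
      then show "?T \<sigma> = 0" using van[of i "\<sigma> i" "\<lambda>i. v (\<sigma> i)"] i by simp
    qed
  qed (auto simp: finite_permutations)
  also have "\<dots> = (\<Sum>(p, q)\<in>?P k \<times> ?P l. ?T (p \<circ> shift_perm k q))"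
  proof (rule sum.reindex_bij_witness[of _ "\<lambda>(p, q). p \<circ> shift_perm k q"
        "\<lambda>\<sigma>. (\<lambda>i. if i < k then \<sigma> i else i, \<lambda>i. if i < l then \<sigma> (k + i) - k else i)"])
    fix \<sigma> assume "\<sigma> \<in> ?G"
    then have \<sigma>: "\<sigma> permutes {..<k + l}" "\<And>i. i < k \<Longrightarrow> \<sigma> i < k" by auto
    have inj: "\<sigma> i = \<sigma> j \<longleftrightarrow> i = j" for i j using permutes_inj[OF \<sigma>(1)] by (auto dest: injD)
    let ?p = "\<lambda>i. if i < k then \<sigma> i else i" and ?q = "\<lambda>i. if i < l then \<sigma> (k + i) - k else i"
    have surj: "\<sigma> ` {..<k} = {..<k}"
      using \<sigma>(2) by (intro endo_inj_surj) (auto simp: inj_on_def inj)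
    have upper: "\<sigma> i < k \<longleftrightarrow> i < k" for i
    proof
      assume "\<sigma> i < k"
      then obtain j where "j < k" "\<sigma> i = \<sigma> j" using surj by (metis imageE lessThan_iff)
      then show "i < k" using inj by simp
    qed (rule \<sigma>(2))
    have upper2: "k \<le> i \<Longrightarrow> i < k + l \<Longrightarrow> k \<le> \<sigma> i \<and> \<sigma> i < k + l" for i
      using upper[of i] permutes_in_image[OF \<sigma>(1), of i] by auto
    have p: "?p permutes {..<k}"
      using surj by (intro bij_imp_permutes) (auto simp: bij_betw_def inj_on_def inj)
    have "inj_on ?q {..<l}"
    proof (rule inj_onI)
      fix i j assume "i \<in> {..<l}" "j \<in> {..<l}" "?q i = ?q j"
      then have "\<sigma> (k + i) - k = \<sigma> (k + j) - k" "k \<le> \<sigma> (k + i)" "k \<le> \<sigma> (k + j)"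
        using upper2[of "k + i"] upper2[of "k + j"] by auto
      then have "\<sigma> (k + i) = \<sigma> (k + j)" by linarith
      then show "i = j" by (simp add: inj)
    qed
    moreover have "?q ` {..<l} \<subseteq> {..<l}" using upper2[of "k + _"] by (auto simp: less_diff_conv2 add.commute)
    ultimately have "?q ` {..<l} = {..<l}" by (intro endo_inj_surj) auto
    with \<open>inj_on ?q {..<l}\<close> have q: "?q permutes {..<l}"
      by (intro bij_imp_permutes) (auto simp: bij_betw_def)
    show "(?p, ?q) \<in> ?P k \<times> ?P l" using p q by simp
    show eq: "(case (?p, ?q) of (p, q) \<Rightarrow> p \<circ> shift_perm k q) = \<sigma>"
    proof
      fix i
      consider "i < k" | "k \<le> i" "i < k + l" | "k + l \<le> i" by linarith
      then show "(case (?p, ?q) of (p, q) \<Rightarrow> p \<circ> shift_perm k q) i = \<sigma> i"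
      proof cases
        case 1
        then show ?thesis by (simp add: shift_perm_def)
      next
        case 2
        then have "i - k < l" by linarith
        then show ?thesis using 2 upper2[of i] by (simp add: shift_perm_def)
      next
        case 3
        then have "\<sigma> i = i" using permutes_not_in[OF \<sigma>(1)] by simp
        then show ?thesis using 3 by (simp add: shift_perm_def)
      qed
    qed
    show "(case (?p, ?q) of (p, q) \<Rightarrow> ?T (p \<circ> shift_perm k q)) = ?T \<sigma>"
      using eq by (simp only: prod.case)
  next
    fix x assume "x \<in> ?P k \<times> ?P l"
    then obtain p q where x: "x = (p, q)" "p permutes {..<k}" "q permutes {..<l}" by auto
    have s: "shift_perm k q permutes {..<k + l}"
      using shift_perm[OF x(3), of k] by (auto intro: permutes_subset)
    have p: "p permutes {..<k + l}" using x(2) by (auto intro: permutes_subset)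
    show "(case x of (p, q) \<Rightarrow> p \<circ> shift_perm k q) \<in> ?G"
      using permutes_compose[OF s p] permutes_in_image[OF x(2)] by (auto simp: x shift_perm_def)
    have "p (k + j) = k + j" for j using permutes_not_in[OF x(2)] by simp
    then show "((\<lambda>i. if i < k then (case x of (p, q) \<Rightarrow> p \<circ> shift_perm k q) i else i),
        (\<lambda>i. if i < l then (case x of (p, q) \<Rightarrow> p \<circ> shift_perm k q) (k + i) - k else i)) = x"
      using permutes_not_in[OF x(2)] permutes_not_in[OF x(3)] by (auto simp: x shift_perm_def fun_eq_iff)
  qed
  also have "\<dots> = (\<Sum>(p, q)\<in>?P k \<times> ?P l. \<alpha> v * \<gamma> (\<lambda>i. v (k + i)))"
  proof (intro sum.cong refl, clarify)
    fix p q assume p: "p permutes {..<k}" and q: "q permutes {..<l}"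
    have "permutation p" "permutation (shift_perm k q)"
      using p shift_perm[OF q, of k] permutation_permutes by blast+
    then have sgn: "sign (p \<circ> shift_perm k q) = sign p * sign q"
      using shift_perm[OF q, of k] by (simp add: sign_compose)
    have "\<alpha> (\<lambda>i. v ((p \<circ> shift_perm k q) i)) = \<alpha> (v \<circ> p)"
      by (intro alt_form_cong[OF assms(1)]) (auto simp: shift_perm_def)
    also have "\<dots> = of_int (sign p) * \<alpha> v" by (rule alt_form_permute[OF assms(1) p])
    finally have 1: "\<alpha> (\<lambda>i. v ((p \<circ> shift_perm k q) i)) = of_int (sign p) * \<alpha> v" .
    have "\<gamma> (\<lambda>i. v ((p \<circ> shift_perm k q) (k + i))) = \<gamma> ((\<lambda>i. v (k + i)) \<circ> q)"
      using permutes_not_in[OF p] by (intro alt_form_cong[OF assms(2)]) (auto simp: shift_perm_def)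
    also have "\<dots> = of_int (sign q) * \<gamma> (\<lambda>i. v (k + i))" by (rule alt_form_permute[OF assms(2) q])
    finally have 2: "\<gamma> (\<lambda>i. v ((p \<circ> shift_perm k q) (k + i))) = of_int (sign q) * \<gamma> (\<lambda>i. v (k + i))" .
    have "of_int (sign p) * of_int (sign p) = (1::real)" "of_int (sign q) * of_int (sign q) = (1::real)"
      by (simp_all flip: of_int_mult)
    then show "?T (p \<circ> shift_perm k q) = \<alpha> v * \<gamma> (\<lambda>i. v (k + i))"
      unfolding 1 2 sgn of_int_mult by algebra
  qed
  also have "\<dots> = fact k * fact l * (\<alpha> v * \<gamma> (\<lambda>i. v (k + i)))"
    by (simp add: card_permutations card_cartesian_product)
  finally show ?thesis unfolding wedge_def by simp
qed

lemma wedge_sum_left: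
  assumes "finite P"
  shows "wedge k l (\<lambda>v. \<Sum>p\<in>P. \<omega> p v) \<gamma> v = (\<Sum>p\<in>P. wedge k l (\<omega> p) \<gamma> v)"
  unfolding wedge_def sum_divide_distrib[symmetric] sum_distrib_left sum_distrib_right
  by (subst sum.swap) simp

lemma alt_form_wedge_power2: "alt_form 2 \<alpha> \<Longrightarrow> alt_form (2 * r) (wedge_power2 \<alpha> r)"
proof (induction r)
  case 0
  then show ?case by (simp add: alt_form_def)
next
  case (Suc r)
  from alt_form_wedge[OF Suc.prems Suc.IH[OF Suc.prems]] show ?case by simp
qed

lemma wedge_power2_kernel_arg:
  assumes "\<And>w i. i < 2 \<Longrightarrow> w i = z \<Longrightarrow> \<alpha> w = 0" "i < 2 * r" "v i = z"
  shows "wedge_power2 \<alpha> r v = 0"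
  using assms(2,3)
proof (induction r arbitrary: v i)
  case (Suc r)
  show ?case unfolding wedge_power2.simps
    by (rule wedge_kernel_arg[of 2 z _ "2 * r" _ i]) (use assms(1) Suc in auto)
qed simp

lemma alt_form_simple_two_form:
  fixes a b :: "'a::real_vector \<Rightarrow> real"
  assumes "linear a" "linear b"
  shows "alt_form 2 (\<lambda>v. a (v 0) * b (v 1) - a (v 1) * b (v 0))"
proof -
  have "linear (\<lambda>x. a x * c - d * b x)" for c d
    by (rule linearI) (simp_all add: linear_add[OF assms(1)] linear_cmul[OF assms(1)]
        linear_add[OF assms(2)] linear_cmul[OF assms(2)] algebra_simps)
  moreover have "linear (\<lambda>x. d * b x - a x * c)" for c d
    by (rule linearI) (simp_all add: linear_add[OF assms(1)] linear_cmul[OF assms(1)]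
        linear_add[OF assms(2)] linear_cmul[OF assms(2)] algebra_simps)
  ultimately show ?thesis
    unfolding alt_form_def by (auto simp: less_2_cases_iff)
qed

text \<open>The two-form is in Darboux shape with respect to the pairs (e, y). Peeling off one
  factor, only the summands belonging to the chosen pairs survive; each of these r + 1 summands
  contributes r! by induction. The selection \<open>g\<close> of pairs is arbitrary so that one pair
  can be removed.\<close>

lemma wedge_power2_frame:
  fixes a b :: "'p \<Rightarrow> 'a::real_vector \<Rightarrow> real" and e y :: "'p \<Rightarrow> 'a"
  assumes P: "finite P"
    and lin: "\<And>p. p \<in> P \<Longrightarrow> linear (a p)" "\<And>p. p \<in> P \<Longrightarrow> linear (b p)"
    and ae: "\<And>p q. p \<in> P \<Longrightarrow> q \<in> P \<Longrightarrow> a p (e q) = of_bool (p = q)"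
    and ay: "\<And>p q. p \<in> P \<Longrightarrow> q \<in> P \<Longrightarrow> a p (y q) = 0"
    and be: "\<And>p q. p \<in> P \<Longrightarrow> q \<in> P \<Longrightarrow> b p (e q) = 0"
    and bby: "\<And>p q. p \<in> P \<Longrightarrow> q \<in> P \<Longrightarrow> b p (y q) = of_bool (p = q)"
    and g: "inj_on g {..<r}" "g ` {..<r} \<subseteq> P"
  shows "wedge_power2 (\<lambda>v. \<Sum>p\<in>P. a p (v 0) * b p (v 1) - a p (v 1) * b p (v 0)) r
    (\<lambda>i. if even i then e (g (i div 2)) else y (g (i div 2))) = fact r"
  using g
proof (induction r arbitrary: g)
  case 0
  then show ?case by simp
next
  case (Suc r)
  define \<omega> where "\<omega> = (\<lambda>p v. a p (v (0::nat)) * b p (v 1) - a p (v 1) * b p (v 0))"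
  let ?\<Omega> = "\<lambda>v. \<Sum>p\<in>P. \<omega> p v"
  define \<Gamma> where "\<Gamma> = wedge_power2 ?\<Omega> r"
  define W where "W = (\<lambda>g i. if even i then e (g (i div 2)) else y (g ((i::nat) div 2)))"
  have alt\<omega>: "alt_form 2 (\<omega> p)" if "p \<in> P" for p
    unfolding \<omega>_def using alt_form_simple_two_form[OF lin(1)[OF that] lin(2)[OF that]] .
  have alt\<Omega>: "alt_form 2 ?\<Omega>"
    unfolding alt_form_def
  proof (intro conjI allI impI)
    fix v w :: "nat \<Rightarrow> 'a" assume "\<forall>i<2. v i = w i"
    then show "?\<Omega> v = ?\<Omega> w" by (intro sum.cong refl alt_form_cong[OF alt\<omega>]) auto
  next
    fix v :: "nat \<Rightarrow> 'a" and i :: nat assume "i < 2"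
    then show "linear (\<lambda>x. ?\<Omega> (v(i := x)))"
      by (intro linear_compose_sum ballI alt_form_linear[OF alt\<omega>])
  next
    fix v :: "nat \<Rightarrow> 'a" and i j :: nat assume "i < j" "j < 2" "v i = v j"
    then show "?\<Omega> v = 0" using alt_form_equal[OF alt\<omega>, of _ i j v] by simp
  qed
  have alt\<Gamma>: "alt_form (2 * r) \<Gamma>" unfolding \<Gamma>_def by (rule alt_form_wedge_power2[OF alt\<Omega>])
  have gP: "g i \<in> P" if "i < Suc r" for i using Suc.prems(2) that by auto
  have IH: "\<Gamma> (W h) = fact r" if "inj_on h {..<r}" "h ` {..<r} \<subseteq> P" for h
    using Suc.IH[OF that] by (simp add: \<Gamma>_def \<omega>_def W_def)
  have vanish: "\<omega> p w = 0" if "p \<in> P" "q \<in> P" "p \<noteq> q" "i < 2" "w i = e q \<or> w i = y q" for p q i w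
    using that by (auto simp: \<omega>_def ae ay be bby less_2_cases_iff)
  have 1: "wedge 2 (2 * r) (\<omega> p) \<Gamma> (W g) = 0" if "p \<in> P - g ` {..<Suc r}" for p
  proof -
    have "\<omega> p (\<lambda>i. W g (\<sigma> i)) = 0" if \<sigma>: "\<sigma> permutes {..<2 + 2 * r}" for \<sigma>
    proof -
      have "\<sigma> 0 div 2 < Suc r" using permutes_in_image[OF \<sigma>, of 0] by auto
      then show ?thesis
        using \<open>p \<in> P - _\<close> gP by (intro vanish[of p "g (\<sigma> 0 div 2)" 0]) (auto simp: W_def)
    qed
    then show ?thesis by (simp add: wedge_def)
  qed
  have 2: "wedge 2 (2 * r) (\<omega> (g i)) \<Gamma> (W g) = fact r" if i: "i < Suc r" for i
  proof -
    \<comment> \<open>Pair i is brought to the front. Exchanging two pairs means two transpositions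
      of vectors, so no sign appears; for i = 0 there is nothing to move.\<close>
    define h where "h = g \<circ> Transposition.transpose 0 i"
    have alt: "alt_form (2 + 2 * r) (wedge 2 (2 * r) (\<omega> (g i)) \<Gamma>)"
      by (intro alt_form_wedge alt\<omega> alt\<Gamma> gP i)
    have tr: "Transposition.transpose 0 i permutes {..<Suc r}" using i by (intro permutes_swap_id) auto
    have hinj: "inj_on h {..<Suc r}" "h ` {..<Suc r} \<subseteq> P" "h 0 = g i"
      unfolding h_def using Suc.prems permutes_inj_on[OF tr] permutes_image[OF tr]
      by (auto intro!: comp_inj_on simp: image_comp[symmetric])
    have "wedge 2 (2 * r) (\<omega> (g i)) \<Gamma> (W g) = wedge 2 (2 * r) (\<omega> (g i)) \<Gamma> (W h)"
    proof (cases "i = 0")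
      case False
      let ?s = "Transposition.transpose 0 (2 * i)" and ?t = "Transposition.transpose 1 (2 * i + 1)"
      have "W h = (W g \<circ> ?s) \<circ> ?t"
      proof
        fix j
        consider "j = 0" | "j = 1" | "j = 2 * i" | "j = 2 * i + 1" | "j div 2 \<noteq> 0" "j div 2 \<noteq> i"
          by (cases "j div 2 = 0"; cases "j div 2 = i"; linarith)
        then show "W h j = ((W g \<circ> ?s) \<circ> ?t) j"
          by cases (use False in \<open>auto simp: W_def h_def Transposition.transpose_def\<close>)
      qed
      then show ?thesis
        using alt_form_transpose[OF alt, of 0 "2 * i" "W g"] alt_form_transpose[OF alt, of 1 "2 * i + 1" "W g \<circ> ?s"]
          False i by simp
    qed (simp add: h_def)
    also have "\<dots> = \<omega> (g i) (W h) * \<Gamma> (\<lambda>j. W h (2 + j))"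
    proof (rule wedge_split[OF alt\<omega>[OF gP[OF i]] alt\<Gamma>])
      fix w and j k :: nat assume *: "j < 2" "2 \<le> k" "k < 2 + 2 * r" "w j = W h k"
      have k2: "k div 2 < Suc r" "k div 2 \<noteq> 0" using * by auto
      then have "h (k div 2) \<noteq> h 0" using inj_onD[OF hinj(1), of "k div 2" 0] by auto
      moreover have "h (k div 2) \<in> P" using hinj(2) k2 by auto
      ultimately show "\<omega> (g i) w = 0"
        using * gP[OF i] hinj(3) by (intro vanish[of "g i" "h (k div 2)" j w]) (auto simp: W_def)
    qed
    also have "\<omega> (g i) (W h) = 1" using gP[OF i] hinj(3) by (simp add: \<omega>_def W_def ae ay be bby)
    also have "(\<lambda>j. W h (2 + j)) = W (h \<circ> Suc)" by (auto simp: W_def)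
    also have "\<Gamma> \<dots> = fact r"
      using hinj by (intro IH) (auto simp: inj_on_def)
    finally show ?thesis by simp
  qed
  have "wedge_power2 ?\<Omega> (Suc r) (W g) = (\<Sum>p\<in>P. wedge 2 (2 * r) (\<omega> p) \<Gamma> (W g))"
    by (simp add: \<Gamma>_def wedge_sum_left[OF P])
  also have "\<dots> = (\<Sum>p\<in>g ` {..<Suc r}. wedge 2 (2 * r) (\<omega> p) \<Gamma> (W g))"
    using Suc.prems(2) 1 P by (intro sum.mono_neutral_right) auto
  also have "\<dots> = (\<Sum>i<Suc r. wedge 2 (2 * r) (\<omega> (g i)) \<Gamma> (W g))"
    using Suc.prems(1) by (simp add: sum.reindex del: sum.lessThan_Suc lessThan_Suc)
  also have "\<dots> = fact (Suc r)" using 2 by (simp del: sum.lessThan_Suc)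
  finally show ?case by (simp only: \<omega>_def W_def)
qed

section \<open>Determinants over ordered index types\<close>

text \<open>Makes \<open>det_nat\<close> an alternating form in its rows, so that
  \<open>alt_form_det_nat_expand\<close> yields multiplicativity and \<open>alt_form_permute\<close>
  the effect of permuting rows.\<close>

lemma alt_form_det_nat:
  fixes \<phi> :: "nat \<Rightarrow> 'a::real_vector \<Rightarrow> real"
  assumes lin: "\<And>j. linear (\<phi> j)"
  shows "alt_form k (\<lambda>v. det_nat k (\<lambda>i j. \<phi> j (v i)))"
  unfolding alt_form_def
proof (intro conjI allI impI)
  fix v w :: "nat \<Rightarrow> 'a" assume "\<forall>i<k. v i = w i"
  then show "det_nat k (\<lambda>i j. \<phi> j (v i)) = det_nat k (\<lambda>i j. \<phi> j (w i))"
    unfolding det_nat_def by (intro sum.cong arg_cong2[of _ _ _ _ "(*)"] prod.cong) auto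
next
  fix v :: "nat \<Rightarrow> 'a" and i assume i: "i < k"
  have "(\<Prod>j<k. \<phi> (\<sigma> j) ((v(i := x)) j)) = 1 * \<phi> (\<sigma> i) x * (\<Prod>j\<in>{..<k} - {i}. \<phi> (\<sigma> j) (v j))" for \<sigma> x
    using i by (subst prod.remove[of _ i]) (auto intro!: prod.cong)
  then have "linear (\<lambda>x. \<Prod>j<k. \<phi> (\<sigma> j) ((v(i := x)) j))" for \<sigma>
    using linear_mult_const_real[OF lin, of 1] by simp
  from linear_mult_const_real[OF this, of "of_int (sign _)" _ 1]
  have "linear (\<lambda>x. of_int (sign \<sigma>) * (\<Prod>j<k. \<phi> (\<sigma> j) ((v(i := x)) j)))" for \<sigma> by simp
  then show "linear (\<lambda>x. det_nat k (\<lambda>i' j. \<phi> j ((v(i := x)) i')))"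
    unfolding det_nat_def by (intro linear_compose_sum) auto
next
  fix v :: "nat \<Rightarrow> 'a" and i j assume ij: "i < j" "j < k" "v i = v j"
  let ?t = "Transposition.transpose i j"
  let ?T = "\<lambda>\<sigma>. of_int (sign \<sigma>) * (\<Prod>i<k. \<phi> (\<sigma> i) (v i))"
  let ?P = "{\<sigma>. \<sigma> permutes {..<k}}"
  have t: "?t permutes {..<k}" using ij by (intro permutes_swap_id) auto
  have v: "v (?t a) = v a" for a using ij by (auto simp: Transposition.transpose_def)
  have "sum ?T ?P = (\<Sum>\<sigma>\<in>?P. ?T (\<sigma> \<circ> ?t))" by (rule sum_permutations_compose_right[OF t])
  also have "\<dots> = (\<Sum>\<sigma>\<in>?P. - ?T \<sigma>)"
  proof (intro sum.cong refl)
    fix \<sigma> assume "\<sigma> \<in> ?P"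
    then have "permutation \<sigma>" using permutation_permutes by blast
    then have "sign (\<sigma> \<circ> ?t) = - sign \<sigma>"
      using ij by (simp add: sign_compose permutation_swap_id sign_swap_id)
    moreover have "(\<Prod>i<k. \<phi> ((\<sigma> \<circ> ?t) i) (v i)) = (\<Prod>i<k. \<phi> (\<sigma> i) (v i))"
      using prod.permute[OF t, of "\<lambda>i. \<phi> (\<sigma> i) (v i)"] by (simp add: v comp_def)
    ultimately show "?T (\<sigma> \<circ> ?t) = - ?T \<sigma>" by (simp only: of_int_minus mult_minus_left)
  qed
  finally show "det_nat k (\<lambda>i j. \<phi> j (v i)) = 0"
    unfolding det_nat_def sum_negf by simp
qed

lemma det_nat_transpose: "det_nat k (\<lambda>i j. B j i) = det_nat k B"
proof -
  have "det_nat k (\<lambda>i j. B j i) = (\<Sum>\<sigma> | \<sigma> permutes {..<k}. of_int (sign (inv \<sigma>)) * (\<Prod>i<k. B (inv \<sigma> i) i))"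
    unfolding det_nat_def by (rule sum_permutations_inverse)
  also have "\<dots> = det_nat k B"
    unfolding det_nat_def
  proof (intro sum.cong refl)
    fix \<sigma> assume "\<sigma> \<in> {\<sigma>. \<sigma> permutes {..<k}}"
    then have \<sigma>: "\<sigma> permutes {..<k}" by simp
    then have "permutation \<sigma>" using permutation_permutes by blast
    moreover have "(\<Prod>i<k. B (inv \<sigma> i) i) = (\<Prod>i<k. B i (\<sigma> i))"
      using prod.permute[OF \<sigma>, of "\<lambda>i. B (inv \<sigma> i) i"] permutes_inverses[OF \<sigma>] by (simp add: comp_def)
    ultimately show "of_int (sign (inv \<sigma>)) * (\<Prod>i<k. B (inv \<sigma> i) i) = of_int (sign \<sigma>) * (\<Prod>i<k. B i (\<sigma> i))"
      by (simp add: sign_inverse)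
  qed
  finally show ?thesis .
qed

lemma det_nat_diagonal:
  assumes "\<And>i j. i < k \<Longrightarrow> j < k \<Longrightarrow> i \<noteq> j \<Longrightarrow> B i j = 0"
  shows "det_nat k B = (\<Prod>i<k. B i i)"
proof -
  have "det_nat k B = (\<Sum>\<sigma>\<in>{id}. of_int (sign \<sigma>) * (\<Prod>i<k. B i (\<sigma> i)))"
    unfolding det_nat_def
  proof (rule sum.mono_neutral_right)
    show "\<forall>\<sigma>\<in>{\<sigma>. \<sigma> permutes {..<k}} - {id}. of_int (sign \<sigma>) * (\<Prod>i<k. B i (\<sigma> i)) = 0"
    proof
      fix \<sigma> assume "\<sigma> \<in> {\<sigma>. \<sigma> permutes {..<k}} - {id}"
      then have \<sigma>: "\<sigma> permutes {..<k}" "\<sigma> \<noteq> id" by auto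
      then obtain i where "\<sigma> i \<noteq> i" by (auto simp: fun_eq_iff)
      then have "i < k" using permutes_not_in[OF \<sigma>(1), of i] by auto
      then have "B i (\<sigma> i) = 0"
        using assms permutes_in_image[OF \<sigma>(1), of i] \<open>\<sigma> i \<noteq> i\<close> by auto
      then show "of_int (sign \<sigma>) * (\<Prod>i<k. B i (\<sigma> i)) = 0"
        using \<open>i < k\<close> by auto
    qed
  qed (auto simp: finite_permutations permutes_id)
  then show ?thesis by simp
qed

lemma det_nat_cong: "(\<And>i j. i < k \<Longrightarrow> j < k \<Longrightarrow> B i j = C i j) \<Longrightarrow> det_nat k B = det_nat k C"
  unfolding det_nat_def
  by (intro sum.cong refl arg_cong2[of _ _ _ _ "(*)"] prod.cong) (auto dest: permutes_in_image)

text \<open>The change of frame is pulled out of the first slot and, after transposing, out of the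
  second; hence the square.\<close>

lemma det_nat_gram:
  fixes h :: "'a::real_vector \<Rightarrow> 'a \<Rightarrow> real"
  assumes h: "\<And>w. linear (\<lambda>v. h v w)" "\<And>v. linear (h v)"
    and v: "\<And>i. i < k \<Longrightarrow> v i = (\<Sum>j<k. C i j *\<^sub>R b j)"
  shows "det_nat k (\<lambda>i j. h (v i) (v j)) = (det_nat k C)\<^sup>2 * det_nat k (\<lambda>i j. h (b i) (b j))"
proof -
  have "det_nat k (\<lambda>i j. h (v i) (v j)) = det_nat k C * det_nat k (\<lambda>i j. h (b i) (v j))"
    using alt_form_det_nat_expand[OF alt_form_det_nat[of "\<lambda>j x. h x (v j)" k, OF h(1)] v] .
  also have "det_nat k (\<lambda>i j. h (b i) (v j)) = det_nat k (\<lambda>i j. h (b j) (v i))"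
    by (subst det_nat_transpose[symmetric]) simp
  also have "\<dots> = det_nat k C * det_nat k (\<lambda>i j. h (b j) (b i))"
    using alt_form_det_nat_expand[OF alt_form_det_nat[of "\<lambda>j x. h (b j) x" k, OF h(2)] v] .
  also have "det_nat k (\<lambda>i j. h (b j) (b i)) = det_nat k (\<lambda>i j. h (b i) (b j))"
    by (rule det_nat_transpose)
  finally show ?thesis by (simp add: power2_eq_square)
qed

section \<open>Enumeration of ordered index types\<close>

definition enum :: "'k::{finite,linorder} list" where
  "enum = sorted_list_of_set UNIV"

lemma enum_props: "length (enum :: 'k::{finite,linorder} list) = CARD('k)"
  "set (enum :: 'k list) = UNIV" "distinct (enum :: 'k list)" "sorted_wrt (<) (enum :: 'k list)"
  by (simp_all add: enum_def)

lemma ith_enum: "ith (Suc k) = enum ! k"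
  by (simp add: ith_def enum_def)

text \<open>List positions count from zero while \<open>pos\<close> and \<open>ith\<close> count
  from one; this offset explains every \<open>pos i - 1\<close> below.\<close>

lemma pos_enum:
  assumes "k < CARD('k::{finite,linorder})"
  shows "pos (enum ! k :: 'k) = Suc k"
proof -
  have less: "(enum ! i :: 'k) < enum ! j" if "i < j" "j < CARD('k)" for i j
    using sorted_wrt_nth_less[OF enum_props(4) that(1)] that(2) by (simp add: enum_props)
  have "{j :: 'k. j \<le> enum ! k} = (!) enum ` {..k}"
  proof (intro equalityI subsetI)
    fix j :: 'k assume "j \<in> {j. j \<le> enum ! k}"
    then have j: "j \<le> enum ! k" by simp
    obtain i where i: "i < CARD('k)" "j = enum ! i"
      using enum_props(1,2)[where 'k='k] by (metis UNIV_I in_set_conv_nth)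
    then have "i \<le> k" using less[of k i] j by (meson leD not_le)
    then show "j \<in> (!) enum ` {..k}" using i by auto
  next
    fix j :: 'k assume "j \<in> (!) enum ` {..k}"
    then obtain i where "i \<le> k" "j = enum ! i" by auto
    then show "j \<in> {j. j \<le> enum ! k}" using less[of i k] assms by (cases "i = k") auto
  qed
  moreover have "inj_on ((!) (enum :: 'k list)) {..k}"
    using assms by (intro inj_on_nth) (auto simp: enum_props)
  ultimately show ?thesis by (simp add: pos_def card_image)
qed

lemma pos_ith: "k < CARD('k::{finite,linorder}) \<Longrightarrow> pos (ith (Suc k) :: 'k) = Suc k"
  by (simp add: ith_enum pos_enum)

lemma enum_cases: obtains k where "k < CARD('k)" "(i :: 'k::{finite,linorder}) = enum ! k"
  using enum_props(1,2)[where 'k='k] by (metis UNIV_I in_set_conv_nth)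

lemma pos_bounds: "0 < pos (i :: 'k::{finite,linorder})" "pos i \<le> CARD('k)"
proof -
  obtain k where "k < CARD('k)" "i = enum ! k" by (rule enum_cases)
  then show "0 < pos i" "pos i \<le> CARD('k)" by (simp_all add: pos_enum)
qed

lemma ith_pos: "ith (pos i) = (i :: 'k::{finite,linorder})"
proof -
  obtain k where "k < CARD('k)" "i = enum ! k" by (rule enum_cases)
  then show ?thesis by (simp add: pos_enum ith_enum)
qed

lemma enum_pos: "enum ! (pos i - 1) = (i :: 'k::{finite,linorder})"
proof -
  obtain k where "k < CARD('k)" "i = enum ! k" by (rule enum_cases)
  then show ?thesis by (simp add: pos_enum)
qed

lemma pos_inject: "pos i = pos j \<longleftrightarrow> i = (j :: 'k::{finite,linorder})"
  by (metis ith_pos)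

lemmas enum_pos' = enum_pos[unfolded One_nat_def]

lemma pos_pred_less: "pos (i :: 'k::{finite,linorder}) - 1 < CARD('k)"
  using pos_bounds[of i] by linarith

lemmas pos_pred_less' = pos_pred_less[unfolded One_nat_def]

lemma enum_eq_iff: "i < CARD('k) \<Longrightarrow> (enum ! i = (j :: 'k::{finite,linorder})) \<longleftrightarrow> i = pos j - 1"
  by (metis enum_pos pos_enum diff_Suc_1)

lemma sum_enum: "(\<Sum>i\<in>UNIV. f (i :: 'k::{finite,linorder})) = (\<Sum>k<CARD('k). f (enum ! k))"
  by (rule sum.reindex_bij_witness[of _ "\<lambda>k. enum ! k" "\<lambda>i. pos i - 1"])
    (auto simp: pos_enum enum_pos' pos_pred_less')

lemma span_axis_enum:
  fixes x :: "'k::{finite,linorder} rvec"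
  shows "x \<in> span ((\<lambda>k. axis (enum ! k) 1) ` {..<CARD('k)})"
proof -
  have "x = (\<Sum>i\<in>UNIV. x $ i *\<^sub>R axis i 1)"
    by (simp add: vec_eq_iff axis_def if_distrib[of "(*) _"] cong: if_cong)
  also have "\<dots> = (\<Sum>k<CARD('k). x $ (enum ! k) *\<^sub>R axis (enum ! k) 1)" by (rule sum_enum)
  also have "\<dots> \<in> span ((\<lambda>k. axis (enum ! k) 1) ` {..<CARD('k)})"
    by (intro span_sum span_mul span_base) auto
  finally show ?thesis .
qed

text \<open>The rows in \<open>C\<close> vary and the others stay fixed. With all rows varying this
  gives \<open>alt_form_det_form\<close>, with only the lower block varying it gives
  \<open>det_block_diag\<close>.\<close>

lemma alt_form_det_rows:
  fixes L :: "'a::real_vector \<Rightarrow> real ^ 'k::finite" and idx :: "'k \<Rightarrow> nat"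
  assumes L: "linear L" and idx: "bij_betw idx C {..<m}"
  shows "alt_form m (\<lambda>v. det (\<chi> r. if r \<in> C then L (v (idx r)) else c r))"
  unfolding alt_form_def
proof (intro conjI allI impI)
  have less: "idx r < m" if "r \<in> C" for r using idx that by (auto simp: bij_betw_def)
  {
    fix v w :: "nat \<Rightarrow> 'a" assume vw: "\<forall>i<m. v i = w i"
    have "(\<chi> r. if r \<in> C then L (v (idx r)) else c r) = (\<chi> r. if r \<in> C then L (w (idx r)) else c r)"
      using vw less by (auto simp: vec_eq_iff)
    then show "det (\<chi> r. if r \<in> C then L (v (idx r)) else c r) = det (\<chi> r. if r \<in> C then L (w (idx r)) else c r)"
      by simp
  next
    fix v :: "nat \<Rightarrow> 'a" and i assume "i < m"
    then obtain r0 where r0: "r0 \<in> C" "idx r0 = i" using idx by (metis bij_betw_iff_bijections lessThan_iff)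
    have eq: "idx r = i \<longleftrightarrow> r = r0" if "r \<in> C" for r
      using idx r0 that by (auto simp: bij_betw_def inj_on_def)
    let ?c = "\<lambda>r. if r \<in> C then L (v (idx r)) else c r"
    have *: "(\<chi> r. if r \<in> C then L ((v(i := x)) (idx r)) else c r) = (\<chi> r. if r = r0 then L x else ?c r)" for x
      using r0 eq by (auto simp: vec_eq_iff)
    show "linear (\<lambda>x. det (\<chi> r. if r \<in> C then L ((v(i := x)) (idx r)) else c r))"
      unfolding *
    proof (rule linearI)
      fix x y :: 'a and t :: real
      show "det (\<chi> r. if r = r0 then L (x + y) else ?c r) =
          det (\<chi> r. if r = r0 then L x else ?c r) + det (\<chi> r. if r = r0 then L y else ?c r)"
        using det_row_add[of r0 "\<lambda>_. L x" "\<lambda>_. L y" ?c] by (simp add: linear_add[OF L] cong: if_cong)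
      show "det (\<chi> r. if r = r0 then L (t *\<^sub>R x) else ?c r) = t *\<^sub>R det (\<chi> r. if r = r0 then L x else ?c r)"
        using det_row_mul[of r0 t "\<lambda>_. L x" ?c] by (simp add: linear_cmul[OF L] scalar_mult_eq_scaleR cong: if_cong)
    qed
  next
    fix v :: "nat \<Rightarrow> 'a" and i j assume ij: "i < j" "j < m" "v i = v j"
    have "i \<in> idx ` C" "j \<in> idx ` C" using idx ij by (auto simp: bij_betw_def)
    then obtain r s where "r \<in> C" "idx r = i" "s \<in> C" "idx s = j" by blast
    then show "det (\<chi> r. if r \<in> C then L (v (idx r)) else c r) = 0"
      using ij by (intro det_identical_rows[of r s]) (auto simp: row_def vec_eq_iff)
  }
qed

lemma det_form_rows: "det_form v = det (\<chi> r. v (pos r - 1))"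
  unfolding det_form_def
  by (subst det_transpose[symmetric]) (simp add: transpose_def)

lemma bij_betw_pos: "bij_betw (\<lambda>i. pos (i :: 'k::{finite,linorder}) - 1) UNIV {..<CARD('k)}"
  by (rule bij_betw_byWitness[of _ "\<lambda>k. enum ! k"]) (auto simp: enum_pos' pos_enum pos_pred_less')

lemma alt_form_det_form:
  "alt_form CARD('k) (det_form :: (nat \<Rightarrow> 'k::{finite,linorder} rvec) \<Rightarrow> real)"
  using alt_form_det_rows[OF linear_id bij_betw_pos[where 'k='k]] by (simp add: det_form_rows[abs_def])

lemma det_form_axis: "(det_form :: (nat \<Rightarrow> 'k::{finite,linorder} rvec) \<Rightarrow> real) (\<lambda>k. axis (enum ! k) 1) = 1"

proof -
  have "(\<chi> r. axis (enum ! (pos r - 1)) 1) = (mat 1 :: ('k rvec, 'k) vec)"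
    by (auto simp: vec_eq_iff mat_def axis_def enum_pos')
  then show ?thesis by (simp add: det_form_rows)
qed

lemma skip_enum:
  fixes i :: "'m::{finite,linorder}" and j :: "'n::{finite,linorder}"
  shows "skip i j = remove1 i enum ! (pos j - 1)"
  by (simp add: skip_def enum_def sorted_list_of_set_remove)

text \<open>The generalized cross product of n vectors in a space of dimension n + 1. The type
  argument is needed because the index type of the columns occurs neither in \<open>c\<close> nor in
  the result.\<close>

definition minors :: "(nat \<Rightarrow> 'm::{finite,linorder} rvec) \<Rightarrow> 'n::{finite,linorder} itself \<Rightarrow> 'm rvec" where
  "minors c T = (\<chi> i. (-1) ^ (pos i + 1) * det_form (\<lambda>k. \<chi> a::'n. c k $ skip i a))"

text \<open>Laplace expansion along the first column. By linearity y may be a unit vector e_i. Then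
  both sides are alternating in the columns and annihilate e_i, so it suffices to compare them on
  the remaining unit vectors, where the sign comes from moving e_i to its place.\<close>

lemma minors_inner:
  fixes c :: "nat \<Rightarrow> 'm::{finite,linorder} rvec"
  assumes dims: "CARD('m) = CARD('n::{finite,linorder}) + 1"
  shows "y \<bullet> minors c TYPE('n) = det_form (case_nat y c)"
proof -
  let ?n = "CARD('n)"
  have alt: "alt_form (Suc ?n) (det_form :: (nat \<Rightarrow> 'm rvec) \<Rightarrow> real)"
    using alt_form_det_form[where 'k='m] dims by simp
  have axis: "minors c TYPE('n) $ i = det_form (case_nat (axis i 1) c)" for i :: 'm
  proof -
    let ?e = "axis i (1::real) :: 'm rvec"
    let ?\<alpha> = "contract ?e det_form"
    let ?L = "\<lambda>x. \<chi> a::'n. (x :: 'm rvec) $ skip i a"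
    let ?\<gamma> = "\<lambda>c. (-1) ^ (pos i + 1) * det_form (\<lambda>k. ?L (c k))"
    have alt1: "alt_form ?n ?\<alpha>" by (rule alt_form_contract[OF alt])
    have L: "linear ?L" by (rule linearI) (auto simp: vec_eq_iff)
    have alt2: "alt_form ?n ?\<gamma>"
      by (rule alt_form_scale[OF alt_form_linear_image[OF alt_form_det_form L]])
    \<comment> \<open>Splitting the enumeration at i makes \<open>pos i\<close> one more than the
      length of \<open>xs\<close> and lets \<open>skip i\<close> enumerate
      \<open>xs @ zs\<close>.\<close>
    obtain xs zs where enum: "enum = xs @ i # zs" using enum_props(2)[where 'k='m] split_list[of i enum] by auto
    have dist: "distinct (xs @ i # zs)" using enum_props(3)[where 'k='m] by (simp add: enum)
    have len: "length xs + length zs = ?n" using enum_props(1)[where 'k='m] dims by (simp add: enum)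
    have pos: "pos i = Suc (length xs)"
      using pos_enum[of "length xs", where 'k='m] len dims by (simp add: enum nth_append)
    have skip: "skip i a = (xs @ zs) ! (pos a - 1)" for a :: 'n
      using dist by (simp add: skip_enum enum remove1_append)
    have skip_ne: "skip i a \<noteq> i" for a :: 'n
      using dist nth_mem[of "pos a - 1" "xs @ zs"] pos_pred_less[of a] len by (auto simp: skip)
    let ?b = "\<lambda>k. axis ((xs @ zs) ! k) (1::real) :: 'm rvec"
    have b1: "?\<alpha> ?b = (-1) ^ length xs"
    proof -
      let ?ax = "\<lambda>i. axis i (1::real) :: 'm rvec"
      have "?\<alpha> ?b = det_form ((!) ([] @ ?ax i # map ?ax xs @ map ?ax zs))"
        unfolding contract_def
        by (rule alt_form_cong[OF alt]) (use len in \<open>auto simp: nth_append split: nat.split\<close>)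
      also have "\<dots> = (-1) ^ length (map ?ax xs) * det_form ((!) ([] @ map ?ax xs @ ?ax i # map ?ax zs))"
        by (rule alt_form_move[OF alt]) (simp add: len)
      also have "det_form ((!) ([] @ map ?ax xs @ ?ax i # map ?ax zs)) = det_form (\<lambda>k. ?ax (enum ! k))"
      proof (rule alt_form_cong[OF alt])
        fix k assume "k < Suc ?n"
        then have "map ?ax (xs @ i # zs) ! k = ?ax ((xs @ i # zs) ! k)"
          using len by (intro nth_map) simp
        then show "([] @ map ?ax xs @ ?ax i # map ?ax zs) ! k = ?ax (enum ! k)" by (simp add: enum)
      qed
      finally show ?thesis by (simp add: det_form_axis)
    qed
    have b2: "?\<gamma> ?b = (-1) ^ length xs"
    proof -
      have "?L (?b k) = axis (enum ! k) 1" if "k < ?n" for k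
      proof -
        have "(xs @ zs) ! (pos a - Suc 0) = (xs @ zs) ! k \<longleftrightarrow> a = enum ! k" for a :: 'n
          using dist that pos_pred_less[of a] len enum_eq_iff[OF that, of a]
          by (subst nth_eq_iff_index_eq) auto
        then show ?thesis by (simp add: vec_eq_iff axis_def skip)
      qed
      then have "det_form (\<lambda>k. ?L (?b k)) = det_form (\<lambda>k. axis (enum ! k) 1 :: 'n rvec)"
        by (rule alt_form_cong[OF alt_form_det_form])
      then show ?thesis by (simp add: det_form_axis pos)
    qed
    have van1: "?\<alpha> (v(j := ?e)) = 0" if "j < ?n" for v j
      unfolding contract_def by (rule alt_form_equal[OF alt, of 0 "Suc j"]) (use that in auto)
    have van2: "?\<gamma> (v(j := ?e)) = 0" if "j < ?n" for v j
    proof -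
      have "?L ((v(j := ?e)) j) = 0" using skip_ne by (auto simp: vec_eq_iff axis_def)
      then show ?thesis using alt_form_zero_arg[OF alt_form_det_form[where 'k='n] that, of "\<lambda>k. ?L ((v(j := ?e)) k)"] by simp
    qed
    \<comment> \<open>Clearing the i-th entry of every column changes neither form and puts the
      columns into the span of \<open>?b\<close>.\<close>
    let ?c = "\<lambda>k. c k + (- (c k $ i)) *\<^sub>R ?e"
    have "?\<alpha> ?c = ?\<gamma> ?c"
    proof (rule alt_form_unique[OF alt1 alt2, of ?b])
      show "?\<alpha> ?b = ?\<gamma> ?b" by (simp only: b1 b2)
      fix k
      have "?c k = (\<Sum>j\<in>UNIV. ?c k $ j *\<^sub>R axis j 1)"
        by (simp add: vec_eq_iff axis_def if_distrib[of "(*) _"] cong: if_cong)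
      also have "\<dots> \<in> span (?b ` {..<?n})"
      proof (intro span_sum)
        fix j
        show "?c k $ j *\<^sub>R axis j 1 \<in> span (?b ` {..<?n})"
        proof (cases "j = i")
          case True
          then show ?thesis by (simp add: axis_def span_zero)
        next
          case False
          moreover have "j \<in> set enum" by (simp add: enum_props)
          ultimately have "j \<in> set (xs @ zs)" by (simp add: enum)
          then obtain l where "l < ?n" "j = (xs @ zs) ! l" using len by (metis in_set_conv_nth length_append)
          then show ?thesis by (intro span_mul span_base) auto
        qed
      qed
      finally show "?c k \<in> span (?b ` {..<?n})" .
    qed
    then have "?\<alpha> c = ?\<gamma> c"
      using alt_form_shift[OF alt1 van1, of c "\<lambda>k. - (c k $ i)"] alt_form_shift[OF alt2 van2, of c "\<lambda>k. - (c k $ i)"]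
      by simp
    then show ?thesis by (simp add: contract_def minors_def)
  qed
  have lin: "linear (\<lambda>y. det_form (case_nat y c))"
    using alt_form_linear[OF alt, of 0 "case_nat 0 c"]
    by (rule back_subst[of linear]) (auto simp: fun_eq_iff intro!: arg_cong[of _ _ det_form] split: nat.split)
  have "det_form (case_nat y c) = det_form (case_nat (\<Sum>i\<in>UNIV. y $ i *\<^sub>R axis i 1) c)"
    by (rule arg_cong[of _ _ "\<lambda>y. det_form (case_nat y c)"])
      (simp add: vec_eq_iff axis_def if_distrib[of "(*) _"] cong: if_cong)
  also have "\<dots> = (\<Sum>i\<in>UNIV. y $ i * det_form (case_nat (axis i 1) c))"
    by (simp add: linear_sum[OF lin] linear_cmul[OF lin])
  finally show ?thesis by (simp add: inner_vec_def axis)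
qed

section \<open>Block matrices\<close>

lemma sum_UNIV_sum: "(\<Sum>x\<in>(UNIV::('a::finite + 'b::finite) set). f x) = (\<Sum>a\<in>UNIV. f (Inl a)) + (\<Sum>b\<in>UNIV. f (Inr b))"
  by (simp add: UNIV_Plus_UNIV[symmetric] sum.Plus del: UNIV_Plus_UNIV)

lemma prod_UNIV_sum: "(\<Prod>x\<in>(UNIV::('a::finite + 'b::finite) set). f x) = (\<Prod>a\<in>UNIV. f (Inl a)) * (\<Prod>b\<in>UNIV. f (Inr b))"
  by (simp add: UNIV_Plus_UNIV[symmetric] prod.Plus del: UNIV_Plus_UNIV)

definition block_mat ::
  "real ^ 'n ^ 'n \<Rightarrow> real ^ 'm ^ 'n \<Rightarrow> real ^ 'n ^ 'm \<Rightarrow> real ^ 'm ^ 'm \<Rightarrow>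
     real ^ ('n::finite + 'm::finite) ^ ('n + 'm)" where
  "block_mat P Q R S = (\<chi> r c. case r of
     Inl I \<Rightarrow> (case c of Inl J \<Rightarrow> P $ I $ J | Inr j \<Rightarrow> Q $ I $ j)
   | Inr i \<Rightarrow> (case c of Inl J \<Rightarrow> R $ i $ J | Inr j \<Rightarrow> S $ i $ j))"

lemma block_mat_nth [simp]:
  "block_mat P Q R S $ Inl I $ Inl J = P $ I $ J"
  "block_mat P Q R S $ Inl I $ Inr j = Q $ I $ j"
  "block_mat P Q R S $ Inr i $ Inl J = R $ i $ J"
  "block_mat P Q R S $ Inr i $ Inr j = S $ i $ j"
  by (simp_all add: block_mat_def)

lemma sum_type_matrix_eqI:
  fixes X Y :: "real ^ ('n::finite + 'm::finite) ^ ('n + 'm)"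
  assumes "\<And>I J. X $ Inl I $ Inl J = Y $ Inl I $ Inl J" "\<And>I j. X $ Inl I $ Inr j = Y $ Inl I $ Inr j"
    "\<And>i J. X $ Inr i $ Inl J = Y $ Inr i $ Inl J" "\<And>i j. X $ Inr i $ Inr j = Y $ Inr i $ Inr j"
  shows "X = Y"
  unfolding vec_eq_iff
proof (intro allI)
  fix r c show "X $ r $ c = Y $ r $ c" using assms by (cases r; cases c) auto
qed

lemma block_mat_mult:
  "block_mat P Q R S ** block_mat P' Q' R' S' =
   block_mat (P ** P' + Q ** R') (P ** Q' + Q ** S') (R ** P' + S ** R') (R ** Q' + S ** S')"
  by (rule sum_type_matrix_eqI) (simp_all add: matrix_matrix_mult_def sum_UNIV_sum)

lemma transpose_block_mat:
  "transpose (block_mat P Q R S) = block_mat (transpose P) (transpose R) (transpose Q) (transpose S)"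
  by (rule sum_type_matrix_eqI) (simp_all add: transpose_def)

lemma block_mat_one: "block_mat (mat 1) 0 0 (mat 1) = mat 1"
  by (rule sum_type_matrix_eqI) (simp_all add: mat_def)

lemma transpose_zero_mat: "transpose (0 :: real ^ 'a::finite ^ 'b::finite) = 0"
  by (simp add: transpose_def vec_eq_iff)

text \<open>Conjugation by diag(2, 1) turns the shear with X into the shear with 2 X, which is its
  square. Hence the determinant equals its own square, and it is nonzero because the shear is
  invertible.\<close>

lemma det_block_shear:
  fixes X :: "real ^ 'm::finite ^ 'n::finite"
  shows "det (block_mat (mat 1) X 0 (mat 1)) = 1"
proof -
  let ?S = "\<lambda>X :: real ^ 'm ^ 'n. block_mat (mat 1) X 0 (mat 1)"
  let ?D = "block_mat (2 *\<^sub>R mat 1) 0 0 (mat 1) :: real ^ ('n + 'm) ^ ('n + 'm)"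
  have "det ?D = (\<Prod>i\<in>UNIV. ?D $ i $ i)"
    by (rule det_diagonal) (auto simp: block_mat_def mat_def split: sum.split)
  then have D: "det ?D \<noteq> 0" by (simp add: prod_UNIV_sum mat_def)
  have "?D ** ?S X = ?S (2 *\<^sub>R X) ** ?D"
    by (simp add: block_mat_mult scalar_matrix_assoc[symmetric] matrix_scalar_ac)
  then have "det ?D * det (?S X) = det (?S (2 *\<^sub>R X)) * det ?D" by (simp only: det_mul[symmetric])
  moreover have "?S (2 *\<^sub>R X) = ?S X ** ?S X" by (simp add: block_mat_mult scaleR_2)
  ultimately have "det ?D * det (?S X) = det (?S X) * det (?S X) * det ?D" by (simp only: det_mul)
  then have "det (?S X) = det (?S X) * det (?S X)" using D by simp
  moreover have "?S X ** ?S (- X) = mat 1" by (simp add: block_mat_mult block_mat_one)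
  then have "det (?S X) * det (?S (- X)) = 1" by (simp only: det_mul[symmetric] det_I)
  then have "det (?S X) \<noteq> 0" by auto
  ultimately show ?thesis by simp
qed

lemma det_block_shear_lower:
  fixes X :: "real ^ 'n::finite ^ 'm::finite"
  shows "det (block_mat (mat 1) 0 X (mat 1)) = 1"
proof -
  have "transpose (block_mat (mat 1) 0 X (mat 1)) = block_mat (mat 1) (transpose X) 0 (mat 1)"
    by (rule sum_type_matrix_eqI) (simp_all add: transpose_def mat_def eq_commute)
  then show ?thesis using det_transpose[of "block_mat (mat 1) 0 X (mat 1)"] by (simp only: det_block_shear)
qed

text \<open>Both sides are alternating in the rows of K, so they need only be compared at the unit
  matrix.\<close>

lemma det_block_diag:
  fixes K :: "('m::{finite,linorder} rvec, 'm) vec"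
  shows "det (block_mat (mat 1) 0 0 K :: real ^ ('n::finite + 'm) ^ ('n + 'm)) = det K"
proof -
  let ?idx = "\<lambda>r :: 'n + 'm. case r of Inl _ \<Rightarrow> 0 | Inr j \<Rightarrow> pos j - 1"
  let ?L = "\<lambda>y :: 'm rvec. (\<chi> c. case c of Inl _ \<Rightarrow> 0 | Inr j \<Rightarrow> y $ j) :: real ^ ('n + 'm)"
  let ?c = "\<lambda>r :: 'n + 'm. axis r (1::real)"
  have L: "linear ?L" by (rule linearI) (auto simp: vec_eq_iff split: sum.split)
  have idx: "bij_betw ?idx (range Inr) {..<CARD('m)}"
    by (rule bij_betw_byWitness[of _ "\<lambda>k. Inr (enum ! k)"]) (auto simp: enum_pos' pos_enum pos_pred_less')
  let ?\<alpha> = "\<lambda>v :: nat \<Rightarrow> 'm rvec. det (\<chi> r. if r \<in> range Inr then ?L (v (?idx r)) else ?c r)"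
  have "?\<alpha> (\<lambda>k. K $ (enum ! k)) = det_form (\<lambda>k. K $ (enum ! k))"
  proof (rule alt_form_unique[OF alt_form_det_rows[OF L idx] alt_form_det_form, of "\<lambda>k. axis (enum ! k) 1"])
    have "(\<chi> r. if r \<in> range Inr then ?L (axis (enum ! ?idx r) 1) else ?c r) = mat 1"
      by (rule sum_type_matrix_eqI) (auto simp: mat_def axis_def enum_pos')
    then show "?\<alpha> (\<lambda>k. axis (enum ! k) 1) = det_form (\<lambda>k. axis (enum ! k) 1 :: 'm rvec)"
      by (simp add: det_form_axis)
  qed (rule span_axis_enum)
  moreover have "(\<chi> r. if r \<in> range Inr then ?L (K $ (enum ! ?idx r)) else ?c r) = block_mat (mat 1) 0 0 K"
    by (rule sum_type_matrix_eqI) (auto simp: mat_def axis_def enum_pos')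
  moreover have "(\<chi> r. K $ (enum ! (pos r - 1))) = K" by (simp add: vec_eq_iff enum_pos')
  ultimately show ?thesis by (simp add: det_form_rows)
qed

lemma det_zero_kernel:
  fixes X :: "real ^ 'k::finite ^ 'k"
  assumes "X *v x = 0" "x \<noteq> 0" shows "det X = 0"
  using assms by (metis invertible_det_nz invertible_left_inverse matrix_left_invertible_ker)

lemma orthogonal_to_columns_exists:
  fixes C :: "real ^ 'n::finite ^ 'm::finite"
  assumes "CARD('n) < CARD('m)"
  obtains x where "x \<noteq> 0" "\<And>J. (\<Sum>i\<in>UNIV. C $ i $ J * x $ i) = 0"
proof -
  let ?S = "range (\<lambda>J. column J C)"
  have "dim ?S \<le> card ?S" by (rule dim_le_card') simp
  also have "\<dots> \<le> CARD('n)" by (rule card_image_le) simp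
  finally have "dim ?S < DIM(real ^ 'm)" using assms by simp
  then obtain x where x: "x \<noteq> 0" "\<And>y. y \<in> span ?S \<Longrightarrow> orthogonal x y"
    by (rule orthogonal_to_subspace_exists) blast
  have "(\<Sum>i\<in>UNIV. C $ i $ J * x $ i) = 0" for J
    using x(2)[of "column J C"] by (simp add: span_base orthogonal_def inner_vec_def column_def mult.commute)
  with x(1) show ?thesis by (rule that)
qed

section \<open>Signed maximal minors and bordered determinants\<close>

definition col_mat :: "'m::{finite,linorder} rvec \<Rightarrow> ('n::{finite,linorder} rvec, 'm) vec \<Rightarrow> ('m rvec, 'm) vec" where
  "col_mat y C = (\<chi> i k. if pos k = 1 then y $ i else C $ i $ ith (pos k - 1))"

definition col_minors :: "('n::{finite,linorder} rvec, 'm::{finite,linorder}) vec \<Rightarrow> 'm rvec" where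
  "col_minors C = (\<chi> i. (-1) ^ (pos i + 1) * det (\<chi> a b. C $ skip i a $ b :: ('n rvec, 'n) vec))"

lemma det_col_mat:
  fixes C :: "('n::{finite,linorder} rvec, 'm::{finite,linorder}) vec"
  assumes "CARD('m) = CARD('n) + 1"
  shows "det (col_mat y C) = y \<bullet> col_minors C"
proof -
  let ?c = "\<lambda>k. column (enum ! k :: 'n) C"
  have "minors ?c TYPE('n) = col_minors C"
    by (simp add: minors_def col_minors_def det_form_def column_def enum_pos')
  moreover have "det_form (case_nat y ?c) = det (col_mat y C)"
  proof -
    have "case_nat y ?c (pos k - 1) $ i = col_mat y C $ i $ k" for i k :: 'm
    proof (cases "pos k")
      case 0
      then show ?thesis using pos_bounds(1)[of k] by simp
    next
      case (Suc l)
      then show ?thesis by (cases l) (simp_all add: col_mat_def column_def ith_enum)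
    qed
    then show ?thesis by (simp add: det_form_def)
  qed
  ultimately show ?thesis using minors_inner[OF assms, of y ?c] by simp
qed

text \<open>The inclusion of n coordinates as the last n of n + 1, so that multiplying [y|C] by it
  returns C. Together with the projection \<open>first_mat\<close> to the first coordinate it forms
  the constant core of the block determinant.\<close>

definition inc_mat :: "('n::{finite,linorder} rvec, 'm::{finite,linorder}) vec" where
  "inc_mat = (\<chi> k J. if pos k = Suc (pos J) then 1 else 0)"

definition first_mat :: "('m::{finite,linorder} rvec, 'm) vec" where
  "first_mat = (\<chi> k l. if pos k = 1 \<and> pos l = 1 then 1 else 0)"

context
  fixes n :: "'n::{finite,linorder} itself" and m :: "'m::{finite,linorder} itself"
  assumes dims: "CARD('m) = CARD('n) + 1"
begin

lemma pos_Suc_unique: "\<exists>!k :: 'm. pos k = Suc (pos (J :: 'n))"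
proof -
  have "pos (ith (Suc (pos J)) :: 'm) = Suc (pos J)"
    using pos_bounds(2)[of J] dims by (intro pos_ith) simp
  then show ?thesis by (metis pos_inject)
qed

lemma pos_one_unique: "\<exists>!k :: 'm. pos k = 1"
proof -
  have "pos (ith (Suc 0) :: 'm) = Suc 0" using dims by (intro pos_ith) simp
  then show ?thesis by (metis pos_inject One_nat_def)
qed

lemma pos_pred_unique:
  assumes "pos (k :: 'm) \<noteq> 1" shows "\<exists>!J :: 'n. pos k = Suc (pos J)"
proof -
  obtain l where l: "pos k = Suc (Suc l)"
    using assms pos_bounds(1)[of k] by (cases "pos k"; cases "pos k - 1") auto
  then have "pos (ith (Suc l) :: 'n) = Suc l" using pos_bounds(2)[of k] dims by (intro pos_ith) simp
  then show ?thesis using l by (metis pos_inject Suc_inject)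
qed

lemma inc_mat_gram: "transpose (inc_mat :: ('n rvec, 'm) vec) ** inc_mat = mat 1"
proof -
  have "(\<Sum>k\<in>UNIV. (if pos (k :: 'm) = Suc (pos I) then 1 else 0) * (if pos k = Suc (pos J) then 1 else 0)) =
      (if I = J then 1 else (0::real))" for I J :: 'n
  proof -
    obtain k0 :: 'm where k0: "pos k0 = Suc (pos I)" using pos_Suc_unique by blast
    have eq: "pos k = Suc (pos I) \<longleftrightarrow> k = k0" for k :: 'm using k0 by (metis pos_inject)
    have "(\<Sum>k\<in>UNIV. (if pos (k :: 'm) = Suc (pos I) then 1 else 0) * (if pos k = Suc (pos J) then 1 else 0)) =
       (\<Sum>k\<in>UNIV. if k = k0 then (if pos k0 = Suc (pos J) then 1 else 0) else (0::real))"
      by (intro sum.cong refl) (auto simp: eq)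
    also have "\<dots> = (if pos k0 = Suc (pos J) then 1 else 0)" by simp
    finally show ?thesis by (simp add: k0 pos_inject)
  qed
  then show ?thesis by (simp add: vec_eq_iff matrix_matrix_mult_def transpose_def inc_mat_def mat_def)
qed

lemma inc_mat_first: "transpose (inc_mat :: ('n rvec, 'm) vec) ** first_mat = 0"
proof -
  have "(if pos (k :: 'm) = Suc (pos I) then 1 else 0) * (if pos k = 1 \<and> P then 1 else 0) = (0::real)" for k and I :: 'n and P
    using pos_bounds(1)[of I] by auto
  then show ?thesis
    by (auto simp: vec_eq_iff matrix_matrix_mult_def transpose_def inc_mat_def first_mat_def intro!: sum.neutral)
qed

lemma inc_mat_complement: "(inc_mat :: ('n rvec, 'm) vec) ** transpose inc_mat + first_mat = mat 1"
proof -
  have "(\<Sum>J\<in>UNIV. (if pos k = Suc (pos (J :: 'n)) then 1 else 0) * (if pos l = Suc (pos J) then 1 else 0)) +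
     (if pos k = 1 \<and> pos l = 1 then 1 else 0) = (if k = l then 1 else (0::real))" for k l :: 'm
  proof (cases "pos k = 1")
    case True
    have "(\<Sum>J\<in>UNIV. (if pos k = Suc (pos (J :: 'n)) then 1 else 0) * (if pos l = Suc (pos J) then 1 else 0)) = (0::real)"
    proof (intro sum.neutral ballI)
      fix J :: 'n
      show "(if pos k = Suc (pos J) then 1 else 0) * (if pos l = Suc (pos J) then 1 else 0) = (0::real)"
        using pos_bounds(1)[of J] True by simp
    qed
    then show ?thesis using True by (auto simp: pos_inject[of k l, symmetric])
  next
    case False
    then obtain J0 :: 'n where J0: "pos k = Suc (pos J0)" using pos_pred_unique by blast
    have eq: "pos k = Suc (pos J) \<longleftrightarrow> J = J0" for J :: 'n using J0 by (auto simp: pos_inject)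
    have "(\<Sum>J\<in>UNIV. (if pos k = Suc (pos (J :: 'n)) then 1 else 0) * (if pos l = Suc (pos J) then 1 else 0)) =
       (\<Sum>J\<in>UNIV. if J = J0 then (if pos l = Suc (pos J0) then 1 else 0) else (0::real))"
      by (intro sum.cong refl) (auto simp: eq)
    also have "\<dots> = (if pos l = Suc (pos J0) then 1 else 0)" by simp
    finally show ?thesis using False J0 by (auto simp: pos_inject[of k l, symmetric])
  qed
  then show ?thesis by (simp add: vec_eq_iff matrix_matrix_mult_def transpose_def inc_mat_def first_mat_def mat_def)
qed

text \<open>Since \<open>inc_mat\<close> has orthonormal columns, all orthogonal to the first unit
  vector, a shear removes B. What remains is, up to a sign change of the first n columns, a product
  of three shears; the sign change is the source of the factor (-1)^n.\<close>

lemma det_core_block: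
  fixes B :: "('n rvec, 'n) vec"
  shows "det (block_mat B (transpose inc_mat) inc_mat first_mat :: real ^ ('n + 'm) ^ ('n + 'm)) = (-1) ^ CARD('n)"
proof -
  let ?E = "inc_mat :: ('n rvec, 'm) vec" and ?R = "first_mat :: ('m rvec, 'm) vec"
  let ?up = "\<lambda>X. block_mat (mat 1) X 0 (mat 1) :: real ^ ('n + 'm) ^ ('n + 'm)"
  let ?low = "\<lambda>X. block_mat (mat 1) 0 X (mat 1) :: real ^ ('n + 'm) ^ ('n + 'm)"
  let ?D = "block_mat (- (mat 1)) 0 0 (mat 1) :: real ^ ('n + 'm) ^ ('n + 'm)"
  let ?J = "block_mat 0 (transpose ?E) ?E ?R"
  have compl: "mat 1 - ?E ** transpose ?E = ?R" using inc_mat_complement by (metis add_diff_cancel_left')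
  have neg: "(- X) ** Y = - (X ** Y)" "X ** (- Y) = - (X ** Y)" for X :: "real ^ 'b::finite ^ 'c::finite" and Y :: "real ^ 'd::finite ^ 'b"
    by (simp_all add: vec_eq_iff matrix_matrix_mult_def sum_negf)
  have J: "?J = ?up (transpose ?E) ** (?low (- ?E) ** (?up (transpose ?E) ** ?D))"
    using compl by (simp add: block_mat_mult neg inc_mat_gram inc_mat_first matrix_add_ldistrib)
  have "det ?D = (\<Prod>i\<in>UNIV. ?D $ i $ i)"
    by (rule det_diagonal) (auto simp: block_mat_def mat_def split: sum.split)
  then have "det ?D = (-1) ^ CARD('n)" by (simp add: prod_UNIV_sum mat_def)
  then have dJ: "det ?J = (-1) ^ CARD('n)"
    unfolding J det_mul det_block_shear det_block_shear_lower by simp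
  have "block_mat B (transpose ?E) ?E ?R = ?up (B ** transpose ?E) ** ?J"
    by (simp add: block_mat_mult matrix_mul_assoc[symmetric] inc_mat_gram inc_mat_first)
  then show ?thesis by (simp only: det_mul det_block_shear dJ mult_1)
qed

lemma col_mat_inc: "col_mat y (C :: ('n rvec, 'm) vec) ** inc_mat = C"
proof -
  have "(\<Sum>k\<in>UNIV. (if pos (k :: 'm) = 1 then y $ i else C $ i $ ith (pos k - 1)) * (if pos k = Suc (pos J) then 1 else 0))
     = C $ i $ J" for i and J :: 'n
  proof -
    obtain k0 :: 'm where k0: "pos k0 = Suc (pos J)" using pos_Suc_unique by blast
    have eq: "pos k = Suc (pos J) \<longleftrightarrow> k = k0" for k :: 'm using k0 by (metis pos_inject)
    have "(\<Sum>k\<in>UNIV. (if pos (k :: 'm) = 1 then y $ i else C $ i $ ith (pos k - 1)) * (if pos k = Suc (pos J) then 1 else 0))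
      = (\<Sum>k\<in>UNIV. if k = k0 then C $ i $ J else 0)"
      using pos_bounds(1)[of J] by (intro sum.cong refl) (auto simp: eq k0 ith_pos)
    then show ?thesis by simp
  qed
  then show ?thesis by (simp add: vec_eq_iff matrix_matrix_mult_def col_mat_def inc_mat_def)
qed

lemma col_mat_first:
  "col_mat y (C :: ('n rvec, 'm) vec) ** first_mat ** transpose (col_mat z (C' :: ('n rvec, 'm) vec)) = (\<chi> i j. y $ i * z $ j)"
proof -
  obtain k0 :: 'm where k0: "pos k0 = 1" using pos_one_unique by blast
  have eq: "pos k = Suc 0 \<longleftrightarrow> k = k0" for k :: 'm using k0 by (metis pos_inject One_nat_def)
  have 1: "(col_mat y C ** first_mat) $ i $ l = (if l = k0 then y $ i else 0)" for i l
  proof -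
    have "(col_mat y C ** first_mat) $ i $ l = (\<Sum>k\<in>UNIV. col_mat y C $ i $ k * first_mat $ k $ l)"
      by (simp add: matrix_matrix_mult_def)
    also have "\<dots> = (\<Sum>k\<in>UNIV. if k = k0 then (if l = k0 then y $ i else 0) else 0)"
      by (intro sum.cong refl) (auto simp: col_mat_def first_mat_def eq)
    finally have "(col_mat y C ** first_mat) $ i $ l = (\<Sum>k\<in>UNIV. if k = k0 then (if l = k0 then y $ i else 0) else 0)" .
    then show ?thesis by simp
  qed
  have "(col_mat y C ** first_mat ** transpose (col_mat z C')) $ i $ j = y $ i * z $ j" for i j
  proof -
    have "(col_mat y C ** first_mat ** transpose (col_mat z C')) $ i $ j =
      (\<Sum>l\<in>UNIV. (col_mat y C ** first_mat) $ i $ l * col_mat z C' $ j $ l)"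
      by (simp add: matrix_matrix_mult_def[of "col_mat y C ** first_mat"] transpose_def)
    also have "\<dots> = (\<Sum>l\<in>UNIV. if l = k0 then y $ i * z $ j else 0)"
      unfolding 1 by (intro sum.cong refl) (auto simp: col_mat_def k0)
    finally have "(col_mat y C ** first_mat ** transpose (col_mat z C')) $ i $ j =
      (\<Sum>l\<in>UNIV. if l = k0 then y $ i * z $ j else 0)" .
    then show ?thesis by simp
  qed
  then show ?thesis by (simp add: vec_eq_iff)
qed

text \<open>The factorization \<open>[[B, C'\<^sup>T], [C, y z\<^sup>T]] = diag(1, [y|C]) [[B, E\<^sup>T], [E, \<epsilon> \<epsilon>\<^sup>T]] diag(1, [z|C'])\<^sup>T\<close>,
  where \<open>C = [y|C] E\<close> and \<open>\<epsilon>\<close> is the first unit vector.\<close>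

lemma det_bordered_block:
  fixes B :: "('n rvec, 'n) vec" and C C' :: "('n rvec, 'm) vec"
  shows "det (block_mat B (transpose C') C (\<chi> i j. y $ i * z $ j)) =
    (-1) ^ CARD('n) * (y \<bullet> col_minors C) * (z \<bullet> col_minors C')"
proof -
  have "block_mat B (transpose C') C (\<chi> i j. y $ i * z $ j) =
    block_mat (mat 1) 0 0 (col_mat y C) ** (block_mat B (transpose inc_mat) inc_mat first_mat
      ** transpose (block_mat (mat 1) 0 0 (col_mat z C')))"
  proof -
    have "transpose (inc_mat :: ('n rvec, 'm) vec) ** transpose (col_mat z C') = transpose C'"
      using col_mat_inc[of z C'] by (metis matrix_transpose_mul)
    then show ?thesis
      by (simp add: transpose_block_mat block_mat_mult transpose_mat transpose_zero_mat col_mat_inc col_mat_first matrix_mul_assoc)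
  qed
  then show ?thesis
    by (simp add: det_mul det_transpose det_block_diag det_core_block det_col_mat[OF dims])
qed

text \<open>If a row or column of the upper left part is struck out, the rest is singular: n columns
  in a space of dimension n + 1 leave a nonzero x orthogonal to all of them, and (0, x) is in the
  kernel. The lower right entries are bordered determinants with unit vectors in place of y and z.
  No rank assumption on C enters.\<close>

lemma adjugate_block_mat:
  fixes B :: "('n rvec, 'n) vec" and C :: "('n rvec, 'm) vec"
  shows "adjugate (block_mat B (transpose C) C 0) =
    (-1) ^ CARD('n) *\<^sub>R block_mat 0 0 0 (\<chi> i j. col_minors C $ i * col_minors C $ j)"
proof -
  let ?cof = "\<lambda>X i j. (\<chi> k l. if k = j \<and> l = i then 1 else if k = j \<or> l = i then 0 else X $ k $ l) :: real ^ ('n + 'm) ^ ('n + 'm)"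
  let ?H = "\<lambda>B. block_mat B (transpose C) C 0 :: real ^ ('n + 'm) ^ ('n + 'm)"
  have left: "det (?cof (?H B) (Inl I) j) = 0" for I j B
  proof -
    obtain x where x: "x \<noteq> 0" "\<And>J. (\<Sum>i\<in>UNIV. C $ i $ J * x $ i) = 0"
      using orthogonal_to_columns_exists[of C] dims by auto
    let ?z = "(\<chi> c. case c of Inl _ \<Rightarrow> 0 | Inr j \<Rightarrow> x $ j) :: real ^ ('n + 'm)"
    have "?z \<noteq> 0"
      using x(1) by (auto simp: vec_eq_iff split: sum.split)
    moreover have "(?cof (?H B) (Inl I) j *v ?z) $ k = 0" for k
    proof (cases k)
      case (Inl K)
      then have "(?cof (?H B) (Inl I) j *v ?z) $ k = (\<Sum>i\<in>UNIV. if Inl K = j then 0 else C $ i $ K * x $ i)"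
        by (auto simp: matrix_vector_mult_def sum_UNIV_sum transpose_def intro!: sum.cong)
      then show ?thesis using x(2)[of K] by (cases "Inl K = j") auto
    next
      case (Inr l)
      then show ?thesis by (auto simp: matrix_vector_mult_def sum_UNIV_sum intro!: sum.neutral)
    qed
    then have "?cof (?H B) (Inl I) j *v ?z = 0" by (simp add: vec_eq_iff)
    ultimately show ?thesis by (rule det_zero_kernel[rotated])
  qed
  have right: "det (?cof (?H B) i (Inl J)) = 0" for i J
  proof -
    \<comment> \<open>Transposition exchanges the two kinds of entries but also transposes B, which
      is why \<open>left\<close> is stated for every B.\<close>
    have "transpose (?cof (?H B) i (Inl J)) = ?cof (?H (transpose B)) (Inl J) i"
      by (rule sum_type_matrix_eqI) (auto simp: transpose_def)
    then show ?thesis using left[where B = "transpose B" and I = J and j = i]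
      det_transpose[of "?cof (?H B) i (Inl J)"] by (simp only:)
  qed
  have main: "det (?cof (?H B) (Inr i) (Inr j)) = (-1) ^ CARD('n) * col_minors C $ i * col_minors C $ j" for i j
  proof -
    let ?z = "\<lambda>j. (\<chi> k J. if k = j then 0 else C $ k $ J) :: ('n rvec, 'm) vec"
    have "?cof (?H B) (Inr i) (Inr j) = block_mat B (transpose (?z i)) (?z j) (\<chi> k l. axis j 1 $ k * axis i 1 $ l)"
      by (rule sum_type_matrix_eqI) (auto simp: transpose_def axis_def)
    \<comment> \<open>The j-th minor does not see row j, so setting that row to zero does not affect
      it.\<close>
    moreover have "axis j 1 \<bullet> col_minors (?z j) = col_minors C $ j" for j
    proof -
      have "skip j a \<noteq> j" for a :: 'n
      proof -
        have "pos a - 1 < length (remove1 j enum)"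
          using pos_pred_less[of a] dims enum_props(1,2)[where 'k='m] by (simp add: length_remove1)
        then have "skip j a \<in> set (remove1 j enum)" unfolding skip_enum by (rule nth_mem)
        then show ?thesis using enum_props(3)[where 'k='m] by auto
      qed
      then show ?thesis by (simp add: inner_axis' col_minors_def)
    qed
    ultimately show ?thesis by (simp add: det_bordered_block)
  qed
  show ?thesis
    by (rule sum_type_matrix_eqI) (simp_all add: adjugate_def left right main)
qed

end

section \<open>Tangent spaces and linear fibres\<close>

lemma tangent_space_curve:
  assumes "v \<in> tangent_space S p"
  obtains c e where "e > 0" "smooth_on {-e<..<e} c" "c 0 = p" "c ` {-e<..<e::real} \<subseteq> S"
    "(c has_vector_derivative v) (at 0)"
  using assms unfolding tangent_space_def by blast

lemma has_derivative_along_curve: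
  fixes c :: "real \<Rightarrow> 'a::euclidean_space"
  assumes "e > 0" "c 0 = p" "c ` {-e<..<e} \<subseteq> S" "(c has_vector_derivative v) (at 0)"
    and "(Y has_derivative Y') (at p within S)"
  shows "((\<lambda>t. Y (c t)) has_vector_derivative Y' v) (at 0)"
proof -
  let ?I = "{-e<..<e}"
  have "(c has_derivative (\<lambda>h. h *\<^sub>R v)) (at 0 within ?I)"
    using assms(4) unfolding has_vector_derivative_def by (rule has_derivative_at_withinI)
  moreover have "(Y has_derivative Y') (at (c 0) within c ` ?I)"
    using has_derivative_subset[OF assms(5,3)] assms(2) by simp
  ultimately have "((\<lambda>t. Y (c t)) has_derivative (\<lambda>h. Y' (h *\<^sub>R v))) (at 0 within ?I)"
    by (rule has_derivative_in_compose)
  moreover have "at 0 within ?I = at 0" using assms(1) by (intro at_within_open) auto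
  ultimately show ?thesis
    unfolding has_vector_derivative_def by (simp add: linear_cmul[OF has_derivative_linear[OF assms(5)]])
qed

text \<open>A derivative within S need not be unique in directions leaving S. On a tangent vector it
  is the velocity of Y along a curve in S, so the choice made by \<open>frechet_derivative\<close>
  is harmless there.\<close>

lemma flat_deriv_eq:
  assumes "v \<in> tangent_space S p" "(Y has_derivative Y') (at p within S)"
  shows "flat_deriv S Y p v = Y' v"
proof -
  obtain c e where c: "e > 0" "c 0 = p" "c ` {-e<..<e} \<subseteq> S" "(c has_vector_derivative v) (at 0)"
    using tangent_space_curve[OF assms(1)] by metis
  have "Y differentiable (at p within S)" using assms(2) by (rule differentiableI)
  then have "(Y has_derivative frechet_derivative Y (at p within S)) (at p within S)"
    by (simp add: frechet_derivative_works)
  from has_derivative_along_curve[OF c this] has_derivative_along_curve[OF c assms(2)]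
  show ?thesis unfolding flat_deriv_def by (rule vector_derivative_unique_at)
qed

lemma flat_deriv_eq_on:
  assumes "p \<in> S" "v \<in> tangent_space S p" "\<And>q. q \<in> S \<Longrightarrow> Y q = Z q" "(Z has_derivative Z') (at p)"
  shows "flat_deriv S Y p v = Z' v"
proof (rule flat_deriv_eq[OF assms(2)])
  show "(Y has_derivative Z') (at p within S)"
    using has_derivative_transform[OF assms(1), of Y Z Z'] assms(3) has_derivative_at_withinI[OF assms(4)] by blast
qed

lemma smooth_along_has_derivative:
  assumes "smooth_along S Y" "p \<in> S"
  obtains Y' where "(Y has_derivative Y') (at p within S)"
proof -
  obtain U g where U: "open U" "p \<in> U" "smooth_on U g" "\<And>q. q \<in> S \<inter> U \<Longrightarrow> g q = Y q"
    using bspec[OF assms(1)[unfolded smooth_along_def] assms(2)] by blast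
  obtain d where d: "d > 0" "ball p d \<subseteq> U" using U openE by blast
  have "(g has_derivative frechet_derivative g (at p)) (at p within S)"
    by (rule has_derivative_at_withinI[OF smooth_on_has_derivative[OF U(3,2)]])
  from has_derivative_transform_within[OF this d(1) assms(2), of Y]
  show ?thesis using U(4) d(2) by (auto simp: dist_commute subset_iff intro: that)
qed

lemma smooth_on_imp_smooth_along: "open D \<Longrightarrow> smooth_on D Y \<Longrightarrow> S \<subseteq> D \<Longrightarrow> smooth_along S Y"
  unfolding smooth_along_def by blast

text \<open>The product rule for a constant form. Expanding the arguments in \<open>Basis\<close>
  exhibits the form as a polynomial in their coordinates, to which the usual rules apply.\<close>

lemma alt_form_has_derivative:
  fixes \<alpha> :: "(nat \<Rightarrow> 'a::euclidean_space) \<Rightarrow> real" and Z :: "nat \<Rightarrow> 'b::euclidean_space \<Rightarrow> 'a"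
  assumes \<alpha>: "alt_form k \<alpha>" and Z: "\<And>i. i < k \<Longrightarrow> (Z i has_derivative Z' i) (at p within S)"
  shows "((\<lambda>q. \<alpha> (\<lambda>i. Z i q)) has_derivative (\<lambda>h. \<Sum>i<k. \<alpha> ((\<lambda>j. Z j p)(i := Z' i h)))) (at p within S)"
proof -
  let ?P = "Pi\<^sub>E {..<k} (\<lambda>_. Basis :: 'a set)"
  have ex: "\<alpha> v = (\<Sum>f\<in>?P. (\<Prod>i<k. v i \<bullet> f i) * \<alpha> f)" for v
  proof -
    have "\<alpha> v = \<alpha> (\<lambda>i. if i < k then \<Sum>b\<in>Basis. (v i \<bullet> b) *\<^sub>R b else undefined)"
      by (rule alt_form_cong[OF \<alpha>]) (simp add: euclidean_representation)
    also have "\<dots> = (\<Sum>f\<in>?P. (\<Prod>i<k. v i \<bullet> f i) * \<alpha> (\<lambda>i. if i < k then f i else undefined))"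
      by (rule alt_form_expand[OF \<alpha>]) auto
    also have "\<dots> = (\<Sum>f\<in>?P. (\<Prod>i<k. v i \<bullet> f i) * \<alpha> f)"
      by (intro sum.cong refl arg_cong2[of _ _ _ _ "(*)"] alt_form_cong[OF \<alpha>]) auto
    finally show ?thesis .
  qed
  have "((\<lambda>q. \<Sum>f\<in>?P. (\<Prod>i<k. Z i q \<bullet> f i) * \<alpha> f) has_derivative
      (\<lambda>h. \<Sum>f\<in>?P. (\<Sum>i<k. (Z' i h \<bullet> f i) * (\<Prod>j\<in>{..<k} - {i}. Z j p \<bullet> f j)) * \<alpha> f)) (at p within S)"
    by (intro has_derivative_sum has_derivative_mult_left has_derivative_prod has_derivative_inner_left) (use Z in auto)
  moreover have "(\<Sum>f\<in>?P. (\<Sum>i<k. (Z' i h \<bullet> f i) * (\<Prod>j\<in>{..<k} - {i}. Z j p \<bullet> f j)) * \<alpha> f) =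
      (\<Sum>i<k. \<alpha> ((\<lambda>j. Z j p)(i := Z' i h)))" for h
  proof -
    have "(Z' i h \<bullet> f i) * (\<Prod>j\<in>{..<k} - {i}. Z j p \<bullet> f j) = (\<Prod>j<k. ((\<lambda>j. Z j p)(i := Z' i h)) j \<bullet> f j)"
      if "i < k" for i f
      using that by (subst prod.remove[of "{..<k}" i]) (auto intro!: prod.cong)
    then show ?thesis
      by (subst ex) (simp add: sum_distrib_right sum.swap[of _ ?P])
  qed
  ultimately show ?thesis by (simp add: ex[of "\<lambda>i. Z i _"])
qed

section \<open>Affine subspaces as fibres of linear maps\<close>

context
  fixes l :: "'a::euclidean_space \<Rightarrow> 'b::euclidean_space" and c :: 'b and L :: "'a set"
  assumes l: "linear l" and L: "L = {q. l q = c}"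
begin

lemma tangent_space_linear_fibre:
  assumes "p \<in> L" shows "tangent_space L p = {v. l v = 0}"
proof (intro equalityI subsetI)
  fix v assume v: "v \<in> tangent_space L p"
  have "(l has_derivative l) (at p within L)"
    using l by (simp add: linear_conv_bounded_linear bounded_linear_imp_has_derivative)
  from flat_deriv_eq[OF v this] have 1: "flat_deriv L l p v = l v" .
  have "((\<lambda>q. c) has_derivative (\<lambda>h. 0)) (at p)" by simp
  from flat_deriv_eq_on[OF assms v _ this, of l] show "v \<in> {v. l v = 0}" using L 1 by auto
next
  fix v assume "v \<in> {v. l v = 0}"
  then have v: "l v = 0" by simp
  have "l (p + t *\<^sub>R v) = c" for t using assms L v by (simp add: linear_add[OF l] linear_cmul[OF l])
  moreover have "smooth_on {-1<..<1} (\<lambda>t. p + t *\<^sub>R v)"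
    by (intro smooth_on_add smooth_on_const smooth_on_scaleR smooth_on_ident) auto
  moreover have "((\<lambda>t. p + t *\<^sub>R v) has_vector_derivative v) (at 0)"
    by (auto intro!: derivative_eq_intros simp: has_vector_derivative_def)
  ultimately show "v \<in> tangent_space L p"
    unfolding tangent_space_def L by (intro CollectI exI[of _ "\<lambda>t. p + t *\<^sub>R v"] exI[of _ "1::real"]) auto
qed

lemma totally_geodesic_linear_fibre: "totally_geodesic L"
  unfolding totally_geodesic_def
proof (intro allI impI ballI)
  fix X Y p assume XY: "tangent_field L X \<and> tangent_field L Y" and p: "p \<in> L"
  have v: "X p \<in> tangent_space L p" using XY p by (simp add: tangent_field_def)
  obtain Y' where Y': "(Y has_derivative Y') (at p within L)"
    using XY p smooth_along_has_derivative unfolding tangent_field_def by blast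
  have "((\<lambda>q. l (Y q)) has_derivative (\<lambda>h. l (Y' h))) (at p within L)"
    using l Y' by (simp add: linear_conv_bounded_linear bounded_linear.has_derivative)
  from flat_deriv_eq[OF v this] have 1: "flat_deriv L (\<lambda>q. l (Y q)) p (X p) = l (Y' (X p))" .
  have "l (Y q) = 0" if "q \<in> L" for q
    using XY that tangent_space_linear_fibre[OF that] by (auto simp: tangent_field_def)
  \<comment> \<open>Tangency of Y says that \<open>l\<close> annihilates it along L; differentiating
    this identity keeps the derivative of Y in the kernel of \<open>l\<close>.\<close>
  then have "flat_deriv L (\<lambda>q. l (Y q)) p (X p) = 0"
    by (intro flat_deriv_eq_on[OF p v, where Z = "\<lambda>q. 0" and Z' = "\<lambda>h. 0"]) auto
  then show "flat_deriv L Y p (X p) \<in> tangent_space L p"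
    using 1 flat_deriv_eq[OF v Y'] by (simp add: tangent_space_linear_fibre[OF p])
qed

lemma smooth_submanifold_linear_fibre:
  assumes "dim {v. l v = 0} = k" shows "smooth_submanifold k L"
  unfolding smooth_submanifold_def
proof
  fix p assume p: "p \<in> L"
  let ?H = "{v. l v = 0}"
  have H: "subspace ?H" by (rule linear_subspace_kernel[OF l])
  have "(\<lambda>x. x - p) ` L = ?H"
  proof (intro equalityI subsetI)
    fix v assume "v \<in> ?H"
    then have "p + v \<in> L" using p L by (simp add: linear_add[OF l])
    then show "v \<in> (\<lambda>x. x - p) ` L" by (intro image_eqI[of _ _ "p + v"]) auto
  qed (use p L in \<open>auto simp: linear_diff[OF l]\<close>)
  moreover have "homeomorphism UNIV UNIV (\<lambda>x. x - p) (\<lambda>x. x + p)"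
    using surjI[of "\<lambda>x. x - p" "\<lambda>x. x + p"] surjI[of "\<lambda>x. x + p" "\<lambda>x. x - p"]
    by (auto simp: homeomorphism_def intro!: continuous_intros)
  moreover have "smooth_on UNIV (\<lambda>x. x - p)" "smooth_on UNIV (\<lambda>x. x + p)"
    by (auto intro!: smooth_on_diff smooth_on_add smooth_on_ident smooth_on_const)
  ultimately show "\<exists>U U' f g H. open U \<and> p \<in> U \<and> open U' \<and> homeomorphism U U' f g \<and>
      smooth_on U f \<and> smooth_on U' g \<and> subspace H \<and> dim H = k \<and> f ` (U \<inter> L) = U' \<inter> (H :: 'a set)"
    using H assms
    by (intro exI[of _ "UNIV :: 'a set"] exI[of _ "\<lambda>x. x - p"] exI[of _ "\<lambda>x. x + p"] exI[of _ ?H]) auto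
qed

lemma affine_linear_fibre: "affine L"
  unfolding affine_def L by (auto simp: linear_add[OF l] linear_cmul[OF l] scaleR_left_distrib[symmetric])

end

section \<open>Traces of square-zero maps\<close>

lemma trace_basis_independent:
  fixes G :: "'a::euclidean_space \<Rightarrow> 'a"
  assumes G: "linear G" and GH: "\<And>v. v \<in> H \<Longrightarrow> G v \<in> H"
    and B: "independent B" "span B = H" and C: "independent C" "span C = H"
  shows "(\<Sum>b\<in>B. representation B (G b) b) = (\<Sum>c\<in>C. representation C (G c) c)"
proof -
  have fin: "finite B" "finite C" using B(1) C(1) by (simp_all add: independent_imp_finite)
  have BH: "b \<in> H" if "b \<in> B" for b using that B(2) span_base by blast
  have CH: "c \<in> H" if "c \<in> C" for c using that C(2) span_base by blast
  \<comment> \<open>Expanding G b in C here and c in B in the next claim makes both traces the same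
    double sum.\<close>
  have 1: "representation B (G b) b = (\<Sum>c\<in>C. representation C (G b) c * representation B c b)" if "b \<in> B" for b
  proof -
    have "G b = (\<Sum>c\<in>C. representation C (G b) c *\<^sub>R c)"
      using sum_representation_eq[OF C(1) _ fin(2), of "G b"] GH[OF BH[OF that]] C(2) by simp
    also have "representation B \<dots> b = (\<Sum>c\<in>C. representation B (representation C (G b) c *\<^sub>R c) b)"
      using B CH by (subst representation_sum) (auto intro: span_scale)
    also have "\<dots> = (\<Sum>c\<in>C. representation C (G b) c * representation B c b)"
      using B CH by (intro sum.cong refl) (simp add: representation_scale)
    finally show ?thesis .
  qed
  have 2: "representation C (G c) c = (\<Sum>b\<in>B. representation C (G b) c * representation B c b)" if "c \<in> C" for c
  proof -
    have "c = (\<Sum>b\<in>B. representation B c b *\<^sub>R b)"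
      using sum_representation_eq[OF B(1) _ fin(1), of c] CH[OF that] B(2) by simp
    then have "G c = (\<Sum>b\<in>B. representation B c b *\<^sub>R G b)"
      by (metis (no_types, lifting) G linear_cmul linear_sum sum.cong)
    also have "representation C \<dots> c = (\<Sum>b\<in>B. representation C (representation B c b *\<^sub>R G b) c)"
      using C BH GH by (subst representation_sum) (auto intro: span_scale)
    also have "\<dots> = (\<Sum>b\<in>B. representation C (G b) c * representation B c b)"
      using C BH GH by (intro sum.cong refl) (simp add: representation_scale)
    finally show ?thesis .
  qed
  show ?thesis by (simp add: 1 2 sum.swap[of _ B] cong: sum.cong)
qed

text \<open>In a basis extending one of the kernel, a basis vector in the kernel has image zero, and
  any other has its image in the span of the kernel part; so all diagonal entries vanish. Only
  agreement of f with a linear G on H is assumed, because the shape operator is controlled on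
  tangent vectors only.\<close>

lemma trace_on_square_zero:
  fixes G :: "'a::euclidean_space \<Rightarrow> 'a"
  assumes H: "subspace H" and G: "linear G" and GH: "\<And>v. v \<in> H \<Longrightarrow> G v \<in> H"
    and GG: "\<And>v. v \<in> H \<Longrightarrow> G (G v) = 0" and f: "\<And>v. v \<in> H \<Longrightarrow> f v = G v"
  shows "trace_on H f = 0"
proof -
  define B where "B = (SOME B. independent B \<and> span B = H)"
  have "\<exists>B. independent B \<and> span B = H"
    using basis_exists[of H] H by (metis span_eq_iff span_mono span_span subset_antisym)
  then have B: "independent B" "span B = H" unfolding B_def using someI_ex by (metis (mono_tags, lifting))+
  let ?K = "{v \<in> H. G v = 0}"
  have K: "subspace ?K"
    using H by (simp add: subspace_def linear_0[OF G] linear_add[OF G] linear_cmul[OF G])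
  obtain BK where BK: "BK \<subseteq> ?K" "independent BK" "?K \<subseteq> span BK"
    using basis_exists[of ?K] by metis
  have spanBK: "span BK = ?K" using BK K by (meson span_minimal subset_antisym)
  obtain C where C: "BK \<subseteq> C" "C \<subseteq> H" "independent C" "H \<subseteq> span C"
    using maximal_independent_subset_extend[of BK H] BK by (metis (no_types, lifting) mem_Collect_eq subset_iff)
  have spanC: "span C = H" using C H by (meson span_minimal subset_antisym)
  have fin: "finite C" using C(3) by (rule independent_imp_finite)
  have "representation C (G c) c = 0" if c: "c \<in> C" for c
  proof (cases "G c = 0")
    case True
    then show ?thesis by (simp add: representation_zero)
  next
    case False
    have "c \<in> H" using c C by blast
    then have "G c \<in> span BK" using GH GG spanBK by simp
    then have "representation C (G c) = representation BK (G c)"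
      using representation_extend[OF C(3) _ C(1)] by blast
    moreover have "c \<notin> BK" using False BK(1) by blast
    ultimately show ?thesis using representation_ne_zero[of BK "G c" c] by auto
  qed
  then have "(\<Sum>c\<in>C. representation C (G c) c) = 0" by simp
  moreover have "trace_on H f = (\<Sum>b\<in>B. representation B (G b) b)"
    unfolding trace_on_def Let_def B_def[symmetric]
  proof (intro sum.cong refl)
    fix b assume "b \<in> B"
    then have "b \<in> H" using B(2) span_base by blast
    then show "representation B (f b) b = representation B (G b) b" by (simp only: f)
  qed
  ultimately show ?thesis
    using trace_basis_independent[OF G GH B C(3) spanC] by simp
qed

section \<open>The Hessian of the family\<close>

locale affine_family =
  fixes M :: "'n::{finite,linorder} rvec set"
    and A :: "'n rvec \<Rightarrow> 'm::{finite,linorder} rvec"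
    and Q :: "'n rvec \<Rightarrow> real"
  assumes dims: "CARD('m) = CARD('n) + 1"
    and openM: "open M" and smA: "smooth_on M A" and smQ: "smooth_on M Q"
begin

abbreviation (input) "D \<equiv> M \<times> (UNIV :: 'm rvec set)"
abbreviation (input) "F \<equiv> F_fun A Q"
abbreviation (input) "V \<equiv> V_field A"

definition dA :: "'n rvec \<Rightarrow> 'n rvec \<Rightarrow> 'm rvec" where
  "dA u = frechet_derivative A (at u)"

definition dQ :: "'n rvec \<Rightarrow> 'n rvec \<Rightarrow> real" where
  "dQ u = frechet_derivative Q (at u)"

definition vv :: "'n rvec \<Rightarrow> 'm rvec" where
  "vv u = col_minors (jacobian A (at u))"

definition dF :: "('n, 'm) phase \<Rightarrow> ('n, 'm) phase \<Rightarrow> real" where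
  "dF p v = dA (fst p) (fst v) \<bullet> snd p + A (fst p) \<bullet> snd v + dQ (fst p) (fst v)"

text \<open>The block B of the Hessian. It differentiates in direction v the first derivatives in
  direction w, so its symmetry is a theorem, namely \<open>base_hess_sym\<close>.\<close>

definition base_hess :: "('n, 'm) phase \<Rightarrow> 'n rvec \<Rightarrow> 'n rvec \<Rightarrow> real" where
  "base_hess p v w = frechet_derivative (\<lambda>u. dA u w) (at (fst p)) v \<bullet> snd p +
     frechet_derivative (\<lambda>u. dQ u w) (at (fst p)) v"

definition hess :: "('n, 'm) phase \<Rightarrow> ('n, 'm) phase \<Rightarrow> ('n, 'm) phase \<Rightarrow> real" where
  "hess p v w = base_hess p (fst v) (fst w) + dA (fst p) (fst w) \<bullet> snd v + dA (fst p) (fst v) \<bullet> snd w"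

lemma openD: "open D"
  using openM by (simp add: open_Times)

lemma A_has_derivative: "u \<in> M \<Longrightarrow> (A has_derivative dA u) (at u)"
  unfolding dA_def by (rule smooth_on_has_derivative[OF smA])

lemma Q_has_derivative: "u \<in> M \<Longrightarrow> (Q has_derivative dQ u) (at u)"
  unfolding dQ_def by (rule smooth_on_has_derivative[OF smQ])

lemma linear_dA: "u \<in> M \<Longrightarrow> linear (dA u)"
  using A_has_derivative has_derivative_linear by blast

lemma linear_dQ: "u \<in> M \<Longrightarrow> linear (dQ u)"
  using Q_has_derivative has_derivative_linear by blast

lemma smooth_dA: "smooth_on M (\<lambda>u. dA u w)"
  unfolding dA_def by (rule smooth_on_frechet_derivative[OF smA])

lemma smooth_dQ: "smooth_on M (\<lambda>u. dQ u w)"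
  unfolding dQ_def by (rule smooth_on_frechet_derivative[OF smQ])

lemma smooth_lift: "smooth_on M f \<Longrightarrow> smooth_on D (\<lambda>p. f (fst p))"
  by (rule smooth_on_compose[OF openD smooth_on_fst[OF openD smooth_on_ident[OF openD]]]) auto

lemma smooth_snd: "smooth_on D snd"
  using smooth_on_snd[OF openD smooth_on_ident[OF openD]] .

lemma smooth_F: "smooth_on D F"
  using smooth_on_add[OF openD smooth_on_inner[OF openD smooth_lift[OF smA] smooth_snd] smooth_lift[OF smQ]]
  by (simp add: F_fun_def[abs_def])

lemma smooth_dF: "smooth_on D (\<lambda>q. dF q w)"
proof -
  have "smooth_on D (\<lambda>q. dA (fst q) (fst w) \<bullet> snd q + A (fst q) \<bullet> snd w + dQ (fst q) (fst w))"
    by (rule smooth_on_add[OF openD smooth_on_add[OF openD smooth_on_inner[OF openD smooth_lift[OF smooth_dA] smooth_snd]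
      smooth_on_inner[OF openD smooth_lift[OF smA] smooth_on_const[OF openD]]] smooth_lift[OF smooth_dQ]])
  then show ?thesis by (simp add: dF_def)
qed

lemma has_derivative_lift:
  assumes "(f has_derivative f') (at (fst p))"
  shows "((\<lambda>q. f (fst q)) has_derivative (\<lambda>v. f' (fst v))) (at p)"
  using has_derivative_compose[OF has_derivative_fst[OF has_derivative_ident] assms] .

lemma F_has_derivative:
  assumes "p \<in> D" shows "(F has_derivative dF p) (at p)"
proof -
  have u: "fst p \<in> M" using assms by auto
  have "((\<lambda>q. A (fst q) \<bullet> snd q + Q (fst q)) has_derivative
    (\<lambda>v. (A (fst p) \<bullet> snd v + dA (fst p) (fst v) \<bullet> snd p) + dQ (fst p) (fst v))) (at p)"
    by (intro has_derivative_add has_derivative_inner has_derivative_lift A_has_derivative[OF u]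
        Q_has_derivative[OF u] has_derivative_snd has_derivative_ident)
  then show ?thesis by (simp add: F_fun_def[abs_def] dF_def[abs_def] add_ac)
qed

lemma dF_has_derivative:
  assumes "p \<in> D" shows "((\<lambda>q. dF q w) has_derivative (\<lambda>v. hess p v w)) (at p)"
proof -
  have u: "fst p \<in> M" using assms by auto
  note dA' = smooth_on_has_derivative[OF smooth_dA u, of "fst w"]
  note dQ' = smooth_on_has_derivative[OF smooth_dQ u, of "fst w"]
  have "((\<lambda>q. dA (fst q) (fst w) \<bullet> snd q + A (fst q) \<bullet> snd w + dQ (fst q) (fst w)) has_derivative
    (\<lambda>v. (dA (fst p) (fst w) \<bullet> snd v + frechet_derivative (\<lambda>u. dA u (fst w)) (at (fst p)) (fst v) \<bullet> snd p) +
      (A (fst p) \<bullet> 0 + dA (fst p) (fst v) \<bullet> snd w) +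
      frechet_derivative (\<lambda>u. dQ u (fst w)) (at (fst p)) (fst v))) (at p)"
    by (intro has_derivative_add has_derivative_inner has_derivative_lift A_has_derivative[OF u]
        dA' dQ' has_derivative_snd has_derivative_ident has_derivative_const)
  then show ?thesis by (simp add: dF_def hess_def base_hess_def add_ac)
qed

lemma linear_dF: "p \<in> D \<Longrightarrow> linear (dF p)"
  using F_has_derivative has_derivative_linear by blast

lemma base_hess_sym:
  assumes "fst p \<in> M" shows "base_hess p v w = base_hess p w v"
  unfolding base_hess_def dA_def dQ_def
  using second_derivative_symmetric[OF openM smA assms, of v w] second_derivative_symmetric[OF openM smQ assms, of v w]
  by simp

lemma hess_sym: "fst p \<in> M \<Longrightarrow> hess p v w = hess p w v"
  using base_hess_sym[of p "fst v" "fst w"] by (simp add: hess_def)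

lemma linear_hess_left: "fst p \<in> M \<Longrightarrow> linear (\<lambda>v. hess p v w)"
  using dF_has_derivative[of p w] has_derivative_linear by (auto simp: mem_Times_iff)

lemma linear_hess_right:
  assumes "fst p \<in> M" shows "linear (hess p v)"
proof -
  have "hess p v = (\<lambda>w. hess p w v)" using hess_sym[OF assms] by blast
  then show ?thesis using linear_hess_left[OF assms, of v] by simp
qed

lemma linear_base_hess_left:
  assumes "fst p \<in> M" shows "linear (\<lambda>v. base_hess p v w)"
proof -
  have "linear (\<lambda>v. hess p (v, 0) (w, 0))"
    using linear_compose[OF _ linear_hess_left[OF assms], of "\<lambda>v. (v, 0)" "(w, 0)"]
    by (simp add: comp_def linear_iff)
  then show ?thesis by (simp add: hess_def)
qed

lemma jac: "u \<in> M \<Longrightarrow> dA u x = jacobian A (at u) *v x"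
  using linear_dA[of u] by (simp add: jacobian_def dA_def[symmetric] matrix_works)

lemma V_eq: "V p = (0, vv (fst p))"
  by (simp add: V_field_def vv_def col_minors_def dA_minor_def)

lemma det_col: "det (col_mat y (jacobian A (at u))) = y \<bullet> vv u"
  unfolding vv_def by (rule det_col_mat[OF dims])

lemma det_A_dA_eq: "det_A_dA A u = A u \<bullet> vv u"
  using det_col[of "A u" u] by (simp add: det_A_dA_def col_mat_def)

lemma of_coords_axis: "of_coords (axis (Inl I) 1) = (axis I 1, 0)" "of_coords (axis (Inr i) 1) = (0, axis i 1)"
  by (auto simp: of_coords_def vec_eq_iff axis_def)

lemma partial_F: "p \<in> D \<Longrightarrow> partial k F p = dF p (of_coords (axis k 1))"
  unfolding partial_def using frechet_derivative_at[OF F_has_derivative] by simp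

lemma partial_partial_F:
  assumes "p \<in> D"
  shows "partial i (partial j F) p = hess p (of_coords (axis i 1)) (of_coords (axis j 1))"
proof -
  have "((\<lambda>q. partial j F q) has_derivative (\<lambda>v. hess p v (of_coords (axis j 1)))) (at p)"
    using has_derivative_transform_within_open[OF dF_has_derivative[OF assms] openD assms] partial_F by auto
  from frechet_derivative_at[OF this, symmetric] show ?thesis unfolding partial_def[of i] by (simp only:)
qed

lemma dA_axis: "u \<in> M \<Longrightarrow> dA u (axis J 1) \<bullet> y = (\<Sum>i\<in>UNIV. jacobian A (at u) $ i $ J * y $ i)"
  by (simp add: jac matrix_vector_mult_basis column_def inner_vec_def)

lemma Hess_F:
  assumes "p \<in> D"
  shows "Hess F p = block_mat (\<chi> I J. base_hess p (axis I 1) (axis J 1))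
    (transpose (jacobian A (at (fst p)))) (jacobian A (at (fst p))) 0"
proof -
  have u: "fst p \<in> M" using assms by auto
  have 0: "base_hess p 0 w = 0" "base_hess p w 0 = 0" for w
    using linear_0[OF linear_base_hess_left[OF u]] base_hess_sym[OF u, of w 0] by simp_all
  have "dA (fst p) (axis J 1) \<bullet> axis i 1 = jacobian A (at (fst p)) $ i $ J" for i J
    unfolding dA_axis[OF u] by (simp add: axis_def if_distrib[of "(*) _"] cong: if_cong)
  then show ?thesis
    by (intro sum_type_matrix_eqI)
      (simp_all add: Hess_def partial_partial_F[OF assms] of_coords_axis hess_def 0 linear_0[OF linear_dA[OF u]] transpose_def)
qed

lemma linear_coords: "linear (coords :: ('n, 'm) phase \<Rightarrow> _)"
  by (rule linearI) (auto simp: coords_def vec_eq_iff split: sum.split)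

lemma coords_of_coords: "coords (of_coords w) = (w :: real ^ ('n + 'm))"
  by (auto simp: coords_def of_coords_def vec_eq_iff split: sum.split)

lemma of_coords_coords: "of_coords (coords z) = (z :: ('n, 'm) phase)"
  by (auto simp: coords_def of_coords_def prod_eq_iff vec_eq_iff)

lemma phase_expansion: "(z :: ('n, 'm) phase) = (\<Sum>k\<in>UNIV. coords z $ k *\<^sub>R of_coords (axis k 1))"
proof -
  have "coords z $ Inl I *\<^sub>R (axis I 1, 0) = (z1 $ I *\<^sub>R axis I 1, 0)" if "z1 = fst z" for I and z1
    using that by (simp add: coords_def)
  have "fst z = (\<Sum>I\<in>UNIV. fst z $ I *\<^sub>R axis I 1)" "snd z = (\<Sum>i\<in>UNIV. snd z $ i *\<^sub>R axis i 1)"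
    by (simp_all add: vec_eq_iff axis_def if_distrib[of "(*) _"] cong: if_cong)
  then show ?thesis
    by (simp add: sum_UNIV_sum of_coords_axis prod_eq_iff fst_sum snd_sum coords_def)
qed

lemma Hess_bilinear:
  assumes "p \<in> D" shows "coords v \<bullet> (Hess F p *v coords w) = hess p v w"
proof -
  have u: "fst p \<in> M" using assms by auto
  have "hess p v w = hess p (\<Sum>k\<in>UNIV. coords v $ k *\<^sub>R of_coords (axis k 1)) (\<Sum>k\<in>UNIV. coords w $ k *\<^sub>R of_coords (axis k 1))"
    using phase_expansion by simp
  also have "\<dots> = (\<Sum>k\<in>UNIV. \<Sum>l\<in>UNIV. coords v $ k * (coords w $ l * Hess F p $ k $ l))"
    by (simp add: linear_sum[OF linear_hess_left[OF u]] linear_cmul[OF linear_hess_left[OF u]]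
        linear_sum[OF linear_hess_right[OF u]] linear_cmul[OF linear_hess_right[OF u]]
        Hess_def partial_partial_F[OF assms] sum_distrib_left) (subst sum.swap, simp add: mult_ac)
  finally show ?thesis
    by (simp add: inner_vec_def matrix_vector_mult_def sum_distrib_left mult_ac)
qed

lemma Hess_radical_eq: "p \<in> D \<Longrightarrow> Hess_radical F p = {v. \<forall>w. hess p v w = 0}"
  by (simp add: Hess_radical_def Hess_bilinear)

lemma col_mat_mult:
  "col_mat y C *v w = (w $ (ith 1)) *\<^sub>R y + C *v (\<chi> J. w $ ith (Suc (pos J)))"
  for C :: "('n rvec, 'm) vec"
proof -
  have "(\<Sum>k\<in>UNIV. (if pos k = 1 then y $ i else C $ i $ ith (pos k - 1)) * w $ k) =
      w $ ith 1 * y $ i + (\<Sum>J\<in>UNIV. C $ i $ J * w $ ith (Suc (pos J)))" for i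
  proof -
    let ?f = "\<lambda>k. (if pos k = 1 then y $ i else C $ i $ ith (pos k - 1)) * w $ k"
    have "sum ?f UNIV = (\<Sum>k<Suc CARD('n). ?f (enum ! k))" by (simp only: sum_enum dims Suc_eq_plus1)
    also have "\<dots> = ?f (enum ! 0) + (\<Sum>k<CARD('n). ?f (enum ! Suc k))" by (rule sum.lessThan_Suc_shift)
    also have "?f (enum ! 0) = w $ ith 1 * y $ i" using dims by (simp add: pos_enum ith_enum)
    also have "(\<Sum>k<CARD('n). ?f (enum ! Suc k)) = (\<Sum>k<CARD('n). C $ i $ (enum ! k) * w $ ith (Suc (pos (enum ! k :: 'n))))"
    proof (intro sum.cong refl)
      fix k assume "k \<in> {..<CARD('n)}"
      then have "pos (enum ! Suc k :: 'm) = Suc (Suc k)" "pos (enum ! k :: 'n) = Suc k"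
        using dims by (simp_all add: pos_enum)
      then show "?f (enum ! Suc k) = C $ i $ (enum ! k) * w $ ith (Suc (pos (enum ! k :: 'n)))"
        by (simp add: ith_enum)
    qed
    also have "\<dots> = (\<Sum>J\<in>UNIV. C $ i $ J * w $ ith (Suc (pos J)))" by (rule sum_enum[symmetric])
    finally show ?thesis .
  qed
  then show ?thesis by (simp add: vec_eq_iff matrix_vector_mult_def col_mat_def)
qed

text \<open>Pairing y with V gives det [y|dA], so it is nonzero iff these columns are independent.
  The immersion and the centroaffine condition are both read off from this.\<close>

lemma det_col_nonzero_iff:
  assumes u: "u \<in> M"
  shows "y \<bullet> vv u \<noteq> 0 \<longleftrightarrow> inj (dA u) \<and> y \<notin> range (dA u)"
proof -
  let ?C = "jacobian A (at u)"
  let ?K = "col_mat y ?C"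
  \<comment> \<open>The vector with first entry a and remaining entries z; [y|dA] maps it to a y +
    dA z.\<close>
  let ?w = "\<lambda>a z. (\<chi> k. if pos k = 1 then a else z $ ith (pos k - 1)) :: 'm rvec"
  have Kw: "?K *v ?w a z = a *\<^sub>R y + dA u z" for a z
  proof -
    have 1: "pos (ith 1 :: 'm) = 1" using pos_ith[of 0, where 'k='m] dims by simp
    have "pos (ith (Suc (pos J)) :: 'm) = Suc (pos J)" for J :: 'n
      using pos_bounds(2)[of J] dims by (intro pos_ith) simp
    then have "?w a z $ ith (Suc (pos J)) = z $ J" for J :: 'n
      using pos_bounds(1)[of J] by (simp add: ith_pos)
    then show ?thesis using 1 by (simp add: col_mat_mult jac[OF u])
  qed
  have w0: "?w a z = 0 \<longleftrightarrow> a = 0 \<and> z = 0" for a and z :: "'n rvec"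
  proof
    assume w: "?w a z = 0"
    have "?w a z $ ith 1 = a" using pos_ith[of 0, where 'k='m] dims by simp
    moreover have "?w a z $ ith (Suc (pos J)) = z $ J" for J :: 'n
    proof -
      have "pos (ith (Suc (pos J)) :: 'm) = Suc (pos J)"
        using pos_bounds(2)[of J] dims by (intro pos_ith) simp
      then show ?thesis using pos_bounds(1)[of J] by (simp add: ith_pos)
    qed
    ultimately show "a = 0 \<and> z = 0" using w by (metis vec_eq_iff zero_index)
  qed (simp add: vec_eq_iff)
  have iff: "det ?K = 0 \<longleftrightarrow> (\<exists>a z. (a, z) \<noteq> (0, 0) \<and> a *\<^sub>R y + dA u z = 0)"
  proof
    assume "det ?K = 0"
    then obtain w where w: "?K *v w = 0" "w \<noteq> 0"
      by (metis invertible_det_nz invertible_left_inverse matrix_left_invertible_ker)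
    let ?z = "\<chi> J :: 'n. w $ ith (Suc (pos J))"
    have eq: "?w (w $ ith 1) ?z = w"
    proof -
      have "(if pos k = 1 then w $ ith 1 else ?z $ ith (pos k - 1)) = w $ k" for k
      proof (cases "pos k = 1")
        case True
        then show ?thesis using ith_pos[of k] by simp
      next
        case False
        then obtain J :: 'n where J: "pos k = Suc (pos J)" using pos_pred_unique[OF dims, of k] by blast
        have "ith (pos k - 1) = J" "ith (Suc (pos J)) = k"
          using ith_pos[of k] by (simp_all add: J ith_pos)
        then have "?z $ ith (pos k - 1) = w $ k" by (simp only: vec_lambda_beta)
        then show ?thesis using False by (simp only: if_False)
      qed
      then show ?thesis unfolding vec_eq_iff vec_lambda_beta by blast
    qed
    have "(w $ ith 1) *\<^sub>R y + dA u ?z = 0" using Kw[of "w $ ith 1" ?z] w(1) by (simp only: eq)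
    moreover have "\<not> (w $ ith 1 = 0 \<and> ?z = 0)" using w0[of "w $ ith 1" ?z] w(2) unfolding eq by blast
    ultimately show "\<exists>a z. (a, z) \<noteq> (0, 0) \<and> a *\<^sub>R y + dA u z = 0" by blast
  next
    assume "\<exists>a z. (a, z) \<noteq> (0, 0) \<and> a *\<^sub>R y + dA u z = 0"
    then obtain a z where az: "(a, z) \<noteq> (0, 0)" "a *\<^sub>R y + dA u z = 0" by blast
    have "?K *v ?w a z = 0" using Kw[of a z] az(2) by (simp only:)
    moreover have "?w a z \<noteq> 0" using w0[of a z] az(1) unfolding prod.inject by blast
    ultimately show "det ?K = 0" by (rule det_zero_kernel)
  qed
  interpret L: linear "dA u" by (rule linear_dA[OF u])
  have "(\<exists>a z. (a, z) \<noteq> (0, 0) \<and> a *\<^sub>R y + dA u z = 0) \<longleftrightarrow> \<not> (inj (dA u) \<and> y \<notin> range (dA u))"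
  proof
    assume "\<exists>a z. (a, z) \<noteq> (0, 0) \<and> a *\<^sub>R y + dA u z = 0"
    then obtain a z where az: "(a, z) \<noteq> (0, 0)" "a *\<^sub>R y + dA u z = 0" by blast
    show "\<not> (inj (dA u) \<and> y \<notin> range (dA u))"
    proof (cases "a = 0")
      case True
      then have "z \<noteq> 0" "dA u z = dA u 0" using az by (auto simp: L.zero)
      then show ?thesis by (auto simp: inj_def)
    next
      case False
      have "dA u (- (1 / a) *\<^sub>R z) = - (1 / a) *\<^sub>R dA u z" by (rule L.scaleR)
      also have "dA u z = - a *\<^sub>R y" using az(2) by (simp add: add_eq_0_iff2)
      finally have "y = dA u (- (1 / a) *\<^sub>R z)" using False by simp
      then show ?thesis by blast
    qed
  next
    assume "\<not> (inj (dA u) \<and> y \<notin> range (dA u))"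
    then consider "\<not> inj (dA u)" | z where "y = dA u z" by blast
    then show "\<exists>a z. (a, z) \<noteq> (0, 0) \<and> a *\<^sub>R y + dA u z = 0"
    proof cases
      case 1
      then obtain z where "dA u z = 0" "z \<noteq> 0" using linear_injective_0[OF linear_dA[OF u]] by blast
      then show ?thesis by (intro exI[of _ 0] exI[of _ z]) simp
    next
      case 2
      then show ?thesis by (intro exI[of _ 1] exI[of _ "- z"]) (simp add: L.neg)
    qed
  qed
  then show ?thesis using iff by (simp add: det_col)
qed

lemma dA_vv: "u \<in> M \<Longrightarrow> dA u z \<bullet> vv u = 0"
  using det_col_nonzero_iff[of u "dA u z"] by blast

text \<open>The range of dA is proper for reasons of dimension: a y outside it pairs nontrivially
  with V if dA is injective. Conversely V pairs nontrivially with itself.\<close>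

lemma inj_iff_vv:
  assumes u: "u \<in> M" shows "inj (dA u) \<longleftrightarrow> vv u \<noteq> 0"
proof
  assume inj: "inj (dA u)"
  have "dim (range (dA u)) \<le> CARD('n)"
    using dim_image_le[OF linear_dA[OF u], of UNIV] by simp
  then have "range (dA u) \<noteq> UNIV" using dims by (metis Suc_eq_plus1 dim_UNIV DIM_cart DIM_real mult.right_neutral not_less_eq_eq order_refl)
  then obtain y where "y \<notin> range (dA u)" by blast
  then show "vv u \<noteq> 0" using det_col_nonzero_iff[OF u, of y] inj by auto
next
  assume "vv u \<noteq> 0"
  then show "inj (dA u)" using det_col_nonzero_iff[OF u, of "vv u"] by simp
qed

lemma immersion_iff: "immersion_on M A \<longleftrightarrow> (\<forall>u\<in>M. vv u \<noteq> 0)"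
  using smA inj_iff_vv by (auto simp: immersion_on_def dA_def)

lemma centroaffine_iff: "centroaffine_immersion M A \<longleftrightarrow> (\<forall>u\<in>M. det_A_dA A u \<noteq> 0)"
proof -
  have "A u \<noteq> 0 \<and> A u \<notin> range (dA u) \<longleftrightarrow> A u \<notin> range (dA u)" if "u \<in> M" for u
    using linear_0[OF linear_dA[OF that]] by (metis rangeI)
  then show ?thesis
    using smA det_col_nonzero_iff[of _ "A _"]
    by (auto simp: centroaffine_immersion_def immersion_on_def det_A_dA_eq dA_def[symmetric])
qed

lemma hess_V: "p \<in> D \<Longrightarrow> hess p (V p) w = 0"
  using dA_vv[of "fst p" "fst w"] linear_0[OF linear_base_hess_left[of p]] linear_0[OF linear_dA]
  by (auto simp: hess_def V_eq)

text \<open>The component y of x orthogonal to V is orthogonal to the range as well. As det [V|dA] =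
  |V|^2 is nonzero, y is a combination of these columns and hence orthogonal to itself.\<close>

lemma orthogonal_range:
  assumes u: "u \<in> M" and nz: "vv u \<noteq> 0" and x: "\<And>z. dA u z \<bullet> x = 0"
  shows "x = (x \<bullet> vv u / (vv u \<bullet> vv u)) *\<^sub>R vv u"
proof -
  define y where "y = x - (x \<bullet> vv u / (vv u \<bullet> vv u)) *\<^sub>R vv u"
  have y1: "y \<bullet> vv u = 0" using nz by (simp add: y_def inner_diff_left)
  have y2: "dA u z \<bullet> y = 0" for z using x dA_vv[OF u, of z] by (simp add: y_def inner_diff_right)
  have "invertible (col_mat (vv u) (jacobian A (at u)))"
    using nz det_col[of "vv u" u] by (simp add: invertible_det_nz)
  then obtain w where "col_mat (vv u) (jacobian A (at u)) *v w = y"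
    by (metis matrix_vector_mul_assoc matrix_vector_mul_lid invertible_def)
  then have "y = w $ ith 1 *\<^sub>R vv u + dA u (\<chi> J. w $ ith (Suc (pos J)))"
    by (simp add: col_mat_mult jac[OF u])
  then have "y \<bullet> y = y \<bullet> (w $ ith 1 *\<^sub>R vv u + dA u (\<chi> J. w $ ith (Suc (pos J))))" by simp
  then have "y \<bullet> y = 0" using y1 y2 by (simp add: inner_add_right inner_commute)
  then show ?thesis by (simp add: y_def)
qed

text \<open>Testing with (0, y) shows that dA kills the u-part of v, which therefore vanishes;
  testing with (z, 0) then shows that the x-part is orthogonal to the range of dA.\<close>

lemma hess_kernel:
  assumes p: "p \<in> D" and nz: "vv (fst p) \<noteq> 0" and ker: "\<And>w. hess p v w = 0"
  shows "v \<in> span {V p}"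
proof -
  have u: "fst p \<in> M" using p by auto
  have "dA (fst p) (fst v) \<bullet> y = 0" for y
    using ker[of "(0, y)"] linear_0[OF linear_base_hess_left[OF u]] base_hess_sym[OF u]
    by (simp add: hess_def linear_0[OF linear_dA[OF u]])
  then have "dA (fst p) (fst v) = dA (fst p) 0" using linear_0[OF linear_dA[OF u]] by (metis inner_eq_zero_iff)
  then have v0: "fst v = 0" using inj_iff_vv[OF u] nz by (auto dest: injD)
  then have "dA (fst p) z \<bullet> snd v = 0" for z
    using ker[of "(z, 0)"] linear_0[OF linear_base_hess_left[OF u]] by (simp add: hess_def)
  from orthogonal_range[OF u nz this]
  have "v = (snd v \<bullet> vv (fst p) / (vv (fst p) \<bullet> vv (fst p))) *\<^sub>R V p"
    using v0 by (simp add: V_eq prod_eq_iff)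
  then show ?thesis by (metis span_mul span_base singletonI)
qed

lemma radical_span:
  assumes "p \<in> D" "vv (fst p) \<noteq> 0" shows "Hess_radical F p = span {V p}"
proof
  show "Hess_radical F p \<subseteq> span {V p}"
    using hess_kernel[OF assms] by (auto simp: Hess_radical_eq[OF assms(1)])
  have "fst p \<in> M" using assms by auto
  then have "hess p (c *\<^sub>R V p) w = 0" for c w
    using hess_V[OF assms(1)] linear_cmul[OF linear_hess_left] by simp
  then show "span {V p} \<subseteq> Hess_radical F p"
    by (auto simp: Hess_radical_eq[OF assms(1)] span_singleton)
qed

lemma adjugate_Hess:
  assumes p: "p \<in> D" shows "adjugate (Hess F p) = (-1) ^ CARD('n) *\<^sub>R tensor_square (V p)"
proof -
  have "block_mat 0 0 0 (\<chi> i j. vv (fst p) $ i * vv (fst p) $ j) = tensor_square (V p)"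
    by (rule sum_type_matrix_eqI) (simp_all add: tensor_square_def V_eq coords_def)
  then show ?thesis
    unfolding Hess_F[OF p] adjugate_block_mat[OF dims] vv_def by simp
qed

lemma sum_coords_partial:
  assumes p: "p \<in> D" shows "(\<Sum>j\<in>UNIV. coords v $ j * partial j F p) = dF p v"
proof -
  have "dF p v = dF p (\<Sum>k\<in>UNIV. coords v $ k *\<^sub>R of_coords (axis k 1))" using phase_expansion by simp
  then show ?thesis
    by (simp add: linear_sum[OF linear_dF[OF p]] linear_cmul[OF linear_dF[OF p]] partial_F[OF p])
qed

lemma dF_V: "p \<in> D \<Longrightarrow> dF p (V p) = det_A_dA A (fst p)"
  using linear_0[OF linear_dA] linear_0[OF linear_dQ] by (auto simp: dF_def V_eq det_A_dA_eq)

lemma N_field_eq: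
  assumes p: "p \<in> D" shows "N_field F p = ((-1) ^ CARD('n) * det_A_dA A (fst p)) *\<^sub>R V p"
proof -
  have "(\<Sum>j\<in>UNIV. adjugate (Hess F p) $ i $ j * partial j F p) =
      (-1) ^ CARD('n) * coords (V p) $ i * (\<Sum>j\<in>UNIV. coords (V p) $ j * partial j F p)" for i
    by (simp add: adjugate_Hess[OF p] tensor_square_def sum_distrib_left mult_ac)
  then have "N_field F p = of_coords (((-1) ^ CARD('n) * det_A_dA A (fst p)) *\<^sub>R coords (V p))"
    unfolding N_field_def by (intro arg_cong[of _ _ of_coords]) (simp add: vec_eq_iff sum_coords_partial[OF p] dF_V[OF p])
  then show ?thesis by (simp add: of_coords_coords flip: linear_cmul[OF linear_coords])
qed

lemma U_fun_eq:
  assumes p: "p \<in> D" shows "U_fun F p = (-1) ^ CARD('n) * (det_A_dA A (fst p))\<^sup>2"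
proof -
  have "U_fun F p = (-1) ^ CARD('n) * ((\<Sum>i\<in>UNIV. coords (V p) $ i * partial i F p) *
      (\<Sum>j\<in>UNIV. coords (V p) $ j * partial j F p))"
    by (simp add: U_fun_def adjugate_Hess[OF p] tensor_square_def sum_distrib_left sum_distrib_right mult_ac)
  then show ?thesis by (simp add: sum_coords_partial[OF p] dF_V[OF p] power2_eq_square)
qed

lemma centroaffine_U: "centroaffine_immersion M A \<longleftrightarrow> (\<forall>p\<in>D. U_fun F p \<noteq> 0)"
  by (auto simp: centroaffine_iff U_fun_eq)

text \<open>The orthogonal complement of the range is the radical, so rank and dimension of the
  radical add up to 2n + 1. If V is nonzero, it spans the radical. If V = 0, then dA has a kernel,
  and the vectors (0, y) with y orthogonal to its range form a subspace of dimension at least 2 in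
  the radical.\<close>

lemma rank_Hess:
  assumes p: "p \<in> D" shows "rank (Hess F p) = 2 * CARD('n) \<longleftrightarrow> vv (fst p) \<noteq> 0"
proof -
  let ?H = "Hess F p"
  let ?R = "{y. \<forall>x\<in>range ((*v) ?H). orthogonal x y}"
  have u: "fst p \<in> M" using p by auto
  have "dim ?R + dim (range ((*v) ?H)) = DIM(real ^ ('n + 'm))"
    using dim_subspace_orthogonal_to_vectors[of "range ((*v) ?H)" UNIV]
    by (simp add: linear_subspace_image matrix_vector_mul_linear)
  then have sum: "dim ?R + rank ?H = 2 * CARD('n) + 1" by (simp add: rank_dim_range dims)
  have R: "?R = coords ` {v. \<forall>w. hess p v w = 0}"
  proof -
    have iff: "coords v \<in> ?R \<longleftrightarrow> (\<forall>w. hess p v w = 0)" for v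
    proof -
      have "coords v \<in> ?R \<longleftrightarrow> (\<forall>x. (?H *v x) \<bullet> coords v = 0)" by (simp add: orthogonal_def)
      also have "\<dots> \<longleftrightarrow> (\<forall>w. (?H *v coords w) \<bullet> coords v = 0)" by (metis coords_of_coords)
      finally show ?thesis by (simp add: inner_commute[of _ "coords v"] Hess_bilinear[OF p])
    qed
    show ?thesis
    proof (intro equalityI subsetI)
      fix y assume "y \<in> ?R"
      then have "of_coords y \<in> {v. \<forall>w. hess p v w = 0}"
        using iff[of "of_coords y"] unfolding coords_of_coords by blast
      then show "y \<in> coords ` {v. \<forall>w. hess p v w = 0}"
        by (rule image_eqI[rotated]) (simp only: coords_of_coords)
    next
      fix y assume "y \<in> coords ` {v. \<forall>w. hess p v w = 0}"
      then show "y \<in> ?R" using iff by blast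
    qed
  qed
  show ?thesis
  proof
    assume nz: "vv (fst p) \<noteq> 0"
    have "?R = coords ` span {V p}" using radical_span[OF p nz] R by (simp add: Hess_radical_eq[OF p])
    also have "\<dots> = span {coords (V p)}" using linear_span_image[OF linear_coords, of "{V p}"] by simp
    finally have "dim ?R = dim {coords (V p)}" by simp
    moreover have "coords (V p) \<noteq> 0"
    proof
      assume "coords (V p) = 0"
      then have "V p = of_coords 0" by (metis of_coords_coords)
      then show False using nz by (auto simp: V_eq of_coords_def vec_eq_iff)
    qed
    ultimately show "rank ?H = 2 * CARD('n)" using sum by simp
  next
    assume r: "rank ?H = 2 * CARD('n)"
    show "vv (fst p) \<noteq> 0"
    proof
      assume "vv (fst p) = 0"
      then have ninj: "\<not> inj (dA (fst p))" using inj_iff_vv[OF u] by simp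
      let ?O = "{y. \<forall>x\<in>range (dA (fst p)). orthogonal x y}"
      have "dim ?O + dim (range (dA (fst p))) = CARD('m)"
        using dim_subspace_orthogonal_to_vectors[of "range (dA (fst p))" UNIV]
        by (simp add: linear_subspace_image linear_dA[OF u])
      moreover have "dim (range (dA (fst p))) < CARD('n)"
      proof -
        have "dA (fst p) = (*v) (jacobian A (at (fst p)))" using jac[OF u] by blast
        then show ?thesis using ninj by (simp add: less_rank_noninjective flip: rank_dim_range)
      qed
      ultimately have O2: "2 \<le> dim ?O" using dims by linarith
      let ?f = "\<lambda>y. coords (0 :: 'n rvec, y :: 'm rvec)"
      have lin: "linear ?f" by (rule linearI) (auto simp: coords_def vec_eq_iff split: sum.split)
      have inj: "inj ?f"
      proof (rule injI)
        fix x y assume "?f x = ?f y"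
        then have "(0 :: 'n rvec, x) = (0, y)" by (metis of_coords_coords)
        then show "x = y" by simp
      qed
      have "?f ` ?O \<subseteq> ?R"
        unfolding R by (auto simp: hess_def linear_0[OF linear_dA[OF u]] linear_0[OF linear_base_hess_left[OF u]] orthogonal_def)
      then have "dim (?f ` ?O) \<le> dim ?R" by (rule dim_subset)
      moreover have "dim (?f ` ?O) = dim ?O" by (rule dim_image_eq[OF lin]) (use inj in \<open>auto simp: inj_on_def\<close>)
      ultimately show False using sum r O2 by linarith
    qed
  qed
qed

end

section \<open>The volume form on the product, and dual frames\<close>

lemma alt_form_Upsilon:
  "alt_form (CARD('n) + CARD('m))
     (Upsilon :: (nat \<Rightarrow> ('n::{finite,linorder}, 'm::{finite,linorder}) phase) \<Rightarrow> real)"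
  unfolding Upsilon_def
  by (rule alt_form_wedge[OF alt_form_linear_image[OF alt_form_det_form linear_fst]
        alt_form_linear_image[OF alt_form_det_form linear_snd]])

lemma Upsilon_split:
  fixes v :: "nat \<Rightarrow> ('n::{finite,linorder}, 'm::{finite,linorder}) phase"
  assumes "\<And>j. CARD('n) \<le> j \<Longrightarrow> j < CARD('n) + CARD('m) \<Longrightarrow> fst (v j) = 0"
  shows "Upsilon v = det_form (\<lambda>i. fst (v i)) * det_form (\<lambda>i. snd (v (CARD('n) + i)))"
  unfolding Upsilon_def
proof (rule wedge_split[OF alt_form_linear_image[OF alt_form_det_form linear_fst]
        alt_form_linear_image[OF alt_form_det_form linear_snd]])
  fix w :: "nat \<Rightarrow> ('n, 'm) phase" and i j
  assume "i < CARD('n)" "CARD('n) \<le> j" "j < CARD('n) + CARD('m)" "w i = v j"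
  then show "det_form (\<lambda>i. fst (w i)) = 0"
    using assms by (intro alt_form_zero_arg[OF alt_form_det_form, of i]) auto
qed

lemma det_form_col_mat:
  fixes C :: "('n::{finite,linorder} rvec, 'm::{finite,linorder}) vec"
  shows "det_form (case_nat y (\<lambda>k. column (enum ! k :: 'n) C)) = det (col_mat y C)"
proof -
  let ?c = "\<lambda>k. column (enum ! k :: 'n) C"
  have "case_nat y ?c (pos k - 1) $ i = col_mat y C $ i $ k" for i k :: 'm
  proof (cases "pos k")
    case 0
    then show ?thesis using pos_bounds(1)[of k] by simp
  next
    case (Suc l)
    then show ?thesis by (cases l) (simp_all add: col_mat_def column_def ith_enum)
  qed
  then show ?thesis by (simp add: det_form_def)
qed

lemma det_nat_scale: "det_nat k (\<lambda>i j. c * B i j) = c ^ k * det_nat k B"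
  by (simp add: det_nat_def prod.distrib sum_distrib_left mult_ac)

context affine_family
begin

lemma A_vv: "A u \<bullet> vv u = det_A_dA A u"
  by (simp add: det_A_dA_eq)

text \<open>The vectors y_J are columns of the inverse transpose of [A|dA], the one dual to A being
  left out and replaced by V. The product of the transpose of [A|dA] with [V|y] is diagonal with
  entries K, 1, ..., 1, so comparing determinants gives det [V|y] = 1.\<close>

lemma dual_frame:
  assumes u: "u \<in> M" and nz: "det_A_dA A u \<noteq> 0"
  obtains y where "\<And>J. A u \<bullet> y J = 0" "\<And>I J. dA u (axis I 1) \<bullet> y J = (if I = J then 1 else 0)"
    "det_form (case_nat (vv u) (\<lambda>k. y (enum ! k))) = 1"
proof -
  let ?C = "jacobian A (at u)"
  let ?K = "col_mat (A u) ?C"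
  have dK: "det ?K = det_A_dA A u" using det_col[of "A u" u] by (simp add: A_vv)
  then have inv: "invertible (transpose ?K)" using nz by (simp add: invertible_det_nz det_transpose)
  have "\<exists>z. transpose ?K *v z = w" for w
    using inv by (metis matrix_vector_mul_assoc matrix_vector_mul_lid invertible_def)
  then obtain z where z: "\<And>w. transpose ?K *v z w = w" by metis
  have zK: "(\<Sum>i\<in>UNIV. ?K $ i $ l * z w $ i) = w $ l" for w l
    using z[of w] by (simp add: vec_eq_iff matrix_vector_mult_def transpose_def)
  define y where "y J = z (axis (ith (Suc (pos (J :: 'n)))) 1)" for J
  have p1: "pos (ith 1 :: 'm) = 1" using pos_ith[of 0, where 'k='m] dims by simp
  have pS: "pos (ith (Suc (pos J)) :: 'm) = Suc (pos J)" for J :: 'n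
    using pos_bounds(2)[of J] dims by (intro pos_ith) simp
  have Ay: "A u \<bullet> y J = 0" for J
  proof -
    have "A u \<bullet> y J = (\<Sum>i\<in>UNIV. ?K $ i $ ith 1 * y J $ i)" using p1 by (simp add: inner_vec_def col_mat_def)
    also have "\<dots> = (axis (ith (Suc (pos J))) 1 :: 'm rvec) $ ith 1" unfolding y_def by (rule zK)
    also have "\<dots> = (0::real)" using p1 pS[of J] pos_bounds(1)[of J] by (auto simp: axis_def)
    finally show ?thesis .
  qed
  have Cy: "dA u (axis I 1) \<bullet> y J = (if I = J then 1 else 0)" for I J
  proof -
    have "dA u (axis I 1) \<bullet> y J = (\<Sum>i\<in>UNIV. ?K $ i $ ith (Suc (pos I)) * y J $ i)"
      using pS[of I] pos_bounds(1)[of I] by (simp add: dA_axis[OF u] col_mat_def ith_pos)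
    also have "\<dots> = (axis (ith (Suc (pos J))) 1 :: 'm rvec) $ ith (Suc (pos I))" unfolding y_def by (rule zK)
    also have "\<dots> = (if I = J then 1 else 0)"
    proof -
      have "(ith (Suc (pos I)) :: 'm) = ith (Suc (pos J)) \<longleftrightarrow> I = J"
        using pS[of I] pS[of J] by (metis Suc_inject pos_inject)
      then show ?thesis by (simp add: axis_def)
    qed
    finally show ?thesis .
  qed
  let ?Y = "(\<chi> i J. y J $ i) :: ('n rvec, 'm) vec"
  let ?L = "col_mat (vv u) ?Y"
  have "transpose ?K ** ?L = (\<chi> k l. if k = l then (if pos k = 1 then det_A_dA A u else 1) else 0)"
  proof -
    have "(\<Sum>i\<in>UNIV. ?K $ i $ k * ?L $ i $ l) = (if k = l then (if pos k = 1 then det_A_dA A u else 1) else 0)" for k l :: 'm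
    proof -
      have kl: "k = l \<longleftrightarrow> pos k = pos l" by (simp add: pos_inject)
      have ex: "\<exists>J :: 'n. pos k = Suc (pos J)" if "pos k \<noteq> 1" for k :: 'm using pos_pred_unique[OF dims that] by blast
      consider "pos k = 1" "pos l = 1" | J where "pos k = 1" "pos l = Suc (pos (J :: 'n))"
        | I where "pos k = Suc (pos (I :: 'n))" "pos l = 1" | I J where "pos k = Suc (pos (I :: 'n))" "pos l = Suc (pos (J :: 'n))"
        using ex by metis
      then show ?thesis
      proof cases
        case 1
        then show ?thesis using kl A_vv[of u] by (simp add: col_mat_def inner_vec_def)
      next
        case (2 J)
        then show ?thesis using kl Ay[of J] pos_bounds(1)[of J] by (simp add: col_mat_def ith_pos inner_vec_def)
      next
        case (3 I)
        then show ?thesis using kl dA_vv[OF u, of "axis I 1"] pos_bounds(1)[of I]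
          by (simp add: col_mat_def ith_pos dA_axis[OF u])
      next
        case (4 I J)
        then show ?thesis using kl Cy[of I J] pos_bounds(1)[of I] pos_bounds(1)[of J]
          by (simp add: col_mat_def ith_pos dA_axis[OF u] pos_inject)
      qed
    qed
    then show ?thesis by (simp add: vec_eq_iff matrix_matrix_mult_def transpose_def)
  qed
  then have "det (transpose ?K ** ?L) = (\<Prod>k\<in>UNIV. if pos (k :: 'm) = 1 then det_A_dA A u else 1)"
    by (simp add: det_diagonal)
  also have "\<dots> = det_A_dA A u"
  proof -
    have "pos k = 1 \<longleftrightarrow> k = (ith 1 :: 'm)" for k :: 'm using p1 by (metis pos_inject)
    then show ?thesis by simp
  qed
  finally have "det_A_dA A u * det ?L = det_A_dA A u" by (simp add: det_mul det_transpose dK)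
  then have "det ?L = 1" using nz by simp
  moreover have "column J ?Y = y J" for J by (simp add: column_def vec_eq_iff)
  ultimately have "det_form (case_nat (vv u) (\<lambda>k. y (enum ! k))) = 1"
    using det_form_col_mat[of "vv u" ?Y] by simp
  with Ay Cy show ?thesis by (rule that)
qed

end

section \<open>Level sets of a centroaffine family\<close>

locale centroaffine_family = affine_family M A Q
  for M :: "'n::{finite,linorder} rvec set" and A :: "'n rvec \<Rightarrow> 'm::{finite,linorder} rvec" and Q +
  assumes nonzero: "\<And>u. u \<in> M \<Longrightarrow> det_A_dA A u \<noteq> 0"
begin

abbreviation (input) "K \<equiv> det_A_dA A"

lemma A_nonzero: "u \<in> M \<Longrightarrow> A u \<noteq> 0"
  using nonzero[of u] A_vv[of u] by auto

lemma vv_nonzero: "u \<in> M \<Longrightarrow> vv u \<noteq> 0"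
  using nonzero[of u] A_vv[of u] by auto

lemma smooth_jacobian: "smooth_on M (\<lambda>u. jacobian A (at u) $ i $ J)"
  using smooth_on_nth[OF openM smooth_dA, of "axis J 1" i]
  by (simp add: jacobian_def matrix_def dA_def)

lemma smooth_vv: "smooth_on M vv"
  unfolding vv_def[abs_def] col_minors_def det_def
  by (intro smooth_on_vec_lambda smooth_on_mult smooth_on_sum smooth_on_prod smooth_on_const openM)
    (simp add: smooth_jacobian)

lemma smooth_K: "smooth_on M K"
  using smooth_on_inner[OF openM smA smooth_vv] by (simp add: A_vv)

lemma smooth_V: "smooth_on D V"
  using smooth_on_Pair[OF openD smooth_on_const[OF openD] smooth_lift[OF smooth_vv]]
  by (simp add: V_eq[abs_def])

lemma level_subset: "level_set M F t \<subseteq> D"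
  by (auto simp: level_set_def)

text \<open>For the harder inclusion the line p + s v is pushed back into the level set along A(u):
  F is affine in x with slope A, so subtracting q A with q = (F(p + s v) - t) / |A|^2 restores the
  value t exactly. If dF(v) = 0, this correction vanishes to first order and the velocity remains
  v.\<close>

lemma tangent_level:
  assumes p: "p \<in> level_set M F t"
  shows "tangent_space (level_set M F t) p = {v. dF p v = 0}"
proof (intro equalityI subsetI)
  have pD: "p \<in> D" using p level_subset by blast
  fix v assume v: "v \<in> tangent_space (level_set M F t) p"
  from flat_deriv_eq[OF v has_derivative_at_withinI[OF F_has_derivative[OF pD]]]
  have "flat_deriv (level_set M F t) F p v = dF p v" .
  moreover have "flat_deriv (level_set M F t) F p v = 0"
    by (rule flat_deriv_eq_on[OF p v, where Z = "\<lambda>q. t" and Z' = "\<lambda>h. 0"]) (auto simp: level_set_def)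
  ultimately show "v \<in> {v. dF p v = 0}" by simp
next
  have pD: "p \<in> D" and Fp: "F p = t" using p by (auto simp: level_set_def)
  then have u: "fst p \<in> M" by auto
  fix v assume "v \<in> {v. dF p v = 0}"
  then have v: "dF p v = 0" by simp
  define l where "l s = fst p + s *\<^sub>R fst v" for s :: real
  obtain r where r: "r > 0" "ball (fst p) r \<subseteq> M" using openM u openE by blast
  \<comment> \<open>Keeps the u-part of the line inside M; the summand 1 covers the case of a
    vanishing u-part.\<close>
  define e where "e = r / (norm (fst v) + 1)"
  have e: "e > 0" using r by (simp add: e_def add_nonneg_pos)
  let ?I = "{-e<..<e}"
  have lM: "l s \<in> M" if "s \<in> ?I" for s
  proof -
    have "norm (s *\<^sub>R fst v) \<le> \<bar>s\<bar> * (norm (fst v) + 1)" by (simp add: algebra_simps)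
    also have "\<dots> < e * (norm (fst v) + 1)"
      using that by (intro mult_strict_right_mono) (auto simp: add_nonneg_pos)
    also have "\<dots> = r" by (simp add: e_def add_nonneg_pos less_imp_neq[symmetric])
    finally show ?thesis using r(2) by (auto simp: l_def dist_norm subset_iff)
  qed
  have oI: "open ?I" by simp
  have line: "smooth_on ?I (\<lambda>s. x + s *\<^sub>R y)" for x y :: "'c::euclidean_space"
    by (intro smooth_on_add smooth_on_const smooth_on_scaleR smooth_on_ident oI)
  have sA: "smooth_on ?I (\<lambda>s. A (l s))"
    unfolding l_def by (rule smooth_on_compose[OF oI line smA]) (use lM in \<open>auto simp: l_def\<close>)
  have sF: "smooth_on ?I (\<lambda>s. F (p + s *\<^sub>R v) - t)"
    by (rule smooth_on_diff[OF oI smooth_on_compose[OF oI line smooth_F] smooth_on_const[OF oI]])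
      (rule image_subsetI, simp add: mem_Times_iff lM[unfolded l_def])
  define q where "q s = (F (p + s *\<^sub>R v) - t) / (A (l s) \<bullet> A (l s))" for s
  have sq: "smooth_on ?I q"
    unfolding q_def[abs_def] using A_nonzero lM by (intro smooth_on_divide smooth_on_inner sA sF oI) auto
  define c where "c s = (l s, snd p + s *\<^sub>R snd v - q s *\<^sub>R A (l s))" for s
  have "smooth_on ?I c"
    unfolding c_def[abs_def]
    by (intro smooth_on_Pair smooth_on_diff smooth_on_scaleR line[unfolded l_def] sq sA oI) (unfold l_def, rule line)
  moreover have c0: "c 0 = p" using Fp by (simp add: c_def l_def q_def)
  moreover have "c s \<in> level_set M F t" if "s \<in> ?I" for s
  proof -
    have "q s * (A (l s) \<bullet> A (l s)) = F (p + s *\<^sub>R v) - t"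
      using A_nonzero[OF lM[OF that]] by (simp add: q_def)
    moreover have "F (p + s *\<^sub>R v) = A (l s) \<bullet> (snd p + s *\<^sub>R snd v) + Q (l s)"
      by (simp add: F_fun_def l_def)
    ultimately have "F (c s) = t" by (simp add: F_fun_def c_def inner_diff_right)
    then show ?thesis using lM[OF that] by (simp add: level_set_def c_def)
  qed
  moreover have "(c has_vector_derivative v) (at 0)"
  proof -
    have 0: "0 \<in> ?I" using e by simp
    have dF0: "((\<lambda>s. F (p + s *\<^sub>R v)) has_vector_derivative 0) (at 0)"
      using has_vector_derivative_line[of F "dF p" p 0 v] F_has_derivative[OF pD] v by simp
    define a where "a s = A (l s) \<bullet> A (l s)" for s
    define b where "b s = inverse (a s)" for s
    have "smooth_on ?I b" unfolding b_def[abs_def] a_def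
      using A_nonzero lM by (intro smooth_on_inverse smooth_on_inner sA oI) auto
    then obtain b' where b': "(b has_vector_derivative b') (at 0)"
      using smooth_on_has_derivative[OF _ 0] has_derivative_linear
      by (metis differentiableI vector_derivative_works)
    obtain A' where A': "((\<lambda>s. A (l s)) has_vector_derivative A') (at 0)"
      using smooth_on_has_derivative[OF sA 0] by (metis differentiableI vector_derivative_works)
    have "((\<lambda>s. (F (p + s *\<^sub>R v) - t) * b s) has_vector_derivative 0) (at 0)"
      using has_vector_derivative_mult[OF has_vector_derivative_diff_const[THEN iffD2, OF dF0, of t] b'] Fp by simp
    then have q': "(q has_vector_derivative 0) (at 0)"
      by (simp add: q_def[abs_def] a_def b_def divide_inverse)
    have "q 0 = 0" using Fp by (simp add: q_def)
    have "((\<lambda>s. q s *\<^sub>R A (l s)) has_vector_derivative 0) (at 0)"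
      using has_vector_derivative_scaleR[OF _ A', of q 0] q' \<open>q 0 = 0\<close>
      by (simp add: has_real_derivative_iff_has_vector_derivative)
    moreover have line': "((\<lambda>s. x + s *\<^sub>R y) has_vector_derivative y) (at 0)" for x y :: "'c::real_normed_vector"
      by (auto intro!: derivative_eq_intros simp: has_vector_derivative_def)
    ultimately have "((\<lambda>s. snd p + s *\<^sub>R snd v - q s *\<^sub>R A (l s)) has_vector_derivative snd v - 0) (at 0)"
      by (intro has_vector_derivative_diff)
    then have "(c has_vector_derivative (fst v, snd v)) (at 0)"
      unfolding c_def[abs_def] l_def by (intro has_vector_derivative_Pair line') simp
    then show ?thesis by simp
  qed
  ultimately show "v \<in> tangent_space (level_set M F t) p"
    unfolding tangent_space_def using e by blast
qed

lemma subspace_dF_kernel: "p \<in> D \<Longrightarrow> subspace {v. dF p v = 0}"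
  by (rule linear_subspace_kernel[OF linear_dF])

text \<open>Differentiate the constant function dF(Y) along v: the derivative of dF contributes the
  Hessian and the derivative of Y contributes dF of it. With k = 0 this gives the metric, with k the
  constant value of dF on the equiaffine normal it gives tangency of the derivative of that
  normal.\<close>

lemma flat_deriv_dF:
  assumes p: "p \<in> level_set M F t" and v: "dF p v = 0"
    and Y: "(Y has_derivative Y') (at p within level_set M F t)"
    and const: "\<And>q. q \<in> level_set M F t \<Longrightarrow> dF q (Y q) = k"
  shows "dF p (flat_deriv (level_set M F t) Y p v) = - hess p v (Y p)"
proof -
  let ?S = "level_set M F t"
  have pD: "p \<in> D" using p level_subset by blast
  then have u: "fst p \<in> M" by auto
  have vT: "v \<in> tangent_space ?S p" using v by (simp add: tangent_level[OF p])
  have eq: "dF q (Y q) = (\<Sum>b\<in>Basis. (Y q \<bullet> b) * dF q b)" if "q \<in> D" for q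
    using linear_euclidean_expansion[OF linear_dF[OF that], of "Y q"] by simp
  have "((\<lambda>q. \<Sum>b\<in>Basis. (Y q \<bullet> b) * dF q b) has_derivative
      (\<lambda>h. \<Sum>b\<in>Basis. (Y p \<bullet> b) * hess p h b + (Y' h \<bullet> b) * dF p b)) (at p within ?S)"
    by (intro has_derivative_sum has_derivative_mult has_derivative_inner_left Y
        has_derivative_at_withinI[OF dF_has_derivative[OF pD]])
  moreover have "(\<Sum>b\<in>Basis. (Y p \<bullet> b) * hess p h b + (Y' h \<bullet> b) * dF p b) = hess p h (Y p) + dF p (Y' h)" for h
    using linear_euclidean_expansion[OF linear_hess_right[OF u], of h "Y p"]
      linear_euclidean_expansion[OF linear_dF[OF pD], of "Y' h"]
    by (simp add: sum.distrib)
  ultimately have d: "((\<lambda>q. \<Sum>b\<in>Basis. (Y q \<bullet> b) * dF q b) has_derivative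
      (\<lambda>h. hess p h (Y p) + dF p (Y' h))) (at p within ?S)" by simp
  have "flat_deriv ?S (\<lambda>q. \<Sum>b\<in>Basis. (Y q \<bullet> b) * dF q b) p v = 0"
  proof (rule flat_deriv_eq_on[OF p vT])
    fix q assume q: "q \<in> ?S"
    then have "q \<in> D" using level_subset by blast
    then show "(\<Sum>b\<in>Basis. (Y q \<bullet> b) * dF q b) = k" using eq const[OF q] by simp
  qed simp
  then have "hess p v (Y p) + dF p (Y' v) = 0" using flat_deriv_eq[OF vT d] by simp
  then show ?thesis using flat_deriv_eq[OF vT Y] by simp
qed

text \<open>Projection along V to the kernel of dF. For fixed w it is a smooth field tangent to all
  level sets, and it extends w from any point where w is tangent; it supplies the fields required by
  \<open>induced_metric\<close> and \<open>parallel_form\<close>.\<close>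

definition proj :: "('n, 'm) phase \<Rightarrow> ('n, 'm) phase \<Rightarrow> ('n, 'm) phase" where
  "proj w q = w - (dF q w / K (fst q)) *\<^sub>R V q"

lemma smooth_proj: "smooth_on D (proj w)"
  unfolding proj_def[abs_def]
  by (intro smooth_on_diff smooth_on_const smooth_on_scaleR smooth_on_divide smooth_dF smooth_lift smooth_K smooth_V openD)
    (use nonzero in auto)

lemma dF_proj: "q \<in> D \<Longrightarrow> dF q (proj w q) = 0"
  using nonzero[of "fst q"]
  by (auto simp: proj_def linear_diff[OF linear_dF] linear_cmul[OF linear_dF] dF_V)

lemma tangent_field_proj: "tangent_field (level_set M F t) (proj w)"
  unfolding tangent_field_def
proof (intro conjI ballI)
  show "smooth_along (level_set M F t) (proj w)"
    by (rule smooth_on_imp_smooth_along[OF openD smooth_proj level_subset])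
  fix q assume q: "q \<in> level_set M F t"
  then have "q \<in> D" using level_subset by blast
  then show "proj w q \<in> tangent_space (level_set M F t) q" using dF_proj by (simp add: tangent_level[OF q])
qed

lemma proj_tangent: "dF p v = 0 \<Longrightarrow> proj v p = v"
  by (simp add: proj_def)

lemma transversal_coeff_eq:
  assumes p: "p \<in> level_set M F t" and T: "dF p (T p) \<noteq> 0"
  shows "transversal_coeff (level_set M F t) T p z = dF p z / dF p (T p)"
proof -
  have pD: "p \<in> D" using p level_subset by blast
  have "z - c *\<^sub>R T p \<in> tangent_space (level_set M F t) p \<longleftrightarrow> c = dF p z / dF p (T p)" for c
    using T by (auto simp: tangent_level[OF p] linear_diff[OF linear_dF[OF pD]] linear_cmul[OF linear_dF[OF pD]] field_simps)
  then show ?thesis unfolding transversal_coeff_def by simp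
qed

lemma tangential_part_eq:
  assumes p: "p \<in> level_set M F t" and T: "dF p (T p) \<noteq> 0"
  shows "tangential_part (level_set M F t) T p z = z - (dF p z / dF p (T p)) *\<^sub>R T p"
proof -
  have pD: "p \<in> D" using p level_subset by blast
  have "w \<in> tangent_space (level_set M F t) p \<and> (\<exists>c. z = w + c *\<^sub>R T p) \<longleftrightarrow> w = z - (dF p z / dF p (T p)) *\<^sub>R T p" for w
    using T by (auto simp: tangent_level[OF p] linear_diff[OF linear_dF[OF pD]] linear_add[OF linear_dF[OF pD]] linear_cmul[OF linear_dF[OF pD]])
  then show ?thesis unfolding tangential_part_def by simp
qed

lemma flat_deriv_tangent_field:
  assumes p: "p \<in> level_set M F t" and v: "dF p v = 0" and Y: "tangent_field (level_set M F t) Y"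
  shows "dF p (flat_deriv (level_set M F t) Y p v) = - hess p v (Y p)"
proof -
  obtain Y' where "(Y has_derivative Y') (at p within level_set M F t)"
    using Y p smooth_along_has_derivative unfolding tangent_field_def by blast
  then show ?thesis
    using Y by (intro flat_deriv_dF[OF p v]) (auto simp: tangent_field_def tangent_level)
qed

text \<open>The definite description needs one value for all extensions of v and w, which
  \<open>flat_deriv_tangent_field\<close> provides, and at least one pair of extensions, provided by
  \<open>proj\<close>.\<close>

lemma induced_metric_eq:
  assumes p: "p \<in> level_set M F t" and T: "dF p (T p) \<noteq> 0" and v: "dF p v = 0" and w: "dF p w = 0"
  shows "induced_metric (level_set M F t) T p v w = - hess p v w / dF p (T p)"
proof -
  have "(\<exists>X Y. tangent_field (level_set M F t) X \<and> tangent_field (level_set M F t) Y \<and> X p = v \<and> Y p = w \<and>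
        c = transversal_coeff (level_set M F t) T p (flat_deriv (level_set M F t) Y p (X p)))
     \<longleftrightarrow> c = - hess p v w / dF p (T p)" (is "?L \<longleftrightarrow> ?R") for c
  proof
    assume ?L
    then show ?R
      using flat_deriv_tangent_field[OF p v] by (auto simp: transversal_coeff_eq[where T = T, OF p T])
  next
    assume ?R
    then show ?L
      using flat_deriv_tangent_field[OF p v tangent_field_proj] proj_tangent[OF v] proj_tangent[OF w]
      by (intro exI[of _ "proj v"] exI[of _ "proj w"]) (simp add: tangent_field_proj transversal_coeff_eq[where T = T, OF p T])
  qed
  then show ?thesis unfolding induced_metric_def by simp
qed

text \<open>The Hessian also vanishes against V, and V together with the tangent vectors spans
  everything, so v lies in the radical and is a multiple of V. But dF(V) = K is nonzero, while dF(v)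
  = 0.\<close>

lemma hess_nondegenerate:
  assumes p: "p \<in> D" and v: "dF p v = 0" and ker: "\<And>w. dF p w = 0 \<Longrightarrow> hess p v w = 0"
  shows "v = 0"
proof -
  have u: "fst p \<in> M" using p by auto
  have "hess p v w = 0" for w
  proof -
    have "hess p v (proj w p) = 0" by (rule ker[OF dF_proj[OF p]])
    moreover have "hess p v (V p) = 0" using hess_V[OF p] hess_sym[OF u] by metis
    ultimately show ?thesis
      by (simp add: proj_def linear_diff[OF linear_hess_right[OF u]] linear_cmul[OF linear_hess_right[OF u]])
  qed
  then have "v \<in> span {V p}" by (rule hess_kernel[OF p vv_nonzero[OF u]])
  then obtain c where c: "v = c *\<^sub>R V p" by (auto simp: span_singleton)
  then have "c * K (fst p) = 0" using v by (simp add: linear_cmul[OF linear_dF[OF p]] dF_V[OF p])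
  then show ?thesis using nonzero[OF u] c by simp
qed

end

section \<open>Frames of the level sets and the induced volume\<close>

lemma dim_functional_kernel:
  fixes f :: "'a::euclidean_space \<Rightarrow> real"
  assumes "linear f" "f w \<noteq> 0" shows "dim {v. f v = 0} = DIM('a) - 1"
proof -
  let ?g = "\<Sum>b\<in>Basis. f b *\<^sub>R b"
  have f: "f v = ?g \<bullet> v" for v
    using linear_euclidean_expansion[OF assms(1), of v] by (simp add: inner_sum_left) (simp add: inner_commute mult.commute)
  then have g: "?g \<noteq> 0" using assms(2) by (metis inner_zero_left)
  have eq: "{v. f v = 0} = {v. ?g \<bullet> v = 0}" by (simp only: f[symmetric])
  show ?thesis unfolding eq by (rule dim_hyperplane[OF g])
qed

context centroaffine_family
begin

lemma DIM_phase: "DIM(('n, 'm) phase) - 1 = 2 * CARD('n)"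
  using dims by simp

lemma dim_dF_kernel: "p \<in> D \<Longrightarrow> dim {v. dF p v = 0} = 2 * CARD('n)"
  using dim_functional_kernel[OF linear_dF, of p "V p"] dF_V[of p] nonzero[of "fst p"] DIM_phase
  by (auto simp: mem_Times_iff)

text \<open>The vectors (0, y_J) span an isotropic subspace of the tangent space that is dual under
  the Hessian to the projected coordinate vectors. Correcting the latter inside this subspace makes
  them isotropic as well without disturbing the duality.\<close>

lemma hyperbolic_frame:
  assumes p: "p \<in> D"
  obtains E Y :: "'n \<Rightarrow> ('n, 'm) phase" where
    "\<And>I. dF p (E I) = 0" "\<And>I. dF p (Y I) = 0" "\<And>I. fst (E I) = axis I 1" "\<And>I. fst (Y I) = 0"
    "\<And>I J. hess p (E I) (E J) = 0" "\<And>I J. hess p (Y I) (Y J) = 0"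
    "\<And>I J. hess p (E I) (Y J) = (if I = J then 1 else 0)"
    "det_form (case_nat (vv (fst p)) (\<lambda>k. snd (Y (enum ! k)))) = 1"
    "\<And>v. dF p v = 0 \<Longrightarrow> \<exists>c. v = (\<Sum>I\<in>UNIV. fst v $ I *\<^sub>R E I) + (\<Sum>J\<in>UNIV. c J *\<^sub>R Y J)"
proof -
  define u where "u = fst p"
  have u: "u \<in> M" "fst p \<in> M" using p by (auto simp: u_def)
  obtain y where y: "\<And>J. A u \<bullet> y J = 0" "\<And>I J. dA u (axis I 1) \<bullet> y J = (if I = J then 1 else 0)"
    "det_form (case_nat (vv u) (\<lambda>k. y (enum ! k))) = 1" using dual_frame[OF u(1) nonzero[OF u(1)]] by metis
  define Y where "Y J = (0 :: 'n rvec, y J)" for J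
  define E0 where "E0 I = proj (axis I 1, 0) p" for I
  define b where "b I J = hess p (E0 I) (E0 J)" for I J
  \<comment> \<open>Each of the two arguments removes half of \<open>b I J\<close>; symmetry of b
    makes the halves equal.\<close>
  define E where "E I = E0 I - (\<Sum>J\<in>UNIV. (b I J / 2) *\<^sub>R Y J)" for I
  note lin = linear_dF[OF p] linear_hess_left[OF u(2)] linear_hess_right[OF u(2)]
  have z: "dA u 0 = 0" "dQ u 0 = 0" "base_hess p 0 w = 0" "base_hess p w 0 = 0" for w
    using linear_0[OF linear_dA[OF u(1)]] linear_0[OF linear_dQ[OF u(1)]] linear_0[OF linear_base_hess_left[OF u(2)]]
      base_hess_sym[OF u(2), of w 0] by simp_all
  have dY: "dF p (Y J) = 0" for J using y(1) by (simp add: dF_def Y_def u_def[symmetric] z)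
  have dE0: "dF p (E0 I) = 0" for I unfolding E0_def by (rule dF_proj[OF p])
  have dE: "dF p (E I) = 0" for I
    by (simp add: E_def linear_diff[OF lin(1)] linear_sum[OF lin(1)] linear_cmul[OF lin(1)] dE0 dY)
  have fE0: "fst (E0 I) = axis I 1" for I by (simp add: E0_def proj_def V_eq)
  have fY: "fst (Y J) = 0" for J by (simp add: Y_def)
  have fE: "fst (E I) = axis I 1" for I by (simp add: E_def fE0 fst_sum fY)
  have hYY: "hess p (Y I) (Y J) = 0" for I J by (simp add: hess_def Y_def z u_def[symmetric])
  have hE0Y: "hess p (E0 I) (Y J) = (if I = J then 1 else 0)" for I J
    by (simp add: hess_def fE0 fY z u_def[symmetric]) (simp add: Y_def y(2))
  have hYE0: "hess p (Y J) (E0 I) = (if I = J then 1 else 0)" for I J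
    using hE0Y[of I J] hess_sym[OF u(2)] by metis
  have hEY: "hess p (E I) (Y J) = (if I = J then 1 else 0)" for I J
    by (simp add: E_def linear_diff[OF lin(2)] linear_sum[OF lin(2)] linear_cmul[OF lin(2)] hE0Y hYY)
  have hYE: "hess p (Y J) (E I) = (if I = J then 1 else 0)" for I J
    using hEY[of I J] hess_sym[OF u(2)] by metis
  have bsym: "b I J = b J I" for I J unfolding b_def by (rule hess_sym[OF u(2)])
  have delta: "(\<Sum>K\<in>UNIV. c K * (if K = J then 1 else 0)) = c J" "(\<Sum>K\<in>UNIV. c K * (if J = K then 1 else 0)) = c J"
    for c :: "'n \<Rightarrow> real" and J by (simp_all add: if_distrib[of "(*) _"] cong: if_cong)
  have hE0E: "hess p (E0 I) (E J) = b I J / 2" for I J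
    by (simp add: E_def linear_diff[OF lin(3)] linear_sum[OF lin(3)] linear_cmul[OF lin(3)] hE0Y delta
        b_def[symmetric] bsym[of J I] sum_divide_distrib[symmetric])
  have hEE: "hess p (E I) (E J) = 0" for I J
    using hE0E[of I J]
    by (simp add: E_def[of I] linear_diff[OF lin(2)] linear_sum[OF lin(2)] linear_cmul[OF lin(2)] hYE delta
        sum_divide_distrib[symmetric])
  have exp: "\<exists>c. v = (\<Sum>I\<in>UNIV. fst v $ I *\<^sub>R E I) + (\<Sum>J\<in>UNIV. c J *\<^sub>R Y J)" if v: "dF p v = 0" for v
  proof -
    define w where "w = v - (\<Sum>I\<in>UNIV. fst v $ I *\<^sub>R E I)"
    have fw: "fst w = 0"
      by (simp add: w_def fst_sum fE vec_eq_iff axis_def if_distrib[of "(*) _"] cong: if_cong)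
    have dw: "dF p w = 0"
      by (simp add: w_def linear_diff[OF lin(1)] linear_sum[OF lin(1)] linear_cmul[OF lin(1)] dE v)
    then have Aw: "A u \<bullet> snd w = 0" by (simp add: dF_def u_def[symmetric] fw z)
    define c where "c J = dA u (axis J 1) \<bullet> snd w" for J
    \<comment> \<open>What is left is orthogonal to the range of dA, hence a multiple of V; pairing
      with A shows that the multiple is zero.\<close>
    define x where "x = snd w - (\<Sum>J\<in>UNIV. c J *\<^sub>R y J)"
    have "dA u (axis I 1) \<bullet> x = 0" for I
      by (simp add: x_def inner_diff_right inner_sum_right y(2) delta c_def[symmetric])
    then have "dA u z \<bullet> x = 0" for z
    proof -
      have "z = (\<Sum>I\<in>UNIV. z $ I *\<^sub>R axis I 1)"
        by (simp add: vec_eq_iff axis_def if_distrib[of "(*) _"] cong: if_cong)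
      then have "dA u z = (\<Sum>I\<in>UNIV. z $ I *\<^sub>R dA u (axis I 1))"
        using linear_sum[OF linear_dA[OF u(1)]] linear_cmul[OF linear_dA[OF u(1)]] by (metis (no_types, lifting) sum.cong)
      then show ?thesis using \<open>\<And>I. dA u (axis I 1) \<bullet> x = 0\<close> by (simp add: inner_sum_left)
    qed
    from orthogonal_range[OF u(1) vv_nonzero[OF u(1)] this]
    obtain a where a: "x = a *\<^sub>R vv u" by blast
    have "A u \<bullet> x = 0" by (simp add: x_def inner_diff_right inner_sum_right y(1) Aw)
    then have "a = 0" using nonzero[OF u(1)] by (simp add: a A_vv)
    then have "snd w = (\<Sum>J\<in>UNIV. c J *\<^sub>R y J)" using a by (simp add: x_def)
    then have "w = (\<Sum>J\<in>UNIV. c J *\<^sub>R Y J)" using fw by (simp add: prod_eq_iff fst_sum snd_sum Y_def)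
    then show ?thesis by (auto simp: w_def algebra_simps)
  qed
  have "det_form (case_nat (vv (fst p)) (\<lambda>k. snd (Y (enum ! k)))) = 1"
    using y(3) by (simp add: Y_def u_def)
  then show ?thesis using dE dY fE fY hEE hYY hEY exp by (intro that) auto
qed

text \<open>The hyperbolic frame listed with all E before all Y, so that the Hessian pairs index i
  with i + n. Moving V past the n vectors E gives the sign; then u-parts and x-parts separate into
  two determinants equal to 1.\<close>

lemma adapted_frame:
  assumes p: "p \<in> D"
  obtains b :: "nat \<Rightarrow> ('n, 'm) phase" where
    "\<And>i. i < 2 * CARD('n) \<Longrightarrow> dF p (b i) = 0"
    "\<And>i j. i < 2 * CARD('n) \<Longrightarrow> j < 2 * CARD('n) \<Longrightarrow> hess p (b i) (b j) = (if j = i + CARD('n) \<or> i = j + CARD('n) then 1 else 0)"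
    "contract (V p) Upsilon b = (-1) ^ CARD('n)"
    "\<And>v. dF p v = 0 \<Longrightarrow> v \<in> span (b ` {..<2 * CARD('n)})"
proof -
  obtain E Y :: "'n \<Rightarrow> ('n, 'm) phase" where EY:
    "\<And>I. dF p (E I) = 0" "\<And>I. dF p (Y I) = 0" "\<And>I. fst (E I) = axis I 1" "\<And>I. fst (Y I) = 0"
    "\<And>I J. hess p (E I) (E J) = 0" "\<And>I J. hess p (Y I) (Y J) = 0"
    "\<And>I J. hess p (E I) (Y J) = (if I = J then 1 else 0)"
    "det_form (case_nat (vv (fst p)) (\<lambda>k. snd (Y (enum ! k)))) = 1"
    "\<And>v. dF p v = 0 \<Longrightarrow> \<exists>c. v = (\<Sum>I\<in>UNIV. fst v $ I *\<^sub>R E I) + (\<Sum>J\<in>UNIV. c J *\<^sub>R Y J)"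
    using hyperbolic_frame[OF p] by blast
  have u: "fst p \<in> M" using p by auto
  have EY': "hess p (Y J) (E I) = (if I = J then 1 else 0)" for I J
    using EY(7)[of I J] hess_sym[OF u] by metis
  define b where "b i = (if i < CARD('n) then E (enum ! i) else Y (enum ! (i - CARD('n))))" for i
  have eq: "(enum ! i :: 'n) = enum ! j \<longleftrightarrow> i = j" if "i < CARD('n)" "j < CARD('n)" for i j
    using that enum_props[where 'k='n] by (simp add: nth_eq_iff_index_eq)
  have 1: "dF p (b i) = 0" for i using EY(1,2) by (simp add: b_def)
  have 2: "hess p (b i) (b j) = (if j = i + CARD('n) \<or> i = j + CARD('n) then 1 else 0)" if "i < 2 * CARD('n)" "j < 2 * CARD('n)" for i j
  proof -
    consider "i < CARD('n)" "j < CARD('n)" | "i < CARD('n)" "\<not> j < CARD('n)" | "\<not> i < CARD('n)" "j < CARD('n)" | "\<not> i < CARD('n)" "\<not> j < CARD('n)" by blast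
    then show ?thesis
    proof cases
      case 1
      then show ?thesis using EY(5) by (simp add: b_def)
    next
      case 2
      then have "hess p (b i) (b j) = (if i = j - CARD('n) then 1 else 0)" using that by (simp add: b_def EY(7) eq)
      then show ?thesis using 2 by auto
    next
      case 3
      then have "hess p (b i) (b j) = (if j = i - CARD('n) then 1 else 0)" using that by (simp add: b_def EY' eq)
      then show ?thesis using 3 by auto
    next
      case 4
      then show ?thesis using that EY(6) by (simp add: b_def)
    qed
  qed
  have alt: "alt_form (CARD('n) + CARD('m)) (Upsilon :: (nat \<Rightarrow> ('n, 'm) phase) \<Rightarrow> real)" by (rule alt_form_Upsilon)
  let ?es = "map E enum" and ?ys = "map Y enum"
  have len: "length ?es = CARD('n)" "length ?ys = CARD('n)" by (simp_all add: enum_props)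
  have 3: "contract (V p) Upsilon b = (-1) ^ CARD('n)"
  proof -
    have "contract (V p) Upsilon b = Upsilon ((!) ([] @ V p # ?es @ ?ys))"
      unfolding contract_def
    proof (rule alt_form_cong[OF alt])
      fix i assume i: "i < CARD('n) + CARD('m)"
      show "case_nat (V p) b i = ([] @ V p # ?es @ ?ys) ! i"
      proof (cases i)
        case (Suc k)
        then have "k < 2 * CARD('n)" using i dims by simp
        then show ?thesis using Suc by (auto simp: b_def nth_append len enum_props)
      qed simp
    qed
    also have "\<dots> = (-1) ^ length ?es * Upsilon ((!) ([] @ ?es @ V p # ?ys))"
      by (rule alt_form_move[OF alt]) (simp add: len dims enum_props)
    also have "Upsilon ((!) ([] @ ?es @ V p # ?ys)) =
        det_form (\<lambda>i. fst (([] @ ?es @ V p # ?ys) ! i)) * det_form (\<lambda>i. snd (([] @ ?es @ V p # ?ys) ! (CARD('n) + i)))"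
    proof (rule Upsilon_split)
      fix j assume j: "CARD('n) \<le> j" "j < CARD('n) + CARD('m)"
      show "fst (([] @ ?es @ V p # ?ys) ! j) = 0"
      proof (cases "j - CARD('n)")
        case 0
        then show ?thesis using j by (simp add: nth_append len V_eq enum_props)
      next
        case (Suc k)
        then have "k < CARD('n)" using j dims by linarith
        then show ?thesis using j Suc EY(4) by (simp add: nth_append len enum_props)
      qed
    qed
    also have "det_form (\<lambda>i. fst (([] @ ?es @ V p # ?ys) ! i)) = det_form (\<lambda>i. axis (enum ! i) 1 :: 'n rvec)"
      by (rule alt_form_cong[OF alt_form_det_form]) (simp add: nth_append len enum_props EY(3))
    also have "det_form (\<lambda>i. snd (([] @ ?es @ V p # ?ys) ! (CARD('n) + i))) =
        det_form (case_nat (vv (fst p)) (\<lambda>k. snd (Y (enum ! k))))"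
    proof (rule alt_form_cong[OF alt_form_det_form])
      fix i assume "i < CARD('m)"
      then show "snd (([] @ ?es @ V p # ?ys) ! (CARD('n) + i)) = (case i of 0 \<Rightarrow> vv (fst p) | Suc k \<Rightarrow> snd (Y (enum ! k)))"
        using dims by (cases i) (simp_all add: nth_append len V_eq enum_props)
    qed
    finally show ?thesis by (simp add: det_form_axis EY(8) enum_props)
  qed
  have 4: "v \<in> span (b ` {..<2 * CARD('n)})" if dv: "dF p v = 0" for v
  proof -
    have E: "E I \<in> span (b ` {..<2 * CARD('n)})" for I
    proof (intro span_base image_eqI)
      show "E I = b (pos I - 1)" using pos_pred_less'[of I] by (simp add: b_def enum_pos')
      show "pos I - 1 \<in> {..<2 * CARD('n)}" using pos_pred_less'[of I] by simp
    qed
    have Y: "Y I \<in> span (b ` {..<2 * CARD('n)})" for I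
    proof (intro span_base image_eqI)
      show "Y I = b (CARD('n) + (pos I - 1))" by (simp add: b_def enum_pos')
      show "CARD('n) + (pos I - 1) \<in> {..<2 * CARD('n)}" using pos_pred_less'[of I] by simp
    qed
    obtain c where "v = (\<Sum>I\<in>UNIV. fst v $ I *\<^sub>R E I) + (\<Sum>J\<in>UNIV. c J *\<^sub>R Y J)" using EY(9)[OF dv] by blast
    moreover have "(\<Sum>I\<in>UNIV. fst v $ I *\<^sub>R E I) + (\<Sum>J\<in>UNIV. c J *\<^sub>R Y J) \<in> span (b ` {..<2 * CARD('n)})"
      by (intro span_add span_sum span_mul E Y)
    ultimately show ?thesis by simp
  qed
  from 1 2 3 4 show ?thesis by (rule that)
qed

lemma alt_form_contract_Upsilon: "alt_form (2 * CARD('n)) (contract (w :: ('n, 'm) phase) Upsilon)"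
proof (rule alt_form_contract)
  show "alt_form (Suc (2 * CARD('n))) (Upsilon :: (nat \<Rightarrow> ('n, 'm) phase) \<Rightarrow> real)"
    using alt_form_Upsilon[where 'n='n and 'm='m] dims by (simp add: mult_2)
qed

lemma linear_contract_Upsilon: "linear (\<lambda>w. contract (w :: ('n, 'm) phase) Upsilon v)"
proof -
  have "alt_form (Suc (2 * CARD('n))) (Upsilon :: (nat \<Rightarrow> ('n, 'm) phase) \<Rightarrow> real)"
    using alt_form_Upsilon[where 'n='n and 'm='m] dims by (simp add: mult_2)
  from alt_form_linear[OF this, of 0 "case_nat 0 v"]
  have "linear (\<lambda>w. Upsilon ((case_nat 0 v)(0 := w)))" by simp
  moreover have "(case_nat 0 v)(0 := w) = case_nat w v" for w by (auto simp: fun_eq_iff split: nat.split)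
  ultimately show ?thesis by (simp add: contract_def)
qed

text \<open>Exchanging the two halves of the frame in one slot turns the Gram matrix into the unit
  matrix.\<close>

lemma gram_frame:
  assumes p: "p \<in> D"
    and b: "\<And>i j. i < 2 * CARD('n) \<Longrightarrow> j < 2 * CARD('n) \<Longrightarrow> hess p (b i) (b j) = (if j = i + CARD('n) \<or> i = j + CARD('n) then 1 else 0)"
  shows "\<bar>det_nat (2 * CARD('n)) (\<lambda>i j. hess p (b i) (b j))\<bar> = 1"
proof -
  have u: "fst p \<in> M" using p by auto
  define \<sigma> where "\<sigma> i = (if i < CARD('n) then i + CARD('n) else if i < 2 * CARD('n) then i - CARD('n) else i)" for i
  have \<sigma>: "\<sigma> permutes {..<2 * CARD('n)}"
    by (rule bij_imp_permutes, rule bij_betw_byWitness[of _ \<sigma>]) (auto simp: \<sigma>_def)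
  let ?\<alpha> = "\<lambda>v. det_nat (2 * CARD('n)) (\<lambda>i j. hess p (v i) (b j))"
  have "?\<alpha> (b \<circ> \<sigma>) = of_int (sign \<sigma>) * ?\<alpha> b"
    by (rule alt_form_permute[OF alt_form_det_nat[OF linear_hess_left[OF u]] \<sigma>])
  moreover have "?\<alpha> (b \<circ> \<sigma>) = (\<Prod>i<2 * CARD('n). hess p ((b \<circ> \<sigma>) i) (b i))"
  proof (rule det_nat_diagonal)
    fix i j assume "i < 2 * CARD('n)" "j < 2 * CARD('n)" "i \<noteq> j"
    then show "hess p ((b \<circ> \<sigma>) i) (b j) = 0"
      using b[of "\<sigma> i" j] permutes_in_image[OF \<sigma>, of i] by (auto simp: \<sigma>_def split: if_splits)
  qed
  moreover have "(\<Prod>i<2 * CARD('n). hess p ((b \<circ> \<sigma>) i) (b i)) = 1"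
  proof (rule prod.neutral, rule ballI)
    fix i assume "i \<in> {..<2 * CARD('n)}"
    then show "hess p ((b \<circ> \<sigma>) i) (b i) = 1"
      using b[of "\<sigma> i" i] permutes_in_image[OF \<sigma>, of i] by (auto simp: \<sigma>_def split: if_splits)
  qed
  ultimately have "1 = of_int (sign \<sigma>) * ?\<alpha> b" by simp
  then show ?thesis by (cases \<sigma> rule: sign_cases) auto
qed

text \<open>Both sides scale with the square of the determinant of the change of frame, and both are
  1 on an adapted frame.\<close>

lemma volume_identity:
  assumes p: "p \<in> D" and v: "\<And>i. i < 2 * CARD('n) \<Longrightarrow> dF p (v i) = 0"
  shows "\<bar>det_nat (2 * CARD('n)) (\<lambda>i j. hess p (v i) (v j))\<bar> = (contract (V p) Upsilon v)\<^sup>2"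
proof -
  have u: "fst p \<in> M" using p by auto
  obtain b where b: "\<And>i. i < 2 * CARD('n) \<Longrightarrow> dF p (b i) = 0"
    "\<And>i j. i < 2 * CARD('n) \<Longrightarrow> j < 2 * CARD('n) \<Longrightarrow> hess p (b i) (b j) = (if j = i + CARD('n) \<or> i = j + CARD('n) then 1 else 0)"
    "contract (V p) Upsilon b = (-1) ^ CARD('n)"
    "\<And>v. dF p v = 0 \<Longrightarrow> v \<in> span (b ` {..<2 * CARD('n)})" using adapted_frame[OF p] by blast
  obtain C where C: "\<forall>i<2 * CARD('n). v i = (\<Sum>j<2 * CARD('n). C i j *\<^sub>R b j)"
    using alt_form_expand_span[of "2 * CARD('n)" v b] b(4) v by blast
  have "contract (V p) Upsilon v = det_nat (2 * CARD('n)) C * (-1) ^ CARD('n)"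
    using alt_form_det_nat_expand[OF alt_form_contract_Upsilon, of v C b "V p"] C b(3) by simp
  then have "(contract (V p) Upsilon v)\<^sup>2 = (det_nat (2 * CARD('n)) C)\<^sup>2"
    by (simp add: power_mult_distrib flip: power_mult)
  moreover have "det_nat (2 * CARD('n)) (\<lambda>i j. hess p (v i) (v j)) = (det_nat (2 * CARD('n)) C)\<^sup>2 * det_nat (2 * CARD('n)) (\<lambda>i j. hess p (b i) (b j))"
    using C by (intro det_nat_gram linear_hess_left[OF u] linear_hess_right[OF u]) auto
  ultimately show ?thesis using gram_frame[OF p b(2)] by (simp add: abs_mult)
qed

lemma contract_tangent_zero:
  assumes p: "p \<in> D" and w: "dF p w = 0" and v: "\<And>i. i < 2 * CARD('n) \<Longrightarrow> dF p (v i) = 0"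
  shows "contract w Upsilon v = 0"
proof -
  obtain b where b: "\<And>i. i < 2 * CARD('n) \<Longrightarrow> dF p (b i) = 0"
    "\<And>i j. i < 2 * CARD('n) \<Longrightarrow> j < 2 * CARD('n) \<Longrightarrow> hess p (b i) (b j) = (if j = i + CARD('n) \<or> i = j + CARD('n) then 1 else 0)"
    "contract (V p) Upsilon b = (-1) ^ CARD('n)"
    "\<And>v. dF p v = 0 \<Longrightarrow> v \<in> span (b ` {..<2 * CARD('n)})" using adapted_frame[OF p] by blast
  \<comment> \<open>There are 2n + 1 arguments in a space of dimension 2n. Padding the frame with a
    zero vector makes the square expansion formula applicable, and the form vanishes on the padded
    frame.\<close>
  let ?b = "b(2 * CARD('n) := 0)"
  have alt: "alt_form (Suc (2 * CARD('n))) (Upsilon :: (nat \<Rightarrow> ('n, 'm) phase) \<Rightarrow> real)"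
    using alt_form_Upsilon[where 'n='n and 'm='m] dims by (simp add: mult_2)
  have "b ` {..<2 * CARD('n)} \<subseteq> ?b ` {..<Suc (2 * CARD('n))}" by force
  then have sp: "dF p x = 0 \<Longrightarrow> x \<in> span (?b ` {..<Suc (2 * CARD('n))})" for x using b(4) span_mono by blast
  have "case_nat w v i \<in> span (?b ` {..<Suc (2 * CARD('n))})" if "i < Suc (2 * CARD('n))" for i
    using that w v by (intro sp) (auto split: nat.split)
  then obtain C where C: "\<forall>i<Suc (2 * CARD('n)). case_nat w v i = (\<Sum>j<Suc (2 * CARD('n)). C i j *\<^sub>R ?b j)"
    using alt_form_expand_span[of "Suc (2 * CARD('n))" "case_nat w v" ?b] by blast
  have "Upsilon (case_nat w v) = det_nat (Suc (2 * CARD('n))) C * Upsilon ?b"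
    by (rule alt_form_det_nat_expand[OF alt]) (use C in blast)
  moreover have "Upsilon ?b = 0" by (rule alt_form_zero_arg[OF alt, of "2 * CARD('n)"]) simp_all
  ultimately show ?thesis by (simp add: contract_def)
qed

lemma contract_transversal:
  assumes p: "p \<in> D" and v: "\<And>i. i < 2 * CARD('n) \<Longrightarrow> dF p (v i) = 0"
  shows "contract w Upsilon v = dF p w / K (fst p) * contract (V p) Upsilon v"
proof -
  have "contract (proj w p) Upsilon v = 0" by (rule contract_tangent_zero[OF p dF_proj[OF p] v])
  then show ?thesis
    by (simp add: proj_def linear_diff[OF linear_contract_Upsilon] linear_cmul[OF linear_contract_Upsilon])
qed

text \<open>Relative to the contraction with V, the contraction with W carries the factor |dF(W)| /
  |K|, while the metric -Hess / dF(W) on a space of dimension 2n has volume density with the factor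
  |dF(W)|^(-n). On an adapted frame the common factor is nonzero, so the two must agree.\<close>

lemma volume_condition_iff:
  assumes p: "p \<in> level_set M F t" and W: "dF p (W p) \<noteq> 0"
  shows "(\<forall>v. (\<forall>i<DIM(('n, 'm) phase) - 1. v i \<in> tangent_space (level_set M F t) p) \<longrightarrow>
        \<bar>contract (W p) Upsilon v\<bar> = volume_density (DIM(('n, 'm) phase) - 1) (induced_metric (level_set M F t) W p) v)
     \<longleftrightarrow> \<bar>dF p (W p)\<bar> ^ (CARD('n) + 1) = \<bar>K (fst p)\<bar>"
proof -
  let ?f = "dF p (W p)" and ?S = "level_set M F t"
  have pD: "p \<in> D" using p level_subset by blast
  then have K: "K (fst p) \<noteq> 0" using nonzero by auto
  have vd: "volume_density (2 * CARD('n)) (induced_metric ?S W p) v = \<bar>contract (V p) Upsilon v\<bar> / \<bar>?f\<bar> ^ CARD('n)"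
    if v: "\<And>i. i < 2 * CARD('n) \<Longrightarrow> dF p (v i) = 0" for v
  proof -
    have "det_nat (2 * CARD('n)) (\<lambda>i j. induced_metric ?S W p (v i) (v j)) =
        det_nat (2 * CARD('n)) (\<lambda>i j. (- 1 / ?f) * hess p (v i) (v j))"
      by (rule det_nat_cong) (simp add: induced_metric_eq[where T = W, OF p W v v])
    also have "\<dots> = (- 1 / ?f) ^ (2 * CARD('n)) * det_nat (2 * CARD('n)) (\<lambda>i j. hess p (v i) (v j))"
      by (rule det_nat_scale)
    finally have "\<bar>det_nat (2 * CARD('n)) (\<lambda>i j. induced_metric ?S W p (v i) (v j))\<bar> =
        (\<bar>contract (V p) Upsilon v\<bar> / \<bar>?f\<bar> ^ CARD('n))\<^sup>2"
      using volume_identity[OF pD v]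
      by (simp add: abs_mult power_abs power_divide power_mult power_even_abs mult.commute[of _ "CARD('n)"])
    then show ?thesis by (simp add: volume_density_def real_sqrt_abs)
  qed
  have ct: "\<bar>contract (W p) Upsilon v\<bar> = \<bar>?f\<bar> / \<bar>K (fst p)\<bar> * \<bar>contract (V p) Upsilon v\<bar>"
    if v: "\<And>i. i < 2 * CARD('n) \<Longrightarrow> dF p (v i) = 0" for v
    by (subst contract_transversal[OF pD v]) (simp_all add: abs_mult)
  have iff: "\<bar>?f\<bar> / \<bar>K (fst p)\<bar> = 1 / \<bar>?f\<bar> ^ CARD('n) \<longleftrightarrow> \<bar>?f\<bar> ^ (CARD('n) + 1) = \<bar>K (fst p)\<bar>"
    using K W by (auto simp: field_simps)
  obtain b where b: "\<And>i. i < 2 * CARD('n) \<Longrightarrow> dF p (b i) = 0"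
    "\<And>i j. i < 2 * CARD('n) \<Longrightarrow> j < 2 * CARD('n) \<Longrightarrow> hess p (b i) (b j) = (if j = i + CARD('n) \<or> i = j + CARD('n) then 1 else 0)"
    "contract (V p) Upsilon b = (-1) ^ CARD('n)"
    "\<And>v. dF p v = 0 \<Longrightarrow> v \<in> span (b ` {..<2 * CARD('n)})" using adapted_frame[OF pD] by blast
  show ?thesis
    unfolding DIM_phase tangent_level[OF p] mem_Collect_eq
  proof
    assume "\<forall>v. (\<forall>i<2 * CARD('n). dF p (v i) = 0) \<longrightarrow>
      \<bar>contract (W p) Upsilon v\<bar> = volume_density (2 * CARD('n)) (induced_metric ?S W p) v"
    then have "\<bar>contract (W p) Upsilon b\<bar> = volume_density (2 * CARD('n)) (induced_metric ?S W p) b" using b(1) by blast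
    then have "\<bar>?f\<bar> / \<bar>K (fst p)\<bar> = 1 / \<bar>?f\<bar> ^ CARD('n)" using vd[of b] ct[of b] b(1,3) by simp
    then show "\<bar>?f\<bar> ^ (CARD('n) + 1) = \<bar>K (fst p)\<bar>" by (simp only: iff)
  next
    assume "\<bar>?f\<bar> ^ (CARD('n) + 1) = \<bar>K (fst p)\<bar>"
    then have "\<bar>?f\<bar> / \<bar>K (fst p)\<bar> = 1 / \<bar>?f\<bar> ^ CARD('n)" by (simp only: iff)
    then show "\<forall>v. (\<forall>i<2 * CARD('n). dF p (v i) = 0) \<longrightarrow>
      \<bar>contract (W p) Upsilon v\<bar> = volume_density (2 * CARD('n)) (induced_metric ?S W p) v"
      by (simp add: vd ct)
  qed
qed

text \<open>The covariant derivative of the induced volume form is its contraction with the derivative of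
  \<open>W\<close> itself.\<close>

lemma parallel_defect:
  assumes p: "p \<in> level_set M F t" and W: "dF p (W p) \<noteq> 0" "smooth_along (level_set M F t) W"
    and X: "dF p (X p) = 0"
    and Y: "\<And>i. i < 2 * CARD('n) \<Longrightarrow> tangent_field (level_set M F t) (Y i)"
  shows "flat_deriv (level_set M F t) (\<lambda>q. contract (W q) Upsilon (\<lambda>i. Y i q)) p (X p) =
    contract (flat_deriv (level_set M F t) W p (X p)) Upsilon (\<lambda>i. Y i p) +
    (\<Sum>i<2 * CARD('n). contract (W p) Upsilon ((\<lambda>j. Y j p)(i := induced_connection (level_set M F t) W X (Y i) p)))"
proof -
  let ?S = "level_set M F t"
  have alt: "alt_form (Suc (2 * CARD('n))) (Upsilon :: (nat \<Rightarrow> ('n, 'm) phase) \<Rightarrow> real)"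
    using alt_form_Upsilon[where 'n='n and 'm='m] dims by (simp add: mult_2)
  have XT: "X p \<in> tangent_space ?S p" using X by (simp add: tangent_level[OF p])
  obtain W' where W': "(W has_derivative W') (at p within ?S)" using smooth_along_has_derivative[OF W(2) p] by blast
  have "\<forall>i. \<exists>Y'. i < 2 * CARD('n) \<longrightarrow> (Y i has_derivative Y') (at p within ?S)"
    using smooth_along_has_derivative[OF _ p] Y unfolding tangent_field_def by metis
  then obtain Y' where Y': "\<And>i. i < 2 * CARD('n) \<Longrightarrow> (Y i has_derivative Y' i) (at p within ?S)" by metis
  let ?Z = "case_nat W Y" and ?Z' = "case_nat W' Y'"
  have Z: "contract (W q) Upsilon (\<lambda>i. Y i q) = Upsilon (\<lambda>i. ?Z i q)" for q
    unfolding contract_def by (rule arg_cong[of _ _ Upsilon]) (auto simp: fun_eq_iff split: nat.split)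
  have "((\<lambda>q. Upsilon (\<lambda>i. ?Z i q)) has_derivative (\<lambda>h. \<Sum>i<Suc (2 * CARD('n)). Upsilon ((\<lambda>j. ?Z j p)(i := ?Z' i h)))) (at p within ?S)"
    by (rule alt_form_has_derivative[OF alt]) (use W' Y' in \<open>auto split: nat.split\<close>)
  from flat_deriv_eq[OF XT this]
  have "flat_deriv ?S (\<lambda>q. contract (W q) Upsilon (\<lambda>i. Y i q)) p (X p) =
      (\<Sum>i<Suc (2 * CARD('n)). Upsilon ((\<lambda>j. ?Z j p)(i := ?Z' i (X p))))" by (simp only: Z)
  also have "\<dots> = Upsilon ((\<lambda>j. ?Z j p)(0 := W' (X p))) + (\<Sum>i<2 * CARD('n). Upsilon ((\<lambda>j. ?Z j p)(Suc i := Y' i (X p))))"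
    by (simp add: sum.lessThan_Suc_shift del: sum.lessThan_Suc)
  also have "Upsilon ((\<lambda>j. ?Z j p)(0 := W' (X p))) = contract (flat_deriv ?S W p (X p)) Upsilon (\<lambda>i. Y i p)"
    unfolding contract_def flat_deriv_eq[OF XT W']
    by (rule arg_cong[of _ _ Upsilon]) (auto simp: fun_eq_iff split: nat.split)
  also have "(\<Sum>i<2 * CARD('n). Upsilon ((\<lambda>j. ?Z j p)(Suc i := Y' i (X p)))) =
      (\<Sum>i<2 * CARD('n). contract (W p) Upsilon ((\<lambda>j. Y j p)(i := induced_connection ?S W X (Y i) p)))"
  proof (intro sum.cong refl)
    fix i assume "i \<in> {..<2 * CARD('n)}"
    then have i: "i < 2 * CARD('n)" by simp
    let ?c = "dF p (Y' i (X p)) / dF p (W p)"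
    have con: "induced_connection ?S W X (Y i) p = Y' i (X p) - ?c *\<^sub>R W p"
      by (simp add: induced_connection_def flat_deriv_eq[OF XT Y'[OF i]] tangential_part_eq[where T = W, OF p W(1)])
    have lin: "linear (\<lambda>x. contract (W p) Upsilon ((\<lambda>j. Y j p)(i := x)))"
      by (rule alt_form_linear[OF alt_form_contract_Upsilon i])
    \<comment> \<open>W already fills the first slot, so the transversal part of the derivative of
      Y_i is invisible and only the induced connection remains.\<close>
    have "contract (W p) Upsilon ((\<lambda>j. Y j p)(i := W p)) = 0"
      unfolding contract_def by (rule alt_form_equal[OF alt, of 0 "Suc i"]) (use i in auto)
    then have "contract (W p) Upsilon ((\<lambda>j. Y j p)(i := induced_connection ?S W X (Y i) p)) =
        contract (W p) Upsilon ((\<lambda>j. Y j p)(i := Y' i (X p)))"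
      unfolding con by (simp add: linear_diff[OF lin] linear_cmul[OF lin])
    also have "\<dots> = Upsilon ((\<lambda>j. ?Z j p)(Suc i := Y' i (X p)))"
      unfolding contract_def by (rule arg_cong[of _ _ Upsilon]) (auto simp: fun_eq_iff split: nat.split)
    finally show "Upsilon ((\<lambda>j. ?Z j p)(Suc i := Y' i (X p))) =
        contract (W p) Upsilon ((\<lambda>j. Y j p)(i := induced_connection ?S W X (Y i) p))" ..
  qed
  finally show ?thesis .
qed

end

section \<open>The equiaffine normal\<close>

locale equiaffine_family = centroaffine_family M A Q
  for M :: "'n::{finite,linorder} rvec set" and A :: "'n rvec \<Rightarrow> 'm::{finite,linorder} rvec" and Q +
  fixes \<kappa> :: real
  assumes K_const: "\<And>u. u \<in> M \<Longrightarrow> det_A_dA A u = \<kappa>" and \<kappa>_nonzero: "\<kappa> \<noteq> 0"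
begin

text \<open>The constant is determined by \<open>|c \<kappa>|\<^bsup>n+1\<^esup> = |\<kappa>|\<close> and \<open>c \<kappa> < 0\<close>, since \<open>dF(c V) = c \<kappa>\<close>.\<close>

definition c :: real where
  "c = - sgn \<kappa> * \<bar>\<kappa>\<bar> powr (- (2 * real CARD('n) / (2 * real CARD('n) + 2)))"

lemma c_nonzero: "c \<noteq> 0"
  using \<kappa>_nonzero by (simp add: c_def sgn_zero_iff)

lemma c_\<kappa>: "c * \<kappa> < 0" "\<bar>c * \<kappa>\<bar> ^ (CARD('n) + 1) = \<bar>\<kappa>\<bar>"
proof -
  let ?a = "2 * real CARD('n) / (2 * real CARD('n) + 2)"
  have "sgn \<kappa> * \<kappa> = \<bar>\<kappa>\<bar>" by (simp add: abs_sgn mult.commute)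
  then have 1: "c * \<kappa> = - (\<bar>\<kappa>\<bar> powr (- ?a) * \<bar>\<kappa>\<bar>)" by (simp add: c_def mult_ac)
  then show "c * \<kappa> < 0" using \<kappa>_nonzero by simp
  have "\<bar>c * \<kappa>\<bar> = \<bar>\<kappa>\<bar> powr (- ?a) * \<bar>\<kappa>\<bar> powr 1" unfolding 1 using \<kappa>_nonzero by simp
  also have "\<dots> = \<bar>\<kappa>\<bar> powr (- ?a + 1)" by (rule powr_add[symmetric])
  also have "- ?a + 1 = 1 / real (CARD('n) + 1)" by (simp add: field_simps)
  finally have "\<bar>c * \<kappa>\<bar> ^ (CARD('n) + 1) = (\<bar>\<kappa>\<bar> powr (1 / real (CARD('n) + 1))) ^ (CARD('n) + 1)" by simp
  also have "\<dots> = (\<bar>\<kappa>\<bar> powr (1 / real (CARD('n) + 1))) powr real (CARD('n) + 1)"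
    by (rule powr_realpow[symmetric]) (use \<kappa>_nonzero in simp)
  also have "\<dots> = \<bar>\<kappa>\<bar> powr (1 / real (CARD('n) + 1) * real (CARD('n) + 1))" by (rule powr_powr)
  finally show "\<bar>c * \<kappa>\<bar> ^ (CARD('n) + 1) = \<bar>\<kappa>\<bar>" using \<kappa>_nonzero by simp
qed

lemma dF_V_const: "p \<in> D \<Longrightarrow> dF p (V p) = \<kappa>"
  using dF_V K_const by auto

lemma dF_cV: "p \<in> D \<Longrightarrow> dF p (c *\<^sub>R V p) = c * \<kappa>"
  by (simp add: linear_cmul[OF linear_dF] dF_V_const)

text \<open>The sign of U(F) and the sign in N are both (-1)^n and cancel. Consequently dF is
  negative on the co-orientation, and the equiaffine normal must satisfy dF(W) < 0.\<close>

lemma co_orientation_eq: "p \<in> D \<Longrightarrow> co_orientation F p = - \<kappa> *\<^sub>R V p"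
proof -
  assume p: "p \<in> D"
  then have K: "K (fst p) = \<kappa>" using K_const by auto
  have "sgn (U_fun F p) = (-1) ^ CARD('n)"
  proof -
    have "(sgn \<kappa>)\<^sup>2 = 1" using \<kappa>_nonzero by (simp add: sgn_if power2_eq_square)
    then show ?thesis by (cases "even CARD('n)") (simp_all add: U_fun_eq[OF p] K sgn_mult)
  qed
  then show ?thesis
    unfolding co_orientation_def N_field_eq[OF p] K by (simp add: power_mult_distrib[symmetric])
qed

lemma smooth_cV: "smooth_on D (\<lambda>q. c *\<^sub>R V q)"
  by (intro smooth_on_scaleR smooth_on_const smooth_V openD)

lemma smooth_along_cV:
  assumes "\<And>q. q \<in> level_set M F t \<Longrightarrow> W q = c *\<^sub>R V q"
  shows "smooth_along (level_set M F t) W"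
  unfolding smooth_along_def
proof
  fix p assume "p \<in> level_set M F t"
  then have "p \<in> D" using level_subset by blast
  then show "\<exists>U g. open U \<and> p \<in> U \<and> smooth_on U g \<and> (\<forall>q\<in>level_set M F t \<inter> U. g q = W q)"
    using smooth_cV openD assms by (intro exI[of _ D] exI[of _ "\<lambda>q. c *\<^sub>R V q"]) auto
qed

text \<open>Stated for every W that agrees with c V on the level set, so that it applies to
  \<open>equiaffine_normal\<close> itself, whose values elsewhere are unspecified.\<close>

lemma is_equiaffine_normal_cV:
  assumes W: "\<And>q. q \<in> level_set M F t \<Longrightarrow> W q = c *\<^sub>R V q"
  shows "is_equiaffine_normal Upsilon (level_set M F t) (co_orientation F) W"
  unfolding is_equiaffine_normal_def
proof (intro conjI)
  let ?S = "level_set M F t"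
  have D: "q \<in> D" if "q \<in> ?S" for q using that level_subset by blast
  have dW: "dF q (W q) = c * \<kappa>" if "q \<in> ?S" for q using W[OF that] dF_cV[OF D[OF that]] by simp
  have ck: "c * \<kappa> \<noteq> 0" using c_nonzero \<kappa>_nonzero by simp
  show "transversal ?S W"
    unfolding transversal_def using smooth_along_cV[OF W] dW ck by (simp add: tangent_level)
  show "\<forall>p\<in>?S. \<exists>k>0. W p - k *\<^sub>R co_orientation F p \<in> tangent_space ?S p"
  proof
    fix p assume p: "p \<in> ?S"
    \<comment> \<open>The factor relating c V to the co-orientation -\<kappa> V; the two differ by
      no tangential part.\<close>
    have "- c / \<kappa> > 0" using c_\<kappa>(1) by (auto simp: mult_less_0_iff divide_less_0_iff)
    moreover have "W p - (- c / \<kappa>) *\<^sub>R co_orientation F p = 0"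
      using W[OF p] \<kappa>_nonzero by (simp add: co_orientation_eq[OF D[OF p]])
    moreover have "0 \<in> tangent_space ?S p"
      by (simp add: tangent_level[OF p] linear_0[OF linear_dF[OF D[OF p]]])
    ultimately show "\<exists>k>0. W p - k *\<^sub>R co_orientation F p \<in> tangent_space ?S p" by metis
  qed
  show "\<forall>p\<in>?S. \<forall>v. (\<forall>i<DIM(('n, 'm) phase) - 1. v i \<in> tangent_space ?S p) \<longrightarrow>
      \<bar>contract (W p) Upsilon v\<bar> = volume_density (DIM(('n, 'm) phase) - 1) (induced_metric ?S W p) v"
  proof
    fix p assume p: "p \<in> ?S"
    have "K (fst p) = \<kappa>" using D[OF p] K_const by auto
    then show "\<forall>v. (\<forall>i<DIM(('n, 'm) phase) - 1. v i \<in> tangent_space ?S p) \<longrightarrow>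
      \<bar>contract (W p) Upsilon v\<bar> = volume_density (DIM(('n, 'm) phase) - 1) (induced_metric ?S W p) v"
      using c_\<kappa>(2) ck dW[OF p] by (subst volume_condition_iff[where W = W, OF p]) simp_all
  qed
  show "parallel_form ?S W (DIM(('n, 'm) phase) - 1) (\<lambda>p. contract (W p) Upsilon)"
    unfolding parallel_form_def DIM_phase
  proof (intro allI impI ballI)
    fix X Y p assume XY: "tangent_field ?S X \<and> (\<forall>i<2 * CARD('n). tangent_field ?S (Y i))" and p: "p \<in> ?S"
    have X: "dF p (X p) = 0" and Y: "\<And>i. i < 2 * CARD('n) \<Longrightarrow> dF p (Y i p) = 0"
      using XY p by (auto simp: tangent_field_def tangent_level)
    have Wp: "dF p (W p) \<noteq> 0" using dW[OF p] ck by simp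
    obtain W' where W': "(W has_derivative W') (at p within ?S)"
      using smooth_along_has_derivative[OF smooth_along_cV[OF W] p] by blast
    have "dF p (flat_deriv ?S W p (X p)) = - hess p (X p) (W p)" by (rule flat_deriv_dF[OF p X W' dW])
    also have "hess p (X p) (W p) = 0"
    proof -
      have u: "fst p \<in> M" using D[OF p] by auto
      have "hess p (X p) (V p) = 0" using hess_V[OF D[OF p]] hess_sym[OF u] by metis
      then show ?thesis using W[OF p] by (simp add: linear_cmul[OF linear_hess_right[OF u]])
    qed
    finally have "contract (flat_deriv ?S W p (X p)) Upsilon (\<lambda>i. Y i p) = 0"
      by (intro contract_tangent_zero[OF D[OF p]] Y) simp
    then show "flat_deriv ?S (\<lambda>q. contract (W q) Upsilon (\<lambda>i. Y i q)) p (X p) =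
        (\<Sum>i<2 * CARD('n). contract (W p) Upsilon ((\<lambda>j. Y j p)(i := induced_connection ?S W X (Y i) p)))"
      using parallel_defect[where W = W and X = X and Y = Y, OF p Wp smooth_along_cV[OF W] X] XY by simp
  qed
qed

lemma is_equiaffine_normal_unique:
  assumes eq: "is_equiaffine_normal Upsilon (level_set M F t) (co_orientation F) W"
    and p: "p \<in> level_set M F t"
  shows "W p = c *\<^sub>R V p"
proof -
  let ?S = "level_set M F t"
  have D: "q \<in> D" if "q \<in> ?S" for q using that level_subset by blast
  have tr: "transversal ?S W"
    and co: "\<And>q. q \<in> ?S \<Longrightarrow> \<exists>k>0. W q - k *\<^sub>R co_orientation F q \<in> tangent_space ?S q"
    and vol: "\<And>q. q \<in> ?S \<Longrightarrow> \<forall>v. (\<forall>i<DIM(('n, 'm) phase) - 1. v i \<in> tangent_space ?S q) \<longrightarrow>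
      \<bar>contract (W q) Upsilon v\<bar> = volume_density (DIM(('n, 'm) phase) - 1) (induced_metric ?S W q) v"
    and par: "parallel_form ?S W (DIM(('n, 'm) phase) - 1) (\<lambda>p. contract (W p) Upsilon)"
    using eq unfolding is_equiaffine_normal_def by blast+
  have sm: "smooth_along ?S W" and nz: "\<And>q. q \<in> ?S \<Longrightarrow> dF q (W q) \<noteq> 0"
    using tr by (auto simp: transversal_def tangent_level)
  have dW: "dF q (W q) = c * \<kappa>" if q: "q \<in> ?S" for q
  proof -
    obtain k where k: "k > 0" "dF q (W q - k *\<^sub>R co_orientation F q) = 0"
      using co[OF q] by (auto simp: tangent_level[OF q])
    then have "dF q (W q) = - k * \<kappa>\<^sup>2"
      by (simp add: co_orientation_eq[OF D[OF q]] linear_add[OF linear_dF[OF D[OF q]]]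
          linear_cmul[OF linear_dF[OF D[OF q]]] dF_V_const[OF D[OF q]] power2_eq_square)
    then have neg: "dF q (W q) < 0" using k(1) \<kappa>_nonzero by simp
    have "K (fst q) = \<kappa>" using D[OF q] K_const by auto
    then have "\<bar>dF q (W q)\<bar> ^ (CARD('n) + 1) = \<bar>c * \<kappa>\<bar> ^ (CARD('n) + 1)"
      using volume_condition_iff[where W = W, OF q nz[OF q]] vol[OF q] c_\<kappa>(2) by simp
    then have "\<bar>dF q (W q)\<bar> = \<bar>c * \<kappa>\<bar>" by (rule power_eq_imp_eq_base) simp_all
    then show ?thesis using neg c_\<kappa>(1) by simp
  qed
  have pD: "p \<in> D" using D[OF p] .
  have u: "fst p \<in> M" using pD by auto
  obtain b where b: "\<And>i. i < 2 * CARD('n) \<Longrightarrow> dF p (b i) = 0"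
    "\<And>i j. i < 2 * CARD('n) \<Longrightarrow> j < 2 * CARD('n) \<Longrightarrow> hess p (b i) (b j) = (if j = i + CARD('n) \<or> i = j + CARD('n) then 1 else 0)"
    "contract (V p) Upsilon b = (-1) ^ CARD('n)"
    "\<And>v. dF p v = 0 \<Longrightarrow> v \<in> span (b ` {..<2 * CARD('n)})" using adapted_frame[OF pD] by blast
  obtain W' where W': "(W has_derivative W') (at p within ?S)" using smooth_along_has_derivative[OF sm p] by blast
  have hess0: "hess p x (W p) = 0" if x: "dF p x = 0" for x
  proof -
    \<comment> \<open>Parallelism is tested on an adapted frame at p, extended to tangent fields.
      The contraction of the volume form with V is nonzero on this frame, so the vanishing defect
      forces the derivative of W to be tangent.\<close>
    let ?Y = "\<lambda>i. proj (b i)"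
    have px: "proj x p = x" by (rule proj_tangent[OF x])
    have Yb: "contract w Upsilon (\<lambda>i. ?Y i p) = contract w Upsilon b" for w
      by (rule alt_form_cong[OF alt_form_contract_Upsilon]) (simp add: proj_tangent b(1))
    have "flat_deriv ?S (\<lambda>q. contract (W q) Upsilon (\<lambda>i. ?Y i q)) p (proj x p) =
        (\<Sum>i<2 * CARD('n). contract (W p) Upsilon ((\<lambda>j. ?Y j p)(i := induced_connection ?S W (proj x) (?Y i) p)))"
      using par[unfolded parallel_form_def DIM_phase, THEN spec[of _ "proj x"], THEN spec[of _ ?Y], THEN mp, THEN bspec[of _ _ p]]
      by (simp add: tangent_field_proj p)
    moreover have "flat_deriv ?S (\<lambda>q. contract (W q) Upsilon (\<lambda>i. ?Y i q)) p (proj x p) =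
        contract (flat_deriv ?S W p (proj x p)) Upsilon (\<lambda>i. ?Y i p) +
        (\<Sum>i<2 * CARD('n). contract (W p) Upsilon ((\<lambda>j. ?Y j p)(i := induced_connection ?S W (proj x) (?Y i) p)))"
      by (rule parallel_defect[where W = W and X = "proj x" and Y = ?Y, OF p nz[OF p] sm dF_proj[OF pD] tangent_field_proj])
    ultimately have "contract (flat_deriv ?S W p x) Upsilon b = 0" by (simp add: Yb px)
    then have "dF p (flat_deriv ?S W p x) = 0"
      using contract_transversal[where w = "flat_deriv ?S W p x" and v = b, OF pD b(1)] nonzero[OF u] by (simp add: b(3))
    then show ?thesis using flat_deriv_dF[OF p x W' dW] by simp
  qed
  have "W p - c *\<^sub>R V p = 0"
  proof (rule hess_nondegenerate[OF pD])
    show "dF p (W p - c *\<^sub>R V p) = 0"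
      by (simp add: linear_diff[OF linear_dF[OF pD]] dW[OF p] dF_cV[OF pD])
    fix x assume x: "dF p x = 0"
    have "hess p x (W p - c *\<^sub>R V p) = - c * hess p x (V p)"
      by (simp add: linear_diff[OF linear_hess_right[OF u]] linear_cmul[OF linear_hess_right[OF u]] hess0[OF x])
    also have "hess p x (V p) = 0" using hess_V[OF pD] hess_sym[OF u] by metis
    finally show "hess p (W p - c *\<^sub>R V p) x = 0" using hess_sym[OF u] by simp
  qed
  then show ?thesis by simp
qed

lemma equiaffine_normal_eq:
  assumes p: "p \<in> level_set M F t"
  shows "equiaffine_normal Upsilon (level_set M F t) (co_orientation F) p = c *\<^sub>R V p"
  unfolding equiaffine_normal_def
proof (rule the_equality)
  show "\<exists>W. is_equiaffine_normal Upsilon (level_set M F t) (co_orientation F) W \<and> c *\<^sub>R V p = W p"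
    using is_equiaffine_normal_cV[of t "\<lambda>q. c *\<^sub>R V q"] by blast
qed (use is_equiaffine_normal_unique p in blast)

section \<open>The shape operator, mean curvature and signature\<close>

definition dvv :: "'n rvec \<Rightarrow> 'n rvec \<Rightarrow> 'm rvec" where
  "dvv u = frechet_derivative vv (at u)"

text \<open>A linear map on the whole space, minus the derivative of c V, with which the shape
  operator agrees on tangent vectors; linearity and vanishing square are evident for it.\<close>

definition shape_map :: "('n, 'm) phase \<Rightarrow> ('n, 'm) phase \<Rightarrow> ('n, 'm) phase" where
  "shape_map p v = (0, - c *\<^sub>R dvv (fst p) (fst v))"

lemma cV_has_derivative:
  assumes p: "p \<in> D" shows "((\<lambda>q. c *\<^sub>R V q) has_derivative (\<lambda>v. - shape_map p v)) (at p)"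
proof -
  have "fst p \<in> M" using p by auto
  then have "(vv has_derivative dvv (fst p)) (at (fst p))"
    unfolding dvv_def by (rule smooth_on_has_derivative[OF smooth_vv])
  then have "((\<lambda>q. c *\<^sub>R (0 :: 'n rvec, vv (fst q))) has_derivative (\<lambda>v. c *\<^sub>R (0, dvv (fst p) (fst v)))) (at p)"
    by (intro has_derivative_scaleR_right has_derivative_Pair has_derivative_const has_derivative_lift)
  then show ?thesis by (simp add: V_eq[abs_def] shape_map_def[abs_def])
qed

lemma linear_shape_map: "p \<in> D \<Longrightarrow> linear (shape_map p)"
  using linear_compose_neg[OF has_derivative_linear[OF cV_has_derivative]] by simp

lemma shape_map_square: "p \<in> D \<Longrightarrow> shape_map p (shape_map p v) = 0"
proof -
  assume p: "p \<in> D"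
  then have "linear (dvv (fst p))"
    unfolding dvv_def using smooth_on_linear_derivative[OF smooth_vv] by auto
  then show ?thesis by (simp add: shape_map_def linear_0 zero_prod_def)
qed

context
  fixes t :: real and \<Sigma> assumes \<Sigma>: "\<Sigma> = level_set M F t"
begin

text \<open>Since dF(W) is constant on the level set and the Hessian annihilates V, the derivative
  of W is already tangent, so taking the tangential part changes nothing.\<close>

lemma
  assumes p: "p \<in> \<Sigma>" and v: "v \<in> tangent_space \<Sigma> p"
  shows equiaffine_shape_eq: "equiaffine_shape Upsilon \<Sigma> (co_orientation F) p v = shape_map p v"
    and shape_map_tangent: "shape_map p v \<in> tangent_space \<Sigma> p"
proof -
  let ?W = "equiaffine_normal Upsilon \<Sigma> (co_orientation F)"
  have p': "p \<in> level_set M F t" using p \<Sigma> by simp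
  have pD: "p \<in> D" using p' level_subset by blast
  have W: "?W q = c *\<^sub>R V q" if "q \<in> level_set M F t" for q using equiaffine_normal_eq[OF that] \<Sigma> by simp
  have dv: "dF p v = 0" using v p' by (simp add: \<Sigma> tangent_level)
  have fd: "flat_deriv \<Sigma> ?W p v = - shape_map p v"
    by (rule flat_deriv_eq_on[OF p v _ cV_has_derivative[OF pD]]) (use W \<Sigma> in simp)
  have Wd: "(?W has_derivative (\<lambda>v. - shape_map p v)) (at p within level_set M F t)"
    by (rule has_derivative_transform[OF p' _ has_derivative_at_withinI[OF cV_has_derivative[OF pD]]]) (rule W)
  have const: "dF q (?W q) = c * \<kappa>" if "q \<in> level_set M F t" for q
    using W[OF that] dF_cV[of q] that level_subset by auto
  have "dF p (flat_deriv \<Sigma> ?W p v) = - hess p v (?W p)"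
    using flat_deriv_dF[OF p' dv Wd const] \<Sigma> by simp
  also have "hess p v (?W p) = 0"
  proof -
    have u: "fst p \<in> M" using pD by auto
    have "hess p v (V p) = 0" using hess_V[OF pD] hess_sym[OF u] by metis
    then show ?thesis using W[OF p'] by (simp add: linear_cmul[OF linear_hess_right[OF u]])
  qed
  finally have z: "dF p (flat_deriv \<Sigma> ?W p v) = 0" by simp
  then show "shape_map p v \<in> tangent_space \<Sigma> p"
    using fd linear_neg[OF linear_dF[OF pD], of "shape_map p v"] by (simp add: \<Sigma> tangent_level[OF p'])
  have "dF p (?W p) \<noteq> 0" using const[OF p'] c_nonzero \<kappa>_nonzero by simp
  from tangential_part_eq[where T = ?W, OF p' this]
  have "tangential_part \<Sigma> ?W p (flat_deriv \<Sigma> ?W p v) = flat_deriv \<Sigma> ?W p v" using z \<Sigma> by simp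
  then show "equiaffine_shape Upsilon \<Sigma> (co_orientation F) p v = shape_map p v"
    by (simp add: equiaffine_shape_def induced_shape_def fd)
qed

lemma equiaffine_shape_square:
  assumes "p \<in> \<Sigma>" "v \<in> tangent_space \<Sigma> p"
  shows "equiaffine_shape Upsilon \<Sigma> (co_orientation F) p (equiaffine_shape Upsilon \<Sigma> (co_orientation F) p v) = 0"
proof -
  have "p \<in> D" using assms(1) \<Sigma> level_subset by blast
  then show ?thesis
    using equiaffine_shape_eq[OF assms] equiaffine_shape_eq[OF assms(1) shape_map_tangent[OF assms]] shape_map_square by simp
qed

lemma equiaffine_mean_curvature_zero:
  assumes p: "p \<in> \<Sigma>" shows "equiaffine_mean_curvature Upsilon \<Sigma> (co_orientation F) p = 0"
proof -
  have p': "p \<in> level_set M F t" using p \<Sigma> by simp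
  have pD: "p \<in> D" using p' level_subset by blast
  have "trace_on (tangent_space \<Sigma> p) (equiaffine_shape Upsilon \<Sigma> (co_orientation F) p) = 0"
    by (rule trace_on_square_zero[OF _ linear_shape_map[OF pD] shape_map_tangent[OF p] shape_map_square[OF pD] equiaffine_shape_eq[OF p]])
      (simp add: \<Sigma> tangent_level[OF p'] subspace_dF_kernel[OF pD])
  then show ?thesis by (simp add: equiaffine_mean_curvature_def)
qed

lemma equiaffine_metric_eq:
  assumes p: "p \<in> \<Sigma>" and v: "dF p v = 0" "dF p w = 0"
  shows "equiaffine_metric Upsilon \<Sigma> (co_orientation F) p v w = - hess p v w / (c * \<kappa>)"
proof -
  have p': "p \<in> level_set M F t" using p \<Sigma> by simp
  have pD: "p \<in> D" using p' level_subset by blast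
  have dW: "dF p (equiaffine_normal Upsilon \<Sigma> (co_orientation F) p) = c * \<kappa>"
    using equiaffine_normal_eq[OF p'] dF_cV[OF pD] \<Sigma> by simp
  then have "dF p (equiaffine_normal Upsilon \<Sigma> (co_orientation F) p) \<noteq> 0" using c_nonzero \<kappa>_nonzero by simp
  from induced_metric_eq[where T = "equiaffine_normal Upsilon \<Sigma> (co_orientation F)", OF p' this v] show ?thesis
    using dW unfolding equiaffine_metric_def \<Sigma> by simp
qed

lemma equiaffine_metric_signature:
  assumes p: "p \<in> \<Sigma>"
  shows "has_signature (tangent_space \<Sigma> p) (equiaffine_metric Upsilon \<Sigma> (co_orientation F) p) CARD('n) CARD('n)"
proof -
  have p': "p \<in> level_set M F t" using p \<Sigma> by simp
  have pD: "p \<in> D" using p' level_subset by blast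
  have u: "fst p \<in> M" using pD by auto
  have T: "tangent_space \<Sigma> p = {v. dF p v = 0}" using tangent_level[OF p'] \<Sigma> by simp
  obtain b where b: "\<And>i. i < 2 * CARD('n) \<Longrightarrow> dF p (b i) = 0"
    "\<And>i j. i < 2 * CARD('n) \<Longrightarrow> j < 2 * CARD('n) \<Longrightarrow> hess p (b i) (b j) = (if j = i + CARD('n) \<or> i = j + CARD('n) then 1 else 0)"
    "contract (V p) Upsilon b = (-1) ^ CARD('n)"
    "\<And>v. dF p v = 0 \<Longrightarrow> v \<in> span (b ` {..<2 * CARD('n)})" using adapted_frame[OF pD] by blast
  \<comment> \<open>The metric is the Hessian divided by 2 s. A hyperbolic pair b, b' gives b + s b'
    and b - s b' with Hessian values 2 s and -2 s, that is, of length 1 and -1.\<close>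
  define s where "s = - (c * \<kappa>) / 2"
  have s: "s > 0" using c_\<kappa>(1) by (simp add: s_def)
  have ck: "- x / (c * \<kappa>) = x / (2 * s)" for x using s by (simp add: s_def field_simps)
  have ck': "2 * s / (c * \<kappa>) = - 1" using c_nonzero \<kappa>_nonzero by (simp add: s_def)
  define e where "e i = (if i < CARD('n) then b i + s *\<^sub>R b (i + CARD('n)) else b (i - CARD('n)) - s *\<^sub>R b i)" for i
  note lin = linear_dF[OF pD] linear_hess_left[OF u] linear_hess_right[OF u]
  have de: "dF p (e i) = 0" if "i < 2 * CARD('n)" for i
    using that b(1) by (simp add: e_def linear_add[OF lin(1)] linear_diff[OF lin(1)] linear_cmul[OF lin(1)])
  have he: "hess p (e i) (e j) = (if i \<noteq> j then 0 else if i < CARD('n) then 2 * s else - 2 * s)"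
    if "i < 2 * CARD('n)" "j < 2 * CARD('n)" for i j
  proof -
    consider "i < CARD('n)" "j < CARD('n)" | "i < CARD('n)" "\<not> j < CARD('n)" | "\<not> i < CARD('n)" "j < CARD('n)" | "\<not> i < CARD('n)" "\<not> j < CARD('n)" by blast
    then show ?thesis
      by cases (use that in \<open>auto simp: e_def b(2) linear_add[OF lin(2)] linear_diff[OF lin(2)] linear_cmul[OF lin(2)]
          linear_add[OF lin(3)] linear_diff[OF lin(3)] linear_cmul[OF lin(3)]\<close>)
  qed
  have "span (e ` {..<2 * CARD('n)}) = {v. dF p v = 0}"
  proof
    show "span (e ` {..<2 * CARD('n)}) \<subseteq> {v. dF p v = 0}"
      by (rule span_minimal) (use de subspace_dF_kernel[OF pD] in auto)
    have "b i \<in> span (e ` {..<2 * CARD('n)})" if i: "i < 2 * CARD('n)" for i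
    proof (cases "i < CARD('n)")
      case True
      have "e i \<in> span (e ` {..<2 * CARD('n)})" "e (i + CARD('n)) \<in> span (e ` {..<2 * CARD('n)})"
        using True by (auto intro!: span_base)
      then have "(1 / 2) *\<^sub>R (e i + e (i + CARD('n))) \<in> span (e ` {..<2 * CARD('n)})" by (intro span_mul span_add)
      moreover have "(1 / 2) *\<^sub>R (e i + e (i + CARD('n))) = b i" using True by (simp add: e_def flip: scaleR_2)
      ultimately show ?thesis by simp
    next
      case False
      have "e (i - CARD('n)) \<in> span (e ` {..<2 * CARD('n)})" "e i \<in> span (e ` {..<2 * CARD('n)})"
        using False i by (auto intro!: span_base)
      then have "(1 / (2 * s)) *\<^sub>R (e (i - CARD('n)) - e i) \<in> span (e ` {..<2 * CARD('n)})" by (intro span_mul span_diff)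
      moreover have "e (i - CARD('n)) - e i = (2 * s) *\<^sub>R b i"
      proof -
        have "i - CARD('n) < CARD('n)" "i - CARD('n) + CARD('n) = i" using False i by auto
        then show ?thesis using False by (simp add: e_def scaleR_2 flip: scaleR_scaleR)
      qed
      ultimately show ?thesis using s by simp
    qed
    then have "span (b ` {..<2 * CARD('n)}) \<subseteq> span (e ` {..<2 * CARD('n)})" by (intro span_minimal) auto
    then show "{v. dF p v = 0} \<subseteq> span (e ` {..<2 * CARD('n)})" using b(4) by blast
  qed
  moreover have "equiaffine_metric Upsilon \<Sigma> (co_orientation F) p (e i) (e j) =
      (if i \<noteq> j then 0 else if i < CARD('n) then 1 else -1)" if "i < CARD('n) + CARD('n)" "j < CARD('n) + CARD('n)" for i j
    using that s by (auto simp add: equiaffine_metric_eq[OF p de de] he ck ck')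
  ultimately show ?thesis
    unfolding has_signature_def T using dim_dF_kernel[OF pD] by (intro conjI exI[of _ e]) (simp_all add: mult_2)
qed

end

end

section \<open>The contact form\<close>

lemma interleave_nth:
  "length es = length ys \<Longrightarrow> i < 2 * length es \<Longrightarrow>
     interleave es ys ! i = (if even i then es ! (i div 2) else ys ! (i div 2))"
proof (induction es ys arbitrary: i rule: list_induct2)
  case (Cons e es y ys)
  consider "i = 0" | "i = 1" | j where "i = Suc (Suc j)" "j < 2 * length es"
    using Cons.prems by (cases i; cases "i - 1") auto
  then show ?case by cases (use Cons.IH in auto)
qed simp

text \<open>Extend z to a basis: a form of top degree is determined by its value there, and z is one
  of the arguments.\<close>

lemma alt_form_vanishing_arg:
  fixes \<alpha> :: "(nat \<Rightarrow> 'a::euclidean_space) \<Rightarrow> real"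
  assumes \<alpha>: "alt_form DIM('a) \<alpha>" and z: "z \<noteq> 0" and van: "\<And>v i. i < DIM('a) \<Longrightarrow> v i = z \<Longrightarrow> \<alpha> v = 0"
  shows "\<alpha> v = 0"
proof -
  obtain B where B: "{z} \<subseteq> B" "independent B" "UNIV \<subseteq> span B"
    using maximal_independent_subset_extend[of "{z}" UNIV] z by auto
  have "card B = DIM('a)" using basis_card_eq_dim[of B UNIV] B by simp
  moreover have "finite B" using B(2) by (rule independent_imp_finite)
  ultimately obtain b where b: "bij_betw b {..<DIM('a)} B" by (metis bij_betw_from_nat_into_finite)
  then obtain i where i: "i < DIM('a)" "b i = z" using B(1) by (auto simp: bij_betw_def)
  have zero: "alt_form DIM('a) (\<lambda>v :: nat \<Rightarrow> 'a. 0)"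
    by (auto simp: alt_form_def intro: linear_zero)
  show ?thesis
  proof (rule alt_form_unique[OF \<alpha> zero, of b])
    show "\<alpha> b = 0" by (rule van[of i b, OF i])
    show "v i \<in> span (b ` {..<DIM('a)})" for i using b B(3) by (auto simp: bij_betw_def)
  qed
qed

text \<open>The coordinate frame, on which the volume form is 1; evaluating there reads off the
  coefficient of a top form.\<close>

definition std_frame :: "nat \<Rightarrow> ('n::{finite,linorder}, 'm::{finite,linorder}) phase" where
  "std_frame i = (if i < CARD('n) then (axis (enum ! i) 1, 0) else (0, axis (enum ! (i - CARD('n))) 1))"

lemma Upsilon_std_frame: "Upsilon (std_frame :: nat \<Rightarrow> ('n::{finite,linorder}, 'm::{finite,linorder}) phase) = 1"
proof -
  have "Upsilon (std_frame :: nat \<Rightarrow> ('n, 'm) phase) =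
     det_form (\<lambda>i. fst ((std_frame :: nat \<Rightarrow> ('n, 'm) phase) i)) * det_form (\<lambda>i. snd ((std_frame :: nat \<Rightarrow> ('n, 'm) phase) (CARD('n) + i)))"
    by (rule Upsilon_split) (simp add: std_frame_def)
  also have "det_form (\<lambda>i. fst ((std_frame :: nat \<Rightarrow> ('n, 'm) phase) i)) = det_form (\<lambda>i. axis (enum ! i) 1 :: 'n rvec)"
    by (rule alt_form_cong[OF alt_form_det_form]) (simp add: std_frame_def)
  also have "(\<lambda>i. snd ((std_frame :: nat \<Rightarrow> ('n, 'm) phase) (CARD('n) + i))) = (\<lambda>i. axis (enum ! i) 1)"
    by (simp add: std_frame_def fun_eq_iff)
  finally show ?thesis by (simp add: det_form_axis)
qed

context affine_family
begin

lemma beta_eq: "beta A p v = A (fst p) \<bullet> snd (v 0)"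
  by (simp add: beta_def inner_vec_def)

lemma alt_form_beta: "alt_form 1 (beta A p)"
  by (auto simp: alt_form_def beta_eq inner_add_right intro!: linearI)

lemma beta_has_derivative:
  assumes "p \<in> D"
  shows "((\<lambda>q. beta A q v) has_derivative (\<lambda>h. dA (fst p) (fst h) \<bullet> snd (v 0))) (at p)"
proof -
  have u: "fst p \<in> M" using assms by auto
  show ?thesis unfolding beta_eq
    by (rule has_derivative_inner_left[OF has_derivative_lift[OF A_has_derivative[OF u]]])
qed

lemma Omega_eq:
  assumes "p \<in> D"
  shows "Omega A p v = dA (fst p) (fst (v 0)) \<bullet> snd (v 1) - dA (fst p) (fst (v 1)) \<bullet> snd (v 0)"
proof -
  have "frechet_derivative (\<lambda>q. beta A q w) (at p) = (\<lambda>h. dA (fst p) (fst h) \<bullet> snd (w 0))" for w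
    using frechet_derivative_at[OF beta_has_derivative[OF assms, of w]] by simp
  then show ?thesis by (simp add: Omega_def ext_deriv_def)
qed

lemma dA_axis_expand: "u \<in> M \<Longrightarrow> dA u x = (\<Sum>I\<in>UNIV. x $ I *\<^sub>R dA u (axis I 1))"
proof -
  assume u: "u \<in> M"
  have "x = (\<Sum>I\<in>UNIV. x $ I *\<^sub>R axis I 1)"
    by (simp add: vec_eq_iff axis_def if_distrib[of "(*) _"] cong: if_cong)
  then show ?thesis
    using linear_sum[OF linear_dA[OF u]] linear_cmul[OF linear_dA[OF u]] by (metis (no_types, lifting) sum.cong)
qed

text \<open>Displays \<Omega> as the sum of du^I wedge <A_I, dx>, the shape required by
  \<open>wedge_power2_frame\<close>.\<close>

lemma Omega_sum:
  assumes p: "p \<in> D"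
  shows "Omega A p = (\<lambda>v. \<Sum>I\<in>UNIV. fst (v 0) $ I * (dA (fst p) (axis I 1) \<bullet> snd (v 1)) -
     fst (v 1) $ I * (dA (fst p) (axis I 1) \<bullet> snd (v 0)))"
proof
  fix v :: "nat \<Rightarrow> ('n, 'm) phase"
  have "fst p \<in> M" using p by auto
  from dA_axis_expand[OF this] have eq: "dA (fst p) x \<bullet> y = (\<Sum>I\<in>UNIV. x $ I * (dA (fst p) (axis I 1) \<bullet> y))" for x y
    by (metis (no_types, lifting) inner_scaleR_left inner_sum_left sum.cong)
  show "Omega A p v = (\<Sum>I\<in>UNIV. fst (v 0) $ I * (dA (fst p) (axis I 1) \<bullet> snd (v 1)) -
     fst (v 1) $ I * (dA (fst p) (axis I 1) \<bullet> snd (v 0)))"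
    unfolding Omega_eq[OF p] sum_subtractf
    using eq[of "fst (v 0)" "snd (v 1)"] eq[of "fst (v 1)" "snd (v 0)"] by (simp only:)
qed

lemma alt_form_Omega:
  assumes p: "p \<in> D" shows "alt_form 2 (Omega A p)"
proof -
  have u: "fst p \<in> M" using p by auto
  have l: "linear (\<lambda>x. dA (fst p) (fst x) \<bullet> z - dA (fst p) y \<bullet> snd x)"
    "linear (\<lambda>x. dA (fst p) y \<bullet> snd x - dA (fst p) (fst x) \<bullet> z)" for y z
    by (rule linearI; simp add: linear_add[OF linear_dA[OF u]] linear_cmul[OF linear_dA[OF u]] algebra_simps inner_add_left inner_add_right)+
  show ?thesis
    unfolding alt_form_def Omega_eq[OF p] using l by (auto simp: less_2_cases_iff)
qed

lemma Omega_bilinear: "p \<in> D \<Longrightarrow> two_form_at (Omega A p) v w = dA (fst p) (fst v) \<bullet> snd w - dA (fst p) (fst w) \<bullet> snd v"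
  by (simp add: two_form_at_def Omega_eq)

definition contact_top :: "('n, 'm) phase \<Rightarrow> (nat \<Rightarrow> ('n, 'm) phase) \<Rightarrow> real" where
  "contact_top p = wedge 1 (2 * CARD('n)) (beta A p) (wedge_power2 (Omega A p) CARD('n))"

lemma alt_form_contact_top:
  assumes p: "p \<in> D" shows "alt_form (CARD('n) + CARD('m)) (contact_top p)"
proof -
  have "CARD('n) + CARD('m) = 1 + 2 * CARD('n)" using dims by simp
  then show ?thesis
    unfolding contact_top_def
    using alt_form_wedge[OF alt_form_beta alt_form_wedge_power2[OF alt_form_Omega[OF p], of "CARD('n)"]] by (simp only:)
qed

text \<open>If K = 0, some nonzero x is orthogonal to A and to all A_I; then (0, x) is annihilated
  by \<beta> and by \<Omega>, and both sides vanish. Otherwise both sides are compared on V, e_1,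
  y_1, e_2, y_2, ...: \<beta> contributes K, the power of \<Omega> contributes n!, and sorting this
  frame for the volume form gives the sign with exponent 1 + ... + n.\<close>

lemma contact_top_eq:
  assumes p: "p \<in> D"
  shows "contact_top p v = (-1) ^ (CARD('n) * (CARD('n) + 1) div 2) * fact CARD('n) * det_A_dA A (fst p) * Upsilon v"
proof -
  let ?s = "(-1) ^ (CARD('n) * (CARD('n) + 1) div 2) :: real"
  define u where "u = fst p"
  have u: "u \<in> M" "fst p \<in> M" using p by (auto simp: u_def)
  note altO = alt_form_wedge_power2[OF alt_form_Omega[OF p]]
  show ?thesis
  proof (cases "det_A_dA A u = 0")
    case True
    then have "det (transpose (col_mat (A u) (jacobian A (at u)))) = 0"
      using det_col[of "A u" u] by (simp add: A_vv det_transpose)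
    then obtain x where x: "transpose (col_mat (A u) (jacobian A (at u))) *v x = 0" "x \<noteq> 0"
      by (metis invertible_det_nz invertible_left_inverse matrix_left_invertible_ker)
    then have col: "(\<Sum>i\<in>UNIV. col_mat (A u) (jacobian A (at u)) $ i $ k * x $ i) = 0" for k
      by (simp add: vec_eq_iff matrix_vector_mult_def transpose_def)
    have Ax: "A u \<bullet> x = 0"
      using col[of "ith 1"] pos_ith[of 0, where 'k='m] dims by (simp add: col_mat_def inner_vec_def)
    have Cx: "dA u (axis I 1) \<bullet> x = 0" for I
    proof -
      have "pos (ith (Suc (pos I)) :: 'm) = Suc (pos I)" using pos_bounds(2)[of I] dims by (intro pos_ith) simp
      then show ?thesis using col[of "ith (Suc (pos I))"] pos_bounds(1)[of I] by (simp add: col_mat_def dA_axis[OF u(1)] ith_pos)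
    qed
    then have dx: "dA u z \<bullet> x = 0" for z by (subst dA_axis_expand[OF u(1)]) (simp add: inner_sum_left)
    let ?z = "(0 :: 'n rvec, x)"
    have O0: "Omega A p w = 0" if "i < 2" "w i = ?z" for w and i :: nat
      using that dx linear_0[OF linear_dA[OF u(1)]] by (auto simp: Omega_eq[OF p] u_def[symmetric] less_2_cases_iff)
    have "contact_top p v = 0"
    proof (rule alt_form_vanishing_arg[of _ ?z])
      show "alt_form DIM(('n, 'm) phase) (contact_top p)" using alt_form_contact_top[OF p] by simp
      show "?z \<noteq> 0" using x(2) by (simp add: zero_prod_def)
      fix w :: "nat \<Rightarrow> ('n, 'm) phase" and i assume i: "i < DIM(('n, 'm) phase)" "w i = ?z"
      show "contact_top p w = 0"
        unfolding contact_top_def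
      proof (rule wedge_kernel_arg[of 1 ?z _ "2 * CARD('n)" _ i w])
        show "beta A p w' = 0" if "j < 1" "w' j = ?z" for w' j using that Ax by (simp add: beta_eq u_def[symmetric])
        show "wedge_power2 (Omega A p) CARD('n) w' = 0" if "j < 2 * CARD('n)" "w' j = ?z" for w' j
          by (rule wedge_power2_kernel_arg[of ?z "Omega A p" j "CARD('n)" w']) (use O0 that in auto)
        show "i < 1 + 2 * CARD('n)" using i(1) dims by simp
      qed (rule i(2))
    qed
    then show ?thesis using True by (simp add: u_def)
  next
    case False
    obtain y where y: "\<And>J. A u \<bullet> y J = 0" "\<And>I J. dA u (axis I 1) \<bullet> y J = (if I = J then 1 else 0)"
      "det_form (case_nat (vv u) (\<lambda>k. y (enum ! k))) = 1" using dual_frame[OF u(1) False] by metis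
    have vvnz: "vv u \<noteq> 0" using False by (auto simp: A_vv[symmetric])
    define e where "e I = (axis I 1 :: 'n rvec, 0 :: 'm rvec)" for I
    define Y where "Y J = (0 :: 'n rvec, y J)" for J
    let ?es = "map e enum" and ?ys = "map Y enum" and ?V = "(0 :: 'n rvec, vv u)"
    have len: "length ?es = length ?ys" "length ?es = CARD('n)" "length ?ys = CARD('n)" by (simp_all add: enum_props)
    let ?f = "(!) ([] @ [?V] @ interleave ?es ?ys)"
    have alt: "alt_form (CARD('n) + CARD('m)) (Upsilon :: (nat \<Rightarrow> ('n, 'm) phase) \<Rightarrow> real)" by (rule alt_form_Upsilon)
    have fS: "?f (Suc i) = (if even i then e (enum ! (i div 2)) else Y (enum ! (i div 2)))" if "i < 2 * CARD('n)" for i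
      using that interleave_nth[OF len(1), of i] by (simp add: enum_props)
    have "contact_top p ?f = beta A p ?f * wedge_power2 (Omega A p) CARD('n) (\<lambda>i. ?f (1 + i))"
      unfolding contact_top_def
    proof (rule wedge_split[OF alt_form_beta altO])
      fix w and i j :: nat assume ij: "i < 1" "1 \<le> j" "j < 1 + 2 * CARD('n)" "w i = ?f j"
      then obtain k where "j = Suc k" "k < 2 * CARD('n)" by (cases j) auto
      then show "beta A p w = 0" using ij fS[of k] y(1) by (auto simp: beta_eq u_def[symmetric] e_def Y_def)
    qed
    also have "beta A p ?f = det_A_dA A u" by (simp add: beta_eq u_def[symmetric] A_vv)
    also have "wedge_power2 (Omega A p) CARD('n) (\<lambda>i. ?f (1 + i)) =
        wedge_power2 (Omega A p) CARD('n) (\<lambda>i. if even i then e (enum ! (i div 2)) else Y (enum ! (i div 2)))"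
      by (rule alt_form_cong[OF altO]) (use fS in simp)
    also have "\<dots> = fact CARD('n)"
      unfolding Omega_sum[OF p]
    proof (rule wedge_power2_frame)
      show "linear (\<lambda>w :: ('n, 'm) phase. fst w $ I)" for I by (rule linearI) auto
      show "linear (\<lambda>w :: ('n, 'm) phase. dA (fst p) (axis I 1) \<bullet> snd w)" for I
        by (rule linearI) (auto simp: inner_add_right)
      show "inj_on ((!) (enum :: 'n list)) {..<CARD('n)}" by (rule inj_on_nth) (simp_all add: enum_props)
    qed (use y in \<open>auto simp: e_def Y_def u_def[symmetric] axis_def\<close>)
    finally have L: "contact_top p ?f = det_A_dA A u * fact CARD('n)" .
    have "Upsilon ?f = (-1) ^ (\<Sum>i<length ?es. length [?V] + i) * Upsilon ((!) ([] @ ?es @ [?V] @ ?ys))"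
      by (rule alt_form_interleave[OF alt len(1)]) (simp add: dims enum_props)
    also have "(\<Sum>i<length ?es. length [?V] + i) = CARD('n) * (CARD('n) + 1) div 2"
    proof -
      have "2 * (\<Sum>i<k. Suc i) = k * (k + 1)" for k by (induction k) auto
      from this[of "CARD('n)"] show ?thesis by (simp add: enum_props)
    qed
    also have "Upsilon ((!) ([] @ ?es @ [?V] @ ?ys)) =
        det_form (\<lambda>i. fst (([] @ ?es @ [?V] @ ?ys) ! i)) * det_form (\<lambda>i. snd (([] @ ?es @ [?V] @ ?ys) ! (CARD('n) + i)))"
    proof (rule Upsilon_split)
      fix j assume j: "CARD('n) \<le> j" "j < CARD('n) + CARD('m)"
      show "fst (([] @ ?es @ [?V] @ ?ys) ! j) = 0"
      proof (cases "j - CARD('n)")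
        case 0
        then show ?thesis using j by (simp add: nth_append len enum_props)
      next
        case (Suc k)
        then have "k < CARD('n)" using j dims by linarith
        then show ?thesis using j Suc by (simp add: nth_append len enum_props Y_def)
      qed
    qed
    also have "det_form (\<lambda>i. fst (([] @ ?es @ [?V] @ ?ys) ! i)) = det_form (\<lambda>i. axis (enum ! i) 1 :: 'n rvec)"
      by (rule alt_form_cong[OF alt_form_det_form]) (simp add: nth_append len enum_props e_def)
    also have "det_form (\<lambda>i. snd (([] @ ?es @ [?V] @ ?ys) ! (CARD('n) + i))) = det_form (case_nat (vv u) (\<lambda>k. y (enum ! k)))"
    proof (rule alt_form_cong[OF alt_form_det_form])
      fix i assume "i < CARD('m)"
      then show "snd (([] @ ?es @ [?V] @ ?ys) ! (CARD('n) + i)) = (case i of 0 \<Rightarrow> vv u | Suc k \<Rightarrow> y (enum ! k))"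
        using dims by (cases i) (simp_all add: nth_append len enum_props Y_def)
    qed
    finally have R: "Upsilon ?f = ?s" by (simp add: det_form_axis y(3))
    have "contact_top p v = ?s * fact CARD('n) * det_A_dA A (fst p) * Upsilon v"
    proof (rule alt_form_unique[where b = ?f, OF alt_form_contact_top[OF p] alt_form_scale[OF alt]])
      have "?s * ?s = 1" by (simp flip: power_add mult_2 power_mult)
      then show "contact_top p ?f = ?s * fact CARD('n) * det_A_dA A (fst p) * Upsilon ?f"
        unfolding L R by (simp add: u_def mult_ac)
      fix i
      let ?B = "?f ` {..<CARD('n) + CARD('m)}"
      have V: "?V \<in> ?B" by (rule image_eqI[of _ _ 0]) auto
      have e: "e I \<in> ?B" for I
      proof (rule image_eqI)
        show "e I = ?f (Suc (2 * (pos I - 1)))" using pos_pred_less'[of I] by (subst fS) (simp_all add: enum_pos')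
        show "Suc (2 * (pos I - 1)) \<in> {..<CARD('n) + CARD('m)}" using pos_pred_less'[of I] dims by simp
      qed
      have Y: "Y I \<in> ?B" for I
      proof (rule image_eqI)
        show "Y I = ?f (Suc (Suc (2 * (pos I - 1))))" using pos_pred_less'[of I] by (subst fS) (simp_all add: enum_pos')
        show "Suc (Suc (2 * (pos I - 1))) \<in> {..<CARD('n) + CARD('m)}" using pos_pred_less'[of I] dims by simp
      qed
      define x where "x = snd (v i) - (\<Sum>J\<in>UNIV. (dA u (axis J 1) \<bullet> snd (v i)) *\<^sub>R y J)"
      have "dA u (axis I 1) \<bullet> x = 0" for I
        by (simp add: x_def inner_diff_right inner_sum_right y(2) if_distrib[of "(*) _"] cong: if_cong)
      then have "dA u z \<bullet> x = 0" for z by (subst dA_axis_expand[OF u(1)]) (simp add: inner_sum_left)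
      from orthogonal_range[OF u(1) vvnz this] obtain a where a: "x = a *\<^sub>R vv u" by blast
      \<comment> \<open>The coefficients of the Y are read off by duality; the remaining x-part is
        orthogonal to the range of dA and hence a multiple of V.\<close>
      have "v i = (\<Sum>I\<in>UNIV. fst (v i) $ I *\<^sub>R e I) + a *\<^sub>R ?V + (\<Sum>J\<in>UNIV. (dA u (axis J 1) \<bullet> snd (v i)) *\<^sub>R Y J)"
      proof (rule prod_eqI)
        show "fst (v i) = fst ((\<Sum>I\<in>UNIV. fst (v i) $ I *\<^sub>R e I) + a *\<^sub>R ?V + (\<Sum>J\<in>UNIV. (dA u (axis J 1) \<bullet> snd (v i)) *\<^sub>R Y J))"
          by (simp add: fst_sum e_def Y_def vec_eq_iff axis_def if_distrib[of "(*) _"] cong: if_cong)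
        show "snd (v i) = snd ((\<Sum>I\<in>UNIV. fst (v i) $ I *\<^sub>R e I) + a *\<^sub>R ?V + (\<Sum>J\<in>UNIV. (dA u (axis J 1) \<bullet> snd (v i)) *\<^sub>R Y J))"
          using a by (simp add: snd_sum e_def Y_def x_def algebra_simps)
      qed
      also have "\<dots> \<in> span ?B"
        by (intro span_add span_sum span_mul span_base V e Y)
      finally show "v i \<in> span ?B" .
    qed
    then show ?thesis .
  qed
qed

lemma contact_top_const_iff:
  "(\<forall>p\<in>D. contact_top p = (\<lambda>v. (-1) ^ (CARD('n) * (CARD('n) + 1) div 2) * fact CARD('n) * \<kappa> * Upsilon v)) \<longleftrightarrow>
   (\<forall>u\<in>M. det_A_dA A u = \<kappa>)"
proof
  assume L: "\<forall>p\<in>D. contact_top p = (\<lambda>v. (-1) ^ (CARD('n) * (CARD('n) + 1) div 2) * fact CARD('n) * \<kappa> * Upsilon v)"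
  show "\<forall>u\<in>M. det_A_dA A u = \<kappa>"
  proof
    fix u assume u: "u \<in> M"
    then have p: "(u, 0) \<in> D" by simp
    have "contact_top (u, 0) std_frame = (-1) ^ (CARD('n) * (CARD('n) + 1) div 2) * fact CARD('n) * \<kappa> * Upsilon (std_frame :: nat \<Rightarrow> ('n, 'm) phase)"
      using L p by simp
    then show "det_A_dA A u = \<kappa>" by (simp add: contact_top_eq[OF p] Upsilon_std_frame)
  qed
next
  assume R: "\<forall>u\<in>M. det_A_dA A u = \<kappa>"
  show "\<forall>p\<in>D. contact_top p = (\<lambda>v. (-1) ^ (CARD('n) * (CARD('n) + 1) div 2) * fact CARD('n) * \<kappa> * Upsilon v)"
  proof (intro ballI ext)
    fix p v assume p: "p \<in> D"
    then have "det_A_dA A (fst p) = \<kappa>" using R by auto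
    then show "contact_top p v = (-1) ^ (CARD('n) * (CARD('n) + 1) div 2) * fact CARD('n) * \<kappa> * Upsilon v"
      by (simp add: contact_top_eq[OF p])
  qed
qed

text \<open>Both sides are n-forms on a space of dimension n; on the unit vectors the pullback is
  det [A|dA] = K.\<close>

lemma pullback_mu:
  assumes u: "u \<in> M" shows "pullback A mu_form u v = det_A_dA A u * det_form v"
proof -
  have alt: "alt_form (Suc CARD('n)) (det_form :: (nat \<Rightarrow> 'm rvec) \<Rightarrow> real)" using alt_form_det_form[where 'k='m] dims by simp
  have "contract (A u) det_form (\<lambda>i. dA u (v i)) = det_A_dA A u * det_form v"
  proof (rule alt_form_unique[where b = "\<lambda>k. axis (enum ! k) 1",
        OF alt_form_linear_image[OF alt_form_contract[OF alt] linear_dA[OF u]] alt_form_scale[OF alt_form_det_form]])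
    have "(\<lambda>i. dA u (axis (enum ! i :: 'n) 1)) = (\<lambda>k. column (enum ! k :: 'n) (jacobian A (at u)))"
      by (simp add: jac[OF u] matrix_vector_mult_basis)
    then show "contract (A u) det_form (\<lambda>i. dA u (axis (enum ! i) 1)) = det_A_dA A u * det_form (\<lambda>k. axis (enum ! k) 1)"
      using det_col[of "A u" u] by (simp add: contract_def det_form_col_mat det_form_axis A_vv)
  qed (rule span_axis_enum)
  then show ?thesis by (simp add: pullback_def mu_form_def dA_def)
qed

lemma pullback_mu_const_iff:
  "(\<forall>u\<in>M. pullback A mu_form u = (\<lambda>v. \<kappa> * det_form v)) \<longleftrightarrow> (\<forall>u\<in>M. det_A_dA A u = \<kappa>)"
proof -
  have "pullback A mu_form u = (\<lambda>v. \<kappa> * det_form v) \<longleftrightarrow> det_A_dA A u = \<kappa>" if u: "u \<in> M" for u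
  proof
    assume "pullback A mu_form u = (\<lambda>v. \<kappa> * det_form v)"
    from fun_cong[OF this, of "\<lambda>k. axis (enum ! k) 1"] show "det_A_dA A u = \<kappa>"
      by (simp add: pullback_mu[OF u] det_form_axis)
  qed (simp add: pullback_mu[OF u] fun_eq_iff)
  then show ?thesis by simp
qed

lemma smooth_beta: "smooth_on D (\<lambda>p. beta A p v)"
  unfolding beta_eq by (rule smooth_on_inner[OF openD smooth_lift[OF smA] smooth_on_const[OF openD]])

lemma contact_form_iff: "contact_form D (beta A) \<longleftrightarrow> centroaffine_immersion M A"
proof -
  have top: "wedge 1 (DIM(('n, 'm) phase) - 1) (beta A p) (wedge_power2 (ext_deriv 1 (beta A) p) ((DIM(('n, 'm) phase) - 1) div 2))
      = contact_top p" for p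
    using dims by (simp add: contact_top_def Omega_def flip: mult_2)
  have "odd DIM(('n, 'm) phase)" using dims by simp
  moreover have "(\<exists>v. contact_top p v \<noteq> 0) \<longleftrightarrow> det_A_dA A (fst p) \<noteq> 0" if p: "p \<in> D" for p
  proof
    assume "det_A_dA A (fst p) \<noteq> 0"
    then have "contact_top p std_frame \<noteq> 0" by (simp add: contact_top_eq[OF p] Upsilon_std_frame)
    then show "\<exists>v. contact_top p v \<noteq> 0" by (rule exI[of _ std_frame])
  qed (auto simp: contact_top_eq[OF p])
  ultimately show ?thesis
    unfolding contact_form_def top centroaffine_iff using smooth_beta by auto
qed

lemma Omega_has_derivative:
  assumes p: "p \<in> D"
  shows "((\<lambda>q. Omega A q w) has_derivative
    (\<lambda>h. frechet_derivative (\<lambda>u. dA u (fst (w 0))) (at (fst p)) (fst h) \<bullet> snd (w 1) -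
         frechet_derivative (\<lambda>u. dA u (fst (w 1))) (at (fst p)) (fst h) \<bullet> snd (w 0))) (at p)"
proof -
  have u: "fst p \<in> M" using p by auto
  have "((\<lambda>q. dA (fst q) (fst (w 0)) \<bullet> snd (w 1) - dA (fst q) (fst (w 1)) \<bullet> snd (w 0)) has_derivative
    (\<lambda>h. frechet_derivative (\<lambda>u. dA u (fst (w 0))) (at (fst p)) (fst h) \<bullet> snd (w 1) -
         frechet_derivative (\<lambda>u. dA u (fst (w 1))) (at (fst p)) (fst h) \<bullet> snd (w 0))) (at p)"
    by (intro has_derivative_diff has_derivative_inner_left has_derivative_lift smooth_on_has_derivative[OF smooth_dA u])
  then show ?thesis
    by (rule has_derivative_transform_within_open[OF _ openD p]) (simp add: Omega_eq)
qed

text \<open>Six terms with second derivatives of A cancel in pairs by symmetry.\<close>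

lemma ext_deriv_Omega:
  assumes p: "p \<in> D" shows "ext_deriv 2 (Omega A) p v = 0"
proof -
  have u: "fst p \<in> M" using p by auto
  have fd: "frechet_derivative (\<lambda>q. Omega A q w) (at p) =
    (\<lambda>h. frechet_derivative (\<lambda>u. dA u (fst (w 0))) (at (fst p)) (fst h) \<bullet> snd (w 1) -
         frechet_derivative (\<lambda>u. dA u (fst (w 1))) (at (fst p)) (fst h) \<bullet> snd (w 0))" for w
    using frechet_derivative_at[OF Omega_has_derivative[OF p, of w]] by simp
  have sym: "frechet_derivative (\<lambda>u. dA u a) (at (fst p)) b = frechet_derivative (\<lambda>u. dA u b) (at (fst p)) a" for a b
    unfolding dA_def by (rule second_derivative_symmetric[OF openM smA u])
  show ?thesis
    using sym[of "fst (v 0)" "fst (v 1)"] sym[of "fst (v 0)" "fst (v 2)"] sym[of "fst (v 1)" "fst (v 2)"]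
    by (simp add: ext_deriv_def fd numeral_2_eq_2)
qed

lemma smooth_Omega: "smooth_on D (\<lambda>p. Omega A p v)"
proof -
  have "smooth_on D (\<lambda>q. dA (fst q) (fst (v 0)) \<bullet> snd (v 1) - dA (fst q) (fst (v 1)) \<bullet> snd (v 0))"
    by (intro smooth_on_diff smooth_on_inner smooth_lift smooth_dA smooth_on_const openD)
  then show ?thesis by (rule smooth_on_eq[OF openD]) (simp add: Omega_eq)
qed

end

context centroaffine_family
begin

text \<open>Same two tests as for the radical of the Hessian; the coefficient of V is then found by
  pairing with A.\<close>

lemma Omega_kernel:
  assumes p: "p \<in> D" and ker: "\<And>w. two_form_at (Omega A p) v w = 0"
  shows "v = (A (fst p) \<bullet> snd v / K (fst p)) *\<^sub>R V p"
proof -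
  have u: "fst p \<in> M" using p by auto
  have "dA (fst p) (fst v) \<bullet> y = 0" for y
    using ker[of "(0, y)"] by (simp add: Omega_bilinear[OF p] linear_0[OF linear_dA[OF u]])
  then have "dA (fst p) (fst v) = dA (fst p) 0" using linear_0[OF linear_dA[OF u]] by (metis inner_eq_zero_iff)
  then have v0: "fst v = 0" using inj_iff_vv[OF u] vv_nonzero[OF u] by (auto dest: injD)
  then have "dA (fst p) z \<bullet> snd v = 0" for z
    using ker[of "(z, 0)"] by (simp add: Omega_bilinear[OF p])
  from orthogonal_range[OF u vv_nonzero[OF u] this] obtain a where a: "snd v = a *\<^sub>R vv (fst p)" by blast
  then have "A (fst p) \<bullet> snd v = a * K (fst p)" by (simp add: A_vv)
  then have "a = A (fst p) \<bullet> snd v / K (fst p)" using nonzero[OF u] by simp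
  then show ?thesis using v0 a by (simp add: V_eq prod_eq_iff)
qed

lemma Omega_V: "p \<in> D \<Longrightarrow> two_form_at (Omega A p) (V p) w = 0"
  using dA_vv[of "fst p" "fst w"] linear_0[OF linear_dA] by (auto simp: Omega_bilinear V_eq)

lemma ext_deriv_beta: "ext_deriv (Suc 0) (beta A) p = Omega A p"
  by (simp add: Omega_def)

lemma Reeb_field_iff:
  "is_Reeb_field D (beta A) R \<longleftrightarrow> (\<forall>p\<in>D. R p = inverse (K (fst p)) *\<^sub>R V p)"
proof -
  have "beta A p (\<lambda>_. R p) = 1 \<and> contract (R p) (ext_deriv 1 (beta A) p) = (\<lambda>_. 0) \<longleftrightarrow> R p = inverse (K (fst p)) *\<^sub>R V p"
    if p: "p \<in> D" for p
  proof -
    have u: "fst p \<in> M" using p by auto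
    have con: "contract (R p) (ext_deriv 1 (beta A) p) = (\<lambda>v. two_form_at (Omega A p) (R p) (v 0))"
      by (simp add: contract_def fun_eq_iff Omega_bilinear[OF p] Omega_eq[OF p] ext_deriv_beta)
    show ?thesis
    proof
      assume L: "beta A p (\<lambda>_. R p) = 1 \<and> contract (R p) (ext_deriv 1 (beta A) p) = (\<lambda>_. 0)"
      have "two_form_at (Omega A p) (R p) w = 0" for w
        using L fun_cong[of "contract (R p) (ext_deriv 1 (beta A) p)" "\<lambda>_. 0" "\<lambda>_. w"] unfolding con by simp
      from Omega_kernel[OF p this] show "R p = inverse (K (fst p)) *\<^sub>R V p"
        using L by (simp add: beta_eq inverse_eq_divide)
    next
      assume R: "R p = inverse (K (fst p)) *\<^sub>R V p"
      have "two_form_at (Omega A p) (R p) w = 0" for w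
        using Omega_V[OF p, of w] linear_0[OF linear_dA[OF u]] by (simp add: R Omega_bilinear[OF p] V_eq)
      moreover have "beta A p (\<lambda>_. R p) = 1" using nonzero[OF u] by (simp add: beta_eq R V_eq A_vv)
      ultimately show "beta A p (\<lambda>_. R p) = 1 \<and> contract (R p) (ext_deriv 1 (beta A) p) = (\<lambda>_. 0)"
        unfolding con by simp
    qed
  qed
  then show ?thesis by (simp add: is_Reeb_field_def)
qed

lemma symplectic_restriction_Omega: "symplectic_restriction (level_set M F t) (Omega A)"
  unfolding symplectic_restriction_def
proof (intro conjI ballI allI impI)
  let ?S = "level_set M F t"
  have D: "q \<in> D" if "q \<in> ?S" for q using that level_subset by blast
  show "smooth_along ?S (\<lambda>p. Omega A p v)" for v
    by (rule smooth_on_imp_smooth_along[OF openD smooth_Omega level_subset])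
  fix p assume p: "p \<in> ?S"
  have u: "fst p \<in> M" using D[OF p] by auto
  show "ext_deriv 2 (Omega A) p v = 0" for v by (rule ext_deriv_Omega[OF D[OF p]])
  show "two_form_at (Omega A p) v v = 0" for v by (simp add: Omega_bilinear[OF D[OF p]])
  show "bilinear (two_form_at (Omega A p))"
    unfolding bilinear_def Omega_bilinear[OF D[OF p]]
    by (intro conjI allI; rule linearI; simp add: linear_add[OF linear_dA[OF u]] linear_cmul[OF linear_dA[OF u]]
        algebra_simps inner_add_left inner_add_right)
  fix v assume v: "v \<in> tangent_space ?S p" and ker: "\<forall>w\<in>tangent_space ?S p. two_form_at (Omega A p) v w = 0"
  have "two_form_at (Omega A p) v w = 0" for w
  proof -
    \<comment> \<open>An arbitrary vector is a tangent vector plus a multiple of V, and V lies in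
      the kernel of \<Omega>. So v is in the kernel too, hence a multiple of V, and tangency leaves
      only v = 0.\<close>
    have "two_form_at (Omega A p) v (proj w p) = 0"
      by (rule ker[THEN bspec]) (simp add: tangent_level[OF p] dF_proj[OF D[OF p]])
    moreover have "two_form_at (Omega A p) v (V p) = 0"
      using Omega_V[OF D[OF p], of v] by (simp add: Omega_bilinear[OF D[OF p]])
    ultimately show ?thesis
      by (simp add: Omega_bilinear[OF D[OF p]] proj_def V_eq inner_diff_right linear_0[OF linear_dA[OF u]])
  qed
  from Omega_kernel[OF D[OF p] this] obtain a where a: "v = a *\<^sub>R V p" by blast
  have "dF p v = 0" using v by (simp add: tangent_level[OF p])
  then have "a * K (fst p) = 0" by (simp add: a linear_cmul[OF linear_dF[OF D[OF p]]] dF_V[OF D[OF p]])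
  then show "v = 0" using nonzero[OF u] a by simp
qed

text \<open>Near p some component A_i is nonzero. Replacing the coordinate x_i by F - t is a chart,
  and its inverse is explicit because F is affine in x_i with slope A_i.\<close>

lemma smooth_submanifold_level: "smooth_submanifold (2 * CARD('n)) (level_set M F t)"
  unfolding smooth_submanifold_def
proof
  fix p assume p: "p \<in> level_set M F t"
  then have pM: "fst p \<in> M" by (auto simp: level_set_def)
  then obtain i where i: "A (fst p) $ i \<noteq> 0" using A_nonzero by (auto simp: vec_eq_iff)
  let ?a = "\<lambda>q :: ('n, 'm) phase. A (fst q) $ i"
  let ?e = "(0, axis i 1) :: ('n, 'm) phase"
  define U where "U = {q \<in> D. ?a q \<in> - {0}}"
  have sa: "smooth_on D ?a" by (rule smooth_lift[OF smooth_on_nth[OF openM smA]])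
  have oU: "open U" unfolding U_def
    by (rule continuous_open_preimage[OF smooth_on_continuous_on[OF sa] openD, unfolded vimage_def Int_def, simplified]) (simp add: open_Compl)
  have UD: "U \<subseteq> D" by (auto simp: U_def)
  define f where "f q = q + (F q - t - snd q $ i) *\<^sub>R ?e" for q
  define g where "g q = q + ((snd q $ i + t - F q) / ?a q) *\<^sub>R ?e" for q
  let ?H = "{q :: ('n, 'm) phase. snd q $ i = 0}"
  have lin: "linear (\<lambda>q :: ('n, 'm) phase. snd q $ i)" by (rule linearI) auto
  have Fe: "F (q + s *\<^sub>R ?e) = F q + s * ?a q" for q s
    by (simp add: F_fun_def inner_add_right inner_axis)
  have fi: "snd (f q) $ i = F q - t" for q by (simp add: f_def)
  have ff: "fst (f q) = fst q" "fst (g q) = fst q" for q by (simp_all add: f_def g_def)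
  have fU: "f q \<in> U" "g q \<in> U" if "q \<in> U" for q using that by (auto simp: U_def ff mem_Times_iff)
  have gf: "g (f q) = q" if "q \<in> U" for q
  proof -
    have "?a q \<noteq> 0" using that by (simp add: U_def)
    moreover have "F (f q) = F q + (F q - t - snd q $ i) * ?a q" unfolding f_def by (rule Fe)
    ultimately have "(snd (f q) $ i + t - F (f q)) / ?a (f q) = - (F q - t - snd q $ i)"
      unfolding fi ff by (simp add: field_simps)
    then have "g (f q) = f q + - (F q - t - snd q $ i) *\<^sub>R ?e" by (simp only: g_def)
    also have "\<dots> = q" by (simp only: f_def scaleR_minus_left add_uminus_conv_diff add_diff_cancel_right')
    finally show ?thesis .
  qed
  have fg: "f (g q) = q" if "q \<in> U" for q
  proof -
    have "?a q \<noteq> 0" using that by (simp add: U_def)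
    moreover have "F (g q) = F q + ((snd q $ i + t - F q) / ?a q) * ?a q" unfolding g_def by (rule Fe)
    ultimately have "F (g q) - t - snd (g q) $ i = - ((snd q $ i + t - F q) / ?a q)"
      by (simp add: g_def)
    then have "f (g q) = g q + - ((snd q $ i + t - F q) / ?a q) *\<^sub>R ?e" by (simp only: f_def)
    also have "\<dots> = q" by (simp only: g_def scaleR_minus_left add_uminus_conv_diff add_diff_cancel_right')
    finally show ?thesis .
  qed
  have sF: "smooth_on U F" "smooth_on U ?a" using smooth_on_subset[OF smooth_F UD] smooth_on_subset[OF sa UD] .
  have si: "smooth_on U (\<lambda>q. snd q $ i)" by (rule smooth_on_linear[OF oU lin])
  have sf: "smooth_on U f" unfolding f_def[abs_def]
    by (intro smooth_on_add smooth_on_ident smooth_on_scaleR smooth_on_diff smooth_on_const sF si oU)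
  have sg: "smooth_on U g" unfolding g_def[abs_def]
    by (intro smooth_on_add smooth_on_ident smooth_on_scaleR smooth_on_divide smooth_on_diff smooth_on_const sF si oU)
      (simp add: U_def)
  have hom: "homeomorphism U U f g"
    using smooth_on_continuous_on[OF sf] smooth_on_continuous_on[OF sg] fU gf fg
    by (intro homeomorphismI) auto
  have img: "f ` (U \<inter> level_set M F t) = U \<inter> ?H"
  proof (intro equalityI subsetI)
    fix q assume "q \<in> f ` (U \<inter> level_set M F t)"
    then obtain x where x: "q = f x" "x \<in> U" "F x = t" by (auto simp: level_set_def)
    then show "q \<in> U \<inter> ?H" using fU(1) fi[of x] by simp
  next
    fix q assume q: "q \<in> U \<inter> ?H"
    then have "F (g q) = t" using fi[of "g q"] fg[of q] by simp
    moreover have "g q \<in> U" using q fU by blast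
    ultimately have "g q \<in> U \<inter> level_set M F t" using UD by (auto simp: level_set_def)
    then show "q \<in> f ` (U \<inter> level_set M F t)" using fg[of q] q by (intro image_eqI[of _ _ "g q"]) auto
  qed
  have "dim ?H = 2 * CARD('n)"
    using dim_functional_kernel[OF lin, of ?e] DIM_phase by simp
  moreover have "subspace ?H" by (rule linear_subspace_kernel[OF lin])
  moreover have "p \<in> U" using pM i by (auto simp: U_def mem_Times_iff)
  ultimately show "\<exists>U U' f g H. open U \<and> p \<in> U \<and> open U' \<and> homeomorphism U U' f g \<and>
      smooth_on U f \<and> smooth_on U' g \<and> subspace H \<and> dim H = 2 * CARD('n) \<and>
      f ` (U \<inter> level_set M F t) = U' \<inter> (H :: ('n, 'm) phase set)"
    using oU hom sf sg img by blast
qed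

lemma transversal_N: "transversal (level_set M F t) (N_field F)"
proof -
  have "smooth_on D (\<lambda>q. ((-1) ^ CARD('n) * K (fst q)) *\<^sub>R V q)"
    by (intro smooth_on_scaleR smooth_on_mult smooth_on_const smooth_lift smooth_K smooth_V openD)
  then have "smooth_on D (N_field F)" by (rule smooth_on_eq[OF openD]) (simp add: N_field_eq)
  then have "smooth_along (level_set M F t) (N_field F)"
    by (rule smooth_on_imp_smooth_along[OF openD _ level_subset])
  moreover have "N_field F p \<notin> tangent_space (level_set M F t) p" if p: "p \<in> level_set M F t" for p
  proof -
    have pD: "p \<in> D" using p level_subset by blast
    have "K (fst p) \<noteq> 0" using nonzero pD by auto
    then show ?thesis
      by (simp add: tangent_level[OF p] N_field_eq[OF pD] linear_cmul[OF linear_dF[OF pD]] dF_V[OF pD])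
  qed
  ultimately show ?thesis by (simp add: transversal_def)
qed

lemma nondegenerate_level: "nondegenerate_hypersurface (level_set M F t)"
  unfolding nondegenerate_hypersurface_def
proof (intro exI conjI ballI impI)
  show "transversal (level_set M F t) (N_field F)" by (rule transversal_N)
  fix p v assume p: "p \<in> level_set M F t" and v: "v \<in> tangent_space (level_set M F t) p"
    and ker: "\<forall>w\<in>tangent_space (level_set M F t) p. induced_metric (level_set M F t) (N_field F) p v w = 0"
  have pD: "p \<in> D" using p level_subset by blast
  have N: "dF p (N_field F p) \<noteq> 0" using transversal_N p by (auto simp: transversal_def tangent_level)
  have dv: "dF p v = 0" using v by (simp add: tangent_level[OF p])
  show "v = 0"
  proof (rule hess_nondegenerate[OF pD dv])
    fix w assume w: "dF p w = 0"
    then have "induced_metric (level_set M F t) (N_field F) p v w = 0"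
      by (intro ker[THEN bspec]) (simp add: tangent_level[OF p])
    then show "hess p v w = 0" using induced_metric_eq[where T = "N_field F", OF p N dv w] N by simp
  qed
qed

lemma adjugate_N:
  assumes p: "p \<in> D"
  shows "adjugate (Hess F p) = ((-1) ^ CARD('n) * inverse ((K (fst p))\<^sup>2)) *\<^sub>R tensor_square (N_field F p)"
proof -
  have "K (fst p) \<noteq> 0" using nonzero p by auto
  moreover have "tensor_square (k *\<^sub>R v) = k\<^sup>2 *\<^sub>R tensor_square v" for k and v :: "('n, 'm) phase"
    by (simp add: tensor_square_def vec_eq_iff linear_cmul[OF linear_coords] power2_eq_square)
  ultimately show ?thesis
    by (simp add: adjugate_Hess[OF p] N_field_eq[OF p] power_mult_distrib flip: power_mult)
qed

section \<open>The Lagrangian ruling\<close>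

definition leaf :: "real \<Rightarrow> 'n rvec \<Rightarrow> ('n, 'm) phase set" where
  "leaf t u = {q. (fst q, A u \<bullet> snd q) = (u, t - Q u)}"

text \<open>The leaf over u is written as a fibre of this map, so the facts on linear fibres give
  its tangent spaces, smoothness and total geodesy.\<close>

lemma linear_leaf: "linear (\<lambda>q :: ('n, 'm) phase. (fst q, A u \<bullet> snd q))"
  by (rule linearI) (auto simp: inner_add_right)

lemma tangent_leaf:
  assumes "q \<in> leaf t u" shows "tangent_space (leaf t u) q = {v. fst v = 0 \<and> A u \<bullet> snd v = 0}"
  using tangent_space_linear_fibre[OF linear_leaf leaf_def assms] by (simp add: zero_prod_def)

lemma dim_leaf:
  assumes u: "u \<in> M" shows "dim {v :: ('n, 'm) phase. fst v = 0 \<and> A u \<bullet> snd v = 0} = CARD('n)"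
proof -
  have "{v :: ('n, 'm) phase. fst v = 0 \<and> A u \<bullet> snd v = 0} = Pair 0 ` {x. A u \<bullet> x = 0}" by force
  moreover have "dim (Pair (0 :: 'n rvec) ` {x. A u \<bullet> x = 0}) = dim {x. A u \<bullet> x = 0}"
    by (rule dim_image_eq) (auto intro!: linearI inj_onI)
  ultimately show ?thesis using dim_hyperplane[OF A_nonzero[OF u]] dims by simp
qed

lemma leaf_subset: "u \<in> M \<Longrightarrow> leaf t u \<subseteq> level_set M F t"
  by (auto simp: leaf_def level_set_def F_fun_def)

text \<open>Where A_i is nonzero, the vectors e_r - (A_r / A_i) e_i with r different from i span the
  orthogonal complement of A and vary smoothly; they are the local frame of the
  distribution.\<close>

lemma ruling_leaves: "ruling CARD('n) (level_set M F t) (leaf t ` M)"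
  unfolding ruling_def
proof (intro conjI ballI)
  show "partition_on (level_set M F t) (leaf t ` M)"
  proof (rule partition_onI)
    show "\<Union> (leaf t ` M) = level_set M F t"
      by (auto simp: leaf_def level_set_def F_fun_def)
    have "(u, ((t - Q u) / (A u \<bullet> A u)) *\<^sub>R A u) \<in> leaf t u" if "u \<in> M" for u
      using A_nonzero[OF that] by (simp add: leaf_def)
    then show "{} \<notin> leaf t ` M" by auto
  qed (auto simp: leaf_def disjnt_def)
next
  fix L assume "L \<in> leaf t ` M"
  then obtain u where u: "u \<in> M" "L = leaf t u" by blast
  show "connected L"
    using affine_linear_fibre[OF linear_leaf leaf_def] u by (simp add: affine_imp_convex convex_connected)
  show "totally_geodesic L" unfolding u by (rule totally_geodesic_linear_fibre[OF linear_leaf leaf_def])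
  show "smooth_submanifold CARD('n) L" unfolding u
    by (rule smooth_submanifold_linear_fibre[OF linear_leaf leaf_def]) (use dim_leaf[OF u(1)] in \<open>simp add: zero_prod_def\<close>)
next
  fix p assume p: "p \<in> level_set M F t"
  then have pM: "fst p \<in> M" by (auto simp: level_set_def)
  then obtain i where i: "A (fst p) $ i \<noteq> 0" using A_nonzero by (auto simp: vec_eq_iff)
  let ?a = "\<lambda>q :: ('n, 'm) phase. A (fst q) $ i"
  define U where "U = {q \<in> D. ?a q \<in> - {0}}"
  have sa: "smooth_on D (\<lambda>q :: ('n, 'm) phase. A (fst q) $ r)" for r by (rule smooth_lift[OF smooth_on_nth[OF openM smA]])
  have oU: "open U" unfolding U_def
    by (rule continuous_open_preimage[OF smooth_on_continuous_on[OF sa] openD, unfolded vimage_def Int_def, simplified]) (simp add: open_Compl)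
  have UD: "U \<subseteq> D" by (auto simp: U_def)
  have "card (UNIV - {i}) = CARD('n)" using dims by (simp add: card_Diff_singleton)
  then obtain b where b: "bij_betw b {..<CARD('n)} (UNIV - {i})"
    using bij_betw_from_nat_into_finite[of "UNIV - {i}"] by auto
  define e where "e r q = ((0 :: 'n rvec), (axis r 1 :: 'm rvec) - (A (fst q) $ r / ?a q) *\<^sub>R axis i 1)" for r and q :: "('n, 'm) phase"
  have "smooth_on U (e r)" for r
    unfolding e_def[abs_def] using smooth_on_subset[OF sa UD]
    by (intro smooth_on_Pair smooth_on_diff smooth_on_const smooth_on_scaleR smooth_on_divide oU) (auto simp: U_def)
  then have sm: "smooth_along (level_set M F t \<inter> U) (e r)" for r
    by (rule smooth_on_imp_smooth_along[OF oU]) simp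
  have sp: "tangent_space L q = span ((\<lambda>k. e (b k) q) ` {..<CARD('n)})" if L: "L \<in> leaf t ` M" and q: "q \<in> L \<inter> U" for L q
  proof -
    obtain u where u: "u \<in> M" "L = leaf t u" using L by blast
    have fq: "fst q = u" using q u by (auto simp: leaf_def)
    have nz: "A u $ i \<noteq> 0" using q by (simp add: U_def fq)
    have T: "tangent_space L q = {v. fst v = 0 \<and> A u \<bullet> snd v = 0}" using tangent_leaf q u by blast
    have img: "(\<lambda>k. e (b k) q) ` {..<CARD('n)} = (\<lambda>r. e r q) ` (UNIV - {i})"
      using b by (auto simp: bij_betw_def image_image[symmetric, of "\<lambda>r. e r q" b])
    show ?thesis unfolding T img
    proof
      show "{v. fst v = 0 \<and> A u \<bullet> snd v = 0} \<subseteq> span ((\<lambda>r. e r q) ` (UNIV - {i}))"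
      proof
        fix v :: "('n, 'm) phase" assume "v \<in> {v. fst v = 0 \<and> A u \<bullet> snd v = 0}"
        then have v: "fst v = 0" "A u \<bullet> snd v = 0" by auto
        have "(\<Sum>r\<in>UNIV - {i}. snd v $ r * A u $ r) = - (snd v $ i * A u $ i)"
          using v(2) by (simp add: inner_vec_def sum.remove[of UNIV i] mult.commute add_eq_0_iff)
        then have s: "(\<Sum>r\<in>UNIV - {i}. snd v $ r * (A u $ r / A u $ i)) = - (snd v $ i)"
          using nz by (simp add: sum_divide_distrib[symmetric])
        have "snd v = (\<Sum>r\<in>UNIV - {i}. snd v $ r *\<^sub>R (axis r 1 - (A u $ r / A u $ i) *\<^sub>R axis i 1))"
        proof -
          have "(\<Sum>r\<in>UNIV - {i}. snd v $ r *\<^sub>R (axis r 1 - (A u $ r / A u $ i) *\<^sub>R axis i 1)) =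
            (\<Sum>r\<in>UNIV - {i}. snd v $ r *\<^sub>R axis r 1) - (\<Sum>r\<in>UNIV - {i}. snd v $ r * (A u $ r / A u $ i)) *\<^sub>R axis i 1"
            by (simp add: scaleR_diff_right sum_subtractf scaleR_sum_left)
          also have "\<dots> = (\<Sum>r\<in>UNIV. snd v $ r *\<^sub>R axis r 1)"
            unfolding s by (simp add: sum.remove[of UNIV i])
          also have "\<dots> = snd v" by (simp add: vec_eq_iff axis_def if_distrib[of "(*) _"] cong: if_cong)
          finally show ?thesis ..
        qed
        then have "v = (\<Sum>r\<in>UNIV - {i}. snd v $ r *\<^sub>R e r q)"
          using v(1) by (simp add: prod_eq_iff fst_sum snd_sum e_def fq)
        also have "\<dots> \<in> span ((\<lambda>r. e r q) ` (UNIV - {i}))" by (intro span_sum span_mul span_base) auto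
        finally show "v \<in> span ((\<lambda>r. e r q) ` (UNIV - {i}))" .
      qed
      have sub: "subspace {v :: ('n, 'm) phase. fst v = 0 \<and> A u \<bullet> snd v = 0}"
        using linear_subspace_kernel[OF linear_leaf[of u]] by (simp add: zero_prod_def)
      show "span ((\<lambda>r. e r q) ` (UNIV - {i})) \<subseteq> {v. fst v = 0 \<and> A u \<bullet> snd v = 0}"
        by (rule span_minimal[OF _ sub]) (use nz in \<open>auto simp: e_def fq inner_diff_right inner_axis\<close>)
    qed
  qed
  show "\<exists>U (E :: nat \<Rightarrow> ('n, 'm) phase \<Rightarrow> ('n, 'm) phase). open U \<and> p \<in> U \<and>
      (\<forall>k<CARD('n). smooth_along (level_set M F t \<inter> U) (E k)) \<and>
      (\<forall>L\<in>leaf t ` M. \<forall>q\<in>L \<inter> U. tangent_space L q = span ((\<lambda>k. E k q) ` {..<CARD('n)}))"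
  proof (intro exI conjI)
    show "p \<in> U" using pM i by (auto simp: U_def mem_Times_iff)
    show "\<forall>L\<in>leaf t ` M. \<forall>q\<in>L \<inter> U. tangent_space L q = span ((\<lambda>k. e (b k) q) ` {..<CARD('n)})" using sp by blast
    show "\<forall>k<CARD('n). smooth_along (level_set M F t \<inter> U) (e (b k))" using sm by blast
  qed (rule oU)
qed

lemma affine_leaf: "affine (leaf t u)"
  by (rule affine_linear_fibre[OF linear_leaf leaf_def])

lemma leaf_nonempty:
  assumes u: "u \<in> M" obtains q where "q \<in> leaf t u"
proof -
  have "(u, ((t - Q u) / (A u \<bullet> A u)) *\<^sub>R A u) \<in> leaf t u" using A_nonzero[OF u] by (simp add: leaf_def)
  then show ?thesis by (rule that)
qed

text \<open>\<Omega> pairs u-directions with x-directions, and vectors tangent to a leaf have no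
  u-part.\<close>

lemma Lagrangian_leaf:
  assumes u: "u \<in> M" and q: "q \<in> leaf t u"
  shows "Lagrangian (tangent_space (level_set M F t) q) (two_form_at (Omega A q)) (tangent_space (leaf t u) q)"
proof -
  have q': "q \<in> level_set M F t" using leaf_subset[OF u] q by blast
  then have qD: "q \<in> D" using level_subset by blast
  have fq: "fst q = u" using q by (simp add: leaf_def)
  have z: "dA u 0 = 0" "dQ u 0 = 0" using linear_0[OF linear_dA[OF u]] linear_0[OF linear_dQ[OF u]] .
  have sub: "subspace {v :: ('n, 'm) phase. fst v = 0 \<and> A u \<bullet> snd v = 0}"
    using linear_subspace_kernel[OF linear_leaf[of u]] by (simp add: zero_prod_def)
  show ?thesis
    unfolding Lagrangian_def tangent_leaf[OF q] tangent_level[OF q'] dim_leaf[OF u] dim_dF_kernel[OF qD]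
    using sub by (auto simp: dF_def fq z Omega_bilinear[OF qD])
qed

text \<open>If the leaves were parallel, a vector y_J orthogonal to A at one point would be
  orthogonal to A at all points of M. Differentiating gives <A_J, y_J> = 0, against the duality
  <A_J, y_J> = 1.\<close>

lemma leaves_not_cylindrical:
  assumes "level_set M F t \<noteq> {}" shows "\<not> cylindrical (leaf t ` M)"
proof
  assume cyl: "cylindrical (leaf t ` M)"
  obtain u0 where u0: "u0 \<in> M" using assms by (auto simp: level_set_def)
  obtain J :: 'n where "J \<in> UNIV" by blast
  obtain y where y: "\<And>J. A u0 \<bullet> y J = 0" "\<And>I J. dA u0 (axis I 1) \<bullet> y J = (if I = J then 1 else 0)"
    using dual_frame[OF u0 nonzero[OF u0]] by metis
  have zero: "A u \<bullet> y J = 0" if u: "u \<in> M" for u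
  proof -
    obtain q q0 where "q \<in> leaf t u" "q0 \<in> leaf t u0" using leaf_nonempty u u0 by metis
    then have "tangent_space (leaf t u) q = tangent_space (leaf t u0) q0"
      using cyl u u0 unfolding cylindrical_def by blast
    then have "{v :: ('n, 'm) phase. fst v = 0 \<and> A u \<bullet> snd v = 0} = {v. fst v = 0 \<and> A u0 \<bullet> snd v = 0}"
      using tangent_leaf \<open>q \<in> leaf t u\<close> \<open>q0 \<in> leaf t u0\<close> by blast
    moreover have "(0, y J) \<in> {v :: ('n, 'm) phase. fst v = 0 \<and> A u0 \<bullet> snd v = 0}" using y(1) by simp
    ultimately have "(0, y J) \<in> {v :: ('n, 'm) phase. fst v = 0 \<and> A u \<bullet> snd v = 0}" by blast
    then show ?thesis by simp
  qed
  have "((\<lambda>u. A u \<bullet> y J) has_derivative (\<lambda>h. dA u0 h \<bullet> y J)) (at u0)"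
    by (rule has_derivative_inner_left[OF A_has_derivative[OF u0]])
  moreover have "((\<lambda>u. A u \<bullet> y J) has_derivative (\<lambda>h. 0)) (at u0)"
    by (rule has_derivative_transform_within_open[OF _ openM u0, of "\<lambda>u. 0"]) (simp_all add: zero)
  ultimately have "(\<lambda>h. dA u0 h \<bullet> y J) = (\<lambda>h. 0)" by (rule has_derivative_unique)
  from fun_cong[OF this, of "axis J 1"] show False by (simp add: y(2))
qed

end

section \<open>The parameterization by the flow\<close>

text \<open>Merges the three cases into one recurrence with zero-based k: the k-th entry is s_k
  a_{k+1} - s_{k-1} a_{k-1}, terms out of range being zero.\<close>

lemma Phi_e_enum:
  fixes a :: "'m::{finite,linorder} rvec" and s :: "'n::{finite,linorder} rvec"
  assumes dims: "CARD('m) = CARD('n) + 1" and k: "k \<le> CARD('n)"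
  shows "Phi_e a s $ (enum ! k) =
    (if k < CARD('n) then s $ (enum ! k) * a $ (enum ! Suc k) else 0) -
    (if 0 < k then s $ (enum ! (k - 1)) * a $ (enum ! (k - 1)) else 0)"
proof -
  have pos: "pos (enum ! k :: 'm) = Suc k" using k dims by (simp add: pos_enum)
  have i: "0 < j \<Longrightarrow> ith j = (enum ! (j - 1) :: 'x::{finite,linorder})" for j
    by (cases j) (simp_all add: ith_enum)
  have n: "0 < CARD('n)" by simp
  consider "k = 0" | "0 < k" "k = CARD('n)" | "0 < k" "k < CARD('n)" using k by linarith
  then show ?thesis
    by cases (use n pos in \<open>auto simp: Phi_e_def i ith_enum Let_def\<close>)
qed

text \<open>The parameter s_k contributes a_{k+1} in place k and -a_k in place k + 1, which is
  orthogonal to a; in the sums this is a shift of the index.\<close>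

lemma sum_Phi_e:
  fixes a :: "'m::{finite,linorder} rvec" and s :: "'n::{finite,linorder} rvec"
  assumes dims: "CARD('m) = CARD('n) + 1"
  shows "a \<bullet> Phi_e a s = 0"
proof -
  let ?N = "CARD('n)"
  let ?a = "\<lambda>k. a $ (enum ! k)" and ?s = "\<lambda>k. s $ (enum ! k)"
  have "a \<bullet> Phi_e a s = (\<Sum>k<Suc ?N. ?a k * Phi_e a s $ (enum ! k))"
    by (simp add: inner_vec_def sum_enum dims del: sum.lessThan_Suc)
  also have "\<dots> = (\<Sum>k<Suc ?N. (if k < ?N then ?a k * ?s k * ?a (Suc k) else 0) -
      (if 0 < k then ?a k * ?s (k - 1) * ?a (k - 1) else 0))"
    by (intro sum.cong refl) (simp add: Phi_e_enum[OF dims] algebra_simps)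
  also have "\<dots> = (\<Sum>k<Suc ?N. if k < ?N then ?a k * ?s k * ?a (Suc k) else 0) -
      (\<Sum>k<Suc ?N. if 0 < k then ?a k * ?s (k - 1) * ?a (k - 1) else 0)"
    by (rule sum_subtractf)
  also have "(\<Sum>k<Suc ?N. if k < ?N then ?a k * ?s k * ?a (Suc k) else 0) = (\<Sum>k<?N. ?a k * ?s k * ?a (Suc k))"
    by simp
  also have "(\<Sum>k<Suc ?N. if 0 < k then ?a k * ?s (k - 1) * ?a (k - 1) else 0) = (\<Sum>k<?N. ?a (Suc k) * ?s k * ?a k)"
    by (simp add: sum.lessThan_Suc_shift del: sum.lessThan_Suc)
  finally show ?thesis by (simp add: mult_ac)
qed

lemma linear_Phi_e: "linear (Phi_e a)"
  by (rule linearI) (auto simp: Phi_e_def Let_def vec_eq_iff algebra_simps)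

text \<open>The recurrence gives s_0 = 0, then s_1 = 0 and so on, each step dividing by an interior
  a_{k+1}. The last s_{n-1} comes from the last entry, which contains only a_{n-1}. For n = 1 there
  are no interior components, and \<open>a\<close> being nonzero has to suffice.\<close>

lemma Phi_e_injective:
  fixes a :: "'m::{finite,linorder} rvec" and s :: "'n::{finite,linorder} rvec"
  assumes dims: "CARD('m) = CARD('n) + 1" and a: "a \<noteq> 0"
    and reg: "\<And>k. 0 < k \<Longrightarrow> k < CARD('n) \<Longrightarrow> a $ (enum ! k) \<noteq> 0" and z: "Phi_e a s = 0"
  shows "s = 0"
proof -
  let ?N = "CARD('n)"
  let ?a = "\<lambda>k. a $ (enum ! k)" and ?s = "\<lambda>k. s $ (enum ! k)"
  have e: "(if k < ?N then ?s k * ?a (Suc k) else 0) = (if 0 < k then ?s (k - 1) * ?a (k - 1) else 0)" if "k \<le> ?N" for k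
    using Phi_e_enum[OF dims that, of a s] by (simp add: z)
  have low: "?s k = 0" if "Suc k < ?N" for k
    using that
  proof (induction k)
    case 0
    then show ?case using e[of 0] reg[of 1] by simp
  next
    case (Suc k)
    then show ?case using e[of "Suc k"] reg[of "Suc (Suc k)"] by simp
  qed
  have last: "?s (?N - 1) = 0"
  proof (cases "?N = 1")
    case True
    have "\<exists>k\<le>1. ?a k \<noteq> 0"
    proof (rule ccontr)
      assume *: "\<not> (\<exists>k\<le>1. ?a k \<noteq> 0)"
      have "a $ i = 0" for i
      proof -
        have "?a (pos i - 1) = 0" using * pos_pred_less[of i] dims True by auto
        then show ?thesis by (simp add: enum_pos')
      qed
      then show False using a by (simp add: vec_eq_iff)
    qed
    then show ?thesis using e[of 0] e[of 1] True by (auto simp: le_Suc_eq)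
  next
    case False
    have "0 < ?N" by simp
    then have "1 < ?N" using False by linarith
    then show ?thesis using e[of ?N] reg[of "?N - 1"] by simp
  qed
  have "?s k = 0" if "k < ?N" for k using low[of k] last that by (cases "Suc k < ?N") (auto simp: not_less less_Suc_eq_le le_antisym Suc_le_eq dest!: le_antisym)
  then have "s $ J = 0" for J using pos_pred_less'[of J] enum_pos'[of J] by metis
  then show ?thesis by (simp add: vec_eq_iff)
qed

context equiaffine_family
begin

abbreviation (input) "R \<equiv> regular_locus M A"

lemma Phi_eq: "Phi A Q \<kappa> t r s = (r, (inverse \<kappa> * (t - Q r)) *\<^sub>R vv r + Phi_e (A r) s)"
proof -
  have "(\<chi> i. (-1) ^ (pos i + 1) * inverse \<kappa> * (t - Q r) * dA_minor A i r) = (inverse \<kappa> * (t - Q r)) *\<^sub>R vv r"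
    by (simp add: vec_eq_iff vv_def col_minors_def dA_minor_def mult_ac)
  then show ?thesis by (simp add: Phi_def)
qed

lemma F_Phi:
  assumes r: "r \<in> M" shows "F (Phi A Q \<kappa> t r s) = t"
proof -
  have k: "inverse \<kappa> * x * \<kappa> = x" for x using \<kappa>_nonzero by (simp add: field_simps)
  show ?thesis
    using K_const[OF r] A_vv[of r] by (simp add: F_fun_def Phi_eq inner_add_right sum_Phi_e[OF dims] k)
qed

text \<open>The t-derivative of \<Phi> is V / \<kappa>. Rescaling time by -|\<kappa>|^(1/(n+1))
  turns this into c V, which is the equiaffine normal.\<close>

lemma Phi_flow:
  assumes r: "r \<in> M" and \<phi>: "\<phi> = (\<lambda>t. Phi A Q \<kappa> (- (\<bar>\<kappa>\<bar> powr (2 / (2 * real CARD('n) + 2))) * t))"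
  shows "((\<lambda>t. \<phi> t r s) has_vector_derivative
    equiaffine_normal Upsilon (level_set M F (F (\<phi> t r s))) (co_orientation F) (\<phi> t r s)) (at t)"
proof -
  let ?w = "\<bar>\<kappa>\<bar> powr (2 / (2 * real CARD('n) + 2))"
  have in_level: "\<phi> t r s \<in> level_set M F (F (\<phi> t r s))"
    using r by (simp add: level_set_def \<phi> Phi_eq)
  have d: "((\<lambda>t. (r, (inverse \<kappa> * (- ?w * t - Q r)) *\<^sub>R vv r + Phi_e (A r) s)) has_vector_derivative
      (0, (inverse \<kappa> * - ?w) *\<^sub>R vv r + 0)) (at t)"
    by (auto intro!: has_vector_derivative_Pair derivative_eq_intros simp: has_vector_derivative_def)
  have cw: "inverse \<kappa> * - ?w = c"
  proof -
    have "?w = \<bar>\<kappa>\<bar> powr (1 + - (2 * real CARD('n) / (2 * real CARD('n) + 2)))" by (simp add: field_simps)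
    also have "\<dots> = \<bar>\<kappa>\<bar> * \<bar>\<kappa>\<bar> powr (- (2 * real CARD('n) / (2 * real CARD('n) + 2)))"
      using \<kappa>_nonzero by (simp only: powr_add) simp
    finally show ?thesis using \<kappa>_nonzero by (simp add: c_def sgn_if)
  qed
  have cV: "c *\<^sub>R V (\<phi> t r s) = (0, c *\<^sub>R vv r)" by (simp add: \<phi> V_eq Phi_eq)
  show ?thesis
    using d unfolding equiaffine_normal_eq[OF in_level] cV cw by (simp add: \<phi> Phi_eq)
qed

lemma regular_nonzero: "r \<in> R \<Longrightarrow> 0 < k \<Longrightarrow> k < CARD('n) \<Longrightarrow> A r $ (enum ! k) \<noteq> 0"
  using pos_enum[of k, where 'k='m] dims by (auto simp: regular_locus_def)

lemma open_regular: "open R"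
proof -
  let ?I = "{i :: 'm. 2 \<le> pos i \<and> pos i \<le> CARD('n)}"
  have "continuous_on M (\<lambda>r. \<Prod>i\<in>?I. A r $ i)"
    by (intro smooth_on_continuous_on smooth_on_prod smooth_on_nth openM smA)
  then have "open (M \<inter> (\<lambda>r. \<Prod>i\<in>?I. A r $ i) -` (- {0}))"
    by (rule continuous_on_open_vimage[OF openM, THEN iffD1, rule_format, simplified Int_commute]) (simp add: open_Compl)
  moreover have "M \<inter> (\<lambda>r. \<Prod>i\<in>?I. A r $ i) -` (- {0}) = R"
    by (auto simp: regular_locus_def)
  ultimately show ?thesis by simp
qed

text \<open>An injective linear map from dimension n into the hyperplane orthogonal to A, which also
  has dimension n.\<close>

lemma Phi_e_onto:
  assumes r: "r \<in> R" and x: "A r \<bullet> x = 0"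
  obtains s :: "'n rvec" where "Phi_e (A r) s = x"
proof -
  have rM: "r \<in> M" using r by (simp add: regular_locus_def)
  have inj: "inj (Phi_e (A r) :: 'n rvec \<Rightarrow> 'm rvec)"
    using Phi_e_injective[OF dims A_nonzero[OF rM] regular_nonzero[OF r]] by (subst linear_injective_0[OF linear_Phi_e]) blast
  have "range (Phi_e (A r) :: 'n rvec \<Rightarrow> 'm rvec) = {x. A r \<bullet> x = 0}"
  proof (rule subspace_dim_equal)
    show "subspace (range (Phi_e (A r) :: 'n rvec \<Rightarrow> 'm rvec))"
      by (rule linear_subspace_image[OF linear_Phi_e subspace_UNIV])
    show "subspace {x. A r \<bullet> x = 0}" by (rule subspace_hyperplane)
    show "range (Phi_e (A r) :: 'n rvec \<Rightarrow> 'm rvec) \<subseteq> {x. A r \<bullet> x = 0}" using sum_Phi_e[OF dims] by blast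
    have "dim (range (Phi_e (A r) :: 'n rvec \<Rightarrow> 'm rvec)) = dim (UNIV :: 'n rvec set)"
      by (rule dim_image_eq[OF linear_Phi_e]) (use inj in simp)
    then show "dim {x. A r \<bullet> x = 0} \<le> dim (range (Phi_e (A r) :: 'n rvec \<Rightarrow> 'm rvec))"
      using dim_hyperplane[OF A_nonzero[OF rM]] dims by simp
  qed
  then show ?thesis using x that by (metis (mono_tags, lifting) mem_Collect_eq rangeE)
qed

lemma smooth_Phi: "smooth_on (M \<times> UNIV) (\<lambda>(r, s :: 'n rvec). Phi A Q \<kappa> t r s)"
proof -
  have oW: "open (M \<times> (UNIV :: 'n rvec set))" using openM by (simp add: open_Times)
  have lift: "smooth_on (M \<times> (UNIV :: 'n rvec set)) (\<lambda>p. g (fst p))" if "smooth_on M g" for g :: "'n rvec \<Rightarrow> 'x::euclidean_space"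
    by (rule smooth_on_compose[OF oW smooth_on_fst[OF oW smooth_on_ident[OF oW]] that]) auto
  have sn: "smooth_on (M \<times> (UNIV :: 'n rvec set)) (\<lambda>p. snd p $ J)" for J
    by (rule smooth_on_nth[OF oW smooth_on_snd[OF oW smooth_on_ident[OF oW]]])
  have Ai: "smooth_on (M \<times> (UNIV :: 'n rvec set)) (\<lambda>p. A (fst p) $ i)" for i
    by (rule lift[OF smooth_on_nth[OF openM smA]])
  have "smooth_on (M \<times> (UNIV :: 'n rvec set)) (\<lambda>p. Phi_e (A (fst p)) (snd p))"
    unfolding Phi_e_def Let_def
  proof (rule smooth_on_vec_lambda[OF oW])
    fix i :: 'm
    show "smooth_on (M \<times> (UNIV :: 'n rvec set)) (\<lambda>p. if pos i = 1 then snd p $ ith 1 * A (fst p) $ ith 2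
      else if pos i = CARD('n) + 1 then - (snd p $ ith CARD('n)) * A (fst p) $ ith CARD('n)
      else - (snd p $ ith (pos i - 1)) * A (fst p) $ ith (pos i - 1) + snd p $ ith (pos i) * A (fst p) $ ith (pos i + 1))"
      by (cases "pos i = 1"; cases "pos i = CARD('n) + 1")
        (simp_all add: smooth_on_mult smooth_on_add smooth_on_diff smooth_on_minus oW sn Ai)
  qed
  then have "smooth_on (M \<times> (UNIV :: 'n rvec set))
      (\<lambda>p. (fst p, (inverse \<kappa> * (t - Q (fst p))) *\<^sub>R vv (fst p) + Phi_e (A (fst p)) (snd p)))"
    by (intro smooth_on_Pair smooth_on_fst smooth_on_ident smooth_on_add smooth_on_scaleR smooth_on_mult
        smooth_on_diff smooth_on_const lift[OF smQ] lift[OF smooth_vv] oW)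
  then show ?thesis by (simp add: case_prod_beta' Phi_eq)
qed

text \<open>Over each u, \<Phi> is a base point plus the injective linear map \<open>Phi_e\<close>,
  which settles the immersion, injectivity and the image. Continuity of the inverse is shown
  coordinate by coordinate, by solving the recurrence of \<open>Phi_e_enum\<close> for s.\<close>

lemma parameterization_Phi:
  "parameterization (R \<times> UNIV) (\<lambda>(r, s :: 'n rvec). Phi A Q \<kappa> t r s) (level_set M F t \<inter> (R \<times> UNIV))"
proof -
  let ?W = "R \<times> (UNIV :: 'n rvec set)" and ?S = "level_set M F t \<inter> (R \<times> UNIV)"
  define f where "f = (\<lambda>(r, s :: 'n rvec). Phi A Q \<kappa> t r s)"
  define base where "base r = (inverse \<kappa> * (t - Q r)) *\<^sub>R vv r" for r
  have f: "f p = (fst p, base (fst p) + Phi_e (A (fst p)) (snd p))" for p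
    by (simp add: f_def case_prod_beta' Phi_eq base_def)
  have RM: "R \<subseteq> M" by (auto simp: regular_locus_def)
  have oW: "open ?W" using open_regular by (simp add: open_Times)
  have inj0: "s = 0" if "r \<in> R" "Phi_e (A r) s = 0" for r and s :: "'n rvec"
    using Phi_e_injective[OF dims A_nonzero regular_nonzero[OF that(1)] that(2)] that(1) RM by blast
  have smf: "smooth_on ?W f" unfolding f_def by (rule smooth_on_subset[OF smooth_Phi]) (use RM in auto)
  have imm: "immersion_on ?W f"
    unfolding immersion_on_def
  proof (intro conjI ballI)
    fix p assume p: "p \<in> ?W"
    let ?f' = "frechet_derivative f (at p)"
    have d: "(f has_derivative ?f') (at p)" by (rule smooth_on_has_derivative[OF smf p])
    have l: "linear ?f'" using d by (rule has_derivative_linear)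
    show "inj ?f'"
      unfolding linear_injective_0[OF l]
    proof (intro allI impI)
      fix v assume v: "?f' v = 0"
      have "((\<lambda>q. fst (f q)) has_derivative (\<lambda>h. fst (?f' h))) (at p)" by (rule has_derivative_fst[OF d])
      moreover have "((\<lambda>q. fst (f q)) has_derivative fst) (at p)" unfolding f by (auto intro!: derivative_eq_intros)
      ultimately have "(\<lambda>h. fst (?f' h)) = fst" by (rule has_derivative_unique)
      then have v1: "fst v = 0" using v by (metis fst_zero)
      \<comment> \<open>With the u-part of v known to vanish, f is affine along the line p + h v, so
        its derivative there is visible.\<close>
      have "((\<lambda>h. f (p + h *\<^sub>R v)) has_vector_derivative ?f' v) (at 0)"
        using has_vector_derivative_line[of f ?f' p 0 v] d by simp
      moreover have "f (p + h *\<^sub>R v) = f p + h *\<^sub>R (0, Phi_e (A (fst p)) (snd v))" for h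
        by (simp add: f v1 linear_add[OF linear_Phi_e] linear_cmul[OF linear_Phi_e])
      moreover have "((\<lambda>h. f p + h *\<^sub>R (0, Phi_e (A (fst p)) (snd v))) has_vector_derivative (0, Phi_e (A (fst p)) (snd v))) (at 0)"
        by (auto intro!: derivative_eq_intros simp: has_vector_derivative_def)
      ultimately have "?f' v = (0, Phi_e (A (fst p)) (snd v))"
        using vector_derivative_unique_at by (metis (no_types, lifting) ext)
      then have "snd v = 0" using v inj0[of "fst p" "snd v"] p by (auto simp: zero_prod_def)
      then show "v = 0" using v1 by (simp add: prod_eq_iff)
    qed
  qed (rule smf)
  have injf: "inj_on f ?W"
  proof (rule inj_onI)
    fix p q assume p: "p \<in> ?W" and q: "q \<in> ?W" and eq: "f p = f q"
    then have 1: "fst p = fst q" "Phi_e (A (fst p)) (snd p) = Phi_e (A (fst p)) (snd q)" by (auto simp: f)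
    then have "Phi_e (A (fst p)) (snd p - snd q) = 0" by (simp add: linear_diff[OF linear_Phi_e])
    moreover have "fst p \<in> R" using p by auto
    ultimately have "snd p - snd q = 0" by (intro inj0)
    then show "p = q" using 1 by (simp add: prod_eq_iff)
  qed
  have img: "f ` ?W = ?S"
  proof (intro equalityI subsetI)
    fix z assume "z \<in> f ` ?W"
    then obtain r s where rs: "r \<in> R" "z = Phi A Q \<kappa> t r s" by (auto simp: f_def)
    then have "F z = t" using F_Phi RM by blast
    then show "z \<in> ?S" using rs RM by (auto simp: level_set_def Phi_eq)
  next
    fix z assume z: "z \<in> ?S"
    then have zR: "fst z \<in> R" and Fz: "F z = t" by (auto simp: level_set_def)
    have "A (fst z) \<bullet> base (fst z) = t - Q (fst z)"
      using K_const[of "fst z"] zR RM \<kappa>_nonzero by (auto simp: base_def A_vv)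
    then have "A (fst z) \<bullet> (snd z - base (fst z)) = 0" using Fz by (simp add: F_fun_def inner_diff_right)
    then obtain s :: "'n rvec" where "Phi_e (A (fst z)) s = snd z - base (fst z)" using Phi_e_onto[OF zR] by blast
    then have "z = f (fst z, s)" by (simp add: f prod_eq_iff)
    then show "z \<in> f ` ?W" using zR by (intro image_eqI[of _ _ "(fst z, s)"]) auto
  qed
  define g where "g = the_inv_into ?W f"
  have fg: "f (g z) = z" "g z \<in> ?W" if "z \<in> ?S" for z
    using f_the_inv_into_f[OF injf, of z] the_inv_into_into[OF injf, of z ?W] that by (auto simp: g_def img)
  have gf: "g (f p) = p" if "p \<in> ?W" for p unfolding g_def by (rule the_inv_into_f_f[OF injf that])
  let ?N = "CARD('n)"
  let ?a = "\<lambda>k z. A (fst z) $ (enum ! k)" and ?s = "\<lambda>k z. snd (g z) $ (enum ! k)"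
  let ?e = "\<lambda>k z. (snd z - base (fst z)) $ (enum ! k)"
  have gfst: "fst (g z) = fst z" if "z \<in> ?S" for z using fg(1)[OF that] by (metis f fst_conv)
  have ge: "Phi_e (A (fst z)) (snd (g z)) = snd z - base (fst z)" if "z \<in> ?S" for z
  proof -
    have "snd (f (g z)) = snd z" using fg(1)[OF that] by simp
    then have "base (fst z) + Phi_e (A (fst z)) (snd (g z)) = snd z" by (simp add: f gfst[OF that])
    then show ?thesis by (metis add_diff_cancel_left')
  qed
  have e: "?e k z = (if k < ?N then ?s k z * ?a (Suc k) z else 0) - (if 0 < k then ?s (k - 1) z * ?a (k - 1) z else 0)"
    if "z \<in> ?S" "k \<le> ?N" for k z
    using Phi_e_enum[OF dims that(2), of "A (fst z)" "snd (g z)"] by (simp only: ge[OF that(1)])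
  have SM: "fst ` ?S \<subseteq> M" using RM by auto
  have cfst: "continuous_on ?S (\<lambda>z. h (fst z))" if "continuous_on M h" for h :: "'n rvec \<Rightarrow> 'x::topological_space"
    by (rule continuous_on_compose2[OF that continuous_on_fst[OF continuous_on_id] SM])
  have ca: "continuous_on ?S (?a k)" for k
    by (rule cfst[OF smooth_on_continuous_on[OF smooth_on_nth[OF openM smA]]])
  have "smooth_on M base"
    unfolding base_def by (intro smooth_on_scaleR smooth_on_mult smooth_on_diff smooth_on_const smQ smooth_vv openM)
  then have cb: "continuous_on ?S (\<lambda>z. base (fst z))" by (intro cfst smooth_on_continuous_on)
  have ce: "continuous_on ?S (?e k)" for k by (intro continuous_intros cb)
  have az: "?a k z \<noteq> 0" if "z \<in> ?S" "0 < k" "k < ?N" for k z using regular_nonzero[of "fst z" k] that by auto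
  have low: "continuous_on ?S (?s k)" if "Suc k < ?N" for k
    using that
  proof (induction k)
    case 0
    have "continuous_on ?S (\<lambda>z. ?e 0 z / ?a 1 z)" using az 0 by (intro continuous_on_divide ce ca) auto
    moreover have "?e 0 z / ?a 1 z = ?s 0 z" if z: "z \<in> ?S" for z using e[OF z, of 0] az[OF z, of 1] 0 by simp
    ultimately show ?case by (rule continuous_on_eq)
  next
    case (Suc k)
    have "continuous_on ?S (\<lambda>z. (?e (Suc k) z + ?s k z * ?a k z) / ?a (Suc (Suc k)) z)"
      using az Suc.prems by (intro continuous_on_divide continuous_on_add continuous_on_mult ce ca Suc.IH) auto
    moreover have "(?e (Suc k) z + ?s k z * ?a k z) / ?a (Suc (Suc k)) z = ?s (Suc k) z" if z: "z \<in> ?S" for z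
      using e[OF z, of "Suc k"] az[OF z, of "Suc (Suc k)"] Suc.prems by simp
    ultimately show ?case by (rule continuous_on_eq)
  qed
  have last: "continuous_on ?S (?s (?N - 1))"
  proof (cases "?N = 1")
    case True
    have nz: "(?a 1 z)\<^sup>2 + (?a 0 z)\<^sup>2 \<noteq> 0" if z: "z \<in> ?S" for z
    proof
      assume "(?a 1 z)\<^sup>2 + (?a 0 z)\<^sup>2 = 0"
      then have 0: "?a 1 z = 0" "?a 0 z = 0" by (simp_all add: sum_power2_eq_zero_iff)
      have "A (fst z) $ i = 0" for i
      proof -
        have "pos i - 1 = 0 \<or> pos i - 1 = 1" using pos_pred_less[of i] dims True by linarith
        then show ?thesis using 0 enum_pos[of i] by metis
      qed
      then show False using A_nonzero[of "fst z"] SM z by (auto simp: vec_eq_iff)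
    qed
    \<comment> \<open>For n = 1 either component of A may vanish somewhere, though not both at once.
      The two equations for the single parameter s are combined with weights a_1 and -a_0, so that
      only the nonzero |A|^2 is divided by.\<close>
    have "continuous_on ?S (\<lambda>z. (?a 1 z * ?e 0 z - ?a 0 z * ?e 1 z) / ((?a 1 z)\<^sup>2 + (?a 0 z)\<^sup>2))"
      using nz by (intro continuous_on_divide continuous_on_diff continuous_on_mult continuous_on_add continuous_on_power ce ca) auto
    moreover have "(?a 1 z * ?e 0 z - ?a 0 z * ?e 1 z) / ((?a 1 z)\<^sup>2 + (?a 0 z)\<^sup>2) = ?s (?N - 1) z" if z: "z \<in> ?S" for z
    proof -
      have ez: "?e 0 z = ?s 0 z * ?a 1 z" "?e 1 z = - (?s 0 z * ?a 0 z)" using e[OF z, of 0] e[OF z, of 1] True by simp_all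
      have "(x * (w * x) - y * - (w * y)) / (x\<^sup>2 + y\<^sup>2) = w" if "x\<^sup>2 + y\<^sup>2 \<noteq> 0" for x y w :: real
        using that by (simp add: divide_simps) (simp add: power2_eq_square algebra_simps)
      from this[OF nz[OF z], of "?s 0 z"] show ?thesis unfolding ez using True by simp
    qed
    ultimately show ?thesis by (rule continuous_on_eq)
  next
    case False
    have "0 < ?N" by simp
    then have N: "1 < ?N" using False by linarith
    have "continuous_on ?S (\<lambda>z. - ?e ?N z / ?a (?N - 1) z)"
      using az N by (intro continuous_on_divide continuous_on_minus ce ca) auto
    moreover have "- ?e ?N z / ?a (?N - 1) z = ?s (?N - 1) z" if z: "z \<in> ?S" for z
      using e[OF z, of ?N] az[OF z, of "?N - 1"] N by simp
    ultimately show ?thesis by (rule continuous_on_eq)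
  qed
  have all: "continuous_on ?S (\<lambda>z. snd (g z) $ J)" for J
  proof -
    have "pos J - 1 < ?N" by (rule pos_pred_less)
    then have "Suc (pos J - 1) < ?N \<or> pos J - 1 = ?N - 1" by linarith
    then have "continuous_on ?S (?s (pos J - 1))" using low last by metis
    then show ?thesis by (simp add: enum_pos')
  qed
  have "continuous_on ?S (\<lambda>z. \<chi> J. snd (g z) $ J)" by (intro continuous_on_vec_lambda all)
  then have "continuous_on ?S (\<lambda>z. snd (g z))" by simp
  then have "continuous_on ?S (\<lambda>z. (fst z, snd (g z)))"
    by (rule continuous_on_Pair[OF continuous_on_fst[OF continuous_on_id]])
  moreover have "(fst z, snd (g z)) = g z" if "z \<in> ?S" for z using gfst[OF that] by (simp add: prod_eq_iff)
  ultimately have cg: "continuous_on ?S g" by (rule continuous_on_eq)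
  have "homeomorphism ?W ?S f g"
  proof (rule homeomorphismI[OF smooth_on_continuous_on[OF smf] cg])
    show "f ` ?W \<subseteq> ?S" using img by blast
    show "g ` ?S \<subseteq> ?W" using fg(2) by blast
  qed (fact gf fg(1))+
  then show ?thesis unfolding parameterization_def using oW imm f_def by blast
qed

text \<open>N is (-1)^n \<kappa> V, and with m = 2n the exponents match because 2(m+1)/(m+2) - 1 =
  m/(m+2).\<close>

lemma cV_eq_N:
  assumes p: "p \<in> D"
  shows "c *\<^sub>R V p = ((-1) ^ (CARD('n) + 1) *
    \<bar>\<kappa>\<bar> powr (- (2 * (2 * real CARD('n) + 1) / (2 * real CARD('n) + 2)))) *\<^sub>R N_field F p"
proof -
  let ?P = "\<bar>\<kappa>\<bar> powr (- (2 * (2 * real CARD('n) + 1) / (2 * real CARD('n) + 2)))"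
  have K: "det_A_dA A (fst p) = \<kappa>" using p K_const by auto
  have "- (2 * real CARD('n) / (2 * real CARD('n) + 2)) = 1 + - (2 * (2 * real CARD('n) + 1) / (2 * real CARD('n) + 2))"
    by (simp add: field_simps)
  then have "\<bar>\<kappa>\<bar> powr (- (2 * real CARD('n) / (2 * real CARD('n) + 2))) = \<bar>\<kappa>\<bar> powr 1 * ?P"
    by (simp only: powr_add)
  also have "\<bar>\<kappa>\<bar> powr 1 = \<bar>\<kappa>\<bar>" using \<kappa>_nonzero by simp
  finally have "c = - ((sgn \<kappa> * \<bar>\<kappa>\<bar>) * ?P)" by (simp add: c_def)
  also have "sgn \<kappa> * \<bar>\<kappa>\<bar> = \<kappa>" by (simp add: sgn_if)
  finally have "c = - (\<kappa> * ?P)" .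
  moreover have "(-1) ^ (CARD('n) + 1) * ?P * ((-1) ^ CARD('n) * \<kappa>) = - (\<kappa> * ?P)"
    by (simp flip: power_add mult_2)
  ultimately show ?thesis unfolding N_field_eq[OF p] K scaleR_scaleR by simp
qed

lemma Lagrangian_ruling:
  assumes \<Sigma>: "\<Sigma> = level_set M F t" and ne: "\<Sigma> \<noteq> {}"
  shows "\<exists>\<L>. ruling CARD('n) \<Sigma> \<L> \<and> (\<forall>L\<in>\<L>. affine L) \<and>
    (\<forall>L\<in>\<L>. \<forall>p\<in>L.
      tangent_space L p \<subseteq> {v \<in> tangent_space \<Sigma> p. equiaffine_shape Upsilon \<Sigma> (co_orientation F) p v = 0} \<and>
      Lagrangian (tangent_space \<Sigma> p) (two_form_at (Omega A p)) (tangent_space L p)) \<and>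
    \<not> cylindrical \<L>"
proof (intro exI conjI ballI)
  show "ruling CARD('n) \<Sigma> (leaf t ` M)" unfolding \<Sigma> by (rule ruling_leaves)
  show "\<not> cylindrical (leaf t ` M)" using leaves_not_cylindrical ne \<Sigma> by simp
  fix L assume "L \<in> leaf t ` M"
  then obtain u where u: "u \<in> M" "L = leaf t u" by blast
  show "affine L" unfolding u by (rule affine_leaf)
  fix p assume "p \<in> L"
  then have p: "p \<in> leaf t u" using u by simp
  have p': "p \<in> level_set M F t" using leaf_subset[OF u(1)] p by blast
  then have pD: "p \<in> D" using level_subset by blast
  show L: "Lagrangian (tangent_space \<Sigma> p) (two_form_at (Omega A p)) (tangent_space L p)"
    unfolding \<Sigma> u(2) by (rule Lagrangian_leaf[OF u(1) p])
  show "tangent_space L p \<subseteq> {v \<in> tangent_space \<Sigma> p. equiaffine_shape Upsilon \<Sigma> (co_orientation F) p v = 0}"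
  proof
    fix v assume v: "v \<in> tangent_space L p"
    then have fv: "fst v = 0" using tangent_leaf[OF p] u by simp
    have vT: "v \<in> tangent_space \<Sigma> p" using v L by (auto simp: Lagrangian_def)
    have "linear (dvv (fst p))"
      unfolding dvv_def using smooth_on_linear_derivative[OF smooth_vv] pD by auto
    then have "shape_map p v = 0" by (simp add: shape_map_def fv linear_0 zero_prod_def)
    then show "v \<in> {v \<in> tangent_space \<Sigma> p. equiaffine_shape Upsilon \<Sigma> (co_orientation F) p v = 0}"
      using vT equiaffine_shape_eq[OF \<Sigma> _ vT] p' \<Sigma> by simp
  qed
qed

end

text \<open>The real number \<open>m\<close> is the dimension 2n of the level sets, and the
  exponents of |\<kappa>| are expressed through it. The parameterization is claimed for the part of
  the level set over \<open>regular_locus\<close>, where \<Phi> fills the fibres, while the level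
  identity and the flow hold over all of M.\<close>

theorem lemma3p1:
  fixes M :: "'n::{finite,linorder} rvec set"
    and A :: "'n rvec \<Rightarrow> 'm::{finite,linorder} rvec"
    and Q :: "'n rvec \<Rightarrow> real"
    and n :: nat and m :: real
    and D :: "('n, 'm) phase set"
    and F :: "('n, 'm) phase \<Rightarrow> real"
    and V N :: "('n, 'm) phase \<Rightarrow> ('n, 'm) phase"
    and \<beta> \<Omega> :: "('n, 'm) phase \<Rightarrow> (nat \<Rightarrow> ('n, 'm) phase) \<Rightarrow> real"
  assumes dims: "CARD('m) = CARD('n) + 1"
    and n: "n = CARD('n)"
    and m: "m = 2 * real n"
    and M: "open M" "connected M"
    and A: "smooth_on M A"
    and Q: "smooth_on M Q"
    and D: "D = M \<times> UNIV"
    and F: "F = F_fun A Q"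
    and V: "V = V_field A"
    and N: "N = N_field F"
    and \<beta>: "\<beta> = beta A"
    and \<Omega>: "\<Omega> = Omega A"
  shows
    "(\<forall>p\<in>D. V p \<in> Hess_radical F p) \<and>
     (\<forall>p\<in>D. adjugate (Hess F p) = (-1) ^ n *\<^sub>R tensor_square (V p) \<and>
             N p = ((-1) ^ n * det_A_dA A (fst p)) *\<^sub>R V p) \<and>
     (immersion_on M A \<longleftrightarrow> (\<forall>p\<in>D. rank (Hess F p) = 2 * n)) \<and>
     (immersion_on M A \<longrightarrow> (\<forall>p\<in>D. Hess_radical F p = span {V p})) \<and>
     (centroaffine_immersion M A \<longleftrightarrow> (\<forall>p\<in>D. U_fun F p \<noteq> 0)) \<and>
     (centroaffine_immersion M A \<longleftrightarrow> contact_form D \<beta>) \<and>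
     (centroaffine_immersion M A \<longrightarrow>
       (\<forall>p\<in>D. adjugate (Hess F p) =
          ((-1) ^ n * inverse ((det_A_dA A (fst p))\<^sup>2)) *\<^sub>R tensor_square (N p)) \<and>
       (\<forall>t \<Sigma>. \<Sigma> = level_set M F t \<and> \<Sigma> \<noteq> {} \<longrightarrow>
          smooth_submanifold (2 * n) \<Sigma> \<and>
          nondegenerate_hypersurface \<Sigma> \<and>
          transversal \<Sigma> N \<and>
          symplectic_restriction \<Sigma> \<Omega>)) \<and>
     (\<forall>\<kappa>. \<kappa> \<noteq> 0 \<longrightarrow>
       ((\<forall>u\<in>M. pullback A mu_form u = (\<lambda>v. \<kappa> * det_form v)) \<longleftrightarrow>
        (\<forall>p\<in>D. wedge 1 (2 * n) (\<beta> p) (wedge_power2 (\<Omega> p) n) =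
           (\<lambda>v. (-1) ^ (n * (n + 1) div 2) * fact n * \<kappa> * Upsilon v)))) \<and>
     (\<forall>\<kappa>. \<kappa> \<noteq> 0 \<and> (\<forall>u\<in>M. pullback A mu_form u = (\<lambda>v. \<kappa> * det_form v)) \<longrightarrow>
       centroaffine_immersion M A \<and>
       (\<forall>t \<Sigma> W S h.
          \<Sigma> = level_set M F t \<and> \<Sigma> \<noteq> {} \<and>
          W = equiaffine_normal Upsilon \<Sigma> (co_orientation F) \<and>
          S = equiaffine_shape Upsilon \<Sigma> (co_orientation F) \<and>
          h = equiaffine_metric Upsilon \<Sigma> (co_orientation F) \<longrightarrow>
          (\<forall>p\<in>\<Sigma>. equiaffine_mean_curvature Upsilon \<Sigma> (co_orientation F) p = 0) \<and>
          is_equiaffine_normal Upsilon \<Sigma> (co_orientation F) W \<and>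
          (\<forall>p\<in>\<Sigma>. W p = ((-1) ^ (n + 1) * \<bar>\<kappa>\<bar> powr (- (2 * (m + 1) / (m + 2)))) *\<^sub>R N p \<and>
                  W p = (- sgn \<kappa> * \<bar>\<kappa>\<bar> powr (- (m / (m + 2)))) *\<^sub>R V p) \<and>
          (\<forall>p\<in>\<Sigma>. \<forall>v\<in>tangent_space \<Sigma> p. S p (S p v) = 0) \<and>
          (\<exists>\<L>. ruling n \<Sigma> \<L> \<and> (\<forall>L\<in>\<L>. affine L) \<and>
             (\<forall>L\<in>\<L>. \<forall>p\<in>L.
                tangent_space L p \<subseteq> {v \<in> tangent_space \<Sigma> p. S p v = 0} \<and>
                Lagrangian (tangent_space \<Sigma> p) (two_form_at (\<Omega> p)) (tangent_space L p)) \<and>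
             \<not> cylindrical \<L>) \<and>
          (\<forall>p\<in>\<Sigma>. has_signature (tangent_space \<Sigma> p) (h p) n n)) \<and>
       (\<forall>R. is_Reeb_field D \<beta> R \<longleftrightarrow> (\<forall>p\<in>D. R p = inverse \<kappa> *\<^sub>R V p)) \<and>
       (\<forall>t. \<forall>r\<in>M. \<forall>s. F (Phi A Q \<kappa> t r s) = t) \<and>
       (\<forall>t. level_set M F t \<noteq> {} \<longrightarrow>
          parameterization (regular_locus M A \<times> UNIV) (\<lambda>(r, s). Phi A Q \<kappa> t r s)
            (level_set M F t \<inter> (regular_locus M A \<times> UNIV))) \<and>
       (\<forall>\<phi>. \<phi> = (\<lambda>t. Phi A Q \<kappa> (- (\<bar>\<kappa>\<bar> powr (2 / (m + 2))) * t)) \<longrightarrow>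
          (\<forall>t. \<forall>r\<in>M. \<forall>s.
             ((\<lambda>t. \<phi> t r s) has_vector_derivative
                equiaffine_normal Upsilon (level_set M F (F (\<phi> t r s))) (co_orientation F)
                  (\<phi> t r s)) (at t))))"
proof (unfold m n D F V N \<beta> \<Omega>, intro conjI)
  interpret family: affine_family M A Q by unfold_locales (fact dims M(1) A Q)+
  have equi: "equiaffine_family M A Q \<kappa>"
    if "\<kappa> \<noteq> 0 \<and> (\<forall>u\<in>M. pullback A mu_form u = (\<lambda>v. \<kappa> * det_form v))" for \<kappa>
  proof -
    have "\<forall>u\<in>M. det_A_dA A u = \<kappa>" using that family.pullback_mu_const_iff by blast
    then show ?thesis using that by unfold_locales auto
  qed
  show "\<forall>p\<in>M \<times> UNIV. V_field A p \<in> Hess_radical (F_fun A Q) p"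
    by (intro ballI) (simp only: family.Hess_radical_eq family.hess_V mem_Collect_eq simp_thms)
  show "\<forall>p\<in>M \<times> UNIV. adjugate (Hess (F_fun A Q) p) = (-1) ^ CARD('n) *\<^sub>R tensor_square (V_field A p) \<and>
      N_field (F_fun A Q) p = ((-1) ^ CARD('n) * det_A_dA A (fst p)) *\<^sub>R V_field A p"
    using family.adjugate_Hess family.N_field_eq by blast
  have "(\<forall>p\<in>M \<times> UNIV. rank (Hess (F_fun A Q) p) = 2 * CARD('n)) \<longleftrightarrow> (\<forall>p\<in>M \<times> (UNIV :: 'm rvec set). family.vv (fst p) \<noteq> 0)"
    by (rule ball_cong[OF refl family.rank_Hess])
  then show "immersion_on M A \<longleftrightarrow> (\<forall>p\<in>M \<times> UNIV. rank (Hess (F_fun A Q) p) = 2 * CARD('n))"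
    by (simp add: family.immersion_iff)
  show "immersion_on M A \<longrightarrow> (\<forall>p\<in>M \<times> UNIV. Hess_radical (F_fun A Q) p = span {V_field A p})"
    using family.radical_span unfolding family.immersion_iff by auto
  show "centroaffine_immersion M A \<longleftrightarrow> (\<forall>p\<in>M \<times> UNIV. U_fun (F_fun A Q) p \<noteq> 0)"
    by (rule family.centroaffine_U)
  show "centroaffine_immersion M A \<longleftrightarrow> contact_form (M \<times> UNIV) (beta A)"
    by (rule family.contact_form_iff[symmetric])
  show "centroaffine_immersion M A \<longrightarrow>
       (\<forall>p\<in>M \<times> UNIV. adjugate (Hess (F_fun A Q) p) =
          ((-1) ^ CARD('n) * inverse ((det_A_dA A (fst p))\<^sup>2)) *\<^sub>R tensor_square (N_field (F_fun A Q) p)) \<and>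
       (\<forall>t \<Sigma>. \<Sigma> = level_set M (F_fun A Q) t \<and> \<Sigma> \<noteq> {} \<longrightarrow>
          smooth_submanifold (2 * CARD('n)) \<Sigma> \<and>
          nondegenerate_hypersurface \<Sigma> \<and>
          transversal \<Sigma> (N_field (F_fun A Q)) \<and>
          symplectic_restriction \<Sigma> (Omega A))" (is "_ \<longrightarrow> ?C")
  proof
    assume "centroaffine_immersion M A"
    then interpret cent: centroaffine_family M A Q
      by unfold_locales (simp add: family.centroaffine_iff)
    show ?C
      using cent.adjugate_N cent.smooth_submanifold_level cent.nondegenerate_level cent.transversal_N
        cent.symplectic_restriction_Omega by blast
  qed
  show "\<forall>\<kappa>. \<kappa> \<noteq> 0 \<longrightarrow>
       ((\<forall>u\<in>M. pullback A mu_form u = (\<lambda>v. \<kappa> * det_form v)) \<longleftrightarrow>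
        (\<forall>p\<in>M \<times> UNIV. wedge 1 (2 * CARD('n)) (beta A p) (wedge_power2 (Omega A p) CARD('n)) =
           (\<lambda>v. (-1) ^ (CARD('n) * (CARD('n) + 1) div 2) * fact CARD('n) * \<kappa> * Upsilon v)))"
    unfolding family.pullback_mu_const_iff family.contact_top_const_iff[symmetric] family.contact_top_def by blast
  show "\<forall>\<kappa>. \<kappa> \<noteq> 0 \<and> (\<forall>u\<in>M. pullback A mu_form u = (\<lambda>v. \<kappa> * det_form v)) \<longrightarrow>
       centroaffine_immersion M A \<and>
       (\<forall>t \<Sigma> W S h.
          \<Sigma> = level_set M (F_fun A Q) t \<and> \<Sigma> \<noteq> {} \<and>
          W = equiaffine_normal Upsilon \<Sigma> (co_orientation (F_fun A Q)) \<and>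
          S = equiaffine_shape Upsilon \<Sigma> (co_orientation (F_fun A Q)) \<and>
          h = equiaffine_metric Upsilon \<Sigma> (co_orientation (F_fun A Q)) \<longrightarrow>
          (\<forall>p\<in>\<Sigma>. equiaffine_mean_curvature Upsilon \<Sigma> (co_orientation (F_fun A Q)) p = 0) \<and>
          is_equiaffine_normal Upsilon \<Sigma> (co_orientation (F_fun A Q)) W \<and>
          (\<forall>p\<in>\<Sigma>. W p = ((-1) ^ (CARD('n) + 1) * \<bar>\<kappa>\<bar> powr (- (2 * (2 * real CARD('n) + 1) / (2 * real CARD('n) + 2)))) *\<^sub>R N_field (F_fun A Q) p \<and>
                  W p = (- sgn \<kappa> * \<bar>\<kappa>\<bar> powr (- (2 * real CARD('n) / (2 * real CARD('n) + 2)))) *\<^sub>R V_field A p) \<and>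
          (\<forall>p\<in>\<Sigma>. \<forall>v\<in>tangent_space \<Sigma> p. S p (S p v) = 0) \<and>
          (\<exists>\<L>. ruling CARD('n) \<Sigma> \<L> \<and> (\<forall>L\<in>\<L>. affine L) \<and>
             (\<forall>L\<in>\<L>. \<forall>p\<in>L.
                tangent_space L p \<subseteq> {v \<in> tangent_space \<Sigma> p. S p v = 0} \<and>
                Lagrangian (tangent_space \<Sigma> p) (two_form_at (Omega A p)) (tangent_space L p)) \<and>
             \<not> cylindrical \<L>) \<and>
          (\<forall>p\<in>\<Sigma>. has_signature (tangent_space \<Sigma> p) (h p) CARD('n) CARD('n))) \<and>
       (\<forall>R. is_Reeb_field (M \<times> UNIV) (beta A) R \<longleftrightarrow> (\<forall>p\<in>M \<times> UNIV. R p = inverse \<kappa> *\<^sub>R V_field A p)) \<and>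
       (\<forall>t. \<forall>r\<in>M. \<forall>s. F_fun A Q (Phi A Q \<kappa> t r s) = t) \<and>
       (\<forall>t. level_set M (F_fun A Q) t \<noteq> {} \<longrightarrow>
          parameterization (regular_locus M A \<times> UNIV) (\<lambda>(r, s). Phi A Q \<kappa> t r s)
            (level_set M (F_fun A Q) t \<inter> (regular_locus M A \<times> UNIV))) \<and>
       (\<forall>\<phi>. \<phi> = (\<lambda>t. Phi A Q \<kappa> (- (\<bar>\<kappa>\<bar> powr (2 / (2 * real CARD('n) + 2))) * t)) \<longrightarrow>
          (\<forall>t. \<forall>r\<in>M. \<forall>s.
             ((\<lambda>t. \<phi> t r s) has_vector_derivative
                equiaffine_normal Upsilon (level_set M (F_fun A Q) (F_fun A Q (\<phi> t r s))) (co_orientation (F_fun A Q))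
                  (\<phi> t r s)) (at t)))"
    (is "\<forall>\<kappa>. ?A \<kappa> \<longrightarrow> _ \<and> ?geometry \<kappa> \<and> ?Reeb \<kappa> \<and> ?level \<kappa> \<and> ?param \<kappa> \<and> ?flow \<kappa>")
  proof (intro allI impI)
    fix \<kappa> assume "?A \<kappa>"
    then interpret eq: equiaffine_family M A Q \<kappa> by (rule equi)
    have geometry: "?geometry \<kappa>"
    proof (intro allI impI)
      fix t and \<Sigma> and W :: "('n, 'm) phase \<Rightarrow> ('n, 'm) phase" and S h
      assume asm: "\<Sigma> = level_set M (F_fun A Q) t \<and> \<Sigma> \<noteq> {} \<and>
          W = equiaffine_normal Upsilon \<Sigma> (co_orientation (F_fun A Q)) \<and>
          S = equiaffine_shape Upsilon \<Sigma> (co_orientation (F_fun A Q)) \<and>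
          h = equiaffine_metric Upsilon \<Sigma> (co_orientation (F_fun A Q))"
      have \<Sigma>: "\<Sigma> = level_set M (F_fun A Q) t" and ne: "\<Sigma> \<noteq> {}"
        and W: "W = equiaffine_normal Upsilon \<Sigma> (co_orientation (F_fun A Q))"
        and S: "S = equiaffine_shape Upsilon \<Sigma> (co_orientation (F_fun A Q))"
        and h: "h = equiaffine_metric Upsilon \<Sigma> (co_orientation (F_fun A Q))" using asm by blast+
      have Wc: "W p = eq.c *\<^sub>R V_field A p" if "p \<in> \<Sigma>" for p
        using eq.equiaffine_normal_eq[of p t] that by (simp add: W \<Sigma>)
      have D: "p \<in> M \<times> UNIV" if "p \<in> \<Sigma>" for p using that eq.level_subset \<Sigma> by blast
      have W1: "\<forall>p\<in>\<Sigma>. W p = ((-1) ^ (CARD('n) + 1) * \<bar>\<kappa>\<bar> powr (- (2 * (2 * real CARD('n) + 1) / (2 * real CARD('n) + 2)))) *\<^sub>R N_field (F_fun A Q) p \<and>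
                  W p = (- sgn \<kappa> * \<bar>\<kappa>\<bar> powr (- (2 * real CARD('n) / (2 * real CARD('n) + 2)))) *\<^sub>R V_field A p"
      proof (intro ballI conjI)
        fix p assume p: "p \<in> \<Sigma>"
        show "W p = ((-1) ^ (CARD('n) + 1) * \<bar>\<kappa>\<bar> powr (- (2 * (2 * real CARD('n) + 1) / (2 * real CARD('n) + 2)))) *\<^sub>R N_field (F_fun A Q) p"
          unfolding Wc[OF p] by (rule eq.cV_eq_N[OF D[OF p]])
        show "W p = (- sgn \<kappa> * \<bar>\<kappa>\<bar> powr (- (2 * real CARD('n) / (2 * real CARD('n) + 2)))) *\<^sub>R V_field A p"
          unfolding Wc[OF p] eq.c_def ..
      qed
      \<comment> \<open>W is the field of definite descriptions, taken point by point; since it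
        agrees with c V on \<Sigma>, it is itself an equiaffine normal.\<close>
      have W2: "is_equiaffine_normal Upsilon \<Sigma> (co_orientation (F_fun A Q)) W"
        unfolding \<Sigma> by (rule eq.is_equiaffine_normal_cV) (simp add: Wc \<Sigma>)
      show "(\<forall>p\<in>\<Sigma>. equiaffine_mean_curvature Upsilon \<Sigma> (co_orientation (F_fun A Q)) p = 0) \<and>
          is_equiaffine_normal Upsilon \<Sigma> (co_orientation (F_fun A Q)) W \<and>
          (\<forall>p\<in>\<Sigma>. W p = ((-1) ^ (CARD('n) + 1) * \<bar>\<kappa>\<bar> powr (- (2 * (2 * real CARD('n) + 1) / (2 * real CARD('n) + 2)))) *\<^sub>R N_field (F_fun A Q) p \<and>
                  W p = (- sgn \<kappa> * \<bar>\<kappa>\<bar> powr (- (2 * real CARD('n) / (2 * real CARD('n) + 2)))) *\<^sub>R V_field A p) \<and>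
          (\<forall>p\<in>\<Sigma>. \<forall>v\<in>tangent_space \<Sigma> p. S p (S p v) = 0) \<and>
          (\<exists>\<L>. ruling CARD('n) \<Sigma> \<L> \<and> (\<forall>L\<in>\<L>. affine L) \<and>
             (\<forall>L\<in>\<L>. \<forall>p\<in>L.
                tangent_space L p \<subseteq> {v \<in> tangent_space \<Sigma> p. S p v = 0} \<and>
                Lagrangian (tangent_space \<Sigma> p) (two_form_at (Omega A p)) (tangent_space L p)) \<and>
             \<not> cylindrical \<L>) \<and>
          (\<forall>p\<in>\<Sigma>. has_signature (tangent_space \<Sigma> p) (h p) CARD('n) CARD('n))"
        unfolding S h
        by (intro conjI W1 W2 eq.Lagrangian_ruling[OF \<Sigma> ne] ballI eq.equiaffine_mean_curvature_zero[OF \<Sigma>]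
            eq.equiaffine_shape_square[OF \<Sigma>] eq.equiaffine_metric_signature[OF \<Sigma>])
    qed
    show "centroaffine_immersion M A \<and> ?geometry \<kappa> \<and> ?Reeb \<kappa> \<and> ?level \<kappa> \<and> ?param \<kappa> \<and> ?flow \<kappa>"
    proof (intro conjI geometry)
      show "centroaffine_immersion M A" using eq.nonzero by (simp add: family.centroaffine_iff)
      show "?Reeb \<kappa>" using eq.Reeb_field_iff eq.K_const by auto
      show "?level \<kappa>" using eq.F_Phi by blast
      show "?param \<kappa>" using eq.parameterization_Phi by blast
      show "?flow \<kappa>" using eq.Phi_flow by blast
    qed
  qed
qed

end
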